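(* Let $\Omega\subset\mathbb{R}^3$ be a bounded Lipschitz domain. Assume $\sigma:\mathbb{R}\to\mathbb{R}$ is continuous with $\sigma_1\le\sigma(s)\le\sigma_2$ for all $s$ ($0<\sigma_1\le\sigma_2$ constants), $u^0\in H^1(\Omega)$, and $\mathbf{E}^0\in L^q(\Omega,\mathbb{R}^3)$ for some $q>3$ with $\nabla\times\mathbf{E}^0=\mathbf{0}$ in $\Omega$. Then problem (P$_E$) has a weak solution $(u,\mathbf{H})\in H^1(\Omega)\times[H_0(\mathrm{div}0,\Omega)\cap H(\mathrm{curl},\Omega)]$.
   Context: Let $\nu$ be the outer unit normal. Problem (P$_E$): $\nabla\times[\sigma(u)^{-1}\nabla\times\mathbf{H}]=\mathbf{0}$, $\nabla\cdot\mathbf{H}=0$, $-\Delta u=\sigma(u)^{-1}|\nabla\times\mathbf{H}|^2$ in $\Omega$; $u=u^0$, $\nu\cdot\mathbf{H}=0$, $\nu\times[\sigma(u)^{-1}\nabla\times\mathbf{H}]=\nu\times\mathbf{E}^0$ on $\partial\Omega$. $H_0(\mathrm{div}0,\Omega)=\{\mathbf{u}\in L^2(\Omega,\mathbb{R}^3):\nabla\cdot\mathbf{u}=0\text{ in }\Omega,\ \nu\cdot\mathbf{u}=0\text{ on }\partial\Omega\}$; $H(\mathrm{curl},\Omega)=\{\mathbf{u}\in L^2:\nabla\times\mathbf{u}\in L^2\}$. A weak solution of (P$_E$) is $(u,\mathbf{H})\in H^1(\Omega)\times[H_0(\mathrm{div}0,\Omega)\cap H(\mathrm{curl},\Omega)]$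 with $u=u^0$ on $\partial\Omega$ (trace), $\int_\Omega\nabla u\cdot\nabla v\,dx=\int_\Omega\sigma(u)^{-1}|\nabla\times\mathbf{H}|^2v\,dx$ for all $v\in H^1_0(\Omega)\cap L^\infty(\Omega)$, and $\int_\Omega\sigma(u)^{-1}(\nabla\times\mathbf{H})\cdot(\nabla\times\mathbf{w})\,dx=\int_\Omega\mathbf{E}^0\cdot\nabla\times\mathbf{w}\,dx$ for all $\mathbf{w}\in H_0(\mathrm{div}0,\Omega)\cap H(\mathrm{curl},\Omega)$. *)

theory Defs
  imports "HOL-Analysis.Analysis"
begin

definition pd :: "3 \<Rightarrow> (real^3 \<Rightarrow> real) \<Rightarrow> real^3 \<Rightarrow> real" where
  "pd i f x = frechet_derivative f (at x) (axis i 1)"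

fun iter_pd :: "3 list \<Rightarrow> (real^3 \<Rightarrow> real) \<Rightarrow> real^3 \<Rightarrow> real" where
  "iter_pd [] f = f"
| "iter_pd (i # is) f = pd i (iter_pd is f)"

definition smooth :: "(real^3 \<Rightarrow> real) \<Rightarrow> bool" where
  "smooth f \<longleftrightarrow> (\<forall>is x. iter_pd is f differentiable (at x))"

definition test_fun :: "(real^3) set \<Rightarrow> (real^3 \<Rightarrow> real) \<Rightarrow> bool" where
  "test_fun \<Omega> \<phi> \<longleftrightarrow> smooth \<phi> \<and> compact (closure {x. \<phi> x \<noteq> 0})
      \<and> closure {x. \<phi> x \<noteq> 0} \<subseteq> \<Omega>"

definition vtest_fun :: "(real^3) set \<Rightarrow> (real^3 \<Rightarrow> real^3) \<Rightarrow> bool" where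
  "vtest_fun \<Omega> \<psi> \<longleftrightarrow> (\<forall>i. test_fun \<Omega> (\<lambda>x. \<psi> x $ i))"

definition grad :: "(real^3 \<Rightarrow> real) \<Rightarrow> real^3 \<Rightarrow> real^3" where
  "grad \<phi> x = (\<chi> i. pd i \<phi> x)"

definition curl :: "(real^3 \<Rightarrow> real^3) \<Rightarrow> real^3 \<Rightarrow> real^3" where
  "curl \<psi> x = vector
     [ pd 2 (\<lambda>y. \<psi> y $ 3) x - pd 3 (\<lambda>y. \<psi> y $ 2) x,
       pd 3 (\<lambda>y. \<psi> y $ 1) x - pd 1 (\<lambda>y. \<psi> y $ 3) x,
       pd 1 (\<lambda>y. \<psi> y $ 2) x - pd 2 (\<lambda>y. \<psi> y $ 1) x ]"

definition Lp :: "(real^3) set \<Rightarrow> real \<Rightarrow> (real^3 \<Rightarrow> 'b::{real_normed_vector,second_countable_topology}) \<Rightarrow> bool" where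
  "Lp \<Omega> p f \<longleftrightarrow> set_borel_measurable lebesgue \<Omega> f
      \<and> set_integrable lebesgue \<Omega> (\<lambda>x. norm (f x) powr p)"

definition L2 :: "(real^3) set \<Rightarrow> (real^3 \<Rightarrow> 'b::{real_normed_vector,second_countable_topology}) \<Rightarrow> bool" where
  "L2 \<Omega> f \<longleftrightarrow> set_borel_measurable lebesgue \<Omega> f
      \<and> set_integrable lebesgue \<Omega> (\<lambda>x. norm (f x) ^ 2)"

definition Linf :: "(real^3) set \<Rightarrow> (real^3 \<Rightarrow> real) \<Rightarrow> bool" where
  "Linf \<Omega> v \<longleftrightarrow> set_borel_measurable lebesgue \<Omega> v
      \<and> (\<exists>M. AE x in lebesgue. x \<in> \<Omega> \<longrightarrow> \<bar>v x\<bar> \<le> M)"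

definition weak_grad :: "(real^3) set \<Rightarrow> (real^3 \<Rightarrow> real) \<Rightarrow> (real^3 \<Rightarrow> real^3) \<Rightarrow> bool" where
  "weak_grad \<Omega> u G \<longleftrightarrow> (\<forall>\<phi> i. test_fun \<Omega> \<phi> \<longrightarrow>
      (LINT x:\<Omega>|lebesgue. u x * pd i \<phi> x) = - (LINT x:\<Omega>|lebesgue. G x $ i * \<phi> x))"

definition weak_curl :: "(real^3) set \<Rightarrow> (real^3 \<Rightarrow> real^3) \<Rightarrow> (real^3 \<Rightarrow> real^3) \<Rightarrow> bool" where
  "weak_curl \<Omega> H C \<longleftrightarrow> (\<forall>\<psi>. vtest_fun \<Omega> \<psi> \<longrightarrow>
      (LINT x:\<Omega>|lebesgue. H x \<bullet> curl \<psi> x) = (LINT x:\<Omega>|lebesgue. C x \<bullet> \<psi> x))"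

definition H1 :: "(real^3) set \<Rightarrow> (real^3 \<Rightarrow> real) \<Rightarrow> bool" where
  "H1 \<Omega> u \<longleftrightarrow> L2 \<Omega> u \<and> (\<exists>G. L2 \<Omega> G \<and> weak_grad \<Omega> u G)"

text \<open>H^1_0: H^1-norm closure of test functions (= H^1 functions with zero trace on Lipschitz domains).\<close>
definition H10 :: "(real^3) set \<Rightarrow> (real^3 \<Rightarrow> real) \<Rightarrow> bool" where
  "H10 \<Omega> v \<longleftrightarrow> L2 \<Omega> v \<and> (\<exists>G. L2 \<Omega> G \<and> weak_grad \<Omega> v G \<and>
     (\<exists>\<phi>s. (\<forall>n. test_fun \<Omega> (\<phi>s n)) \<and>
        (\<lambda>n. LINT x:\<Omega>|lebesgue. (\<phi>s n x - v x)^2 + norm (grad (\<phi>s n) x - G x)^2)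
          \<longlonglongrightarrow> 0))"

definition Hcurl :: "(real^3) set \<Rightarrow> (real^3 \<Rightarrow> real^3) \<Rightarrow> bool" where
  "Hcurl \<Omega> H \<longleftrightarrow> L2 \<Omega> H \<and> (\<exists>C. L2 \<Omega> C \<and> weak_curl \<Omega> H C)"

text \<open>H_0(div0): L^2 fields with div = 0 in the domain and zero normal trace, i.e. (Green's formula)
  the integral of H . grad phi vanishes for every phi in H^1.\<close>
definition H0div0 :: "(real^3) set \<Rightarrow> (real^3 \<Rightarrow> real^3) \<Rightarrow> bool" where
  "H0div0 \<Omega> H \<longleftrightarrow> L2 \<Omega> H \<and> (\<forall>\<phi> G. L2 \<Omega> \<phi> \<and> L2 \<Omega> G \<and> weak_grad \<Omega> \<phi> G \<longrightarrow>
      (LINT x:\<Omega>|lebesgue. H x \<bullet> G x) = 0)"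

definition lipschitz_domain :: "(real^3) set \<Rightarrow> bool" where
  "lipschitz_domain \<Omega> \<longleftrightarrow> open \<Omega> \<and> connected \<Omega> \<and> bounded \<Omega> \<and> \<Omega> \<noteq> {} \<and>
    (\<forall>p\<in>frontier \<Omega>. \<exists>(Q :: real^3 \<Rightarrow> real^3) (r::real) (h::real) (L::real) (g :: real \<times> real \<Rightarrow> real).
       orthogonal_transformation Q \<and> r > 0 \<and> h > 0 \<and> L-lipschitz_on UNIV g \<and>
       (\<forall>x. let y = Q (x - p) in
          (norm (y $ 1, y $ 2) < r \<and> \<bar>y $ 3\<bar> < h) \<longrightarrow>
          (x \<in> \<Omega> \<longleftrightarrow> y $ 3 < g (y $ 1, y $ 2))))"

definition weak_solution ::
  "(real^3) set \<Rightarrow> (real \<Rightarrow> real) \<Rightarrow> (real^3 \<Rightarrow> real) \<Rightarrow> (real^3 \<Rightarrow> real^3)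
   \<Rightarrow> (real^3 \<Rightarrow> real) \<Rightarrow> (real^3 \<Rightarrow> real^3) \<Rightarrow> bool" where
  "weak_solution \<Omega> \<sigma> u0 E0 u H \<longleftrightarrow>
     H1 \<Omega> u \<and> H0div0 \<Omega> H \<and> Hcurl \<Omega> H \<and> H10 \<Omega> (\<lambda>x. u x - u0 x) \<and>
     (\<exists>Gu CH. L2 \<Omega> Gu \<and> weak_grad \<Omega> u Gu \<and> L2 \<Omega> CH \<and> weak_curl \<Omega> H CH \<and>
       (\<forall>v Gv. H10 \<Omega> v \<and> Linf \<Omega> v \<and> L2 \<Omega> Gv \<and> weak_grad \<Omega> v Gv \<longrightarrow>
          (LINT x:\<Omega>|lebesgue. Gu x \<bullet> Gv x)
            = (LINT x:\<Omega>|lebesgue. inverse (\<sigma> (u x)) * (norm (CH x))^2 * v x)) \<and>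
       (\<forall>w Cw. H0div0 \<Omega> w \<and> L2 \<Omega> Cw \<and> weak_curl \<Omega> w Cw \<longrightarrow>
          (LINT x:\<Omega>|lebesgue. inverse (\<sigma> (u x)) * (CH x \<bullet> Cw x))
            = (LINT x:\<Omega>|lebesgue. E0 x \<bullet> Cw x)))"

end

theory Submission imports Defs "HOL-Analysis.Cross3" begin

text \<open>The weak curls of \<open>L\<^sup>2\<close> fields on \<open>\<Omega>\<close> form a closed subspace: locally, where \<open>\<Omega>\<close> is star-shaped with
  respect to a ball, a field is a gradient plus a field bounded by its curl, and the gradients are
  compactly embedded. Its orthogonal complement consists of the gradients of potentials \<open>\<psi>\<close> on the whole
  space with gradient vanishing off \<open>\<Omega>\<close>, that is, constant on each component of the complement. For frozen \<open>s = \<sigma>(u)\<close> the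
  field \<open>E = E0 + grad \<psi>\<close> is found by Lax-Milgram, and \<open>s E\<close> is then orthogonal to that complement, hence a curl.
  Stampacchia's truncation method bounds \<open>\<psi>\<close> because \<open>q > 3\<close>, so the heat source \<open>s |E|\<^sup>2\<close>, tested with \<open>v\<close>, equals
  \<open>\<integral> s E \<bullet> (v E0 - \<psi> grad v)\<close> and is a bounded functional on \<open>H\<^sup>1\<^sub>0\<close>. Schauder's theorem gives a fixed point \<open>u\<close>.\<close>

text \<open>The unknown is the electric field E = curl H / \<sigma>(u) rather than H, because E - E0
  is the gradient of a scalar: scalars can be truncated, vector fields cannot, and truncation is the
  source of the sup bound. Without that bound the heat source, a product of two L2 fields, is only
  in L1 and gives no functional on H^1_0. The potentials cannot be confined to H^1_0 of the domain:
  if its complement has several components, curls are also orthogonal to gradients of potentials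
  with different constants there. Zero extension to the whole space treats every topology alike and
  is stable under truncation, since composing a potential with a C1 function keeps its gradient zero
  off the domain. The same convention replaces traces: the tangential condition becomes absence of a
  surface curl, the normal one orthogonality to all weak gradients. The inequalities of Poincare,
  Rellich and Sobolev all come from one operator, \<open>mollify\<close>, which averages after a
  dilation that moves points along segments of a star-shaped set. H is recovered last, as the part
  orthogonal to weak gradients of any field with curl \<sigma>(u) E.\<close>

abbreviation (input) "BM \<equiv> borel_measurable borel"
notation (input) iff (infixr "<->" 25) and LIMSEQ ("(_/ ---> _)" [60, 60] 60) and scaleR (infixr "*R" 75)
abbreviation (input) lebesgue_int (binder "\<integral>" 10) where "lebesgue_int \<equiv> integral\<^sup>L lborel"
abbreviation (input) lebesgue_nn_int (binder "\<integral>\<^sup>+" 10) where "lebesgue_nn_int == nn_integral lborel"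
abbreviation (input) lebesgue_AE (binder "AE " 10) where "lebesgue_AE P == eventually P (ae_filter lborel)"
type_synonym en = ennreal
abbreviation (input) "en == ennreal"
abbreviation (input) "ind s == indicator {0..s::real}"

lemmas bm_cont = borel_measurable_continuous_onI and lint_cong = Bochner_Integration.integral_cong and lint_diff = Bochner_Integration.integral_diff
 and lint_add = Bochner_Integration.integral_add

section \<open>Hilbert spaces and a fixed point theorem\<close>

lemma norm_diff_scaleR_power2:
 fixes a b :: "'a::real_inner"
 shows "(norm (a - t *R b))^2 = (norm a)^2 - 2 * t * inner a b + t\<^sup>2 * (norm b)^2" unfolding power2_norm_eq_inner
 by (simp add: inner_diff_left inner_diff_right inner_commute[of b a] power2_eq_square algebra_simps
   del: real_inner_class.dot_square_norm)

text \<open>The parallelogram law makes a minimizing sequence for the distance Cauchy; varying the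
  minimizer along a line in \<open>S\<close> gives orthogonality.\<close>

lemma hilbert_projection:
 fixes S :: "'a::{real_inner,complete_space} set"
 assumes S: "closed S" "subspace S"
 shows "EX p:S. ALL y:S. inner (x - p) y = 0"
proof -
 define D where "D = (%y. (norm (x - y))^2) ` S"
 define d where "d = Inf D"
 have ne: "D ~= {}" using subspace_0[OF S(2)] by (auto simp: D_def)
 have bb: "bdd_below D" by (rule bdd_belowI[of _ 0]) (auto simp: D_def)
 have dle: "d <= (norm (x - y))^2" if "y : S" for y unfolding d_def by (rule cInf_lower) (use that bb in \<open>auto simp: D_def\<close>)
 have "EX y:S. (norm (x - y))^2 < d + 1 / real (Suc n)" for n
 proof -
  have "Inf D < d + 1 / real (Suc n)" by (simp add: d_def)
  from cInf_lessD[OF ne this] show ?thesis by (auto simp: D_def)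
 qed
 then obtain y where yS: "!!n. y n : S" and y: "!!n. (norm (x - y n))^2 < d + 1 / real (Suc n)" by metis
 have par: "(norm (y n - y m))^2 <= 2 / real (Suc n) + 2 / real (Suc m)" for n m
 proof -
  have "(1/2) *R (y n + y m) : S" using S(2) yS by (simp add: subspace_add subspace_scale)
  from dle[OF this] have "4 * d <= (norm ((x - y n) + (x - y m)))^2"
  proof -
   have "(x - y n) + (x - y m) = 2 *R (x - (1/2) *R (y n + y m))" by (simp add: algebra_simps flip: scaleR_2)
   then have "(norm ((x - y n) + (x - y m)))^2 = 4 * (norm (x - (1/2) *R (y n + y m)))^2" by (simp add: power_mult_distrib)
   then show ?thesis using dle[OF \<open>(1/2) *R (y n + y m) : S\<close>] by simp
  qed
  moreover have "(norm (y n - y m))^2 = 2 * (norm (x - y n))^2 + 2 * (norm (x - y m))^2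
    - (norm ((x - y n) + (x - y m)))^2" by (simp add: power2_norm_eq_inner inner_diff_left inner_diff_right inner_add_left inner_add_right inner_commute)
  moreover have "2 / real (Suc k) = 2 * (1 / real (Suc k))" for k by simp
  ultimately show ?thesis using y[of n] y[of m] by linarith
 qed
 have "Cauchy y"
 proof (rule metric_CauchyI)
  fix e :: real assume e: "e > 0"
  obtain N where N: "4 / e\<^sup>2 < real N" using reals_Archimedean2 by blast
  show "EX M. ALL m>=M. ALL n>=M. dist (y m) (y n) < e"
  proof (intro exI allI impI)
   fix m n assume "m >= N" "n >= N"
   have N0: "real N > 0" using N e by (meson divide_pos_pos less_trans zero_less_numeral zero_less_power)
   have "(norm (y m - y n))^2 <= 2 / real (Suc m) + 2 / real (Suc n)" by (rule par)
   also have "... <= 2 / real N + 2 / real N" using \<open>m >= N\<close> \<open>n >= N\<close> N0 by (intro add_mono divide_left_mono) auto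
   also have "... < e\<^sup>2" using N N0 e by (simp add: field_simps)
   finally show "dist (y m) (y n) < e" using e by (simp add: dist_norm power_less_imp_less_base)
  qed
 qed
 then obtain p where p: "y ---> p" using Cauchy_convergent convergent_def by blast
 have pS: "p : S" using closed_sequentially[OF S(1)] yS p by blast
 have "(%n. (norm (x - y n))^2) ---> (norm (x - p))^2" by (intro tendsto_intros p)
 moreover have "(%n. d + 1 / real (Suc n)) ---> d + 0" by (intro tendsto_intros LIMSEQ_Suc[OF lim_1_over_n])
 ultimately have "(norm (x - p))^2 <= d + 0" by (rule LIMSEQ_le) (use y less_imp_le in blast)
 then have pd: "(norm (x - p))^2 <= (norm (x - z))^2" if "z : S" for z using dle[OF that] by linarith
 have "inner (x - p) z = 0" if z: "z : S" for z
 proof (cases "z = 0")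
  case False
  define t where "t = inner (x - p) z / (norm z)^2"
  have "p + t *R z : S" using S(2) pS z by (simp add: subspace_add subspace_scale)
  from pd[OF this] have "0 <= - 2 * t * inner (x - p) z + t\<^sup>2 * (norm z)^2" unfolding diff_diff_eq[symmetric] norm_diff_scaleR_power2 by linarith
  also have "... = - (inner (x - p) z)\<^sup>2 / (norm z)^2" using False by (simp add: t_def power2_eq_square field_simps)
  finally have "(inner (x - p) z)^2 / (norm z)^2 <= 0" by simp
  then show ?thesis using False by (simp add: divide_le_0_iff)
 qed simp
 with pS show ?thesis by blast
qed

lemma riesz_representation:
 fixes L :: "'a::{real_inner,complete_space} => real"
 assumes "bounded_linear L"
 shows "EX x. ALL y. L y = inner x y"
proof (cases "ALL y. L y = 0")
 case True then show ?thesis by (intro exI[of _ 0]) simp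
next
 case False
 interpret L: bounded_linear L by fact
 obtain z where z: "L z ~= 0" using False by blast
 have 1: "closed {y. L y = 0}" by (intro closed_Collect_eq continuous_intros L.continuous_on)
 have 2: "subspace {y. L y = 0}" by (auto simp: subspace_def L.add L.scaleR)
 obtain p where p: "L p = 0" "!!y. L y = 0 ==> inner (z - p) y = 0" using hilbert_projection[OF 1 2, of z] by auto
 define w where "w = z - p"
 have Lw: "L w ~= 0" using z p by (simp add: w_def L.diff)
 then have w0: "w ~= 0" by (auto simp: L.zero)
 show ?thesis
 proof (intro exI allI)
  fix y
  have "L (y - (L y / L w) *R w) = 0" using Lw by (simp add: L.diff L.scaleR)
  from p(2)[OF this] have "inner w y = (L y / L w) * inner w w" by (simp add: w_def[symmetric] inner_diff_right)
  then show "L y = inner ((L w / inner w w) *R w) y" using Lw w0 by (simp add: field_simps)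
 qed
qed

text \<open>Banach's fixed point theorem for \<open>x - t *R P (A x - b)\<close>, with
  \<open>P\<close> the orthogonal projection onto \<open>S\<close>. Coercivity is asked for on
  \<open>S\<close> only: the form of the heat equation is degenerate on the ambient product
  space.\<close>

lemma lax_milgram:
 fixes S :: "'a::{real_inner,complete_space} set"
 assumes S: "closed S" "subspace S" and A: "bounded_linear A" and \<alpha>: "\<alpha> > 0"
  and coercive: "!!x. x : S ==> \<alpha> * (norm x)^2 <= inner (A x) x"
 shows "EX x:S. ALL y:S. inner (A x - b) y = 0"
proof -
 interpret A: bounded_linear A by fact
 obtain P where PS: "!!x. P x : S" and P: "!!x y. y : S ==> inner (x - P x) y = 0" using hilbert_projection[OF S] by metis
 obtain B where B: "B > 0" "!!x. norm (A x) <= norm x * B" using A.pos_bounded by blast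
 \<comment> \<open>This \<open>t\<close> minimizes 1 - 2 t \<alpha> + t^2 B^2, the bound for the
   squared contraction factor.\<close>
 define t where "t = \<alpha> / B\<^sup>2"
 \<comment> \<open>The \<open>max 0\<close> covers \<alpha> > B, which can happen when
   \<open>S\<close> contains only 0.\<close>
 define c where "c = sqrt (max 0 (1 - \<alpha>\<^sup>2 / B\<^sup>2))"
 have t: "t > 0" using \<alpha> B by (simp add: t_def)
 have c: "0 <= c" "c < 1" using \<alpha> B by (auto simp: c_def)
 have Pd: "P x - P y = P (x - y)" for x y
 proof -
  have m: "P x - P y - P (x - y) : S" by (intro subspace_diff S PS)
  have "inner (P x - P y - P (x - y)) z = 0" if "z : S" for z using P[OF that, of x] P[OF that, of y] P[OF that, of "x - y"] by (simp add: inner_diff_left)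
  from this[OF m] show ?thesis by simp
 qed
 have Pn: "norm (P x) <= norm x" for x
 proof -
  have "inner (P x) (P x) = inner x (P x)" using P[OF PS[of x], of x] by (simp add: inner_diff_left)
  then have "norm (P x) * norm (P x) <= norm x * norm (P x)" using norm_cauchy_schwarz[of x "P x"] by (simp add: dot_square_norm power2_eq_square)
  then show ?thesis by (metis mult_le_cancel_right norm_ge_zero norm_le_zero_iff not_le order.trans)
 qed
 define T where "T x = x - t *R P (A x - b)" for x
 have contr: "dist (T x) (T y) <= c * dist x y" if "x : S" "y : S" for x y
 proof -
  define v where "v = x - y"
  have vS: "v : S" using that S by (simp add: v_def subspace_diff)
  have e: "T x - T y = v - t *R P (A v)" using Pd[of "A x - b" "A y - b"] by (simp add: T_def v_def A.diff algebra_simps flip: scaleR_diff_right)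
  have "inner v (P (A v)) = inner (A v) v" using P[OF vS, of "A v"] by (simp add: inner_diff_left inner_diff_right inner_commute)
  then have "(norm (T x - T y))^2 = (norm v)^2 - 2 * t * inner (A v) v + t\<^sup>2 * (norm (P (A v)))^2" unfolding e norm_diff_scaleR_power2 by simp
  also have "... <= (norm v)^2 - 2 * t * (\<alpha> * (norm v)^2) + t\<^sup>2 * (norm v * B)^2" using coercive[OF vS] t Pn[of "A v"] B(2)[of v]
   by (intro add_mono diff_mono mult_left_mono power_mono) auto
  also have "... = (1 - \<alpha>\<^sup>2 / B\<^sup>2) * (norm v)^2" using B by (simp add: t_def field_simps power2_eq_square)
  also have "... <= c\<^sup>2 * (norm v)^2" by (intro mult_right_mono) (auto simp: c_def)
  finally have "norm (T x - T y) <= c * norm v" by (metis c(1) mult_nonneg_nonneg norm_ge_zero power2_le_imp_le power_mult_distrib)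
  then show ?thesis by (simp add: dist_norm v_def)
 qed
 have "\<exists>!x. x : S & T x = x"
 proof (rule Banach_fix[OF _ _ c(1) c(2)])
  show "complete S" using S by (simp add: complete_eq_closed)
  show "S ~= {}" using subspace_0[OF S(2)] by auto
  show "T ` S <= S" using S PS by (auto simp: T_def subspace_diff subspace_scale)
  show "!!x y. [|x : S; y : S|] ==> dist (T x) (T y) <= c * dist x y" using contr by blast
 qed
 then obtain x where x: "x : S" "T x = x" by blast
 then have "P (A x - b) = 0" using t by (simp add: T_def)
 then have "inner (A x - b) y = 0" if "y : S" for y using P[OF that, of "A x - b"] by simp
 with x show ?thesis by blast
qed

text \<open>Tychonoff's theorem replaces the diagonal argument: the rows lie in a compact product of
  intervals, and with countably many coordinates compactness is sequential.\<close>

lemma pointwise_convergent_subseq: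
 fixes f :: "nat => nat => real"
 assumes "!!n m. \<bar>f n m\<bar> <= c m"
 shows "EX r. strict_mono r & (ALL m. convergent (%n. f (r n) m))"
proof -
 have "compactin (product_topology (%_. euclideanreal) UNIV) (PiE UNIV (%m. {- c m..c m}))" by (subst compactin_PiE) auto
 then have "compact (PiE UNIV (%m. {- c m..c m}))" by (simp add: euclidean_product_topology)
 then have "seq_compact (PiE UNIV (%m. {- c m..c m}))" by (simp add: compact_imp_seq_compact)
 moreover have "ALL n. f n : PiE UNIV (%m. {- c m..c m})" using assms by (auto simp: PiE_def Pi_def abs_le_iff minus_le_iff)
 ultimately obtain l r where "strict_mono (r :: nat => nat)" "(f \<circ> r) ---> l" unfolding seq_compact_def by blast
 moreover from this have "(%n. f (r n) m) ---> l m" for m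
  using continuous_on_tendsto_compose[OF continuous_on_product_coordinates[of m] \<open>(f \<circ> r) ---> l\<close>] by (simp add: o_def)
 ultimately show ?thesis by (metis convergentI)
qed

text \<open>No separability is involved. A subsequence is chosen for which the inner products with
  the members of the sequence converge; the vectors \<open>y\<close> with convergent inner products
  form a closed subspace containing the sequence, and any vector differs from its projection onto
  that subspace by something orthogonal to the whole sequence.\<close>

lemma weakly_convergent_subseq:
 fixes x :: "nat => 'a::{real_inner,complete_space}"
 assumes b: "!!n. norm (x n) <= c"
 shows "EX r l. strict_mono r & (ALL y. (%n. inner (x (r n)) y) ---> inner l y)"
proof -
 have "\<bar>inner (x n) (x m)\<bar> <= c * norm (x m)" for n m by (meson Cauchy_Schwarz_ineq2 b mult_right_mono norm_ge_zero order_trans)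
 then obtain r where r: "strict_mono r" "!!m. convergent (%n. inner (x (r n)) (x m))"
  using pointwise_convergent_subseq[of "%n m. inner (x n) (x m)" "%m. c * norm (x m)"] by blast
 define S where "S = {y. convergent (%n. inner (x (r n)) y)}"
 have sub: "subspace S" by (auto simp: subspace_def S_def inner_add_right convergent_add convergent_const
    intro!: convergent_mult)
 have c0: "c >= 0" using b[of 0] norm_ge_zero order_trans by blast
 have clo: "closed S" unfolding closed_sequential_limits
 proof (intro allI impI, elim conjE)
  fix y l assume y: "ALL n. y n : S" "y ---> l"
  have "Cauchy (%n. inner (x (r n)) l)"
  proof (rule metric_CauchyI)
   fix e :: real assume e: "e > 0"
   then have "e / (3 * (c + 1)) > 0" using c0 by simp
   then obtain k where k: "norm (y k - l) < e / (3 * (c + 1))" using y(2) unfolding LIMSEQ_iff by blast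
   have "Cauchy (%n. inner (x (r n)) (y k))" using y(1) by (simp add: S_def convergent_Cauchy)
   then obtain M where M: "!!m n. m >= M ==> n >= M ==> dist (inner (x (r m)) (y k)) (inner (x (r n)) (y k)) < e / 3"
    using e unfolding Cauchy_def by (meson divide_pos_pos zero_less_numeral)
   have small: "\<bar>inner (x n) (y k - l)\<bar> <= e / 3" for n
   proof -
    have "\<bar>inner (x n) (y k - l)\<bar> <= c * (e / (3 * (c + 1)))" by (meson Cauchy_Schwarz_ineq2 b c0 k less_imp_le mult_mono norm_ge_zero order_trans)
    also have "... <= (c + 1) * (e / (3 * (c + 1)))" using e c0 by (intro mult_right_mono) auto
    also have "... = e / 3" using c0 by (simp add: field_simps add_nonneg_eq_0_iff)
    finally show ?thesis .
   qed
   show "EX M. ALL m>=M. ALL n>=M. dist (inner (x (r m)) l) (inner (x (r n)) l) < e"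
   proof (intro exI[of _ M] allI impI)
    fix m n assume "m >= M" "n >= M"
    from M[OF this] small[of "r m"] small[of "r n"]
    show "dist (inner (x (r m)) l) (inner (x (r n)) l) < e" unfolding dist_real_def inner_diff_right by linarith
   qed
  qed
  then show "l : S" by (simp add: S_def Cauchy_convergent)
 qed
 have all: "convergent (%n. inner (x (r n)) y)" for y
 proof -
  obtain p where p: "p : S" "ALL z:S. inner (y - p) z = 0" using hilbert_projection[OF clo sub] by blast
  have "x (r n) : S" for n using r(2) by (simp add: S_def)
  then have "inner (x (r n)) y = inner (x (r n)) p" for n using p(2) by (metis eq_iff_diff_eq_0 inner_commute inner_diff_right)
  then show ?thesis using p(1) by (simp add: S_def)
 qed
 define L where "L y = lim (%n. inner (x (r n)) y)" for y
 have L: "(%n. inner (x (r n)) y) ---> L y" for y using all by (simp add: L_def convergent_LIMSEQ_iff)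
 have "bounded_linear L"
 proof (rule bounded_linear_intro[where K = c])
  show "L (a + b) = L a + L b" for a b by (rule LIMSEQ_unique[OF L]) (simp add: inner_add_right, intro tendsto_add L)
  show "L (s *R b) = s *R L b" for s b by (rule LIMSEQ_unique[OF L]) (simp, intro tendsto_mult L tendsto_const)
  show "norm (L y) <= norm y * c" for y
  proof (rule LIMSEQ_le_const2[OF tendsto_norm[OF L[of y]]], intro exI allI impI)
   show "norm (inner (x (r n)) y) <= norm y * c" for n using Cauchy_Schwarz_ineq2[of "x (r n)" y] mult_right_mono[OF b[of "r n"] norm_ge_zero[of y]]
    by (simp add: mult.commute)
  qed
 qed
 then obtain l where "ALL y. L y = inner l y" using riesz_representation by blast
 with L r(1) show ?thesis by metis
qed

text \<open>Kuhn's combinatorial lemma on a grid of mesh 1 / p; almost fixed points are enough for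
  Schauder's theorem. Points are functions on \<open>nat\<close> of which the first \<open>n\<close>
  values count, because the dimension will be the size of a net and so cannot be a type.\<close>

lemma brouwer_cube_approx:
 fixes f :: "(nat => real) => nat => real"
 assumes maps: "!!x i. (!!j. j < n ==> x j : {0..1}) ==> i < n ==> f x i : {0..1}"
  and ucont: "!!e. e > 0 ==> EX d>0. ALL x y. (ALL j<n. x j : {0..1} & y j : {0..1} & \<bar>x j - y j\<bar> <= d)
         --> (ALL i<n. \<bar>f x i - f y i\<bar> <= e)"
  and e: "e > 0"
 shows "EX x. (ALL j<n. x j : {0..1}) & (ALL i<n. \<bar>f x i - x i\<bar> <= e)"
proof -
 obtain d where d: "d > 0" and uc: "!!x y i. (ALL j<n. x j : {0..1} & y j : {0..1} & \<bar>x j - y j\<bar> <= d)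
         ==> i < n ==> \<bar>f x i - f y i\<bar> <= e / 2" using ucont[of "e / 2"] e by (metis half_gt_zero)
 obtain p where p: "p > 0" "1 / real p < min d (e / 2)"
  using reals_Archimedean[of "min d (e/2)"] d e by (metis inverse_eq_divide min_less_iff_conj half_gt_zero zero_less_Suc)
 define g where "g x = (%j. real (x j) / real p)" for x :: "nat => nat"
 have g: "g x j : {0..1}" if "x j <= p" for x j using that p by (simp add: g_def)
 \<comment> \<open>Label 0 says that \<open>f\<close> does not decrease coordinate \<open>i\<close>.
   The clause \<open>x i ~= p\<close> forces label 1 on the upper face, as Kuhn's lemma
   requires.\<close>
 define label where "label x i = (if f (g x) i >= g x i & x i ~= p then 0 else 1 :: nat)" for x i
 have l0: "ALL x. (ALL i<n. x i <= p) --> (ALL i<n. x i = 0 --> label x i = 0)" using maps[of "g _"] g p(1) by (auto simp: label_def g_def)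
 have l1: "ALL x. (ALL i<n. x i <= p) --> (ALL i<n. x i = p --> label x i = 1)" by (auto simp: label_def)
 have l01: "ALL x. (ALL i<n. x i <= p) --> (ALL i<n. label x i = (0::nat) \<or> label x i = 1)" by (auto simp: label_def)
 obtain q where q: "ALL i<n. q i < p"
  and rs: "ALL i<n. EX r s. (ALL j<n. q j <= r j & r j <= q j + 1) & (ALL j<n. q j <= s j & s j <= q j + 1) & label r i ~= label s i"
  by (rule kuhn_lemma[OF p(1) l01 l0 l1])
 have near: "\<bar>f (g q) i - f (g r) i\<bar> <= e / 2" "\<bar>g q i - g r i\<bar> <= e / 2" "g r i : {0..1}" "f (g r) i : {0..1}"
  if r: "ALL j<n. q j <= r j & r j <= q j + 1" and i: "i < n" for r i
 proof -
  have d': "\<bar>g q j - g r j\<bar> <= 1 / real p" if "j < n" for j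
  proof -
   have "\<bar>real (q j) - real (r j)\<bar> <= 1" using r that by (auto simp: abs_if)
   then show ?thesis using p(1) by (simp add: g_def field_simps flip: diff_divide_distrib)
  qed
  have rp: "r j <= p" "q j <= p" if "j < n" for j using r q that by fastforce+
  show "\<bar>f (g q) i - f (g r) i\<bar> <= e / 2"
  proof (intro uc allI impI conjI i)
   fix j assume j: "j < n"
   show "g q j : {0..1}" "g r j : {0..1}" using g rp[OF j] by blast+
   show "\<bar>g q j - g r j\<bar> <= d" using d'[OF j] p(2) by linarith
  qed
  show "\<bar>g q i - g r i\<bar> <= e / 2" using d'[OF i] p(2) by simp
  show "g r i : {0..1}" "f (g r) i : {0..1}" using g rp i maps[of "g r"] by blast+
 qed
 \<comment> \<open>The cell at \<open>q\<close> has corners with both labels in every coordinate, so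
   the displacement of \<open>f\<close> changes sign within it; \<open>near\<close> then makes it
   small at \<open>q\<close>.\<close>
 have "\<bar>f (g q) i - g q i\<bar> <= e" if i: "i < n" for i
 proof -
  obtain r s where r: "ALL j<n. q j <= r j & r j <= q j + 1" and s: "ALL j<n. q j <= s j & s j <= q j + 1"
   and l: "label r i = 0" "label s i = 1" using rs i unfolding label_def by (metis zero_neq_one)
  have "f (g r) i >= g r i" using l by (simp add: label_def split: if_splits)
  moreover have "f (g s) i <= g s i" using l near(4)[OF s i] p(1) by (auto simp: label_def g_def split: if_splits)
  ultimately show ?thesis using near(1,2)[OF r i] near(1,2)[OF s i] by linarith
 qed
 then show ?thesis using g q by (intro exI[of _ "g q"]) (auto intro: less_imp_le)
qed

text \<open>The Schauder projection. Weights over a finite net of the range turn \<open>T\<close>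
  into a self-map \<open>f\<close> of a cube. If \<open>x\<close> is almost fixed by
  \<open>f\<close>, then \<open>U x\<close> is almost fixed by \<open>T\<close>:
  \<open>U (f x)\<close> is a convex combination of net points close to \<open>T (U x)\<close>, and
  it is close to \<open>U x\<close>. As \<open>T\<close> is defined everywhere, no convex set has to
  be kept invariant.\<close>

lemma schauder_approx:
 fixes T :: "'a::real_normed_vector => 'a"
 assumes cont: "continuous_on UNIV T" and comp: "compact (closure (range T))" and e: "e > 0"
 shows "EX u. norm (T u - u) < e"
proof -
 obtain k where k: "finite k" "closure (range T) <= (\<Union>x\<in>k. ball x (e / 2))"
  using compact_imp_seq_compact[OF comp] seq_compact_imp_totally_bounded e by (metis half_gt_zero)
 obtain N :: nat and y where y: "k = y ` {..<N}" using k(1) by (metis finite_imp_nat_seg_image_inj_on lessThan_def)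
 define m where "m i v = max 0 (e / 2 - norm (v - y i))" for i v
 define s where "s v = (\<Sum>i<N. m i v)" for v
 have m0: "m i v >= 0" for i v by (simp add: m_def)
 have mc: "continuous_on UNIV (m i)" for i unfolding m_def by (intro continuous_intros)
 have s0: "s (T u) > 0" for u
 proof -
  have "T u : (\<Union>x\<in>k. ball x (e / 2))" using k(2) closure_subset[of "range T"] by blast
  then obtain i where i: "i < N" "norm (T u - y i) < e / 2" by (auto simp: y dist_norm norm_minus_commute)
  have "m i (T u) > 0" using i by (simp add: m_def)
  then show ?thesis unfolding s_def using i m0 by (metis finite_lessThan lessThan_iff sum_pos2)
 qed
 define U where "U x = (\<Sum>j<N. x j *R y j)" for x :: "nat => real"
 define f where "f x i = m i (T (U x)) / s (T (U x))" for x i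
 have sumf: "(\<Sum>i<N. f x i) = 1" for x using s0[of "U x"] by (simp add: f_def s_def flip: sum_divide_distrib)
 have f0: "f x i >= 0" for x i using m0 s0[of "U x"] by (simp add: f_def)
 have f1: "f x i <= 1" if "i < N" for x i using member_le_sum[of i "{..<N}" "f x"] that f0 sumf by simp
 define C where "C = {U x | x. ALL j<N. x j : {0..1}}"
 have Cc: "compact C"
 proof -
  have "compact {\<Sum>j<n. x j *R y j | x. ALL j<n. x j : {0..1::real}}" for n
  proof (induction n)
   case (Suc n)
   let ?A = "{\<Sum>j<n. x j *R y j | x. ALL j<n. x j : {0..1::real}}"
   let ?B = "(%t. t *R y n) ` {0..1::real}"
   have "{\<Sum>j<Suc n. x j *R y j | x. ALL j<Suc n. x j : {0..1::real}} = {a + b | a b. a : ?A & b : ?B}"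
   proof (intro equalityI subsetI)
    fix v assume "v : {a + b | a b. a : ?A & b : ?B}"
    then obtain x t where x: "v = (\<Sum>j<n. x j *R y j) + t *R y n" "ALL j<n. x j : {0..1}" "t : {0..1}" by auto
    show "v : {\<Sum>j<Suc n. x j *R y j | x. ALL j<Suc n. x j : {0..1::real}}"
     by (rule CollectI, rule exI[of _ "x(n := t)"]) (use x in \<open>auto simp: less_Suc_eq\<close>)
   qed fastforce
   moreover have "compact ?B" by (intro compact_continuous_image continuous_intros) auto
   ultimately show ?case using compact_sums[OF Suc.IH] by simp
  qed simp
  then show ?thesis by (simp add: C_def U_def)
 qed
 have wc: "uniformly_continuous_on C (%v. m i (T v) / s (T v))" for i
 proof (rule compact_uniformly_continuous[OF _ Cc])
  have "continuous_on UNIV (%v. m i (T v))" for i using continuous_on_compose2[OF mc cont] by auto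
  then show "continuous_on C (%v. m i (T v) / s (T v))" unfolding s_def using s0 by (intro continuous_intros) (auto simp: s_def less_le intro: continuous_on_subset)
 qed
 \<comment> \<open>A Lipschitz constant of \<open>U\<close> for the maximum norm on coefficients;
   the 1 keeps it positive.\<close>
 define Y where "Y = (\<Sum>j<N. norm (y j)) + 1"
 have Y: "Y > 0" by (auto simp: Y_def intro!: add_nonneg_pos sum_nonneg)
 have Ud: "norm (U x - U x') <= d * Y" if d: "!!j. j < N ==> \<bar>x j - x' j\<bar> <= d" and d0: "d >= 0" for x x' d
 proof -
  have "norm (U x - U x') <= (\<Sum>j<N. norm ((x j - x' j) *R y j))" by (simp add: U_def scaleR_diff_left norm_sum flip: sum_subtractf)
  also have "... <= (\<Sum>j<N. d * norm (y j))" by (intro sum_mono) (auto intro!: mult_right_mono d)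
  also have "... <= d * Y" using d0 by (simp add: Y_def sum_distrib_left distrib_left)
  finally show ?thesis .
 qed
 have "EX x. (ALL j<N. x j : {0..1}) & (ALL i<N. \<bar>f x i - x i\<bar> <= e / (4 * Y))"
 proof (rule brouwer_cube_approx)
  fix \<epsilon> :: real assume \<epsilon>: "\<epsilon> > 0"
  have "EX d>0. ALL a:C. ALL b:C. dist a b < d --> dist (m i (T a) / s (T a)) (m i (T b) / s (T b)) < \<epsilon>" for i
   using wc[of i] \<epsilon> unfolding uniformly_continuous_on_def by (metis dist_commute)
  then obtain d where d: "!!i. d i > 0"
   "!!i a b. a : C ==> b : C ==> dist a b < d i ==> dist (m i (T a) / s (T a)) (m i (T b) / s (T b)) < \<epsilon>" by metis
  define D where "D = Min (insert 1 (d ` {..<N}))"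
  have D: "D > 0" "!!i. i < N ==> D <= d i" using d(1) by (auto simp: D_def)
  show "EX d>0. ALL x x'. (ALL j<N. x j : {0..1} & x' j : {0..1} & \<bar>x j - x' j\<bar> <= d) --> (ALL i<N. \<bar>f x i - f x' i\<bar> <= \<epsilon>)"
  proof (intro exI[of _ "D / (2 * Y)"] conjI allI impI)
   fix x x' i assume h: "ALL j<N. x j : {0..1} & x' j : {0..1} & \<bar>x j - x' j\<bar> <= D / (2 * Y)" and i: "i < N"
   have "norm (U x - U x') <= D / (2 * Y) * Y" using h D Y by (intro Ud) auto
   also have "... < D" using D Y by simp
   also have "... <= d i" by (rule D(2)[OF i])
   finally have "dist (U x) (U x') < d i" by (simp add: dist_norm)
   moreover have "U x : C" "U x' : C" using h by (auto simp: C_def)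
   ultimately have "dist (m i (T (U x)) / s (T (U x))) (m i (T (U x')) / s (T (U x'))) < \<epsilon>" by (intro d(2))
   then show "\<bar>f x i - f x' i\<bar> <= \<epsilon>" by (simp add: f_def dist_real_def)
  qed (use D Y in auto)
 qed (use f0 f1 e Y in auto)
 then obtain x where x: "!!j. j < N ==> x j : {0..1}" "!!i. i < N ==> \<bar>f x i - x i\<bar> <= e / (4 * Y)" by blast
 define u where "u = U x"
 have "norm (U (f x) - u) <= e / (4 * Y) * Y" unfolding u_def by (rule Ud) (use x e Y in auto)
 then have a: "norm (U (f x) - u) <= e / 4" using Y by simp
 have "T u - U (f x) = (\<Sum>i<N. f x i *R (T u - y i))" by (simp add: U_def scaleR_diff_right sum_subtractf flip: scaleR_left.sum) (simp add: sumf)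
 also have "norm ... <= (\<Sum>i<N. norm (f x i *R (T u - y i)))" by (rule norm_sum)
 also have "... <= (\<Sum>i<N. f x i * (e / 2))"
 proof (rule sum_mono)
  fix i assume "i : {..<N}"
  show "norm (f x i *R (T u - y i)) <= f x i * (e / 2)"
  proof (cases "norm (T u - y i) <= e / 2")
   case True then show ?thesis using mult_left_mono[OF True f0[of x i]] f0[of x i] by simp
  next
   case False
   then have "f x i = 0" by (simp add: f_def m_def u_def)
   then show ?thesis by simp
  qed
 qed
 also have "... = e / 2" by (simp add: sumf flip: sum_distrib_right sum_divide_distrib)
 finally have "norm (T u - U (f x)) <= e / 2" .
 with a have "norm (T u - u) < e" using norm_triangle_ineq[of "T u - U (f x)" "U (f x) - u"] e by simp
 then show ?thesis by blast
qed

text \<open>Compactness is phrased along images of arbitrary sequences, the form in which Rellich's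
  theorem will deliver it. Points of the closure of the range are first replaced by nearby values of
  \<open>T\<close>.\<close>

lemma schauder_fixpoint:
 fixes T :: "'a::real_normed_vector => 'a"
 assumes cont: "continuous_on UNIV T"
  and comp: "!!x :: nat => 'a. EX r l. strict_mono r & (%n. T (x (r n))) ---> l"
 shows "EX x. T x = x"
proof -
 have "seq_compact (closure (range T))" unfolding seq_compact_def
 proof (intro allI impI)
  fix y assume "ALL n::nat. y n : closure (range T)"
  then have "EX x. dist (T x) (y n) < inverse (real (Suc n))" for n
   using closure_approachable[of "y n" "range T"] by (metis inverse_positive_iff_positive of_nat_0_less_iff rangeE zero_less_Suc)
  then obtain x where x: "!!n. dist (T (x n)) (y n) < inverse (real (Suc n))" by metis
  obtain r l where r: "strict_mono r" "(%n. T (x (r n))) ---> l" using comp by blast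
  have "(%n. dist (T (x n)) (y n)) ---> 0" by (rule tendsto_sandwich[OF _ _ tendsto_const LIMSEQ_inverse_real_of_nat])
    (use x in \<open>auto intro!: always_eventually less_imp_le simp del: of_nat_Suc\<close>)
  then have "(%n. dist (T (x (r n))) (y (r n))) ---> 0" using LIMSEQ_subseq_LIMSEQ[OF _ r(1)] by (fastforce simp: o_def)
  then have "(%n. T (x (r n)) - y (r n)) ---> 0" by (simp add: dist_norm tendsto_norm_zero_iff)
  from tendsto_diff[OF r(2) this] have "(y \<circ> r) ---> l" by (simp add: o_def)
  moreover from this have "l : closure (range T)" using \<open>ALL n. y n : closure (range T)\<close> closed_sequentially[OF closed_closure] by (metis comp_def)
  ultimately show "EX l:closure (range T). EX r. strict_mono r & (y \<circ> r) ---> l" using r(1) by blast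
 qed
 then have "compact (closure (range T))" by (simp add: compact_eq_seq_compact_metric)
 from schauder_approx[OF cont this]
 have "EX u. norm (T u - u) < inverse (real (Suc n))" for n by simp
 then obtain u where u: "!!n. norm (T (u n) - u n) < inverse (real (Suc n))" by metis
 obtain r l where r: "strict_mono r" "(%n. T (u (r n))) ---> l" using comp by blast
 have "(%n. norm (T (u n) - u n)) ---> 0" by (rule tendsto_sandwich[OF _ _ tendsto_const LIMSEQ_inverse_real_of_nat])
   (use u in \<open>auto intro!: always_eventually less_imp_le simp del: of_nat_Suc\<close>)
 then have "(%n. T (u n) - u n) ---> 0" by (simp add: tendsto_norm_zero_iff)
 then have "(%n. T (u (r n)) - u (r n)) ---> 0" using LIMSEQ_subseq_LIMSEQ[OF _ r(1)] by (fastforce simp: o_def)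
 from tendsto_diff[OF r(2) this] have ul: "(%n. u (r n)) ---> l" by simp
 have "(%n. T (u (r n))) ---> T l" by (rule continuous_on_tendsto_compose[OF cont ul]) auto
 then have "T l = l" using r(2) LIMSEQ_unique by blast
 then show ?thesis by blast
qed

section \<open>The Hilbert space of square integrable functions\<close>

text \<open>Functions live on all of space: a field on the domain is extended by zero, so that one
  Hilbert space serves the domain, the balls around it and the whole space.\<close>

definition sqi :: "(real^3 => 'b::euclidean_space) => bool" where
 "sqi f <-> f : BM & integrable lborel (%x. (norm (f x))^2)"

lemma sqi_bm[measurable_dest]: "sqi f ==> f : BM" by (simp add: sqi_def)

lemma sqi_integrable: "sqi f ==> integrable lborel (%x. (norm (f x))^2)" by (simp add: sqi_def)

lemma sqi_iff_nn: "sqi f <-> f : BM & (\<integral>\<^sup>+x. en ((norm (f x))^2)) < \<infinity>" unfolding sqi_def by (auto simp: integrable_iff_bounded)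

lemma sqi_bound:
 assumes "f : BM" "integrable lborel h" "AE x. (norm (f x))^2 <= h x"
 shows "sqi f" unfolding sqi_def
proof (intro conjI assms(1))
 show "integrable lborel (%x. (norm (f x))^2)" by (rule Bochner_Integration.integrable_bound[OF assms(2)]) (use assms in auto)
qed

lemma sqi_mono:
 assumes "f : BM" "sqi h" "AE x. norm (f x) <= norm (h x)"
 shows "sqi f" by (rule sqi_bound[OF assms(1) sqi_integrable[OF assms(2)]]) (use assms(3) in \<open>auto intro: power_mono\<close>)

lemma sqi_zero[simp]: "sqi (%x. 0)" by (simp add: sqi_def)

lemma sqi_scaleR: assumes "sqi f" shows "sqi (%x. c *R f x)" using assms by (auto simp: sqi_def power_mult_distrib)

lemma sqi_add: assumes f: "sqi f" "sqi g" shows "sqi (%x. f x + g x)"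
proof (rule sqi_bound[where h = "%x. 2 * (norm (f x))^2 + 2 * (norm (g x))^2"])
 show "(%x. f x + g x) : BM" using f[THEN sqi_bm] by measurable
 have "(norm (f x + g x))^2 <= 2 * (norm (f x))^2 + 2 * (norm (g x))^2" for x
 proof -
  have "(norm (f x + g x))^2 <= (norm (f x) + norm (g x))^2" by (intro power_mono norm_triangle_ineq) simp
  also have "... <= 2 * (norm (f x))^2 + 2 * (norm (g x))^2" using sum_squares_bound[of "norm (f x)" "norm (g x)"] by (simp add: power2_sum)
  finally show ?thesis .
 qed
 then show "AE x. (norm (f x + g x))^2 <= 2 * (norm (f x))^2 + 2 * (norm (g x))^2" by simp
qed (use f in \<open>auto simp: sqi_def\<close>)

lemma sqi_diff: assumes "sqi f" "sqi g" shows "sqi (%x. f x - g x)" using sqi_add[OF assms(1) sqi_scaleR[OF assms(2), of "-1"]] by simp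

lemma sqi_sum: assumes "!!i. i : I ==> sqi (f i)" shows "sqi (%x. \<Sum>i\<in>I. f i x)" using assms by (induction I rule: infinite_finite_induct) (auto intro: sqi_add)

lemma sqi_bdd_mult:
 assumes "s : BM" "AE x. \<bar>s x\<bar> <= c" "sqi f"
 shows "sqi (%x. s x *R f x)"
proof (rule sqi_mono[OF _ sqi_scaleR[OF assms(3), of c]])
 show "(%x. s x *R f x) : BM" using assms(1) sqi_bm[OF assms(3)] by measurable
 show "AE x. norm (s x *R f x) <= norm (c *R f x)" using assms(2) by eventually_elim (auto intro: mult_right_mono)
qed

lemma sqi_indicator: assumes "sqi f" "A : sets borel" shows "sqi (%x. indicator A x *R f x)"
 by (rule sqi_bdd_mult[where c = 1]) (use assms in \<open>auto simp: indicator_def\<close>)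

lemma sqi_inner: assumes f: "sqi f" "sqi g" shows "integrable lborel (%x. f x \<bullet> g x)"
proof (rule Bochner_Integration.integrable_bound[where f = "%x. (norm (f x))^2 + (norm (g x))^2"])
 show "(%x. f x \<bullet> g x) : borel_measurable lborel" using f[THEN sqi_bm] by simp
 have "\<bar>f x \<bullet> g x\<bar> <= (norm (f x))^2 + (norm (g x))^2" for x
 proof -
  have "\<bar>f x \<bullet> g x\<bar> <= norm (f x) * norm (g x)" by (rule Cauchy_Schwarz_ineq2)
  also have "... <= (norm (f x))^2 + (norm (g x))^2" using sum_squares_bound[of "norm (f x)" "norm (g x)"] zero_le_power2[of "norm (f x)"] zero_le_power2[of "norm (g x)"]
    mult_nonneg_nonneg[OF norm_ge_zero[of "f x"] norm_ge_zero[of "g x"]] by linarith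
  finally show ?thesis .
 qed
 then show "AE x. norm (f x \<bullet> g x) <= norm ((norm (f x))^2 + (norm (g x))^2)" by simp
qed (use f in \<open>auto simp: sqi_def\<close>)

\<comment> \<open>The relation is partial since only square integrable functions represent a class.
  Having L2 as a type makes it an instance of the inner product and completeness classes, so that
  projection, weak compactness and Lax-Milgram apply directly.\<close>
quotient_type (overloaded) 'b l2 = "real^3 => 'b::euclidean_space" /
 partial: "%f g. sqi f & sqi g & (AE x. f x = g x)"
proof (rule part_equivpI)
 show "EX f :: real^3 => 'b. sqi f & sqi f & (AE x. f x = f x)" by (rule exI[of _ "%x. 0"]) simp
 show "symp (%f g :: real^3 => 'b. sqi f & sqi g & (AE x. f x = g x))" by (rule sympI) (auto elim: eventually_mono)
 show "transp (%f g :: real^3 => 'b. sqi f & sqi g & (AE x. f x = g x))" by (rule transpI) (auto elim: eventually_elim2)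
qed

abbreviation (input) cls :: "(real^3 => 'b::euclidean_space) => 'b l2" where "cls \<equiv> abs_l2"
abbreviation (input) rep :: "'b::euclidean_space l2 => real^3 => 'b" where "rep \<equiv> rep_l2"

lemma sqi_rep[simp]: "sqi (rep u)" using Quotient3_rep_reflp[OF Quotient3_l2, of u] by simp

lemma rep_measurable[measurable]: "rep u : BM" using sqi_rep sqi_bm by blast

lemma cls_rep[simp]: "cls (rep u) = u" by (rule Quotient3_abs_rep[OF Quotient3_l2])

lemma cls_eq_iff: "sqi f ==> sqi g ==> cls f = cls g <-> (AE x. f x = g x)" using Quotient3_rel[OF Quotient3_l2, of f g] by auto

lemma cls_eqI: "sqi f ==> sqi g ==> (AE x. f x = g x) ==> cls f = cls g" by (simp add: cls_eq_iff)

lemma rep_cls: "sqi f ==> AE x. rep (cls f) x = f x" using cls_eq_iff[of "rep (cls f)" f] by simp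

lemma l2_eqI: "(AE x. rep u x = rep v x) ==> u = v" using cls_eq_iff[of "rep u" "rep v"] by simp

instantiation l2 :: (euclidean_space) real_inner
begin

definition "0 = cls (%x. 0)"
definition "u + v = cls (%x. rep u x + rep v x)"
definition "u - v = cls (%x. rep u x - rep v x)"
definition "- u = cls (%x. - rep u x)"
definition "c *R u = cls (%x. c *R rep u x)"
definition "inner u v = (\<integral>x. rep u x \<bullet> rep v x)"
definition "norm (u :: 'a l2) = sqrt (inner u u)"
definition "dist (u :: 'a l2) v = norm (u - v)"
definition "sgn (u :: 'a l2) = scaleR (inverse (norm u)) u"
definition "uniformity = (INF e\<in>{0<..}. principal {(u :: 'a l2, v). dist u v < e})"
definition "open (U :: 'a l2 set) <-> (ALL u:U. eventually (%(u', v). u' = u --> v : U) uniformity)"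

lemma rep_zero: "AE x. rep (0 :: 'a l2) x = 0" unfolding zero_l2_def by (rule rep_cls) simp
lemma rep_add: "AE x. rep (u + v) x = rep u x + rep (v :: 'a l2) x" unfolding plus_l2_def by (intro rep_cls sqi_add sqi_rep)
lemma rep_diff: "AE x. rep (u - v) x = rep u x - rep (v :: 'a l2) x" unfolding minus_l2_def by (intro rep_cls sqi_diff sqi_rep)
lemma rep_scaleR: "AE x. rep (c *R u) x = c *R rep (u :: 'a l2) x" unfolding scaleR_l2_def by (intro rep_cls sqi_scaleR sqi_rep)
lemma rep_uminus: "AE x. rep (- u) x = - rep (u :: 'a l2) x" unfolding uminus_l2_def using sqi_scaleR[OF sqi_rep[of u], of "-1"] by (intro rep_cls) simp

lemma inner_rep_integrable: "integrable lborel (%x. rep u x \<bullet> rep (v :: 'a l2) x)" by (intro sqi_inner sqi_rep)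

instance
proof
 fix a b c :: "'a l2" and r s :: real
 show "a + b + c = a + (b + c)" by (rule l2_eqI) (use rep_add[of "a + b" c] rep_add[of a b] rep_add[of a "b + c"] rep_add[of b c] in \<open>eventually_elim, simp\<close>)
 show "a + b = b + a" by (rule l2_eqI) (use rep_add[of a b] rep_add[of b a] in \<open>eventually_elim, simp\<close>)
 show "0 + a = a" by (rule l2_eqI) (use rep_add[of 0 a] rep_zero in \<open>eventually_elim, simp\<close>)
 show "- a + a = 0" by (rule l2_eqI) (use rep_add[of "- a" a] rep_uminus[of a] rep_zero in \<open>eventually_elim, simp\<close>)
 show "a - b = a + - b" by (rule l2_eqI) (use rep_add[of a "- b"] rep_uminus[of b] rep_diff[of a b] in \<open>eventually_elim, simp\<close>)
 show "r *R (a + b) = r *R a + r *R b"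
  by (rule l2_eqI) (use rep_add[of a b] rep_scaleR[of r "a + b"] rep_add[of "r *R a" "r *R b"] rep_scaleR[of r a] rep_scaleR[of r b] in \<open>eventually_elim, simp add: scaleR_add_right\<close>)
 show "(r + s) *R a = r *R a + s *R a"
  by (rule l2_eqI) (use rep_scaleR[of "r + s" a] rep_add[of "r *R a" "s *R a"] rep_scaleR[of r a] rep_scaleR[of s a] in \<open>eventually_elim, simp add: scaleR_add_left\<close>)
 show "r *R s *R a = (r * s) *R a" by (rule l2_eqI) (use rep_scaleR[of r "s *R a"] rep_scaleR[of s a] rep_scaleR[of "r * s" a] in \<open>eventually_elim, simp\<close>)
 show "1 *R a = a" by (rule l2_eqI) (use rep_scaleR[of 1 a] in \<open>eventually_elim, simp\<close>)
 show "dist a b = norm (a - b)" by (rule dist_l2_def)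
 show "sgn a = scaleR (inverse (norm a)) a" by (rule sgn_l2_def)
 show "uniformity = (INF e\<in>{0<..}. principal {(x :: 'a l2, y). dist x y < e})" by (rule uniformity_l2_def)
 show "open U <-> (ALL x:U. \<forall>\<^sub>F (x', y) in uniformity. x' = x --> y : U)" for U :: "'a l2 set" by (rule open_l2_def)
 show "inner a b = inner b a" by (simp add: inner_l2_def inner_commute)
 have "inner (a + b) c = (\<integral>x. rep a x \<bullet> rep c x + rep b x \<bullet> rep c x)" unfolding inner_l2_def
 proof (rule integral_cong_AE)
  show "AE x. rep (a + b) x \<bullet> rep c x = rep a x \<bullet> rep c x + rep b x \<bullet> rep c x" using rep_add[of a b] by eventually_elim (simp add: inner_add_left)
 qed simp_all
 then show "inner (a + b) c = inner a c + inner b c" by (simp add: inner_l2_def inner_rep_integrable)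
 have "inner (r *R a) b = (\<integral>x. r * (rep a x \<bullet> rep b x))" unfolding inner_l2_def
 proof (rule integral_cong_AE)
  show "AE x. rep (r *R a) x \<bullet> rep b x = r * (rep a x \<bullet> rep b x)" using rep_scaleR[of r a] by eventually_elim simp
 qed simp_all
 then show "inner (r *R a) b = r * inner a b" by (simp add: inner_l2_def)
 show "0 <= inner a a" by (simp add: inner_l2_def)
 show "(inner a a = 0) = (a = 0)"
 proof
  assume "inner a a = 0"
  then have "AE x. rep a x \<bullet> rep a x = 0" unfolding inner_l2_def by (subst (asm) integral_nonneg_eq_0_iff_AE) (auto simp: inner_rep_integrable)
  then have "AE x. rep a x = rep (0 :: 'a l2) x" using rep_zero by eventually_elim simp
  then show "a = 0" by (rule l2_eqI)
 next
  assume "a = 0"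
  from rep_zero have "AE x. rep a x \<bullet> rep a x = 0" unfolding \<open>a = 0\<close> by eventually_elim simp
  then show "inner a a = 0" unfolding inner_l2_def by (rule integral_eq_zero_AE)
 qed
 show "norm a = sqrt (inner a a)" by (rule norm_l2_def)
qed

end

lemma cls_add: assumes "sqi f" "sqi g" shows "cls f + cls g = cls (%x. f x + g x)" unfolding plus_l2_def using rep_cls[OF assms(1)] rep_cls[OF assms(2)] assms
 by (intro cls_eqI sqi_add sqi_rep) (auto elim: eventually_elim2)

lemma cls_diff: assumes "sqi f" "sqi g" shows "cls f - cls g = cls (%x. f x - g x)" unfolding minus_l2_def using rep_cls[OF assms(1)] rep_cls[OF assms(2)] assms
 by (intro cls_eqI sqi_diff sqi_rep) (auto elim: eventually_elim2)

lemma cls_scaleR: assumes "sqi f" shows "c *R cls f = cls (%x. c *R f x)" unfolding scaleR_l2_def using rep_cls[OF assms] assms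
 by (intro cls_eqI sqi_scaleR sqi_rep) (auto elim: eventually_mono)

lemma cls_sum: assumes "!!i. i : I ==> sqi (f i)" shows "(\<Sum>i\<in>I. cls (f i)) = cls (%x. \<Sum>i\<in>I. f i x)"
 using assms by (induction I rule: infinite_finite_induct) (auto simp: zero_l2_def[symmetric] cls_add sqi_sum)

lemma inner_cls: assumes "sqi f" "sqi g" shows "inner (cls f) (cls g) = (\<integral>x. f x \<bullet> g x)"
 unfolding inner_l2_def using rep_cls[OF assms(1)] rep_cls[OF assms(2)] assms[THEN sqi_bm] by (intro integral_cong_AE) (auto elim: eventually_elim2)

abbreviation (input) "l2n f == norm (cls f)"

lemma norm_cls: assumes "sqi f" shows "(l2n f)^2 = (\<integral>x. (norm (f x))^2)" using inner_cls[OF assms assms] by (simp add: dot_square_norm)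

lemma nn_norm_cls: assumes "sqi f" shows "(\<integral>\<^sup>+x. en ((norm (f x))^2)) = en ((l2n f)^2)"
 unfolding norm_cls[OF assms] by (rule nn_integral_eq_integral) (use assms in \<open>auto simp: sqi_def\<close>)

lemma norm_cls_le:
 assumes "f : BM" "(\<integral>\<^sup>+x. en ((norm (f x))^2)) <= en (c\<^sup>2)" "c >= 0"
 shows "sqi f" "l2n f <= c"
proof -
 show 1: "sqi f" using assms by (auto simp: sqi_iff_nn intro: le_less_trans)
 have "(l2n f)^2 <= c\<^sup>2" using assms(2) by (simp add: nn_norm_cls[OF 1])
 then show "l2n f <= c" by (rule power2_le_imp_le) fact
qed

lemma norm_cls_mono:
 assumes "f : BM" "sqi h" "AE x. norm (f x) <= norm (h x)"
 shows "l2n f <= l2n h"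
proof (rule norm_cls_le(2)[OF assms(1)])
 have "(\<integral>\<^sup>+x. en ((norm (f x))^2)) <= (\<integral>\<^sup>+x. en ((norm (h x))^2))"
  using assms(3) by (intro nn_integral_mono_AE) (auto elim!: eventually_mono intro!: ennreal_leI power_mono)
 then show "(\<integral>\<^sup>+x. en ((norm (f x))^2)) <= en ((l2n h)^2)" by (simp add: nn_norm_cls[OF assms(2)])
qed simp

text \<open>Riesz-Fischer. Along the subsequence \<open>R\<close> the steps have norm at most
  (1/4)^k, so the series of 4^k times the squared pointwise steps has finite integral. Where it is
  finite the steps are at most \<open>sqrt S * (1/2)^k\<close>, which gives pointwise convergence;
  Fatou's lemma turns this into convergence in norm.\<close>

lemma l2_Cauchy_convergent:
 fixes X :: "nat => 'b::euclidean_space l2"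
 assumes "Cauchy X" shows "convergent X"
proof -
 have "EX N. ALL m>=N. ALL n>=N. norm (X m - X n) < (1/4)^k" for k :: nat using assms by (simp add: Cauchy_iff)
 then obtain N where N: "!!k m n. m >= N k ==> n >= N k ==> norm (X m - X n) < (1/4)^k" by metis
 \<comment> \<open>The maximum keeps the indices strictly increasing while staying beyond
   \<open>N\<close>.\<close>
 define R where "R = rec_nat (N 0) (%k r. max (Suc r) (N (Suc k)))"
 have R: "R (Suc k) = max (Suc (R k)) (N (Suc k))" for k by (simp add: R_def)
 have Rm: "strict_mono R" by (rule strict_monoI_Suc) (simp add: R)
 have RN: "R k >= N k" for k by (cases k) (simp_all add: R_def)
 define f where "f k = rep (X (R k))" for k
 have [measurable]: "f k : BM" for k by (simp add: f_def)
 have fd: "sqi (%x. f j x - f k x)" for j k unfolding f_def by (intro sqi_diff sqi_rep)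
 have fn: "cls (%x. f j x - f k x) = X (R j) - X (R k)" for j k unfolding f_def by (subst cls_diff[symmetric]) simp_all
 have "(\<integral>\<^sup>+x. (\<Sum>k. en (4^k * (norm (f (Suc k) x - f k x))^2)))
   = (\<Sum>k. \<integral>\<^sup>+x. en (4^k * (norm (f (Suc k) x - f k x))^2))" by (rule nn_integral_suminf) measurable
 also have "... <= (\<Sum>k. en ((1/4)^k))"
 proof (intro suminf_le allI)
  fix k
  have "(\<integral>\<^sup>+x. en (4^k * (norm (f (Suc k) x - f k x))^2))
   = en (4^k) * (\<integral>\<^sup>+x. en ((norm (f (Suc k) x - f k x))^2))" by (subst nn_integral_cmult[symmetric]) (auto simp: ennreal_mult)
  also have "... = en (4^k * (norm (X (R (Suc k)) - X (R k)))^2)" by (simp add: nn_norm_cls[OF fd] fn ennreal_mult)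
  also have "... <= en ((1/4)^k)"
  proof (rule ennreal_leI)
   have "R (Suc k) >= N k" using RN[of k] by (simp add: R)
   then have "norm (X (R (Suc k)) - X (R k)) <= (1/4)^k" using N RN less_imp_le by blast
   then have "(norm (X (R (Suc k)) - X (R k)))^2 <= ((1/4)^k)^2" by (intro power_mono norm_ge_zero)
   then have "4^k * (norm (X (R (Suc k)) - X (R k)))^2 <= 4^k * ((1/4)^k)^2" by (intro mult_left_mono) auto
   also have "... = (1/4::real)^k" by (simp add: power2_eq_square power_mult_distrib[symmetric] flip: mult.assoc)
   finally show "4^k * (norm (X (R (Suc k)) - X (R k)))^2 <= (1/4)^k" .
  qed
  finally show "(\<integral>\<^sup>+x. en (4^k * (norm (f (Suc k) x - f k x))^2)) <= en ((1/4)^k)" .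
 qed auto
 also have "... = en (\<Sum>k. (1/4)^k)" by (rule suminf_ennreal2) (auto intro: summable_geometric)
 also have "... < \<infinity>" by simp
 finally have "AE x. (\<Sum>k. en (4^k * (norm (f (Suc k) x - f k x))^2)) ~= \<infinity>" by (intro nn_integral_PInf_AE) auto
 then have conv: "AE x. convergent (%k. f k x)"
 proof eventually_elim
  case (elim x)
  then have sm: "summable (%k. 4^k * (norm (f (Suc k) x - f k x))^2)" by (intro summable_suminf_not_top) (auto simp: top.not_eq_extremum)
  then obtain S where S: "!!k. 4^k * (norm (f (Suc k) x - f k x))^2 <= S" using Bseq_eq_bounded[of "%k. 4^k * (norm (f (Suc k) x - f k x))^2"] summable_imp_Bseq[OF sm]
   unfolding Bseq_def by (auto dest: abs_le_D1)
  have S0: "S >= 0" using S[of 0] order_trans[OF zero_le_power2[of "norm (f (Suc 0) x - f 0 x)"]] by simp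
  have "norm (f (Suc k) x - f k x) <= sqrt S * (1/2)^k" for k
  proof (rule power2_le_imp_le)
   have "(norm (f (Suc k) x - f k x))^2 <= S / 4^k" using S[of k] by (simp add: field_simps)
   also have "... = (sqrt S * (1/2)^k)^2" using S0 by (simp add: power_mult_distrib power_divide power2_eq_square flip: power_mult_distrib)
   finally show "(norm (f (Suc k) x - f k x))^2 <= (sqrt S * (1/2)^k)^2" .
  qed (use S0 in simp)
  then have "summable (%k. f (Suc k) x - f k x)" by (rule summable_comparison_test'[where g = "%k. sqrt S * (1/2)^k" and N = 0, rotated])
    (simp add: summable_mult summable_geometric)
  then have "convergent (%n. \<Sum>k<n. f (Suc k) x - f k x)" by (simp add: summable_iff_convergent)
  then have "convergent (%n. f n x - f 0 x)" by (subst (asm) sum_lessThan_telescope)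
  from convergent_add[OF this convergent_const[of "f 0 x"]] show ?case by simp
 qed
 define g where "g x = lim (%k. f k x)" for x
 have [measurable]: "g : BM" unfolding g_def by measurable
 have fg: "AE x. (%k. f k x) ---> g x" using conv by eventually_elim (simp add: g_def convergent_LIMSEQ_iff)
 have est: "(\<integral>\<^sup>+x. en ((norm (g x - f k x))^2)) <= en (((1/4)^k)^2)" for k
 proof -
  have "(\<integral>\<^sup>+x. en ((norm (g x - f k x))^2))
   = (\<integral>\<^sup>+x. liminf (%j. en ((norm (f j x - f k x))^2)))"
  proof (rule nn_integral_cong_AE, use fg in eventually_elim)
   fix x assume "(%k. f k x) ---> g x"
   then have "(%j. en ((norm (f j x - f k x))^2)) ---> en ((norm (g x - f k x))^2)" by (intro tendsto_intros)
   from lim_imp_Liminf[OF _ this]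
   show "en ((norm (g x - f k x))^2) = liminf (%j. en ((norm (f j x - f k x))^2))" by simp
  qed
  also have "... <= liminf (%j. \<integral>\<^sup>+x. en ((norm (f j x - f k x))^2))" by (rule nn_integral_liminf) measurable
  also have "... <= liminf (%j. en (((1/4)^k)^2))"
  proof (rule Liminf_mono)
   show "\<forall>\<^sub>F j in sequentially. (\<integral>\<^sup>+x. en ((norm (f j x - f k x))^2)) <= en (((1/4)^k)^2)"
   proof (rule eventually_sequentiallyI[of k])
    fix j assume "j >= k"
    then have "R j >= N k" using RN[of k] strict_mono_less_eq[OF Rm, of k j] by simp
    then have "norm (X (R j) - X (R k)) <= (1/4)^k" using N RN less_imp_le by blast
    then show "(\<integral>\<^sup>+x. en ((norm (f j x - f k x))^2)) <= en (((1/4)^k)^2)" unfolding nn_norm_cls[OF fd] fn by (intro ennreal_leI power_mono) auto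
   qed
  qed
  also have "... = en (((1/4)^k)^2)" by (simp add: Liminf_const)
  finally show ?thesis .
 qed
 have gd: "sqi (%x. g x - f k x)" "l2n (%x. g x - f k x) <= (1/4)^k" for k using norm_cls_le[OF _ est, of k] by auto
 have gs: "sqi g" using sqi_add[OF gd(1)[of 0] sqi_rep[of "X (R 0)"]] by (simp add: f_def)
 have "cls g - X (R k) = cls (%x. g x - f k x)" for k unfolding f_def by (subst cls_diff[symmetric]) (use gs in simp_all)
 then have "norm (X (R k) - cls g) <= (1/4)^k" for k using gd(2)[of k] by (simp add: norm_minus_commute)
 then have "(%k. X (R k) - cls g) ---> 0" by (intro tendsto_norm_zero_cancel[OF tendsto_sandwich[OF _ _ tendsto_const LIMSEQ_realpow_zero[of "1/4"]]]) auto
 then have "(X \<circ> R) ---> cls g" by (simp add: LIM_zero_iff o_def)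
 from Cauchy_converges_subseq[OF assms Rm this] have "X ---> cls g" .
 then show ?thesis by (rule convergentI)
qed

instance l2 :: (euclidean_space) complete_space
proof
 show "convergent X" if "Cauchy X" for X :: "nat => 'a l2" using that by (rule l2_Cauchy_convergent)
qed

lemma tendsto_cls_iff:
 assumes "!!n. sqi (f n)" "sqi g"
 shows "(%n. cls (f n)) ---> cls g <-> (%n. \<integral>x. (norm (f n x - g x))^2) ---> 0"
proof -
 have "(%n. cls (f n)) ---> cls g <-> (%n. (norm (cls (f n) - cls g))^2) ---> 0"
 proof
  assume "(%n. cls (f n)) ---> cls g"
  then have "(%n. (norm (cls (f n) - cls g))^2) ---> (norm (cls g - cls g))^2" by (intro tendsto_intros)
  then show "(%n. (norm (cls (f n) - cls g))^2) ---> 0" by simp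
 next
  assume "(%n. (norm (cls (f n) - cls g))^2) ---> 0"
  from tendsto_real_sqrt[OF this] have "(%n. norm (cls (f n) - cls g)) ---> 0" by simp
  then show "(%n. cls (f n)) ---> cls g" by (rule LIM_zero_cancel[OF tendsto_norm_zero_cancel])
 qed
 moreover have "(norm (cls (f n) - cls g))^2 = (\<integral>x. (norm (f n x - g x))^2)" for n unfolding cls_diff[OF assms] by (intro norm_cls sqi_diff assms)
 ultimately show ?thesis by (simp only:)
qed

lemma l2_AE_subseq:
 fixes X :: "nat => 'b::euclidean_space l2"
 assumes "X ---> u"
 shows "EX r. strict_mono r & (AE x. (%n. rep (X (r n)) x) ---> rep u x)"
proof -
 have "(%n. cls (rep (X n))) ---> cls (rep u)" using assms by simp
 then have "(%n. \<integral>x. (norm (rep (X n) x - rep u x))^2) ---> 0" by (subst (asm) tendsto_cls_iff) auto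
 then have "(%n. \<integral>x. norm ((norm (rep (X n) x - rep u x))^2)) ---> 0" by simp
 then obtain r where "strict_mono r" "AE x. (%n. (norm (rep (X (r n)) x - rep u x))^2) ---> 0"
  using tendsto_L1_AE_subseq[of lborel "%n x. (norm (rep (X n) x - rep u x))^2"]
   sqi_integrable[OF sqi_diff[OF sqi_rep sqi_rep]] by blast
 moreover from this(2) have "AE x. (%n. rep (X (r n)) x) ---> rep u x"
 proof eventually_elim
  case (elim x)
  from tendsto_real_sqrt[OF this] show ?case by (simp add: tendsto_norm_zero_iff LIM_zero_iff)
 qed
 ultimately show ?thesis by blast
qed

lemma l2_dominated_convergence:
 assumes f: "!!n. f n : BM" and g: "g : BM" and h: "sqi h"
  and lim: "AE x. (%n. f n x) ---> g x"
  and b: "!!n. AE x. norm (f n x) <= norm (h x)"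
 shows "sqi g" "sqi (f n)" "(%n. cls (f n)) ---> cls g"
proof -
 show s: "sqi (f n)" for n by (rule sqi_mono[OF f h b])
 have bg: "AE x. norm (g x) <= norm (h x)"
 proof -
  have "AE x. ALL n. norm (f n x) <= norm (h x)" using b by (simp add: AE_all_countable)
  with lim show ?thesis
  proof eventually_elim
   case (elim x)
   show ?case by (rule LIMSEQ_le_const2[OF tendsto_norm[OF elim(1)]]) (use elim(2) in blast)
  qed
 qed
 show sg: "sqi g" by (rule sqi_mono[OF g h bg])
 note [measurable] = f g
 have "(%n. \<integral>x. (norm (f n x - g x))^2) ---> (\<integral>x. 0 \<partial>(lborel :: (real^3) measure))"
 proof (rule integral_dominated_convergence[where w = "%x. 4 * (norm (h x))^2"])
  show "integrable lborel (%x. 4 * (norm (h x))^2)" using h by (simp add: sqi_def)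
  show "AE x. (%n. (norm (f n x - g x))^2) ---> 0" using lim
  proof eventually_elim
   case (elim x)
   have "(%n. (norm (f n x - g x))^2) ---> (norm (g x - g x))^2" by (intro tendsto_intros elim)
   then show ?case by simp
  qed
  show "AE x. norm ((norm (f n x - g x))^2) <= 4 * (norm (h x))^2" for n using b[of n] bg
  proof eventually_elim
   case (elim x)
   have "norm (f n x - g x) <= 2 * norm (h x)" using elim norm_triangle_ineq4[of "f n x" "g x"] by simp
   then have "(norm (f n x - g x))^2 <= (2 * norm (h x))^2" by (intro power_mono) auto
   then show ?case by (simp add: power_mult_distrib)
  qed
 qed simp_all
 then show "(%n. cls (f n)) ---> cls g" by (simp add: tendsto_cls_iff s sg)
qed

text \<open>The multiplier is a function and the argument a class, because the two converge
  differently: coefficients such as \<sigma>(u) almost everywhere, fields in norm.\<close>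

definition mulop :: "(real^3 => real) => 'b::euclidean_space l2 => 'b l2" where
 "mulop s u = cls (%x. s x *R rep u x)"

lemma sqi_mulop:
 assumes "s : BM" "AE x. \<bar>s x\<bar> <= c"
 shows "sqi (%x. s x *R rep u x)" by (rule sqi_bdd_mult[OF assms]) simp

lemma rep_mulop:
 assumes "s : BM" "AE x. \<bar>s x\<bar> <= c"
 shows "AE x. rep (mulop s u) x = s x *R rep u x" unfolding mulop_def by (rule rep_cls[OF sqi_mulop[OF assms]])

lemma mulop_cls:
 assumes "s : BM" "AE x. \<bar>s x\<bar> <= c" "sqi f"
 shows "mulop s (cls f) = cls (%x. s x *R f x)" unfolding mulop_def
proof (rule cls_eqI[OF sqi_mulop[OF assms(1,2)] sqi_bdd_mult[OF assms]])
 show "AE x. s x *R rep (cls f) x = s x *R f x" using rep_cls[OF assms(3)] by eventually_elim simp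
qed

lemma bounded_linear_mulop:
 assumes s: "s : BM" "AE x. \<bar>s x\<bar> <= c" and c: "c >= 0"
 shows "bounded_linear (mulop s :: 'b::euclidean_space l2 => 'b l2)" "norm (mulop s (u :: 'b l2)) <= c * norm u"
proof -
 have n: "norm (mulop s u) <= c * norm u" for u :: "'b l2"
 proof -
  have "norm (mulop s u) <= l2n (%x. c *R rep u x)" unfolding mulop_def
  proof (rule norm_cls_mono)
   show "(%x. s x *R rep u x) : BM" using s(1) by simp
   show "sqi (%x. c *R rep u x)" by (intro sqi_scaleR sqi_rep)
   show "AE x. norm (s x *R rep u x) <= norm (c *R rep u x)" using s(2) by eventually_elim (use c in \<open>auto intro: mult_right_mono\<close>)
  qed
  also have "... = norm (c *R u)" by (simp add: scaleR_l2_def)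
  also have "... = c * norm u" using c by simp
  finally show ?thesis .
 qed
 show "norm (mulop s u) <= c * norm u" by (rule n)
 show "bounded_linear (mulop s :: 'b l2 => 'b l2)"
 proof (rule bounded_linear_intro[where K = c])
  show "mulop s (u + v) = mulop s u + mulop s v" for u v :: "'b l2"
   by (rule l2_eqI) (use rep_add[of u v] rep_mulop[OF s, of u] rep_mulop[OF s, of v] rep_mulop[OF s, of "u + v"] rep_add[of "mulop s u" "mulop s v"] in \<open>eventually_elim, simp add: scaleR_add_right\<close>)
  show "mulop s (r *R v) = r *R mulop s v" for r and v :: "'b l2"
   by (rule l2_eqI) (use rep_scaleR[of r v] rep_mulop[OF s, of v] rep_mulop[OF s, of "r *R v"] rep_scaleR[of r "mulop s v"] in \<open>eventually_elim, simp\<close>)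
  show "norm (mulop s u) <= norm u * c" for u :: "'b l2" using n[of u] by (simp add: mult.commute)
 qed
qed

section \<open>Continuously differentiable functions and mollification\<close>

lemma inner_axis_sum: "(\<Sum>i\<in>UNIV. (h $ i) * L (axis i 1)) = L h"
 if "linear L" for L :: "real^3 => real" and h :: "real^3"
proof -
 have "h = (\<Sum>i\<in>UNIV. h $ i *R axis i 1)" using basis_expansion[of h] by (simp add: scalar_mult_eq_scaleR)
 then have "L h = L (\<Sum>i\<in>UNIV. h $ i *R axis i 1)" by simp
 then show ?thesis by (simp add: linear_sum[OF that] linear_scale[OF that])
qed

lemma grad_nth[simp]: "grad f x $ i = pd i f x" by (simp add: grad_def)

lemma has_derivative_grad:
 assumes "f differentiable (at x)" shows "(f has_derivative (%h. grad f x \<bullet> h)) (at x)"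
proof -
 have "(f has_derivative frechet_derivative f (at x)) (at x)" using assms frechet_derivative_works by blast
 moreover from this have "frechet_derivative f (at x) = (%h. grad f x \<bullet> h)"
 proof (intro ext)
  fix h
  show "frechet_derivative f (at x) h = grad f x \<bullet> h"
   using inner_axis_sum[OF has_derivative_linear[OF \<open>(f has_derivative frechet_derivative f (at x)) (at x)\<close>], of h]
   by (simp add: inner_vec_def pd_def grad_def mult.commute)
 qed
 ultimately show ?thesis by simp
qed

lemma pd_unique: "(f has_derivative f') (at x) ==> pd i f x = f' (axis i 1)" unfolding pd_def using frechet_derivative_at by metis

lemma grad_unique: assumes "(f has_derivative (%h. g \<bullet> h)) (at x)" shows "grad f x = g" by (simp add: vec_eq_iff pd_unique[OF assms] inner_axis)

lemma pd_of_grad: "grad f = G ==> pd i f = (%x. G x $ i)" by auto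

text \<open>Used instead of \<open>smooth\<close> because it is stable under composition with the
  piecewise quadratic truncations on which the estimates rest.\<close>

definition C1 :: "(real^3 => real) => bool" where
 "C1 f <-> (ALL x. (f has_derivative (%h. grad f x \<bullet> h)) (at x)) & continuous_on UNIV (grad f)"

lemma C1I:
 assumes "!!x. (f has_derivative (%h. g x \<bullet> h)) (at x)" "continuous_on UNIV g"
 shows "C1 f" "grad f = g"
proof -
 show "grad f = g" using grad_unique[OF assms(1)] by blast
 then show "C1 f" using assms by (simp add: C1_def)
qed

lemma C1_derivative: "C1 f ==> (f has_derivative (%h. grad f x \<bullet> h)) (at x within S)" by (auto simp: C1_def intro: has_derivative_at_withinI)

lemma C1_cont_grad: "C1 f ==> continuous_on S (grad f)" by (auto simp: C1_def intro: continuous_on_subset)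

lemma C1_cont: assumes "C1 f" shows "continuous_on S f" by (rule has_derivative_continuous_on[OF C1_derivative[OF assms]])

lemma C1_bm[measurable_dest]: "C1 f ==> f : BM" by (intro bm_cont C1_cont)

lemma C1_grad_bm[measurable_dest]: "C1 f ==> grad f : BM" by (intro bm_cont C1_cont_grad)

lemma C1_differentiable: "C1 f ==> f differentiable (at x)" using C1_derivative differentiableI by blast

lemma C1_cont_pd: "C1 f ==> continuous_on S (pd i f)" using continuous_on_component[OF C1_cont_grad, of f S i] by simp

lemma C1_const: "C1 (%x. c)" "grad (%x. c) = (%x. 0)" by (rule C1I[of _ "%x. 0"]; auto)+

lemma C1_add: assumes "C1 f" "C1 g"
 shows "C1 (%x. f x + g x)" "grad (%x. f x + g x) = (%x. grad f x + grad g x)"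
proof -
 have "((%x. f x + g x) has_derivative (%h. (grad f x + grad g x) \<bullet> h)) (at x)" for x unfolding inner_add_left by (intro has_derivative_add C1_derivative assms)
 from C1I[OF this] show "C1 (%x. f x + g x)" "grad (%x. f x + g x) = (%x. grad f x + grad g x)" by (simp_all add: continuous_on_add C1_cont_grad assms)
qed

lemma C1_mult: assumes "C1 f" "C1 g"
 shows "C1 (%x. f x * g x)" "grad (%x. f x * g x) = (%x. f x *R grad g x + g x *R grad f x)"
proof -
 have "((%x. f x * g x) has_derivative (%h. (f x *R grad g x + g x *R grad f x) \<bullet> h)) (at x)" for x
  by (rule has_derivative_eq_rhs[OF has_derivative_mult[OF C1_derivative[OF assms(1)] C1_derivative[OF assms(2)]]])
   (simp add: inner_add_left mult.commute)
 from C1I[OF this] show "C1 (%x. f x * g x)" "grad (%x. f x * g x) = (%x. f x *R grad g x + g x *R grad f x)"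
  by (simp_all add: continuous_on_add continuous_on_scaleR C1_cont C1_cont_grad assms)
qed

lemma C1_cmult: assumes "C1 f"
 shows "C1 (%x. c * f x)" "grad (%x. c * f x) = (%x. c *R grad f x)" using C1_mult[OF C1_const(1)[of c] assms] by (auto simp: C1_const(2))

lemma C1_sum: assumes "!!i. i : I ==> C1 (f i)"
 shows "C1 (%x. \<Sum>i\<in>I. f i x)" "grad (%x. \<Sum>i\<in>I. f i x) = (%x. \<Sum>i\<in>I. grad (f i) x)"
 using assms by (induction I rule: infinite_finite_induct) (auto simp: C1_const C1_add)

lemma C1_compose: assumes f: "C1 f" and T: "!!s. (T has_real_derivative T' s) (at s)" "continuous_on UNIV T'"
 shows "C1 (%x. T (f x))" "grad (%x. T (f x)) = (%x. T' (f x) *R grad f x)"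
proof -
 have "((%x. T (f x)) has_derivative (%h. (T' (f x) *R grad f x) \<bullet> h)) (at x)" for x
  by (rule has_derivative_eq_rhs[OF has_derivative_compose[OF C1_derivative[OF f] has_field_derivative_imp_has_derivative[OF T(1)]]]) auto
 moreover have "continuous_on UNIV (%x. T' (f x) *R grad f x)" by (intro continuous_on_scaleR C1_cont_grad f continuous_on_compose2[OF T(2) C1_cont[OF f]]) auto
 ultimately show "C1 (%x. T (f x))" "grad (%x. T (f x)) = (%x. T' (f x) *R grad f x)" by (rule C1I)+
qed

lemma C1_affine: assumes f: "C1 f"
 shows "C1 (%x. f (l *R x + a))" "grad (%x. f (l *R x + a)) = (%x. l *R grad f (l *R x + a))"
proof -
 have "((%x. f (l *R x + a)) has_derivative (%h. (l *R grad f (l *R x + a)) \<bullet> h)) (at x)" for x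
  by (rule has_derivative_eq_rhs[OF has_derivative_compose[OF _ C1_derivative[OF f]]])
   (auto intro!: derivative_eq_intros)
 moreover have "continuous_on UNIV (%x. l *R grad f (l *R x + a))" by (intro continuous_intros continuous_on_compose2[OF C1_cont_grad[OF f, of UNIV]]) auto
 ultimately show "C1 (%x. f (l *R x + a))" "grad (%x. f (l *R x + a)) = (%x. l *R grad f (l *R x + a))" by (rule C1I)+
qed

text \<open>The test functions of all weak notions below; \<open>test_fun_dense\<close> leads back
  to smooth ones. Any compact \<open>K\<close> outside which \<open>f\<close> vanishes may serve as
  witness, which spares computing supports of sums and products.\<close>

definition C1c :: "(real^3) set => (real^3 => real) => bool" where
 "C1c \<Omega> f <-> C1 f & (EX K. compact K & K <= \<Omega> & (ALL x. x ~: K --> f x = 0))"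

lemma C1c_C1: "C1c \<Omega> f ==> C1 f" by (simp add: C1c_def)

lemma grad_eq_0_outside:
 assumes "closed K" "!!x. x ~: K ==> f x = 0" "x ~: K" shows "grad f x = 0"
proof -
 have o: "open (- K)" using assms(1) by blast
 have "(f has_derivative (%h. 0 \<bullet> h)) (at x)" by (rule has_derivative_transform_within_open[OF _ o, of "%x. 0"]) (use assms in auto)
 then show ?thesis by (rule grad_unique)
qed

lemma C1c_obtain:
 assumes "C1c \<Omega> f"
 obtains K where "compact K" "K <= \<Omega>" "!!x. x ~: K ==> f x = 0" "!!x. x ~: K ==> grad f x = 0"
 using assms grad_eq_0_outside[of _ f] unfolding C1c_def by (metis compact_imp_closed)

lemma C1cI: "C1 f ==> compact K ==> K <= \<Omega> ==> (!!x. x ~: K ==> f x = 0) ==> C1c \<Omega> f" unfolding C1c_def by blast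

lemma C1c_mono: "C1c \<Omega> f ==> \<Omega> <= \<Omega>' ==> C1c \<Omega>' f" unfolding C1c_def by blast

lemma C1c_add: assumes "C1c \<Omega> f" "C1c \<Omega> g" shows "C1c \<Omega> (%x. f x + g x)"
proof -
 obtain K K' where "compact K" "K <= \<Omega>" "!!x. x ~: K ==> f x = 0"
  "compact K'" "K' <= \<Omega>" "!!x. x ~: K' ==> g x = 0" using assms unfolding C1c_def by metis
 then show ?thesis using C1_add(1)[OF C1c_C1[OF assms(1)] C1c_C1[OF assms(2)]] by (intro C1cI[where K = "K \<union> K'"]) auto
qed

lemma C1c_mult: assumes "C1 g" "C1c \<Omega> f" shows "C1c \<Omega> (%x. g x * f x)"
proof -
 obtain K where "compact K" "K <= \<Omega>" "!!x. x ~: K ==> f x = 0" using assms(2) unfolding C1c_def by metis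
 then show ?thesis using C1_mult(1)[OF assms(1) C1c_C1[OF assms(2)]] by (intro C1cI[where K = K]) auto
qed

lemma C1c_cmult: assumes "C1c \<Omega> f" shows "C1c \<Omega> (%x. c * f x)" using C1c_mult[OF C1_const(1) assms] .

lemma C1c_zero: "C1c \<Omega> (%x. 0)" by (rule C1cI[where K = "{}"]) (auto simp: C1_const)

lemma compact_support_bounded:
 fixes f :: "'a::euclidean_space => 'b::real_normed_vector"
 assumes "continuous_on UNIV f" "compact K" "!!x. x ~: K ==> f x = 0"
 shows "EX B>0. ALL x. norm (f x) <= B"
proof -
 have "compact (f ` K)" using assms by (intro compact_continuous_image) (auto intro: continuous_on_subset)
 then obtain B where "B > 0" "ALL y:f ` K. norm y <= B" by (meson bounded_pos compact_imp_bounded)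
 then show ?thesis using assms(3) by (intro exI[of _ B]) (metis image_eqI less_imp_le norm_zero)
qed

lemma compact_support_uniform:
 fixes f :: "'a::euclidean_space => 'b::real_normed_vector"
 assumes c: "continuous_on UNIV f" and K: "compact K" "!!x. x ~: K ==> f x = 0" and e: "e > 0"
 shows "EX d>0. ALL x y. norm (x - y) < d --> norm (f x - f y) < e"
proof -
 obtain R where R: "R > 0" "!!x. x : K ==> norm x <= R" by (metis K(1) bounded_pos compact_imp_bounded)
 have "uniformly_continuous_on (cball 0 (R + 1)) f" by (rule compact_uniformly_continuous) (auto intro: continuous_on_subset[OF c])
 then obtain d where d: "d > 0" "!!x y. x : cball 0 (R+1) ==> y : cball 0 (R+1) ==> dist y x < d ==> dist (f y) (f x) < e"
  unfolding uniformly_continuous_on_def using e by metis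
 show ?thesis
 proof (intro exI[of _ "min d 1"] conjI allI impI)
  fix x y :: 'a assume xy: "norm (x - y) < min d 1"
  show "norm (f x - f y) < e"
  proof (cases "x : cball 0 (R+1) & y : cball 0 (R+1)")
   case True then show ?thesis using d(2)[of y x] xy by (simp add: dist_norm)
  next
   case False
   then have "x ~: K & y ~: K" using xy R(2)[of x] R(2)[of y] norm_triangle_sub[of x y] norm_triangle_sub[of y x] by (auto simp: norm_minus_commute)
   then show ?thesis using K(2) e by simp
  qed
 qed (use d in simp)
qed

lemma sqi_compact_support:
 fixes f :: "real^3 => 'b::euclidean_space"
 assumes c: "continuous_on UNIV f" and K: "compact K" "!!x. x ~: K ==> f x = 0"
 shows "sqi f"
proof -
 obtain B where B: "B > 0" "!!x. norm (f x) <= B" using compact_support_bounded[OF c K] by blast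
 show ?thesis unfolding sqi_def
 proof (intro conjI bm_cont c)
  show "integrable lborel (%x. (norm (f x))^2)" by (rule integrableI_bounded_set[where A = K and B = "B\<^sup>2"])
    (use K B emeasure_compact_finite[OF K(1)] bm_cont[OF c] in
     \<open>auto simp: compact_imp_closed intro!: power_mono\<close>)
 qed
qed

lemma integrable_compact_support:
 fixes f :: "real^3 => 'b::euclidean_space"
 assumes c: "continuous_on UNIV f" and K: "compact K" "!!x. x ~: K ==> f x = 0"
 shows "integrable lborel f"
proof -
 obtain B where B: "!!x. norm (f x) <= B" using compact_support_bounded[OF c K] by blast
 show ?thesis by (rule integrableI_bounded_set[where A = K and B = B])
   (use K B emeasure_compact_finite[OF K(1)] bm_cont[OF c] in \<open>auto simp: compact_imp_closed\<close>)
qed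

lemma C1c_sqi: assumes "C1c \<Omega> f" shows "sqi f" "sqi (grad f)"
proof -
 obtain K where K: "compact K" "K <= \<Omega>" "!!x. x ~: K ==> f x = 0" "!!x. x ~: K ==> grad f x = 0" using assms C1c_obtain by blast
 show "sqi f" "sqi (grad f)" using sqi_compact_support[OF _ K(1)] K C1_cont C1_cont_grad C1c_C1[OF assms] by blast+
qed

lemma nn_integral_affine:
 fixes t :: "real^3"
 assumes [measurable]: "f : BM" and c: "c ~= 0"
 shows "(\<integral>\<^sup>+x. f (t + c *R x)) = en (1 / \<bar>c\<bar>^3) * (\<integral>\<^sup>+x. f x)"
proof -
 have "(\<integral>\<^sup>+x. f x) = (\<integral>\<^sup>+x. f x \<partial>density (distr lborel borel (%x. t + c *R x)) (%_. en (\<bar>c\<bar>^3)))"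
  using lborel_affine[OF c, of t] by (simp add: ennreal_power)
 also have "... = en (\<bar>c\<bar>^3) * (\<integral>\<^sup>+x. f (t + c *R x))" by (simp add: nn_integral_density nn_integral_distr nn_integral_cmult)
 finally have "en (1 / \<bar>c\<bar>^3) * (\<integral>\<^sup>+x. f x) = en (1 / \<bar>c\<bar>^3 * \<bar>c\<bar>^3) * (\<integral>\<^sup>+x. f (t + c *R x))"
  using c by (subst ennreal_mult) (auto simp: mult.assoc)
 then show ?thesis using c by simp
qed

lemma integrable_affine_iff:
 fixes f :: "real^3 => 'b::euclidean_space"
 assumes c: "c ~= 0"
 shows "integrable lborel (%x. f (t + c *R x)) <-> integrable lborel f"
proof -
 have 1: "integrable lborel (%x. f (t + c *R x))" if f: "integrable lborel f" and c: "c ~= 0"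
  for f :: "real^3 => 'b" and c t
 proof -
  have [measurable]: "f : BM" using f by auto
  show ?thesis using f unfolding integrable_iff_bounded by (auto simp: nn_integral_affine[of "%x. en (norm (f x))", OF _ c] ennreal_mult_less_top)
 qed
 show ?thesis using 1[OF _ c, of f t] 1[of "%x. f (t + c *R x)" "1/c" "- (1/c) *R t"] c by (auto simp: algebra_simps)
qed

lemma integral_affine:
 fixes f :: "real^3 => 'b::euclidean_space"
 assumes c: "c ~= 0"
 shows "(\<integral>x. f x) = \<bar>c\<bar>^3 *R (\<integral>x. f (t + c *R x))"
proof (cases "integrable lborel f")
 case True
 then have [measurable]: "f : BM" by auto
 show ?thesis by (subst lborel_affine[OF c, of t])
   (simp add: integral_density integral_distr ennreal_power)
next
 case False
 then show ?thesis by (simp add: integrable_affine_iff[OF c] not_integrable_integral_eq)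
qed

lemma integral_shift:
 fixes f :: "real^3 => 'b::euclidean_space"
 shows "(\<integral>x. f (x + a)) = (\<integral>x. f x)" using integral_affine[of 1 f a] by (simp add: add.commute)

lemma C1_mean_value:
 assumes "C1 f"
 shows "EX t:{0<..<1}. f (x + h) - f x = grad f (x + t *R h) \<bullet> h"
proof -
 have "((%t. f (x + t *R h)) has_derivative (%s. grad f (x + t *R h) \<bullet> (s *R h))) (at t within {0..1})" for t :: real
  by (rule has_derivative_compose[OF _ C1_derivative[OF assms]]) (auto intro!: derivative_eq_intros)
 from mvt_simple[OF zero_less_one this] show ?thesis by simp
qed

text \<open>Difference quotients in direction \<open>axis i 1\<close> have integral zero by
  translation invariance, and they converge to the derivative under a bound supported in a fixed
  ball.\<close>

lemma C1c_integral_pd: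
 assumes f: "C1c UNIV f" shows "integrable lborel (pd i f)" "(\<integral>x. pd i f x) = 0"
proof -
 obtain K where K: "compact K" "!!x. x ~: K ==> f x = 0" "!!x. x ~: K ==> grad f x = 0" using f C1c_obtain by metis
 have c: "C1 f" using f C1c_C1 by blast
 obtain B where B: "B > 0" "!!x. norm (grad f x) <= B" using compact_support_bounded[OF C1_cont_grad[OF c] K(1,3)] by blast
 obtain R where R: "R > 0" "!!x. x : K ==> norm x <= R" by (metis K(1) bounded_pos compact_imp_bounded)
 define hh :: "nat => real^3" where "hh n = (1 / real (Suc n)) *R axis i 1" for n
 define q where "q n x = real (Suc n) * (f (x + hh n) - f x)" for n x
 have mb: "emeasure lborel (cball (0::real^3) (R+1)) < \<infinity>" by (intro emeasure_compact_finite) auto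
 have [measurable]: "f : BM" "pd i f : BM" using c by (auto intro!: bm_cont C1_cont C1_cont_pd)
 have qb: "norm (q n x) <= indicator (cball 0 (R+1)) x * B" for n x
 proof -
  define h :: "real^3" where "h = hh n"
  have nh: "norm h = 1 / real (Suc n)" by (simp add: h_def hh_def norm_axis_1)
  then have nh1: "norm h <= 1" by simp
  show ?thesis
  proof (cases "x : cball 0 (R+1)")
   case True
   obtain t where "f (x + h) - f x = grad f (x + t *R h) \<bullet> h" using C1_mean_value[OF c] by blast
   then have "\<bar>f (x + h) - f x\<bar> <= B * norm h"
    using Cauchy_Schwarz_ineq2[of "grad f (x + t *R h)" h] mult_right_mono[OF B(2)[of "x + t *R h"] norm_ge_zero[of h]] by simp
   then have "real (Suc n) * \<bar>f (x + h) - f x\<bar> <= B" unfolding nh by (simp add: field_simps)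
   then show ?thesis using True by (simp add: q_def h_def[symmetric] abs_mult)
  next
   case False
   then have "x ~: K" "x + h ~: K" using R(2)[of x] R(2)[of "x + h"] nh1 norm_triangle_ineq4[of "x + h" h] by auto
   then show ?thesis using False K(2) by (simp add: q_def h_def[symmetric])
  qed
 qed
 have lim: "(%n. q n x) ---> pd i f x" for x
 proof -
  have "((%t. f (x + t *R axis i 1)) has_derivative (%s. grad f (x + 0 *R axis i 1) \<bullet> (s *R axis i 1))) (at 0)"
   by (rule has_derivative_compose[OF _ C1_derivative[OF c]]) (auto intro!: derivative_eq_intros)
  then have "((%t. f (x + t *R axis i 1)) has_real_derivative pd i f x) (at 0)" by (simp add: has_field_derivative_def inner_axis mult_commute_abs)
  then have *: "(%h. (f (x + h *R axis i 1) - f x) / h) \<midarrow>0\<rightarrow> pd i f x" by (simp add: DERIV_def)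
  have "filterlim (%n. 1 / real (Suc n)) (at 0) sequentially" using LIMSEQ_Suc[OF lim_1_over_n[where 'a = real]] by (auto simp: filterlim_at)
  from filterlim_compose[OF * this]
  have "(%n. (f (x + (1 / real (Suc n)) *R axis i 1) - f x) / (1 / real (Suc n))) ---> pd i f x" .
  then show ?thesis by (simp add: q_def hh_def mult.commute)
 qed
 have w: "integrable lborel (%x::real^3. indicator (cball 0 (R+1)) x * B)" using mb by (intro integrable_mult_left integrable_real_indicator) auto
 have dc: "(%n. \<integral>x. q n x) ---> (\<integral>x. pd i f x)" by (rule integral_dominated_convergence[OF _ _ w]) (use lim qb in \<open>auto simp: q_def\<close>)
 have fi: "integrable lborel f" by (rule integrable_compact_support[OF C1_cont[OF c] K(1,2)])
 have "(\<integral>x. q n x) = 0" for n using integrable_affine_iff[of 1 f "hh n"] fi integral_shift[of f "hh n"] by (simp add: q_def add.commute)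
 with dc show "(\<integral>x. pd i f x) = 0" by (simp add: LIMSEQ_const_iff)
 show "integrable lborel (pd i f)" by (rule integrable_compact_support[OF C1_cont_pd[OF c] K(1)]) (use K(3) in \<open>simp add: vec_eq_iff\<close>)
qed

lemma C1c_integration_by_parts:
 assumes "C1 f" "C1c UNIV g"
 shows "(\<integral>x. f x * pd i g x) = - (\<integral>x. g x * pd i f x)"
  and "integrable lborel (%x. f x * pd i g x)" "integrable lborel (%x. g x * pd i f x)"
proof -
 have g: "C1 g" using assms C1c_C1 by blast
 obtain K where K: "compact K" "!!x. x ~: K ==> g x = 0" "!!x. x ~: K ==> grad g x = 0" using assms C1c_obtain by metis
 note int = integrable_compact_support[OF _ K(1)]
 have pdg: "pd i g x = 0" if "x ~: K" for x using K(3)[OF that] by (simp add: vec_eq_iff)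
 show 1: "integrable lborel (%x. f x * pd i g x)" by (intro int continuous_on_mult C1_cont C1_cont_pd assms(1) g) (simp add: pdg)
 show 2: "integrable lborel (%x. g x * pd i f x)" by (intro int continuous_on_mult C1_cont C1_cont_pd assms(1) g) (simp add: K)
 have "pd i (%x. f x * g x) = (%x. f x * pd i g x + g x * pd i f x)" by (subst pd_of_grad[OF C1_mult(2)[OF assms(1) g]]) simp
 with C1c_integral_pd(2)[OF C1c_mult[OF assms], of i]
 show "(\<integral>x. f x * pd i g x) = - (\<integral>x. g x * pd i f x)" using 1 2 by simp
qed

section \<open>Convolution, smooth bumps and mollification\<close>

definition convol :: "(real^3 => real) => (real^3 => 'b::euclidean_space) => real^3 => 'b" where
 "convol k w x = (\<integral>y. k (x - y) *R w y)"

lemma sqi_indicator_set: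
 assumes "A : sets borel" "emeasure lborel A < \<infinity>"
 shows "sqi (%x. indicator A x :: real)"
proof -
 have "(norm (indicator A x :: real))^2 = indicator A x" for x :: "real^3" by (simp add: indicator_def)
 then show ?thesis unfolding sqi_def using assms by (simp add: integrable_real_indicator)
qed

lemma sqi_integrable_bounded_set:
 assumes w: "sqi w" and A: "A : sets borel" "emeasure lborel A < \<infinity>"
 shows "integrable lborel (%x. indicator A x * norm (w x))"
proof -
 have "sqi (%x. indicator A x :: real)" by (rule sqi_indicator_set[OF A])
 moreover have "sqi (%x. norm (w x))" using w sqi_bm[OF w] by (simp add: sqi_def)
 ultimately show ?thesis using sqi_inner by force
qed

lemma integral_bounded_mult:
 fixes w :: "real^3 => 'b::euclidean_space"
 assumes w: "sqi w" and A: "A : sets borel" "emeasure lborel A < \<infinity>"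
  and p: "p : BM" "!!y. \<bar>p y\<bar> <= e" "!!y. y ~: A ==> p y = 0"
 shows "integrable lborel (%y. p y *R w y)"
  "norm (\<integral>y. p y *R w y) <= e * (\<integral>x. indicator A x * norm (w x))"
proof -
 have b: "norm (p y *R w y) <= e * (indicator A y * norm (w y))" for y using p(2)[of y] p(3)[of y] by (cases "y : A") (auto intro: mult_right_mono)
 have i: "integrable lborel (%x. e * (indicator A x * norm (w x)))" by (intro integrable_mult_right sqi_integrable_bounded_set[OF w A])
 have e0: "e >= 0" using p(2)[of undefined] by linarith
 show 1: "integrable lborel (%y. p y *R w y)"
 proof (rule Bochner_Integration.integrable_bound[OF i])
  show "(%y. p y *R w y) : borel_measurable lborel" using p(1) sqi_bm[OF w] by simp
  show "AE x. norm (p x *R w x) <= norm (e * (indicator A x * norm (w x)))" using b e0 by simp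
 qed
 have "norm (\<integral>y. p y *R w y) <= (\<integral>x. e * (indicator A x * norm (w x)))"
  by (rule Bochner_Integration.integral_norm_bound_integral[OF 1 i]) (use b in auto)
 then show "norm (\<integral>y. p y *R w y) <= e * (\<integral>x. indicator A x * norm (w x))" by simp
qed

locale convol_kernel =
 fixes k :: "real^3 => real" and R :: real
 assumes cont: "continuous_on UNIV k" and R: "R > 0" and supp: "!!x. norm x > R ==> k x = 0"
begin

lemma uniform: "e > 0 ==> EX d>0. ALL x y. norm (x - y) < d --> norm (k x - k y) < e" by (rule compact_support_uniform[OF cont compact_cball[of 0 R]]) (use supp in auto)

lemma bounded: "EX B>0. ALL x. norm (k x) <= B" by (rule compact_support_bounded[OF cont compact_cball[of 0 R]]) (use supp in auto)

lemma measurable_k[measurable]: "k : BM" using cont by (rule bm_cont)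

lemma finite_cball: "emeasure lborel (cball (x::real^3) r) < \<infinity>" by (intro emeasure_compact_finite) auto

lemma integrable_convol:
 assumes w: "sqi w" shows "integrable lborel (%y. k (x - y) *R w y)"
proof -
 obtain B where B: "!!x. norm (k x) <= B" using bounded by blast
 show ?thesis by (rule integral_bounded_mult(1)[OF w, of "cball x R" _ B]) (use B finite_cball supp in \<open>auto simp: dist_norm\<close>)
qed

lemma convol_outside:
 assumes "!!y. y : A \<or> w y = 0" "!!y. y : A ==> norm (x - y) > R"
 shows "convol k w x = 0"
proof -
 have "(%y. k (x - y) *R w y) = (%y. 0)" using assms supp by (metis scale_eq_0_iff)
 then show ?thesis by (simp add: convol_def)
qed

lemma continuous_convol:
 fixes w :: "real^3 => 'b::euclidean_space"
 assumes w: "sqi w" shows "continuous_on UNIV (convol k w)" unfolding continuous_on_iff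
proof (intro ballI allI impI)
 fix x :: "real^3" and e :: real assume e: "e > 0"
 define C where "C = (\<integral>y. indicator (cball x (R+1)) y * norm (w y))"
 have C: "C >= 0" unfolding C_def by (rule integral_nonneg_AE) simp
 define e' where "e' = e / (C + 1)"
 have "e' > 0" using e C by (simp add: e'_def)
 then obtain d where d: "d > 0" "!!x y. norm (x - y) < d ==> norm (k x - k y) < e'" using uniform by blast
 show "EX d>0. ALL x':UNIV. dist x' x < d --> dist (convol k w x') (convol k w x) < e"
 proof (intro exI[of _ "min d 1"] conjI ballI impI)
  fix z assume z: "dist z x < min d 1"
  have "convol k w z - convol k w x = (\<integral>y. (k (z - y) - k (x - y)) *R w y)"
   unfolding convol_def scaleR_diff_left by (rule lint_diff[symmetric]; rule integrable_convol[OF w])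
  also have "norm ... <= e' * C" unfolding C_def
  proof (rule integral_bounded_mult(2)[OF w])
   show "\<bar>k (z - y) - k (x - y)\<bar> <= e'" for y using d(2)[of "z - y" "x - y"] z by (simp add: dist_norm)
   show "k (z - y) - k (x - y) = 0" if "y ~: cball x (R+1)" for y
   proof -
    have "norm (x - y) > R + 1" using that by (simp add: dist_norm)
    moreover have "norm (z - y) > R" using calculation z norm_triangle_ineq[of "x - z" "z - y"] by (simp add: dist_norm norm_minus_commute)
    ultimately show ?thesis using supp by simp
   qed
  qed (use finite_cball in auto)
  also have "... < e" using e C by (simp add: e'_def field_simps)
  finally show "dist (convol k w z) (convol k w x) < e" by (simp add: dist_norm)
 qed (use d in simp)
qed

end

text \<open>Differentiation under the integral sign: the mean value theorem and uniform continuity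
  of \<open>grad k\<close> bound the remainder by \<open>e' * norm h\<close> uniformly in the
  integration variable, and for increments below 1 the integrand is supported in one ball.\<close>

lemma C1_convol:
 fixes w :: "real^3 => real"
 assumes k: "C1 k" and R: "R > 0" and supp: "!!x. norm x > R ==> k x = 0" and w: "sqi w"
 shows "C1 (convol k w)" "pd i (convol k w) = convol (pd i k) w"
proof -
 have supp': "grad k x = 0" if "norm x > R" for x by (rule grad_eq_0_outside[of "cball 0 R"]) (use that supp in auto)
 interpret K: convol_kernel k R by standard (use k R supp C1_cont in auto)
 have pk: "convol_kernel (pd i k) R" for i by standard (use R C1_cont_pd[OF k] supp' in \<open>auto simp: vec_eq_iff\<close>)
 define G where "G x = (\<chi> i. convol (pd i k) w x)" for x
 have Gc: "continuous_on UNIV G" unfolding G_def by (intro continuous_on_vec_lambda convol_kernel.continuous_convol[OF pk w])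
 have "(convol k w has_derivative (%h. G x \<bullet> h)) (at x)" for x unfolding has_derivative_at_alt
 proof (intro conjI allI impI)
  show "bounded_linear (%h. G x \<bullet> h)" by (rule bounded_linear_inner_right)
  fix e :: real assume e: "e > 0"
  define C where "C = (\<integral>y. indicator (cball x (R+1)) y * norm (w y))"
  have C: "C >= 0" unfolding C_def by (rule integral_nonneg_AE) simp
  define e' where "e' = e / (C + 1)"
  have e': "e' > 0" using e C by (simp add: e'_def)
  then obtain d where d: "d > 0" "!!x y. norm (x - y) < d ==> norm (grad k x - grad k y) < e'"
   using compact_support_uniform[OF C1_cont_grad[OF k] compact_cball[of 0 R]] supp' by (metis linorder_not_less mem_cball_0)
  show "EX d>0. ALL z. norm (z - x) < d --> norm (convol k w z - convol k w x - G x \<bullet> (z - x)) <= e * norm (z - x)"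
  proof (intro exI[of _ "min d 1"] conjI allI impI)
   fix z assume z: "norm (z - x) < min d 1"
   define h where "h = z - x"
   have "G x \<bullet> h = (\<Sum>i\<in>UNIV. (\<integral>y. pd i k (x - y) *R w y) * h $ i)" by (simp add: inner_vec_def G_def convol_def)
   also have "... = (\<Sum>i\<in>UNIV. (\<integral>y. pd i k (x - y) *R w y * h $ i))" by simp
   also have "... = (\<integral>y. (\<Sum>i\<in>UNIV. pd i k (x - y) *R w y * h $ i))" by (rule Bochner_Integration.integral_sum[symmetric])
     (intro integrable_mult_left convol_kernel.integrable_convol[OF pk w])
   also have "(%y. \<Sum>i\<in>UNIV. pd i k (x - y) *R w y * h $ i) = (%y. (grad k (x - y) \<bullet> h) *R w y)" by (simp add: inner_vec_def sum_distrib_left mult_ac)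
   finally have Gh: "G x \<bullet> h = (\<integral>y. (grad k (x - y) \<bullet> h) *R w y)" .
   have gi: "integrable lborel (%y. (grad k (x - y) \<bullet> h) *R w y)"
   proof -
    have "integrable lborel (%y. \<Sum>i\<in>UNIV. pd i k (x - y) *R w y * h $ i)"
     by (intro Bochner_Integration.integrable_sum integrable_mult_left convol_kernel.integrable_convol[OF pk w])
    then show ?thesis by (simp add: inner_vec_def sum_distrib_left mult_ac)
   qed
   have "convol k w z - convol k w x - G x \<bullet> h
    = (\<integral>y. (k (z - y) - k (x - y) - grad k (x - y) \<bullet> h) *R w y)" unfolding Gh convol_def scaleR_diff_left by (subst lint_diff; (subst lint_diff)?)
     (intro Bochner_Integration.integrable_diff K.integrable_convol[OF w] gi refl)+
   also have "norm ... <= (e' * norm h) * C" unfolding C_def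
   proof (rule integral_bounded_mult(2)[OF w])
    have [measurable]: "k : BM" "grad k : BM" using k by (auto dest: C1_bm C1_grad_bm)
    show "(%y. k (z - y) - k (x - y) - grad k (x - y) \<bullet> h) : BM" by measurable
    show "\<bar>k (z - y) - k (x - y) - grad k (x - y) \<bullet> h\<bar> <= e' * norm h" for y
    proof -
     obtain t where t: "t : {0<..<1}" "k (x - y + h) - k (x - y) = grad k (x - y + t *R h) \<bullet> h" using C1_mean_value[OF k] by blast
     have "norm (t *R h) <= norm h" using t by (simp add: mult_left_le_one_le)
     then have "norm (grad k (x - y + t *R h) - grad k (x - y)) <= e'" using d(2)[of "x - y + t *R h" "x - y"] z by (simp add: h_def)
     then have "\<bar>(grad k (x - y + t *R h) - grad k (x - y)) \<bullet> h\<bar> <= e' * norm h"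
      by (meson Cauchy_Schwarz_ineq2 mult_right_mono norm_ge_zero order_trans)
     then show ?thesis using t(2) by (simp add: h_def inner_diff_left)
    qed
    show "k (z - y) - k (x - y) - grad k (x - y) \<bullet> h = 0" if "y ~: cball x (R+1)" for y
    proof -
     have "norm (x - y) > R + 1" using that by (simp add: dist_norm)
     moreover have "norm (z - y) > R" using calculation z norm_triangle_ineq[of "x - z" "z - y"] by (simp add: norm_minus_commute)
     ultimately show ?thesis using supp supp' by simp
    qed
   qed (use K.finite_cball in auto)
   also have "... = e * norm h * (C / (C + 1))" by (simp add: e'_def)
   also have "... <= e * norm h * 1" using e C by (intro mult_left_mono) auto
   finally show "norm (convol k w z - convol k w x - G x \<bullet> (z - x)) <= e * norm (z - x)" by (simp add: h_def)
  qed (use d in simp)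
 qed
 from C1I[OF this Gc] show "C1 (convol k w)" and g: "pd i (convol k w) = convol (pd i k) w" by (auto simp: fun_eq_iff vec_eq_iff G_def)
qed

lemma smooth_C1: assumes "smooth f" shows "C1 f" "smooth (pd i f)"
proof -
 have a: "iter_pd (is @ js) f = iter_pd is (iter_pd js f)" for "is" js f by (induction "is") auto
 show "smooth (pd i f)" for i unfolding smooth_def
 proof (intro allI)
  fix "is" x
  have "iter_pd is (pd i f) = iter_pd (is @ [i]) f" by (simp add: a)
  then show "iter_pd is (pd i f) differentiable at x" using assms by (metis smooth_def)
 qed
 have "f differentiable (at x)" for x using assms unfolding smooth_def by (metis iter_pd.simps(1))
 moreover have "continuous_on UNIV (pd i f)" for i
 proof -
  have "pd i f differentiable (at x)" for x using assms unfolding smooth_def by (metis iter_pd.simps)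
  then show ?thesis using differentiable_imp_continuous_within continuous_at_imp_continuous_on by blast
 qed
 then have "continuous_on UNIV (grad f)" unfolding grad_def by (intro continuous_on_vec_lambda)
 ultimately show "C1 f" using has_derivative_grad by (auto simp: C1_def)
qed

text \<open>Smoothness through an invariant class: induction on the list of directions keeps every
  iterated derivative inside \<open>S\<close>.\<close>

lemma smoothI:
 assumes "f : S" "!!g x. g : S ==> g differentiable (at x)" "!!g i. g : S ==> pd i g : S"
 shows "smooth f"
proof -
 have "iter_pd is f : S" for "is" by (induction "is") (use assms in auto)
 then show ?thesis using assms(2) by (auto simp: smooth_def)
qed

lemma smooth_convol:
 fixes w :: "real^3 => real"
 assumes k: "smooth k" and R: "R > 0" and supp: "!!x. norm x > R ==> k x = 0" and w: "sqi w"
 shows "smooth (convol k w)"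
proof (rule smoothI[where S = "{convol k w | k. smooth k & (ALL x. norm x > R --> k x = 0)}"])
 show "convol k w : {convol k w | k. smooth k & (ALL x. norm x > R --> k x = 0)}" using k supp by blast
 fix g x i assume "g : {convol k w | k. smooth k & (ALL x. norm x > R --> k x = 0)}"
 then obtain k where g: "g = convol k w" and k: "smooth k" and supp: "!!x. norm x > R ==> k x = 0" by blast
 note c = C1_convol[OF smooth_C1(1)[OF k] R supp w]
 show "g differentiable (at x)" using c(1) by (simp add: g C1_differentiable)
 have "ALL x. R < norm x --> pd i k x = 0" using grad_eq_0_outside[of "cball 0 R" k] supp by (auto simp: vec_eq_iff)
 moreover have "pd i g = convol (pd i k) w" unfolding g by (rule c(2))
 ultimately show "pd i g : {convol k w | k. smooth k & (ALL x. norm x > R --> k x = 0)}" using smooth_C1(2)[OF k] by (intro CollectI exI[of _ "pd i k"]) simp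
qed

text \<open>The functions t^(-k) exp(-1/t), cut off at 0. The whole family is introduced because
  differentiation leads from \<open>k\<close> to \<open>k + 1\<close> and \<open>k + 2\<close>, so
  no explicit higher derivative of exp(-1/t) is ever needed.\<close>

definition es :: "nat => real => real" where
 "es k t = (if t > 0 then (1 / t) ^ k * exp (- (1 / t)) else 0)"

lemma es_tendsto_0: "(es k \<longlongrightarrow> 0) (at 0)"
proof -
 have "filterlim (%t::real. inverse t) at_top (at_right 0)" by (rule filterlim_inverse_at_top_right)
 from filterlim_compose[OF tendsto_power_div_exp_0 this, of k]
 have "((%t::real. (1 / t) ^ k * exp (- (1 / t))) \<longlongrightarrow> 0) (at_right 0)" by (simp add: exp_minus inverse_eq_divide field_simps)
 then have "(es k \<longlongrightarrow> 0) (at_right 0)" by (rule Lim_transform_eventually)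
   (auto simp: es_def eventually_at_filter)
 moreover have "(es k \<longlongrightarrow> 0) (at_left 0)" by (rule Lim_transform_eventually[OF tendsto_const])
   (auto simp: es_def eventually_at_filter)
 ultimately show ?thesis by (simp add: filterlim_at_split)
qed

lemma es_derivative: "(es k has_real_derivative (es (k + 2) t - real k * es (k + 1) t)) (at t)"
proof (cases "t = 0")
 case True
 have "((%h. (es k (0 + h) - es k 0) / h) \<longlongrightarrow> 0) (at 0)" by (rule Lim_transform_eventually[OF es_tendsto_0[of "Suc k"]])
   (auto simp: es_def eventually_at_filter)
 then show ?thesis using True by (simp add: DERIV_def es_def)
next
 case False
 show ?thesis
 proof (cases "t > 0")
  case True
  have "((%t. (1 / t) ^ k * exp (- (1 / t))) has_real_derivative
   (es (k + 2) t - real k * es (k + 1) t)) (at t)"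
  proof (cases k)
   case 0
   show ?thesis unfolding 0 using True by (auto intro!: derivative_eq_intros simp: es_def power2_eq_square field_simps)
  next
   case (Suc m)
   have inv: "((%t. 1 / t) has_real_derivative - (1 / t\<^sup>2)) (at t)" using True by (auto intro!: derivative_eq_intros simp: power2_eq_square)
   show ?thesis unfolding Suc by (rule DERIV_cong[OF DERIV_mult[OF DERIV_power[OF inv, of "Suc m"] DERIV_chain2[OF DERIV_exp DERIV_minus[OF inv]]]])
     (use True in \<open>simp add: es_def field_simps power2_eq_square\<close>)
  qed
  then show ?thesis by (rule has_field_derivative_transform_within_open[of _ _ _ "{0<..}"]) (use True in \<open>auto simp: es_def\<close>)
 next
  case F: False
  have "((%t. 0) has_real_derivative (es (k + 2) t - real k * es (k + 1) t)) (at t)" using F by (simp add: es_def)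
  then show ?thesis by (rule has_field_derivative_transform_within_open[of _ _ _ "{..<0}"]) (use F False in \<open>auto simp: es_def\<close>)
 qed
qed

text \<open>Built to be closed under partial derivatives, which is all that \<open>smoothI\<close>
  asks for.\<close>

inductive_set bump_algebra :: "(real^3 => real) set" where
 base: "(%x. es k (a + c * x $ i)) : bump_algebra"
| scale: "f : bump_algebra ==> (%x. r * f x) : bump_algebra"
| add: "f : bump_algebra ==> g : bump_algebra ==> (%x. f x + g x) : bump_algebra"
| mult: "f : bump_algebra ==> g : bump_algebra ==> (%x. f x * g x) : bump_algebra"

lemma bump_algebra_pd: "f : bump_algebra ==> (ALL x. f differentiable (at x)) & (ALL i. pd i f : bump_algebra)"
proof (induction rule: bump_algebra.induct)
 case (base k a c i)
 define D where "D t = es (k + 2) t - real k * es (k + 1) t" for t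
 have d: "((%x. es k (a + c * x $ i)) has_derivative (%h. (c * h $ i) * D (a + c * x $ i))) (at x)" for x :: "real^3" unfolding D_def
  by (rule has_derivative_eq_rhs[OF has_derivative_compose[OF _ has_field_derivative_imp_has_derivative[OF es_derivative]]])
   (auto intro!: derivative_eq_intros bounded_linear.has_derivative[OF bounded_linear_vec_nth])
 have "pd j (%x. es k (a + c * x $ i)) : bump_algebra" for j
 proof -
  have "pd j (%x. es k (a + c * x $ i)) = (%x. (c * axis j 1 $ i) * (es (k + 2) (a + c * x $ i) + (- real k) * es (k + 1) (a + c * x $ i)))"
   by (intro ext) (simp add: pd_unique[OF d] D_def)
  then show ?thesis by (simp only:) (intro bump_algebra.intros)
 qed
 then show ?case using d differentiableI by blast
next
 case (scale f r)
 then have d: "((%x. r * f x) has_derivative (%h. r * (grad f x \<bullet> h))) (at x)" for x by (intro has_derivative_mult_right has_derivative_grad) auto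
 have "pd j (%x. r * f x) = (%x. r * pd j f x)" for j by (intro ext) (simp add: pd_unique[OF d] inner_axis)
 then show ?case using d differentiableI scale bump_algebra.scale by auto
next
 case (add f g)
 then have d: "((%x. f x + g x) has_derivative (%h. grad f x \<bullet> h + grad g x \<bullet> h)) (at x)" for x by (intro has_derivative_add has_derivative_grad) auto
 have "pd j (%x. f x + g x) = (%x. pd j f x + pd j g x)" for j by (intro ext) (simp add: pd_unique[OF d] inner_axis)
 then show ?case using d differentiableI add bump_algebra.add by auto
next
 case (mult f g)
 then have d: "((%x. f x * g x) has_derivative (%h. f x * (grad g x \<bullet> h) + (grad f x \<bullet> h) * g x)) (at x)" for x
  by (intro has_derivative_mult has_derivative_grad) auto
 have "pd j (%x. f x * g x) = (%x. f x * pd j g x + pd j f x * g x)" for j by (intro ext) (simp add: pd_unique[OF d] inner_axis)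
 then show ?case using d differentiableI mult bump_algebra.add bump_algebra.mult by auto
qed

lemma bump_algebra_smooth: "f : bump_algebra ==> smooth f" using bump_algebra_pd by (intro smoothI[where S = bump_algebra]) auto

text \<open>The product over the coordinates of
  \<open>es 0 (1/2 + x $ i) * es 0 (1/2 - x $ i)\<close> is nonzero only if every coordinate is
  below 1/2 in modulus, hence only for norm squared at most 3/4. It is positive at 0, so its
  integral can be divided out.\<close>

lemma exists_bump:
 "\<exists>\<eta>. smooth \<eta> & (ALL x. \<eta> x >= 0) & (ALL x. norm x > 1 --> \<eta> x = 0) & integrable lborel \<eta> & (\<integral>x. \<eta> x) = 1"
proof -
 define b where "b i x = es 0 (1/2 + 1 * x $ i) * es 0 (1/2 + (-1) * x $ i)" for i :: 3 and x :: "real^3"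
 define g where "g x = b 1 x * b 2 x * b 3 x" for x
 have gB: "g : bump_algebra" unfolding g_def b_def by (intro bump_algebra.intros)
 have g0: "g x >= 0" for x by (simp add: g_def b_def es_def)
 have gs: "g x = 0" if "norm x > 1" for x
 proof (rule ccontr)
  assume "g x ~= 0"
  then have "\<bar>x $ i\<bar> < 1/2" for i using exhaust_3[of i] by (auto simp: g_def b_def es_def split: if_splits)
  then have "(x $ i)^2 <= (1/2)^2" for i by (metis abs_ge_zero less_imp_le power2_abs power_mono)
  then have "(\<Sum>i\<in>UNIV. (x $ i)^2) <= (\<Sum>i\<in>(UNIV::3 set). (1/2)^2)" by (intro sum_mono)
  then have "(norm x)^2 <= 1\<^sup>2" by (simp add: norm_vec_def L2_set_def sum_nonneg power2_eq_square)
  then show False using that power2_le_imp_le[of "norm x" 1] by simp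
 qed
 have gc: "C1 g" using bump_algebra_smooth[OF gB] smooth_C1 by blast
 have gi: "integrable lborel g" by (rule integrable_compact_support[OF C1_cont[OF gc] compact_cball[of 0 1]]) (use gs in auto)
 have "g 0 > 0" by (simp add: g_def b_def es_def)
 have pos: "(\<integral>x. g x) > 0"
 proof (rule ccontr)
  assume "\<not> ?thesis"
  moreover have "(\<integral>x. g x) >= 0" using g0 by (intro integral_nonneg_AE) simp
  ultimately have "(\<integral>x. g x) = 0" by simp
  then have "AE x. g x = 0" using integral_nonneg_eq_0_iff_AE[OF gi] g0 by auto
  then have ae: "AE x. x ~: {x. g x > 0}" by eventually_elim auto
  have o: "open {x. g x > 0}" by (intro open_Collect_less continuous_on_const C1_cont[OF gc])
  then have "{x. g x > 0} : sets lborel" by simp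
  from AE_iff_null_sets[OF this] ae have "{x. g x > 0} : null_sets lborel" by blast
  then have "negligible {x. g x > 0}" by (simp add: negligible_iff_null_sets null_sets_completionI)
  moreover have "{x. g x > 0} ~= {}" using \<open>g 0 > 0\<close> by blast
  ultimately show False using o open_not_negligible by blast
 qed
 define \<eta> where "\<eta> x = (1 / (\<integral>x. g x)) * g x" for x
 have "smooth \<eta>" unfolding \<eta>_def by (intro bump_algebra_smooth bump_algebra.scale gB)
 moreover have "ALL x. \<eta> x >= 0" using g0 pos by (simp add: \<eta>_def)
 moreover have "ALL x. norm x > 1 --> \<eta> x = 0" using gs by (simp add: \<eta>_def)
 moreover have "integrable lborel \<eta>" unfolding \<eta>_def by (intro integrable_mult_right gi)
 moreover have "(\<integral>x. \<eta> x) = 1" using pos unfolding \<eta>_def by simp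
 ultimately show ?thesis by blast
qed

definition bump :: "real^3 => real" where
 "bump = (SOME \<eta>. smooth \<eta> & (ALL x. \<eta> x >= 0) & (ALL x. norm x > 1 --> \<eta> x = 0) & integrable lborel \<eta> & (\<integral>x. \<eta> x) = 1)"

lemma bump: "smooth bump" "bump x >= 0" "norm x > 1 ==> bump x = 0" "integrable lborel bump" "(\<integral>x. bump x) = 1"
 using someI_ex[OF exists_bump] unfolding bump_def[symmetric] by blast+

lemma bump_C1: "C1 bump" using bump(1) smooth_C1 by blast

lemma bump_measurable[measurable]: "bump : BM" using bump_C1 by (rule C1_bm)

lemma nn_integral_bump: "(\<integral>\<^sup>+x. en (bump x)) = 1" using nn_integral_eq_integral[OF bump(4)] bump by simp

lemma bump_bounded: "EX B>0. ALL x. bump x <= B" using compact_support_bounded[OF C1_cont[OF bump_C1] compact_cball[of 0 1]] bump(2,3)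
 by (metis abs_of_nonneg mem_cball_0 linorder_not_less real_norm_def)

text \<open>The weighted mean of \<open>w\<close> over the ball of radius \<bar>d\<bar> around
  \<open>l *R x + a\<close>. With l = 1, a = 0 it is ordinary mollification;
  \<open>moll a r t\<close> draws x towards the ball of radius r around a and becomes the mean over
  that ball at t = 1; factors above 1 push x outwards. A negative \<open>d\<close> is allowed and
  will occur.\<close>

definition mollify :: "real => real^3 => real => (real^3 => 'b::euclidean_space) => real^3 => 'b" where
 "mollify l a d w x = (\<integral>z. bump z *R w (l *R x + a + d *R z))"

abbreviation (input) "moll a r t == mollify (1 - t) (t *R a) (t * r)"

text \<open>The bump rescaled and reflected so that \<open>mollify\<close> becomes a convolution
  evaluated at \<open>l *R x + a\<close>; the modulus accounts for negative
  \<open>d\<close>.\<close>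

definition kern :: "real => real^3 => real" where
 "kern d u = (1 / \<bar>d\<bar>^3) * bump ((- (1 / d)) *R u + 0)"

lemma mollify_eq_convol:
 fixes w :: "real^3 => 'b::euclidean_space"
 assumes "d ~= 0" shows "mollify l a d w x = convol (kern d) w (l *R x + a)"
proof -
 have "(\<integral>y. kern d (l *R x + a - y) *R w y)
  = \<bar>d\<bar>^3 *R (\<integral>z. kern d (l *R x + a - (l *R x + a + d *R z)) *R w (l *R x + a + d *R z))" by (rule integral_affine[OF assms])
 also have "(%z. kern d (l *R x + a - (l *R x + a + d *R z)) *R w (l *R x + a + d *R z))
  = (%z. (1 / \<bar>d\<bar>^3) *R (bump z *R w (l *R x + a + d *R z)))" using assms by (simp add: kern_def)
 also have "(\<integral>z. (1 / \<bar>d\<bar>^3) *R (bump z *R w (l *R x + a + d *R z)))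
  = (1 / \<bar>d\<bar>^3) *R mollify l a d w x" unfolding mollify_def by (rule integral_scaleR_right)
 finally show ?thesis using assms by (simp add: convol_def)
qed

lemma kern_props:
 assumes "d ~= 0"
 shows "smooth (kern d)" "C1 (kern d)" "!!x. norm x > \<bar>d\<bar> ==> kern d x = 0"
proof -
 define S where "S = {(%x. c * f ((- (1 / d)) *R x + 0)) | c f. smooth f}"
 show "smooth (kern d)"
 proof (rule smoothI[where S = S])
  show "kern d : S" unfolding S_def kern_def[abs_def] using bump(1) by blast
  fix g x i assume "g : S"
  then obtain c f where g: "g = (%x. c * f ((- (1 / d)) *R x + 0))" and f: "smooth f" unfolding S_def by blast
  note 1 = C1_affine[OF smooth_C1(1)[OF f], of "- (1 / d)" 0]
  show "g differentiable (at x)" unfolding g using C1_cmult(1)[OF 1(1)] C1_differentiable by blast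
  have "grad g = (%x. c *R (- (1 / d)) *R grad f ((- (1 / d)) *R x + 0))" unfolding g C1_cmult(2)[OF 1(1)] 1(2) ..
  from pd_of_grad[OF this] have "pd i g = (%x. (c * (- (1 / d))) * pd i f ((- (1 / d)) *R x + 0))" by simp
  then show "pd i g : S" unfolding S_def using smooth_C1(2)[OF f] by blast
 qed
 then show "C1 (kern d)" by (rule smooth_C1)
 show "kern d x = 0" if "norm x > \<bar>d\<bar>" for x using that assms bump(3)[of "(- (1 / d)) *R x"] by (simp add: kern_def field_simps)
qed

lemma mollify_C1:
 fixes w :: "real^3 => real"
 assumes "d ~= 0" "sqi w"
 shows "C1 (mollify l a d w)" "pd i (mollify l a d w) x = l * convol (pd i (kern d)) w (l *R x + a)"
proof -
 have e: "mollify l a d w = (%x. convol (kern d) w (l *R x + a))" using mollify_eq_convol[OF assms(1)] by blast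
 note c = C1_convol[OF kern_props(2)[OF assms(1)] _ kern_props(3)[OF assms(1)] assms(2), of "\<bar>d\<bar>"]
 have c1: "C1 (convol (kern d) w)" using c assms by simp
 show "C1 (mollify l a d w)" unfolding e by (rule C1_affine(1)[OF c1])
 have "grad (mollify l a d w) x $ i = (l *R grad (convol (kern d) w) (l *R x + a)) $ i" unfolding e C1_affine(2)[OF c1] ..
 then show "pd i (mollify l a d w) x = l * convol (pd i (kern d)) w (l *R x + a)" using c(2) assms by simp
qed

text \<open>The unsigned companion of \<open>mollify\<close>, with values in \<open>ennreal\<close>
  so that Fubini and Cauchy-Schwarz apply without integrability conditions.\<close>

definition av :: "real => real^3 => real => (real^3 => en) => real^3 => en" where
 "av l a d g x = (\<integral>\<^sup>+z. en (bump z) * g (l *R x + a + d *R z))"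

abbreviation (input) "avt a r t == av (1 - t) (t *R a) (t * r)"

lemma av_measurable[measurable]:
 assumes [measurable]: "g : BM" shows "av l a d g : BM" unfolding av_def by measurable

text \<open>This bound comes from the dilation in x and blows up as l tends to 0;
  \<open>av_le\<close> comes from the averaging in z and blows up as d tends to 0. For l = 1 - t and
  d = t r, each t in the unit interval is safe for one of the two.\<close>

lemma nn_integral_av:
 assumes [measurable]: "g : BM" and l: "l ~= 0"
 shows "(\<integral>\<^sup>+x. av l a d g x) = en (1 / \<bar>l\<bar>^3) * (\<integral>\<^sup>+x. g x)"
proof -
 have "(\<integral>\<^sup>+x. av l a d g x) = (\<integral>\<^sup>+z. \<integral>\<^sup>+x. en (bump z) * g (l *R x + a + d *R z))"
  unfolding av_def by (rule lborel_pair.Fubini') measurable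
 also have "... = (\<integral>\<^sup>+z. en (bump z) * (en (1 / \<bar>l\<bar>^3) * (\<integral>\<^sup>+x. g x)))"
 proof (rule nn_integral_cong)
  fix z
  have "(\<integral>\<^sup>+x. en (bump z) * g (l *R x + a + d *R z))
   = en (bump z) * (\<integral>\<^sup>+x. g ((a + d *R z) + l *R x))" by (subst nn_integral_cmult[symmetric]) (auto simp: algebra_simps)
  then show "(\<integral>\<^sup>+x. en (bump z) * g (l *R x + a + d *R z))
   = en (bump z) * (en (1 / \<bar>l\<bar>^3) * (\<integral>\<^sup>+x. g x))" by (simp only: nn_integral_affine[OF assms])
 qed
 also have "... = en (1 / \<bar>l\<bar>^3) * (\<integral>\<^sup>+x. g x)" by (subst nn_integral_multc) (auto simp: nn_integral_bump)
 finally show ?thesis .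
qed

lemma av_le:
 assumes [measurable]: "g : BM" and d: "d ~= 0" and B: "!!x. bump x <= B"
 shows "av l a d g x <= en (B / \<bar>d\<bar>^3) * (\<integral>\<^sup>+x. g x)"
proof -
 have B0: "B >= 0" using B[of 0] bump(2)[of 0] by linarith
 have "av l a d g x <= (\<integral>\<^sup>+z. en B * g ((l *R x + a) + d *R z))" unfolding av_def by (intro nn_integral_mono mult_right_mono ennreal_leI B) auto
 also have "... = en B * (en (1 / \<bar>d\<bar>^3) * (\<integral>\<^sup>+x. g x))" by (subst nn_integral_cmult) (simp_all add: nn_integral_affine[OF _ d])
 also have "... = en (B / \<bar>d\<bar>^3) * (\<integral>\<^sup>+x. g x)" using B0 by (simp add: mult.assoc[symmetric] ennreal_mult[symmetric])
 finally show ?thesis .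
qed

text \<open>Jensen's inequality for the probability density \<open>bump\<close>, by Cauchy-Schwarz
  after splitting the density into two square roots.\<close>

lemma av_square:
 assumes [measurable]: "g : BM"
 shows "(av l a d g x)^2 <= av l a d (%y. (g y)^2) x"
proof -
 have e: "en (bump z) = en (sqrt (bump z)) * en (sqrt (bump z))" for z using bump(2)[of z] by (simp add: ennreal_mult[symmetric])
 have "av l a d g x = (\<integral>\<^sup>+z. en (sqrt (bump z)) * (en (sqrt (bump z)) * g (l *R x + a + d *R z)))" unfolding av_def by (simp add: e mult.assoc)
 also have "...\<^sup>2 <= (\<integral>\<^sup>+z. (en (sqrt (bump z)))^2) * (\<integral>\<^sup>+z. (en (sqrt (bump z)) * g (l *R x + a + d *R z))^2)"
  by (rule Cauchy_Schwarz_nn_integral) measurable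
 also have "... = av l a d (%y. (g y)^2) x" by (simp add: power_mult_distrib power2_eq_square[of "en _"] e[symmetric] nn_integral_bump av_def)
 finally show ?thesis .
qed

lemma mollify_measurable[measurable]:
 assumes [measurable]: "w : BM" shows "mollify l a d w : BM" unfolding mollify_def by measurable

lemma norm_mollify_le:
 fixes w :: "real^3 => 'b::euclidean_space"
 assumes [measurable]: "w : BM"
 shows "en (norm (mollify l a d w x)) <= av l a d (%y. en (norm (w y))) x"
proof (cases "integrable lborel (%z. bump z *R w (l *R x + a + d *R z))")
 case True
 from integral_norm_bound_ennreal[OF this] show ?thesis using bump(2) by (simp add: mollify_def av_def ennreal_mult)
next
 case False then show ?thesis by (simp add: mollify_def not_integrable_integral_eq)
qed

lemma norm_mollify_square_le:
 fixes w :: "real^3 => 'b::euclidean_space"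
 assumes [measurable]: "w : BM"
 shows "en ((norm (mollify l a d w x))^2) <= av l a d (%y. en ((norm (w y))^2)) x"
proof -
 have "en ((norm (mollify l a d w x))^2) = (en (norm (mollify l a d w x)))^2" by (simp add: ennreal_power)
 also have "... <= (av l a d (%y. en (norm (w y))) x)^2" by (intro power_mono norm_mollify_le assms) simp
 also have "... <= av l a d (%y. (en (norm (w y)))^2) x" by (rule av_square) measurable
 finally show ?thesis by (simp add: ennreal_power)
qed

lemma mollify_L2:
 assumes w: "sqi w" and l: "l ~= 0"
 shows "sqi (mollify l a d w)" "l2n (mollify l a d w) <= sqrt (1 / \<bar>l\<bar>^3) * l2n w"
proof -
 have [measurable]: "w : BM" using w by (rule sqi_bm)
 have "(\<integral>\<^sup>+x. en ((norm (mollify l a d w x))^2)) <= (\<integral>\<^sup>+x. av l a d (%y. en ((norm (w y))^2)) x)"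
  by (intro nn_integral_mono norm_mollify_square_le) measurable
 also have "... = en (1 / \<bar>l\<bar>^3) * (\<integral>\<^sup>+x. en ((norm (w x))^2))" by (rule nn_integral_av[OF _ l]) measurable
 also have "... = en ((sqrt (1 / \<bar>l\<bar>^3) * l2n w)^2)" unfolding nn_norm_cls[OF w] by (simp add: power_mult_distrib ennreal_mult[symmetric])
 finally have *: "(\<integral>\<^sup>+x. en ((norm (mollify l a d w x))^2)) <= en ((sqrt (1 / \<bar>l\<bar>^3) * l2n w)^2)" .
 have m: "mollify l a d w : BM" by measurable
 show "sqi (mollify l a d w)" "l2n (mollify l a d w) <= sqrt (1 / \<bar>l\<bar>^3) * l2n w" by (rule norm_cls_le[OF m *]; simp)+
qed

lemma mollify_integrable:
 assumes w: "sqi w" and d: "d ~= 0"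
 shows "integrable lborel (%z. bump z *R w (l *R x + a + d *R z))"
proof -
 interpret K: convol_kernel "kern d" "\<bar>d\<bar>" by standard (use kern_props[OF d] d C1_cont in auto)
 have "integrable lborel (%z. kern d (l *R x + a - (l *R x + a + d *R z)) *R w (l *R x + a + d *R z))"
  using K.integrable_convol[OF w, of "l *R x + a"] integrable_affine_iff[OF d, of "%y. kern d (l *R x + a - y) *R w y" "l *R x + a"] by blast
 also have "(%z. kern d (l *R x + a - (l *R x + a + d *R z)) *R w (l *R x + a + d *R z))
  = (%z. (1 / \<bar>d\<bar>^3) *R (bump z *R w (l *R x + a + d *R z)))" using d by (simp add: kern_def)
 finally have "integrable lborel (%z. (1 / \<bar>d\<bar>^3) *R (bump z *R w (l *R x + a + d *R z)))" .
 from integrable_scaleR_right[of "\<bar>d\<bar>^3", OF this] show ?thesis using d by simp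
qed

lemma mollify_diff:
 assumes "sqi v" "sqi w" "d ~= 0"
 shows "mollify l a d (%y. v y - w y) x = mollify l a d v x - mollify l a d w x" unfolding mollify_def scaleR_diff_right
 by (rule lint_diff; rule mollify_integrable; fact)

lemma mollify_component:
 fixes w :: "real^3 => real^3"
 assumes "sqi w" "d ~= 0"
 shows "mollify l a d w x $ i = mollify l a d (%y. w y $ i) x"
proof -
 have "mollify l a d w x $ i = (\<integral>z. (bump z *R w (l *R x + a + d *R z)) $ i)" unfolding mollify_def
  by (rule integral_bounded_linear[OF bounded_linear_vec_nth mollify_integrable[OF assms], symmetric])
 then show ?thesis by (simp add: mollify_def)
qed

text \<open>A measurable function is an almost everywhere limit of continuous ones. The radial
  truncation \<open>T n\<close> of the values and the spatial cutoff \<open>ch n\<close> preserve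
  continuity and make the limit dominated.\<close>

lemma continuous_dense_L2:
 fixes w :: "real^3 => 'b::euclidean_space"
 assumes w: "sqi w" and e: "e > 0"
 shows "EX g R. continuous_on UNIV g & R > 0 & (ALL x. norm x > R --> g x = 0) & norm (cls w - cls g) < e"
proof -
 have [measurable]: "w : BM" using w by (rule sqi_bm)
 have "w : borel_measurable lebesgue" by (rule measurable_completion) simp
 then have "w measurable_on UNIV" by (rule lebesgue_measurable_imp_measurable_on) simp
 then obtain N g where N: "negligible N" and g: "!!n. continuous_on UNIV (g n)"
  and lim: "!!x. x ~: N ==> (%n. g n x) ---> w x" unfolding measurable_on_def by auto
 have "AE x in lebesgue. x ~: N" using N by (simp add: AE_not_in negligible_iff_null_sets)
 then have aeN: "AE x. x ~: N" by (simp add: AE_completion_iff)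
 define T where "T n v = (real (Suc n) / max (real (Suc n)) (norm v)) *R v" for n and v :: 'b
 define ch where "ch n x = max 0 (min 1 (real (Suc n) + 1 - norm x))" for n and x :: "real^3"
 have mx: "max (real (Suc n)) (norm v) ~= 0" for n and v :: 'b by (metis max.cobounded1 not_less of_nat_0_less_iff zero_less_Suc)
 have Tc: "continuous_on UNIV (T n)" for n unfolding T_def by (intro continuous_intros ballI mx)
 have chc: "continuous_on UNIV (ch n)" for n unfolding ch_def by (intro continuous_intros)
 have Tn: "norm (T n v) <= norm v" "norm (T n v) <= real (Suc n)" for n v
 proof -
  have m0: "max (real (Suc n)) (norm v) > 0" using mx[of n v] by (auto simp: less_max_iff_disj)
  have "norm (T n v) = real (Suc n) * norm v / max (real (Suc n)) (norm v)" using m0 by (simp add: T_def)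
  moreover have "real (Suc n) * norm v <= norm v * max (real (Suc n)) (norm v)" by (subst mult.commute) (intro mult_left_mono, auto)
  moreover have "real (Suc n) * norm v <= real (Suc n) * max (real (Suc n)) (norm v)" by (intro mult_left_mono) auto
  ultimately show "norm (T n v) <= norm v" "norm (T n v) <= real (Suc n)" using m0 by (simp_all add: divide_le_eq)
 qed
 have ch01: "0 <= ch n x" "ch n x <= 1" "norm x > real (Suc n) + 1 ==> ch n x = 0" for n x by (auto simp: ch_def)
 have [measurable]: "T n : BM" "ch n : BM" "g n : BM" for n using Tc chc g by (auto intro: bm_cont)
 have "(%n. cls (%x. ch n x *R T n (w x))) ---> cls w"
 proof (rule l2_dominated_convergence(3)[OF _ _ w])
  show "AE x. (%n. ch n x *R T n (w x)) ---> w x"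
  proof (intro AE_I2 tendsto_eventually)
   fix x
   obtain M where M: "max (norm x) (norm (w x)) < real M" using reals_Archimedean2 by blast
   show "\<forall>\<^sub>F n in sequentially. ch n x *R T n (w x) = w x"
   proof (rule eventually_sequentiallyI[of M])
    fix n assume "n >= M"
    then have "real (Suc n) > norm x" "real (Suc n) > norm (w x)" using M by auto
    then show "ch n x *R T n (w x) = w x" by (simp add: ch_def T_def max_def)
   qed
  qed
  show "AE x. norm (ch n x *R T n (w x)) <= norm (w x)" for n using mult_mono[OF ch01(2)[of n] Tn(1)[of n "w _"]] ch01(1) by simp
 qed measurable
 then obtain n where n: "norm (cls (%x. ch n x *R T n (w x)) - cls w) < e / 2" using e unfolding LIMSEQ_iff by (meson half_gt_zero order_refl)
 have dom: "sqi (%x::real^3. indicator (cball 0 (real (Suc n) + 1)) x * real (Suc n))"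
  using sqi_scaleR[OF sqi_indicator_set[of "cball 0 (real (Suc n) + 1)"], of "real (Suc n)"]
   emeasure_compact_finite[OF compact_cball[of "0::real^3" "real (Suc n) + 1"]] by (simp add: mult.commute)
 have bnd: "norm (ch n x *R T n v) <= norm (indicator (cball 0 (real (Suc n) + 1)) x * real (Suc n))" for x v
 proof (cases "x : cball 0 (real (Suc n) + 1)")
  case True
  then show ?thesis using mult_mono[OF ch01(2)[of n x] Tn(2)[of n v]] ch01(1)[of n x] by simp
 next
  case False then show ?thesis using ch01(3)[of n x] by simp
 qed
 note dc = l2_dominated_convergence[OF _ _ dom, of "%k x. ch n x *R T n (g k x)" "%x. ch n x *R T n (w x)"]
 have lim2: "AE x. (%k. ch n x *R T n (g k x)) ---> ch n x *R T n (w x)" using aeN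
 proof eventually_elim
  case (elim x)
  show ?case by (intro tendsto_scaleR tendsto_const continuous_on_tendsto_compose[OF Tc lim[OF elim]]) auto
 qed
 have c: "(%k. cls (%x. ch n x *R T n (g k x))) ---> cls (%x. ch n x *R T n (w x))" by (rule dc(3)[OF _ _ lim2]) (use bnd in auto)
 then obtain k where k: "norm (cls (%x. ch n x *R T n (g k x)) - cls (%x. ch n x *R T n (w x))) < e / 2" using e unfolding LIMSEQ_iff by (meson half_gt_zero order_refl)
 show ?thesis
 proof (intro exI conjI allI impI)
  show "continuous_on UNIV (%x. ch n x *R T n (g k x))" by (intro continuous_on_scaleR chc continuous_on_compose2[OF Tc g]) auto
  show "real (Suc n) + 1 > 0" by simp
  show "ch n x *R T n (g k x) = 0" if "norm x > real (Suc n) + 1" for x using ch01(3)[OF that] by simp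
  show "norm (cls w - cls (%x. ch n x *R T n (g k x))) < e"
   using n k norm_triangle_lt[of "cls w - cls (%x. ch n x *R T n (w x))" "cls (%x. ch n x *R T n (w x)) - cls (%x. ch n x *R T n (g k x))" e]
   by (simp add: norm_minus_commute)
 qed
qed

lemma mollify_tendsto_continuous:
 fixes g :: "real^3 => 'b::euclidean_space"
 assumes g: "continuous_on UNIV g" "R > 0" "!!x. norm x > R ==> g x = 0"
  and lim: "l ---> 1" "a ---> 0" "d ---> 0"
  and b: "!!n. l n >= 1/2" "!!n. norm (a n) <= 1" "!!n. \<bar>d n\<bar> <= 1" "!!n. d n ~= 0"
 shows "(%n. cls (mollify (l n) (a n) (d n) g)) ---> cls g"
proof -
 have gz: "x ~: cball 0 R ==> g x = 0" for x using g(3) by simp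
 have gs: "sqi g" by (rule sqi_compact_support[OF g(1) compact_cball gz])
 have [measurable]: "g : BM" using gs by (rule sqi_bm)
 obtain B where B: "B > 0" "!!x. norm (g x) <= B" using compact_support_bounded[OF g(1) compact_cball gz] by blast
 have dom: "sqi (%x::real^3. indicator (cball 0 (2 * (R + 2))) x * B)" using sqi_scaleR[OF sqi_indicator_set[of "cball 0 (2 * (R + 2))"], of B]
   emeasure_compact_finite[OF compact_cball[of "0::real^3" "2 * (R + 2)"]] by (simp add: mult.commute)
 show ?thesis
 proof (rule l2_dominated_convergence(3)[OF _ _ dom])
  show "AE x. (%n. mollify (l n) (a n) (d n) g x) ---> g x"
  proof (rule AE_I2, rule LIMSEQ_I)
   fix x :: "real^3" and e :: real assume e: "e > 0"
   then obtain dl where dl: "dl > 0" "!!x y. norm (x - y) < dl ==> norm (g x - g y) < e / 2"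
    using compact_support_uniform[OF g(1) compact_cball gz half_gt_zero[OF e]] by blast
   have "(%n. \<bar>l n - 1\<bar> * norm x + norm (a n) + \<bar>d n\<bar>) ---> \<bar>1 - 1\<bar> * norm x + norm (0::real^3) + \<bar>0\<bar>"
    by (intro tendsto_intros lim)
   then have "\<forall>\<^sub>F n in sequentially. \<bar>l n - 1\<bar> * norm x + norm (a n) + \<bar>d n\<bar> < dl" using dl(1) by (intro order_tendstoD(2)) auto
   then obtain N where N: "!!n. n >= N ==> \<bar>l n - 1\<bar> * norm x + norm (a n) + \<bar>d n\<bar> < dl" unfolding eventually_sequentially by blast
   show "EX N. ALL n>=N. norm (mollify (l n) (a n) (d n) g x - g x) < e"
   proof (intro exI[of _ N] allI impI)
    fix n assume n: "n >= N"
    have "g x = (\<integral>z. bump z *R g x)" using bump(4,5) by simp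
    then have "mollify (l n) (a n) (d n) g x - g x = (\<integral>z. bump z *R (g (l n *R x + a n + d n *R z) - g x))" unfolding mollify_def scaleR_diff_right
     using mollify_integrable[OF gs b(4)] bump(4) by (subst lint_diff) auto
    also have "norm ... <= (\<integral>z. bump z * (e / 2))"
    proof (rule Bochner_Integration.integral_norm_bound_integral)
     show "integrable lborel (%z. bump z *R (g (l n *R x + a n + d n *R z) - g x))" unfolding scaleR_diff_right using mollify_integrable[OF gs b(4)] bump(4) by auto
     fix z :: "real^3"
     show "norm (bump z *R (g (l n *R x + a n + d n *R z) - g x)) <= bump z * (e / 2)"
     proof (cases "norm z > 1")
      case False
      have "norm (l n *R x + a n + d n *R z - x) = norm ((l n - 1) *R x + a n + d n *R z)" by (simp add: algebra_simps)
      also have "... <= \<bar>l n - 1\<bar> * norm x + norm (a n) + \<bar>d n\<bar> * norm z" by (intro norm_triangle_le add_mono) auto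
      also have "... <= \<bar>l n - 1\<bar> * norm x + norm (a n) + \<bar>d n\<bar>" using False by (simp add: mult_left_le)
      also have "... < dl" by (rule N[OF n])
      finally have "norm (g (l n *R x + a n + d n *R z) - g x) <= e / 2" using dl(2) less_imp_le by blast
      from mult_left_mono[OF this bump(2)[of z]] show ?thesis using bump(2)[of z] by simp
     qed (simp add: bump(3))
    qed (use bump(4) in auto)
    also have "... < e" using e bump(5) by simp
    finally show "norm (mollify (l n) (a n) (d n) g x - g x) < e" .
   qed
  qed
  show "AE x. norm (mollify (l n) (a n) (d n) g x) <= norm (indicator (cball 0 (2 * (R + 2))) x * B)" for n
  proof (rule AE_I2)
   fix x :: "real^3"
   show "norm (mollify (l n) (a n) (d n) g x) <= norm (indicator (cball 0 (2 * (R + 2))) x * B)"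
   proof (cases "x : cball 0 (2 * (R + 2))")
    case True
    have "norm (mollify (l n) (a n) (d n) g x) <= (\<integral>z. bump z * B)" unfolding mollify_def
     by (rule Bochner_Integration.integral_norm_bound_integral[OF mollify_integrable[OF gs b(4)]]) (use bump B in \<open>auto intro: mult_left_mono\<close>)
    then show ?thesis using True bump(5) B(1) by simp
   next
    case False
    have "bump z *R g (l n *R x + a n + d n *R z) = 0" for z
    proof (cases "norm z > 1")
     case nz: False
     have "norm (l n *R x) >= 1/2 * norm x" using b(1)[of n] mult_right_mono[OF b(1)[of n] norm_ge_zero[of x]] by simp
     moreover have "norm (d n *R z) <= 1" using nz b(3)[of n] by (simp add: mult_le_one)
     moreover have "norm (l n *R x) <= norm (l n *R x + a n + d n *R z) + norm (a n) + norm (d n *R z)"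
      using norm_triangle_ineq4[of "l n *R x + a n + d n *R z" "a n + d n *R z"] norm_triangle_ineq[of "a n" "d n *R z"] by simp
     ultimately have "norm (l n *R x + a n + d n *R z) > R" using False b(2)[of n] by simp
     then show ?thesis using g(3) by simp
    qed (simp add: bump(3))
    then have "mollify (l n) (a n) (d n) g x = 0" unfolding mollify_def by (simp only:) simp
    then show ?thesis by simp
   qed
  qed
 qed measurable
qed

text \<open>The operators are bounded by 4 uniformly, as all dilations are at least 1/2, so
  convergence on the dense class of continuous functions with compact support carries over.\<close>

lemma mollify_tendsto:
 fixes w :: "real^3 => 'b::euclidean_space"
 assumes w: "sqi w" and lim: "l ---> 1" "a ---> 0" "d ---> 0"
  and b: "!!n. l n >= 1/2" "!!n. norm (a n) <= 1" "!!n. \<bar>d n\<bar> <= 1" "!!n. d n ~= 0"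
 shows "(%n. cls (mollify (l n) (a n) (d n) w)) ---> cls w"
proof (rule LIMSEQ_I)
 fix e :: real assume e: "e > 0"
 obtain g R where g: "continuous_on UNIV g" "R > 0" "!!x. norm x > R ==> g x = 0" "norm (cls w - cls g) < e / 8" using continuous_dense_L2[OF w, of "e / 8"] e by auto
 have gs: "sqi g" by (rule sqi_compact_support[OF g(1) compact_cball[of 0 R]]) (use g(3) in auto)
 obtain N where N: "!!n. n >= N ==> norm (cls (mollify (l n) (a n) (d n) g) - cls g) < e / 4"
  using LIMSEQ_D[OF mollify_tendsto_continuous[OF g(1-3) lim b], of "e/4"] e by auto
 show "EX N. ALL n>=N. norm (cls (mollify (l n) (a n) (d n) w) - cls w) < e"
 proof (intro exI[of _ N] allI impI)
  fix n assume n: "n >= N"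
  have l0: "l n ~= 0" "l n > 0" using b(1)[of n] by auto
  have "1 / \<bar>l n\<bar>^3 <= 1 / (1/2)^3" using b(1)[of n] l0 by (intro divide_left_mono power_mono mult_pos_pos) auto
  \<comment> \<open>The actual bound is 8; 16 has a rational root.\<close>
  then have "sqrt (1 / \<bar>l n\<bar>^3) <= sqrt 16" by (intro real_sqrt_le_mono) (simp add: power3_eq_cube)
  then have sq: "sqrt (1 / \<bar>l n\<bar>^3) <= 4" by simp
  have "cls (mollify (l n) (a n) (d n) w) - cls (mollify (l n) (a n) (d n) g) = cls (mollify (l n) (a n) (d n) (%y. w y - g y))"
   unfolding cls_diff[OF mollify_L2(1)[OF w l0(1)] mollify_L2(1)[OF gs l0(1)]] by (rule arg_cong[of _ _ cls]) (auto simp: mollify_diff[OF w gs b(4)])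
  also have "norm ... <= sqrt (1 / \<bar>l n\<bar>^3) * l2n (%y. w y - g y)" by (rule mollify_L2(2)[OF sqi_diff[OF w gs] l0(1)])
  also have "... <= 4 * norm (cls w - cls g)" unfolding cls_diff[OF w gs, symmetric] by (intro mult_right_mono sq) simp
  finally have "norm (cls (mollify (l n) (a n) (d n) w) - cls (mollify (l n) (a n) (d n) g)) < e / 2" using g(4) by simp
  then show "norm (cls (mollify (l n) (a n) (d n) w) - cls w) < e" using N[OF n] g(4) e
    norm_triangle_ineq[of "cls (mollify (l n) (a n) (d n) w) - cls (mollify (l n) (a n) (d n) g)" "cls (mollify (l n) (a n) (d n) g) - cls w"]
    norm_triangle_ineq[of "cls (mollify (l n) (a n) (d n) g) - cls g" "cls g - cls w"] by (simp add: norm_minus_commute)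
 qed
qed

section \<open>Weak gradients and density of smooth test functions\<close>

definition wgrad :: "(real^3) set => (real^3 => real) => (real^3 => real^3) => bool" where
 "wgrad \<Omega> u G <-> (\<forall>\<phi> i. C1c \<Omega> \<phi> --> (\<integral>x. u x * pd i \<phi> x) = - (\<integral>x. G x $ i * \<phi> x))"

lemma C1_wgrad: "C1 f ==> wgrad \<Omega> f (grad f)" unfolding wgrad_def using C1c_integration_by_parts(1) C1c_mono[of \<Omega> _ UNIV] by (simp add: mult.commute)

lemma kern_reflected:
 assumes d: "d ~= 0"
 shows "C1 (%y. kern d (b - y))" "pd i (%y. kern d (b - y)) = (%y. - pd i (kern d) (b - y))"
  "y ~: cball b \<bar>d\<bar> ==> kern d (b - y) = 0"
proof -
 have e: "(%y. kern d (b - y)) = (%y. kern d ((-1) *R y + b))" by simp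
 note a = C1_affine[OF kern_props(2)[OF d], of "-1" b]
 show "C1 (%y. kern d (b - y))" unfolding e by (rule a)
 show "pd i (%y. kern d (b - y)) = (%y. - pd i (kern d) (b - y))" unfolding e by (subst pd_of_grad[OF a(2)]) simp
 show "y ~: cball b \<bar>d\<bar> ==> kern d (b - y) = 0" using kern_props(3)[OF d] by (simp add: dist_norm)
qed

lemma kern_reflected_C1c:
 assumes d: "d ~= 0" and "cball b \<bar>d\<bar> <= \<Omega>"
 shows "C1c \<Omega> (%y. kern d (b - y))" by (rule C1cI[OF kern_reflected(1)[OF d] compact_cball assms(2)]) (rule kern_reflected(3)[OF d])

lemma sqi_component: "sqi (w :: real^3 => real^3) ==> sqi (%x. w x $ i)"
proof (rule sqi_mono)
 assume w: "sqi w"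
 have "(%x. w x \<bullet> axis i 1) : BM" using sqi_bm[OF w] by measurable
 then show "(%x. w x $ i) : BM" by (simp add: inner_axis)
qed (auto simp: component_le_norm_cart)

text \<open>The reflected kernel around \<open>l *R x + a\<close> is an admissible test function as
  soon as the averaging ball lies in \<Omega>; the factor \<open>l\<close> is the inner
  derivative.\<close>

lemma mollify_grad_weak:
 fixes w :: "real^3 => real"
 assumes d: "d ~= 0" and w: "sqi w" and G: "sqi G" and wg: "wgrad \<Omega> w G" and b: "cball (l *R x + a) \<bar>d\<bar> <= \<Omega>"
 shows "grad (mollify l a d w) x = l *R mollify l a d G x"
proof (rule vec_eq_iff[THEN iffD2], rule allI)
 fix i
 let ?b = "l *R x + a"
 have "(\<integral>y. w y * pd i (%y. kern d (?b - y)) y) = - (\<integral>y. G y $ i * kern d (?b - y))" using wg kern_reflected_C1c[OF d b] unfolding wgrad_def by blast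
 then have "convol (pd i (kern d)) w ?b = convol (kern d) (%y. G y $ i) ?b" by (simp add: kern_reflected(2)[OF d] convol_def mult.commute)
 then show "grad (mollify l a d w) x $ i = (l *R mollify l a d G x) $ i" unfolding grad_nth vector_scaleR_component mollify_component[OF G d] mollify_C1(2)[OF d w]
  by (simp add: mollify_eq_convol[OF d])
qed

lemma C1_mollify_vec:
 fixes G :: "real^3 => real^3"
 assumes "d ~= 0" "sqi G" shows "C1 (%x. mollify l a d G x $ i)"
 using mollify_C1(1)[OF assms(1) sqi_component[OF assms(2)]] by (simp add: mollify_component[OF assms(2,1)])

lemma test_fun_obtain:
 assumes "test_fun \<Omega> \<phi>" shows "C1c \<Omega> \<phi>"
proof -
 have "x ~: closure {x. \<phi> x ~= 0} ==> \<phi> x = 0" for x using closure_subset[of "{x. \<phi> x ~= 0}"] by blast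
 moreover have "smooth \<phi>" "compact (closure {x. \<phi> x ~= 0})" "closure {x. \<phi> x ~= 0} <= \<Omega>" using assms unfolding test_fun_def by simp_all
 ultimately show ?thesis using C1cI[OF smooth_C1(1)] by blast
qed

lemma test_funI:
 assumes "smooth \<phi>" "compact K" "K <= \<Omega>" "!!x. x ~: K ==> \<phi> x = 0" shows "test_fun \<Omega> \<phi>"
proof -
 have "closure {x. \<phi> x ~= 0} <= K" using assms by (intro closure_minimal) (auto intro: compact_imp_closed)
 moreover from this have "compact (closure {x. \<phi> x ~= 0})" using bounded_subset[OF compact_imp_bounded[OF assms(2)]] by (simp add: compact_eq_bounded_closed)
 ultimately show ?thesis unfolding test_fun_def using assms(1,3) by blast
qed

text \<open>The bridge from C1 test functions to the smooth ones of the definitions: mollification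
  at scales below the distance between the support and the complement of \<Omega>.\<close>

lemma test_fun_dense:
 assumes \<phi>: "C1c \<Omega> \<phi>" and \<Omega>: "open \<Omega>"
 shows "\<exists>\<phi>s. (ALL n. test_fun \<Omega> (\<phi>s n)) & (%n. cls (\<phi>s n)) ---> cls \<phi> & (%n. cls (grad (\<phi>s n))) ---> cls (grad \<phi>)"
proof -
 obtain K where K: "compact K" "K <= \<Omega>" "!!x. x ~: K ==> \<phi> x = 0" using \<phi> C1c_obtain by metis
 obtain e where e: "e > 0" "(\<Union>x\<in>K. cball x e) <= \<Omega>" using compact_subset_open_imp_cball_epsilon_subset[OF K(1) \<Omega> K(2)] by blast
 define d where "d n = min e (1 / real (Suc n))" for n
 have d: "d n > 0" "d n <= e" "d n <= 1" for n using e by (auto simp: d_def min_le_iff_disj)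
 have d0: "d ---> 0" by (rule tendsto_sandwich[OF _ _ tendsto_const LIMSEQ_Suc[OF lim_1_over_n]]) (use d(1) in \<open>auto simp: d_def less_imp_le\<close>)
 have s: "sqi \<phi>" "sqi (grad \<phi>)" using C1c_sqi[OF \<phi>] by auto
 define \<phi>s where "\<phi>s n = mollify 1 0 (d n) \<phi>" for n
 have dn: "d n ~= 0" for n using d(1)[of n] by simp
 have g: "grad (\<phi>s n) = mollify 1 0 (d n) (grad \<phi>)" for n
  unfolding \<phi>s_def using mollify_grad_weak[OF dn s C1_wgrad[OF C1c_C1[OF \<phi>]], where \<Omega> = UNIV and l = 1] by auto
 have t: "test_fun \<Omega> (\<phi>s n)" for n
 proof (rule test_funI)
  have eq: "\<phi>s n = convol (kern (d n)) \<phi>" unfolding \<phi>s_def using mollify_eq_convol[OF dn[of n], of 1 0 \<phi>] by auto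
  show "smooth (\<phi>s n)" unfolding eq by (rule smooth_convol[OF kern_props(1)[OF dn] _ kern_props(3)[OF dn] s(1)]) (use dn in auto)
  show "compact {x + y |x y. x : K & y : cball 0 (d n)}" by (rule compact_sums[OF K(1) compact_cball])
  show "{x + y |x y. x : K & y : cball 0 (d n)} <= \<Omega>"
  proof clarify
   fix x y :: "real^3" assume "x : K" "y : cball 0 (d n)"
   then have "x + y : cball x e" using d(2)[of n] by (simp add: dist_norm)
   then show "x + y : \<Omega>" using e(2) \<open>x : K\<close> by blast
  qed
  interpret C: convol_kernel "kern (d n)" "\<bar>d n\<bar>" by standard (use kern_props[OF dn[of n]] dn C1_cont in auto)
  show "\<phi>s n x = 0" if "x ~: {x + y |x y. x : K & y : cball 0 (d n)}" for x unfolding eq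
  proof (rule C.convol_outside[of K])
   show "y : K \<or> \<phi> y = 0" for y using K(3) by blast
   show "\<bar>d n\<bar> < norm (x - y)" if "y : K" for y
   proof (rule ccontr)
    assume "\<not> ?thesis"
    then have "x - y : cball 0 (d n)" using d(1)[of n] by simp
    moreover have "x = y + (x - y)" by simp
    ultimately show False using \<open>x ~: _\<close> \<open>y : K\<close> by blast
   qed
  qed
 qed
 have "(%n. cls (\<phi>s n)) ---> cls \<phi>" unfolding \<phi>s_def
  by (rule mollify_tendsto[OF s(1) tendsto_const tendsto_const d0]) (use d(3) d(1) dn in \<open>auto simp: abs_of_pos\<close>)
 moreover have "(%n. cls (grad (\<phi>s n))) ---> cls (grad \<phi>)" unfolding g
  by (rule mollify_tendsto[OF s(2) tendsto_const tendsto_const d0]) (use d(3) d(1) dn in \<open>auto simp: abs_of_pos\<close>)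
 ultimately show ?thesis using t by blast
qed

text \<open>The fundamental lemma of the calculus of variations. On a compact part of \<Omega> all
  sufficiently fine mollifications of the difference vanish, and a subsequence of them converges to
  it almost everywhere; compact sets exhaust \<Omega>.\<close>

lemma wgrad_unique:
 assumes "open \<Omega>" "sqi G" "sqi G'" "wgrad \<Omega> u G" "wgrad \<Omega> u G'"
 shows "AE x. x : \<Omega> --> G x = G' x"
proof -
 have *: "AE x. x : \<Omega> --> f x = 0"
  if f: "sqi f" and orth: "!!\<phi>. C1c \<Omega> \<phi> ==> (\<integral>x. f x * \<phi> x) = 0" for f :: "real^3 => real"
 proof -
  have loc: "AE x. x : K --> f x = 0" if K: "compact K" "K <= \<Omega>" for K
  proof -
   obtain e where e: "e > 0" "(\<Union>x\<in>K. cball x e) <= \<Omega>" using compact_subset_open_imp_cball_epsilon_subset[OF K(1) assms(1) K(2)] by blast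
   define d where "d n = min e (1 / real (Suc n))" for n
   have d: "d n > 0" "d n <= e" "d n <= 1" for n using e by (auto simp: d_def min_le_iff_disj)
   have d0: "d ---> 0" by (rule tendsto_sandwich[OF _ _ tendsto_const LIMSEQ_Suc[OF lim_1_over_n]]) (use d(1) in \<open>auto simp: d_def less_imp_le\<close>)
   have dn: "d n ~= 0" for n using d(1)[of n] by simp
   have Ks: "K : sets borel" using K(1) by (simp add: compact_imp_closed)
   have z: "mollify 1 0 (d n) f x = 0" if x: "x : K" for n x
   proof -
    have "C1c \<Omega> (%y. kern (d n) (x - y))" by (rule kern_reflected_C1c[OF dn]) (use e(2) x d(1,2)[of n] in force)
    from orth[OF this] show ?thesis using mollify_eq_convol[OF dn[of n], of 1 0 f x] by (simp add: convol_def mult.commute)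
   qed
   have "(%n. cls (mollify 1 0 (d n) f)) ---> cls f"
    by (rule mollify_tendsto[OF f tendsto_const tendsto_const d0]) (use d(3) d(1) dn in \<open>auto simp: abs_of_pos\<close>)
   from l2_AE_subseq[OF this] obtain r where
    "AE x. (%n. rep (cls (mollify 1 0 (d (r n)) f)) x) ---> rep (cls f) x" by blast
   moreover have "AE x. ALL n. rep (cls (mollify 1 0 (d (r n)) f)) x = mollify 1 0 (d (r n)) f x"
    unfolding AE_all_countable by (intro allI rep_cls mollify_L2(1)[OF f]) simp
   moreover have "AE x. rep (cls f) x = f x" by (rule rep_cls[OF f])
   ultimately show ?thesis by eventually_elim (use z LIMSEQ_unique[OF tendsto_const] in fastforce)
  qed
  obtain K :: "nat => (real^3) set" where K: "!!n. compact (K n)" "!!n. K n <= \<Omega>" "(\<Union>n. K n) = \<Omega>"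
   using open_Union_compact_subsets[OF assms(1)] by metis
  have "AE x. ALL n. x : K n --> f x = 0" unfolding AE_all_countable using loc K(1,2) by blast
  then show ?thesis by eventually_elim (use K(3) in blast)
 qed
 have "AE x. x : \<Omega> --> G x $ i - G' x $ i = 0" for i
 proof (rule *)
  show "sqi (%x. G x $ i - G' x $ i)" by (intro sqi_diff sqi_component assms)
  fix \<phi> assume p: "C1c \<Omega> \<phi>"
  have "integrable lborel (%x. G x $ i * \<phi> x)" "integrable lborel (%x. G' x $ i * \<phi> x)" using sqi_inner[OF sqi_component[OF assms(2)] C1c_sqi(1)[OF p]]
    sqi_inner[OF sqi_component[OF assms(3)] C1c_sqi(1)[OF p]] by auto
  then show "(\<integral>x. (G x $ i - G' x $ i) * \<phi> x) = 0" using assms(4,5)[unfolded wgrad_def, rule_format, OF p, of i] by (simp add: left_diff_distrib)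
 qed
 then have "AE x. ALL i:UNIV. x : \<Omega> --> G x $ i - G' x $ i = 0" by (subst AE_finite_all) auto
 then show ?thesis by eventually_elim (simp add: vec_eq_iff)
qed

section \<open>Domains that are star-shaped with respect to a ball\<close>

definition star_ball :: "(real^3) set => real^3 => real => bool" where
 "star_ball D a r <-> open D & bounded D & r > 0 & D ~= {} &
  (ALL x:D. ALL b:cball a r. ALL t:{0..1}. (1 - t) *R x + t *R b : D)"

lemma star_ballD:
 assumes "star_ball D a r"
 shows "open D" "bounded D" "r > 0" "cball a r <= D" "D : sets borel" "emeasure lborel D < \<infinity>"
  "!!x b t. x : D ==> b : cball a r ==> 0 <= t ==> t <= 1 ==> (1 - t) *R x + t *R b : D"
  "!!x z t. x : D ==> norm z <= 1 ==> 0 <= t ==> t <= 1 ==> (1 - t) *R x + t *R a + (t * r) *R z : D"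
proof -
 show 1: "open D" "bounded D" "r > 0" using assms by (auto simp: star_ball_def)
 show "D : sets borel" using 1 by simp
 show "emeasure lborel D < \<infinity>" using 1(2) by (rule emeasure_bounded_finite)
 show s: "!!x b t. x : D ==> b : cball a r ==> 0 <= t ==> t <= 1 ==> (1 - t) *R x + t *R b : D" using assms by (auto simp: star_ball_def)
 obtain x where x: "x : D" using assms by (auto simp: star_ball_def)
 show "cball a r <= D" using s[OF x, of _ 1] by auto
 show "(1 - t) *R x + t *R a + (t * r) *R z : D" if "x : D" "norm z <= 1" "0 <= t" "t <= 1" for x z t
 proof -
  have "a + r *R z : cball a r" using that 1(3) by (simp add: dist_norm mult_left_le)
  from s[OF that(1) this that(3,4)] show ?thesis by (simp add: algebra_simps)
 qed
qed

abbreviation (input) rst :: "(real^3) set => (real^3 => 'b::euclidean_space) => real^3 => 'b" where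
 "rst D f \<equiv> (%x. indicator D x *R f x)"

lemma sqi_rst:
 fixes f :: "real^3 => 'b::euclidean_space"
 assumes "continuous_on UNIV f" "bounded D" "D : sets borel"
 shows "sqi (rst D f)"
proof -
 have "compact (closure D)" using assms(2) by (simp add: compact_closure)
 then obtain B where B: "!!x. x : closure D ==> norm (f x) <= B" using compact_imp_bounded[OF compact_continuous_image[OF continuous_on_subset[OF assms(1)]]]
  by (metis bounded_iff image_eqI subset_UNIV)
 have B': "x : D ==> norm (f x) <= B" for x using B closure_subset by blast
 have [measurable]: "f : BM" using assms(1) by (rule bm_cont)
 have "sqi (%x. B *R (indicator D x :: real))" by (intro sqi_scaleR sqi_indicator_set assms emeasure_bounded_finite)
 then show ?thesis
 proof (rule sqi_mono[rotated])
  show "(%x. indicator D x *R f x) : BM" using assms(3) by measurable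
  show "AE x. norm (indicator D x *R f x) <= norm (B *R (indicator D x :: real))" using order_trans[OF B' abs_ge_self] by (auto simp: indicator_def)
 qed
qed

lemma nn_Cauchy_Schwarz_interval:
 assumes [measurable]: "h : BM" and T: "T >= 0"
 shows "(\<integral>\<^sup>+t. ind T t * h t)^2 <= en T * (\<integral>\<^sup>+t. ind T t * (h t)^2 \<partial>(lborel :: real measure))"
proof -
 have "(\<integral>\<^sup>+t. ind T t * h t) = (\<integral>\<^sup>+t. ind T t * (ind T t * h t))" by (intro nn_integral_cong) (auto simp: indicator_def)
 also have "...\<^sup>2 <= (\<integral>\<^sup>+t. (ind T t)^2) * (\<integral>\<^sup>+t. (ind T t * h t)^2)" by (rule Cauchy_Schwarz_nn_integral) measurable
 also have "(\<integral>\<^sup>+t. (ind T t)^2 \<partial>(lborel :: real measure)) = (\<integral>\<^sup>+t. ind T t)"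
  by (intro nn_integral_cong) (auto simp: indicator_def)
 also have "... = en T" using T by simp
 also have "(\<integral>\<^sup>+t. (ind T t * h t)^2 \<partial>(lborel :: real measure)) = (\<integral>\<^sup>+t. ind T t * (h t)^2)"
  by (intro nn_integral_cong) (auto simp: indicator_def)
 finally show ?thesis .
qed

lemma C1_segment_bound:
 assumes p: "C1 p" and T: "0 <= T" and d: "norm (b - x) <= d"
 shows "en \<bar>p x - p (x + T *R (b - x))\<bar> <= en d * (\<integral>\<^sup>+t. ind T t * en (norm (grad p (x + t *R (b - x)))))"
proof -
 define f where "f t = p (x + t *R (b - x))" for t
 define f' where "f' t = grad p (x + t *R (b - x)) \<bullet> (b - x)" for t
 have c: "continuous_on {0..T} f'" unfolding f'_def by (intro continuous_intros continuous_on_compose2[OF C1_cont_grad[OF p, of UNIV]]) auto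
 have der: "(f has_vector_derivative f' t) (at t within {0..T})" for t
 proof -
  have "((%t. p (x + t *R (b - x))) has_derivative (%s. grad p (x + t *R (b - x)) \<bullet> (s *R (b - x)))) (at t within {0..T})"
   by (rule has_derivative_compose[OF _ C1_derivative[OF p]]) (auto intro!: derivative_eq_intros)
  then show ?thesis by (simp add: has_vector_derivative_def f_def[abs_def] f'_def)
 qed
 have hb: "has_bochner_integral lborel (%t. ind T t *R f' t) (f T - f 0)" by (rule has_bochner_integral_FTC_Icc[OF T der c])
 have "en \<bar>p x - p (x + T *R (b - x))\<bar> = en (norm (f T - f 0))" by (simp add: f_def abs_minus_commute)
 also have "... <= (\<integral>\<^sup>+t. norm (ind T t *R f' t))" by (rule has_bochner_integral_norm_bound[OF hb])
 also have "... <= (\<integral>\<^sup>+t. en d * (ind T t * en (norm (grad p (x + t *R (b - x))))))"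
 proof (rule nn_integral_mono)
  fix t :: real
  have "\<bar>f' t\<bar> <= d * norm (grad p (x + t *R (b - x)))" unfolding f'_def using Cauchy_Schwarz_ineq2[of "grad p (x + t *R (b - x))" "b - x"]
    mult_left_mono[OF d norm_ge_zero[of "grad p (x + t *R (b - x))"]] by (simp add: mult.commute)
  moreover have "d >= 0" using d norm_ge_zero order_trans by blast
  ultimately show "en (norm (ind T t *R f' t)) <= en d * (ind T t * en (norm (grad p (x + t *R (b - x)))))"
   by (auto simp: indicator_def ennreal_mult[symmetric] intro!: ennreal_leI)
 qed
 also have "... = en d * (\<integral>\<^sup>+t. ind T t * en (norm (grad p (x + t *R (b - x)))))"
 proof (rule nn_integral_cmult)
  have [measurable]: "grad p : BM" using p by (rule C1_grad_bm)
  show "(%t. ind T t * en (norm (grad p (x + t *R (b - x))))) : borel_measurable lborel" by measurable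
 qed
 finally show ?thesis .
qed

text \<open>Each difference of \<open>p\<close> between x and a point on the way to b in the ball is
  a line integral inside \<open>D\<close>. Averaging over b spreads the segment into a cone, and
  Fubini leaves means of the gradient over balls of radius t r, which L2 norms can control although
  they do not see lines.\<close>

lemma star_key:
 assumes D: "star_ball D a r" and p: "C1 p" and d: "!!x b. x : D ==> b : cball a r ==> norm (b - x) <= d"
  and T: "0 < T" "T <= 1" and x: "x : D"
 shows "en \<bar>p x - moll a r T (rst D p) x\<bar>
  <= en d * (\<integral>\<^sup>+t. ind T t * avt a r t (%y. en (norm (rst D (grad p) y))) x)"
proof -
 note S = star_ballD[OF D]
 have [measurable]: "p : BM" "grad p : BM" "D : sets borel" using p S by (auto intro: C1_bm C1_grad_bm)
 have ps: "sqi (rst D p)" by (rule sqi_rst[OF C1_cont[OF p] S(2,5)])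
 have d0: "T * r ~= 0" using T S(3) by simp
 define g where "g y = en (norm (rst D (grad p) y))" for y
 let ?f = "%z t. ind T t * (en (bump z) * g ((1 - t) *R x + t *R a + (t * r) *R z))"
 have [measurable]: "g : BM" unfolding g_def by measurable
 define q where "q z = (1 - T) *R x + T *R a + (T * r) *R z" for z
 have int: "integrable lborel (%z. bump z *R rst D p (q z))" unfolding q_def by (rule mollify_integrable[OF ps d0])
 have "p x - moll a r T (rst D p) x = (\<integral>z. bump z * p x - bump z *R rst D p (q z))" using int bump(4,5) by (subst lint_diff) (auto simp: mollify_def q_def)
 moreover have "integrable lborel (%z. bump z * p x - bump z *R rst D p (q z))" using int bump(4) by auto
 ultimately have "en \<bar>p x - moll a r T (rst D p) x\<bar>
  <= (\<integral>\<^sup>+z. en (norm (bump z * p x - bump z *R rst D p (q z))))"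
  using integral_norm_bound_ennreal[of lborel "%z. bump z * p x - bump z *R rst D p (q z)"] by simp
 also have "... <= (\<integral>\<^sup>+z. en d * (\<integral>\<^sup>+t. ?f z t))"
 proof (rule nn_integral_mono)
  fix z :: "real^3"
  show "en (norm (bump z * p x - bump z *R rst D p (q z)))
   <= en d * (\<integral>\<^sup>+t. ?f z t)"
  proof (cases "norm z > 1")
   case True then show ?thesis by (simp add: bump(3))
  next
   case False
   define b where "b = a + r *R z"
   have b: "b : cball a r" using False S(3) by (simp add: b_def dist_norm mult_left_le)
   have seg: "x + t *R (b - x) = (1 - t) *R x + t *R a + (t * r) *R z" for t by (simp add: b_def algebra_simps)
   have inD: "(1 - t) *R x + t *R a + (t * r) *R z : D" if "t : {0..T}" for t using S(8)[OF x, of z t] False that T by auto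
   have "rst D p (q z) = p (x + T *R (b - x))" using inD[of T] T by (simp add: q_def seg)
   then have "en (norm (bump z * p x - bump z *R rst D p (q z))) = en (bump z) * en \<bar>p x - p (x + T *R (b - x))\<bar>"
    using bump(2)[of z] by (simp add: ennreal_mult[symmetric] abs_mult right_diff_distrib[symmetric])
   also have "... <= en (bump z) * (en d * (\<integral>\<^sup>+t. ind T t * en (norm (grad p (x + t *R (b - x))))))"
    using T by (intro mult_left_mono C1_segment_bound p d x b) auto
   also have "(\<integral>\<^sup>+t. ind T t * en (norm (grad p (x + t *R (b - x)))))
    = (\<integral>\<^sup>+t. ind T t * g ((1 - t) *R x + t *R a + (t * r) *R z))"
    by (intro nn_integral_cong) (use inD in \<open>auto simp: indicator_def g_def seg\<close>)
   also have "en (bump z) * (en d * ...) = en d * (en (bump z) * ...)" by (simp add: mult_ac)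
   also have "... = en d * (\<integral>\<^sup>+t. en (bump z) * (ind T t * g ((1 - t) *R x + t *R a + (t * r) *R z)))" by (subst nn_integral_cmult) simp_all
   finally show ?thesis by (simp add: mult_ac)
  qed
 qed
 also have "... = en d * (\<integral>\<^sup>+z. (\<integral>\<^sup>+t. ?f z t))"
  by (rule nn_integral_cmult) measurable
 also have "(\<integral>\<^sup>+z. (\<integral>\<^sup>+t. ?f z t))
  = (\<integral>\<^sup>+t. (\<integral>\<^sup>+z. ?f z t))"
  by (rule lborel_pair.Fubini'[symmetric]) measurable
 also have "... = (\<integral>\<^sup>+t. ind T t * avt a r t g x)" unfolding av_def by (intro nn_integral_cong nn_integral_cmult) measurable
 finally show ?thesis unfolding g_def .
qed

lemma av_joint_measurable[measurable]:
 assumes [measurable]: "g : BM"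
 shows "(%(t, x). avt a r t g x) : borel_measurable (borel \<Otimes>\<^sub>M borel)" unfolding av_def by measurable

text \<open>One constant for all t: up to 1/2 the dilation factor 1 - t is at least 1/2, beyond 1/2
  the averaging radius t r is at least r / 2. Cubing 1/2 produces the 8 in \<open>C\<close>.\<close>

lemma star_av_bound:
 assumes D: "star_ball D a r"
 shows "EX C>0. ALL g:BM. ALL t:{0..1}. (\<integral>\<^sup>+x. indicator D x * avt a r t g x) <= en C * (\<integral>\<^sup>+x. g x)"
proof -
 note S = star_ballD[OF D]
 obtain B where B: "B > 0" "!!x. bump x <= B" using bump_bounded by blast
 define m where "m = measure lborel D"
 have m: "emeasure lborel D = en m" "m >= 0" using S(6) by (auto simp: m_def emeasure_eq_ennreal_measure)
 define C where "C = 8 + 8 * B * m / r^3"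
 have C: "C >= 8" "C >= 8 * B * m / r^3" using B m(2) S(3) by (auto simp: C_def)
 show ?thesis
 proof (intro exI[of _ C] conjI ballI)
  fix g :: "real^3 => en" and t :: real
  assume [measurable]: "g : BM" and t: "t : {0..1}"
  have [measurable]: "D : sets borel" by (rule S(5))
  show "(\<integral>\<^sup>+x. indicator D x * avt a r t g x) <= en C * (\<integral>\<^sup>+x. g x)"
  proof (cases "t <= 1/2")
   case True
   have "(\<integral>\<^sup>+x. indicator D x * avt a r t g x) <= (\<integral>\<^sup>+x. avt a r t g x)" by (intro nn_integral_mono) (auto simp: indicator_def)
   also have "... = en (1 / \<bar>1 - t\<bar>^3) * (\<integral>\<^sup>+x. g x)" using True by (intro nn_integral_av) auto
   also have "... <= en C * (\<integral>\<^sup>+x. g x)"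
   proof (intro mult_right_mono ennreal_leI)
    have "1 / \<bar>1 - t\<bar>^3 <= 1 / (1/2)^3" using True by (intro divide_left_mono power_mono mult_pos_pos) auto
    then show "1 / \<bar>1 - t\<bar>^3 <= C" using C(1) by (simp add: power3_eq_cube)
   qed simp
   finally show ?thesis .
  next
   case False
   have tr: "t * r ~= 0" using False S(3) by simp
   have "(\<integral>\<^sup>+x. indicator D x * avt a r t g x)
    <= (\<integral>\<^sup>+x. indicator D x * (en (B / \<bar>t * r\<bar>^3) * (\<integral>\<^sup>+x. g x)))" by (intro nn_integral_mono mult_left_mono av_le tr B(2)) auto
   also have "... = en m * (en (B / \<bar>t * r\<bar>^3) * (\<integral>\<^sup>+x. g x))" by (subst nn_integral_multc) (simp_all add: m)
   also have "... = en (m * (B / \<bar>t * r\<bar>^3)) * (\<integral>\<^sup>+x. g x)" using m(2) B(1) by (subst ennreal_mult) (simp_all add: mult.assoc)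
   also have "... <= en C * (\<integral>\<^sup>+x. g x)"
   proof (intro mult_right_mono ennreal_leI)
    have "(1/2 * r)^3 <= \<bar>t * r\<bar>^3" using False S(3) by (intro power_mono) auto
    then have "m * (B / \<bar>t * r\<bar>^3) <= m * (B / (1/2 * r)^3)" using m B(1) S(3) False by (intro mult_left_mono divide_left_mono) auto
    also have "... = 8 * B * m / r^3" by (simp add: power_mult_distrib power3_eq_cube)
    finally show "m * (B / \<bar>t * r\<bar>^3) <= C" using C(2) by simp
   qed simp
   finally show ?thesis .
  qed
 qed (use C in simp)
qed

text \<open>The factor \<open>T\<close>, one half of it from Cauchy-Schwarz in t and one from the
  t-integral, drives Rellich's theorem. At T = 1 the mean over the ball around \<open>a\<close> is
  subtracted and this is Poincare's inequality.\<close>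

lemma star_estimate:
 assumes D: "star_ball D a r"
 shows "EX C>0. ALL p T. C1 p --> 0 < T --> T <= 1 -->
  sqi (rst D (%x. p x - moll a r T (rst D p) x)) &
  l2n (rst D (%x. p x - moll a r T (rst D p) x)) <= C * T * l2n (rst D (grad p))"
proof -
 note S = star_ballD[OF D]
 obtain C0 where C0: "C0 > 0" "!!g t. g : BM ==> t : {0..1} ==> (\<integral>\<^sup>+x. indicator D x * avt a r t g x) <= en C0 * (\<integral>\<^sup>+x. g x)"
  using star_av_bound[OF D] by blast
 obtain M where M: "M > 0" "!!x. x : D ==> norm x <= M" using S(2) by (metis bounded_pos)
 define d where "d = 2 * M"
 have d: "norm (b - x) <= d" if "x : D" "b : cball a r" for x b using M(2)[OF that(1)] M(2)[of b] that(2) S(4) norm_triangle_ineq4[of b x] by (auto simp: d_def)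
 have d0: "d > 0" using M by (simp add: d_def)
 define C where "C = d * sqrt C0"
 show ?thesis
 proof (intro exI[of _ C] conjI allI impI)
  show "C > 0" using d0 C0 by (simp add: C_def)
  fix p T assume p: "C1 p" and T: "0 < T" "T <= (1::real)"
  have [measurable]: "p : BM" "grad p : BM" "D : sets borel" using p S by (auto intro: C1_bm C1_grad_bm)
  define g where "g y = en (norm (rst D (grad p) y))" for y
  have [measurable]: "g : BM" unfolding g_def by measurable
  have gs: "sqi (rst D (grad p))" by (rule sqi_rst[OF C1_cont_grad[OF p] S(2,5)])
  define f where "f = rst D (%x. p x - moll a r T (rst D p) x)"
  have [measurable]: "f : BM" unfolding f_def by measurable
  define h where "h t x = avt a r t (%y. (g y)^2) x" for t x
  have hm[measurable]: "(%(t, x). h t x) : borel_measurable (borel \<Otimes>\<^sub>M borel)" unfolding h_def by measurable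
  have [measurable]: "(%t. avt a r t g x) : BM" for x unfolding av_def by measurable
  have pt: "en ((norm (f x))^2) <= en (d\<^sup>2 * T) * (\<integral>\<^sup>+t. ind T t * (indicator D x * h t x))" for x
  proof (cases "x : D")
   case True
   have "en ((norm (f x))^2) = (en \<bar>p x - moll a r T (rst D p) x\<bar>)^2" using True by (simp add: f_def ennreal_power)
   also have "... <= (en d * (\<integral>\<^sup>+t. ind T t * avt a r t g x))^2" unfolding g_def by (intro power_mono star_key[OF D p d T True]) auto
   also have "... <= (en d)^2 * (en T * (\<integral>\<^sup>+t. ind T t * (avt a r t g x)^2))"
    unfolding power_mult_distrib using T by (intro mult_left_mono nn_Cauchy_Schwarz_interval) auto
   also have "... <= (en d)^2 * (en T * (\<integral>\<^sup>+t. ind T t * (indicator D x * h t x)))"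
    unfolding h_def using True by (intro mult_left_mono nn_integral_mono) (auto intro!: mult_left_mono av_square)
   also have "... = en (d\<^sup>2 * T) * (\<integral>\<^sup>+t. ind T t * (indicator D x * h t x))" using d0 T by (simp add: ennreal_mult ennreal_power mult.assoc)
   finally show ?thesis .
  qed (simp add: f_def)
  have "(\<integral>\<^sup>+x. en ((norm (f x))^2)) <= (\<integral>\<^sup>+x. en (d\<^sup>2 * T) * (\<integral>\<^sup>+t. ind T t * (indicator D x * h t x)))"
   by (intro nn_integral_mono pt)
  also have "... = en (d\<^sup>2 * T) * (\<integral>\<^sup>+x. (\<integral>\<^sup>+t. ind T t * (indicator D x * h t x)))" by (rule nn_integral_cmult) measurable
  also have "... <= en (d\<^sup>2 * T) * (en T * (en C0 * (\<integral>\<^sup>+x. (g x)^2)))"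
  proof (rule mult_left_mono)
  have "(\<integral>\<^sup>+x. (\<integral>\<^sup>+t. ind T t * (indicator D x * h t x)))
   = (\<integral>\<^sup>+t. (\<integral>\<^sup>+x. ind T t * (indicator D x * h t x)))" by (rule lborel_pair.Fubini'[symmetric]) measurable
  also have "... <= (\<integral>\<^sup>+t. ind T t * (en C0 * (\<integral>\<^sup>+x. (g x)^2)))"
  proof (rule nn_integral_mono)
   fix t :: real
   show "(\<integral>\<^sup>+x. ind T t * (indicator D x * h t x)) <= ind T t * (en C0 * (\<integral>\<^sup>+x. (g x)^2))"
    using C0(2)[of "%y. (g y)^2" t] T by (auto simp: indicator_def h_def)
  qed
  also have "... = en T * (en C0 * (\<integral>\<^sup>+x. (g x)^2))" using T by (subst nn_integral_multc) auto
  finally show "(\<integral>\<^sup>+x. (\<integral>\<^sup>+t. ind T t * (indicator D x * h t x)))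
   <= en T * (en C0 * (\<integral>\<^sup>+x. (g x)^2))" .
  qed simp
  also have "(\<integral>\<^sup>+x. (g x)^2) = en ((l2n (rst D (grad p)))^2)" unfolding g_def nn_norm_cls[OF gs, symmetric] by (simp add: ennreal_power)
  also have "en (d\<^sup>2 * T) * (en T * (en C0 * en ((l2n (rst D (grad p)))^2)))
   = en ((C * T * l2n (rst D (grad p)))^2)" using T C0(1) by (simp add: ennreal_mult[symmetric] C_def power_mult_distrib mult_ac power2_eq_square[of T])
  finally have fin: "(\<integral>\<^sup>+x. en ((norm (f x))^2)) <= en ((C * T * l2n (rst D (grad p)))^2)" .
  have nn: "0 <= C * T * l2n (rst D (grad p))" using d0 C0 T by (simp add: C_def)
  show "sqi (rst D (%x. p x - moll a r T (rst D p) x))"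
    "l2n (rst D (%x. p x - moll a r T (rst D p) x)) <= C * T * l2n (rst D (grad p))" using norm_cls_le[OF _ fin nn] unfolding f_def[symmetric] by simp_all
 qed
qed

lemma norm_axis_real: "norm (axis i c :: real^3) = \<bar>c\<bar>"
proof -
 have "(axis i c :: real^3) = c *R axis i 1" by (simp add: axis_def vec_eq_iff)
 then show ?thesis by (simp add: norm_axis_1)
qed

text \<open>The averaging ball is placed off \<open>ball 0 R\<close>: for functions supported in
  \<open>ball 0 R\<close> the mean subtracted in \<open>star_estimate\<close> is zero, which yields
  inequalities of Poincare and Sobolev type for zero boundary values.\<close>

lemma ball_star_ball: assumes "R > 0" shows "star_ball (ball 0 (4 * R)) (axis 1 (3 * R)) (R / 2)"
proof -
 have "cball (axis 1 (3 * R)) (R / 2) <= ball (0::real^3) (4 * R)"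
 proof
  fix b :: "real^3" assume "b : cball (axis 1 (3 * R)) (R / 2)"
  then have "norm (b - axis 1 (3 * R)) <= R / 2" by (simp add: dist_norm norm_minus_commute)
  moreover have "norm (axis 1 (3 * R) :: real^3) = 3 * R" using assms by (simp add: norm_axis_real)
  ultimately show "b : ball 0 (4 * R)" using norm_triangle_sub[of b "axis 1 (3 * R)"] assms by simp
 qed
 moreover have "(1 - t) *R x + t *R b : ball 0 (4 * R)" if "x : ball 0 (4 * R)" "b : ball (0::real^3) (4 * R)" "t : {0..1}" for x b t
  using that convexD_alt[OF convex_ball, of x 0 "4 * R" b t] by simp
 ultimately show ?thesis unfolding star_ball_def using assms by (auto intro!: exI[of _ 0])
qed

lemma mollify_0_outside:
 assumes v: "!!x. x ~: ball 0 R ==> v x = 0" and R: "R > 0"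
 shows "mollify 0 (axis 1 (3 * R)) (R / 2) (v :: real^3 => 'b::euclidean_space) x = 0"
proof -
 have "bump z *R v (0 *R x + axis 1 (3 * R) + (R / 2) *R z) = 0" for z
 proof (cases "norm z > 1")
  case False
  have "norm (axis 1 (3 * R) :: real^3) = 3 * R" using R by (simp add: norm_axis_real)
  moreover have "norm ((R / 2) *R z) <= R / 2" using False R by (simp add: mult_left_le)
  ultimately have "norm (axis 1 (3 * R) + (R / 2) *R z) >= R" using norm_triangle_ineq4[of "axis 1 (3 * R) + (R / 2) *R z" "(R / 2) *R z"] R
   by (simp only: add_diff_cancel_right')
  then show ?thesis using v by simp
 qed (simp add: bump(3))
 then show ?thesis unfolding mollify_def by (simp only:) simp
qed

lemma rst_id: "(!!x. x ~: D ==> f x = 0) ==> rst D f = f" by (auto simp: indicator_def fun_eq_iff)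

lemma C1c_ball_supp:
 assumes "C1c (ball 0 R) \<phi>"
 shows "x ~: ball 0 R ==> \<phi> x = 0" "x ~: ball 0 R ==> grad \<phi> x = 0"
proof -
 obtain K where K: "K <= ball 0 R" "!!x. x ~: K ==> \<phi> x = 0" "!!x. x ~: K ==> grad \<phi> x = 0" using C1c_obtain[OF assms] by metis
 show "x ~: ball 0 R ==> \<phi> x = 0" "x ~: ball 0 R ==> grad \<phi> x = 0" using K by blast+
qed

lemma poincare_ball:
 assumes R: "R > 0"
 shows "EX C>0. \<forall>\<phi>. C1c (ball 0 R) \<phi> --> l2n \<phi> <= C * l2n (grad \<phi>)"
proof -
 let ?D = "ball (0::real^3) (4 * R)"
 obtain C where C: "C > 0" and b': "ALL p T. C1 p --> 0 < T --> T <= 1 -->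
  sqi (rst ?D (%x. p x - mollify (1 - T) (T *R axis 1 (3 * R)) (T * (R / 2)) (rst ?D p) x)) &
  l2n (rst ?D (%x. p x - mollify (1 - T) (T *R axis 1 (3 * R)) (T * (R / 2)) (rst ?D p) x)) <= C * T * l2n (rst ?D (grad p))"
  using star_estimate[OF ball_star_ball[OF R]] by auto
 have b: "l2n (rst ?D (%x. p x - mollify 0 (axis 1 (3 * R)) (R / 2) (rst ?D p) x)) <= C * l2n (rst ?D (grad p))"
  if "C1 p" for p using b'[rule_format, OF that, of 1] by simp
 show ?thesis
 proof (intro exI[of _ C] conjI allI impI C)
  fix \<phi> assume p: "C1c (ball 0 R) \<phi>"
  note s = C1c_ball_supp[OF p]
  have "rst ?D \<phi> = \<phi>" "rst ?D (grad \<phi>) = grad \<phi>" using s R by (intro rst_id; force)+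
  with b[OF C1c_C1[OF p]] mollify_0_outside[of R \<phi>] s R
  show "l2n \<phi> <= C * l2n (grad \<phi>)" by simp
 qed
qed

text \<open>For fixed \<open>T\<close> the value of the averaged function at x is an inner product
  with a translate of one fixed kernel, so along a weakly convergent subsequence the averages
  converge pointwise and boundedly, hence in L2 of \<open>D\<close>. The functions themselves differ
  from their averages by at most \<open>C * T * M\<close>, uniformly in n.\<close>

lemma star_rellich:
 fixes p :: "nat => real^3 => real"
 assumes D: "star_ball D a r" and p: "!!n. C1 (p n)"
  and b: "!!n. l2n (rst D (p n)) <= M" "!!n. l2n (rst D (grad (p n))) <= M"
 shows "EX s. strict_mono s & convergent (%n. cls (rst D (p (s n))))"
proof -
 note S = star_ballD[OF D]
 obtain C where C: "C > 0" and est: "!!p T. C1 p ==> 0 < T ==> T <= 1 ==>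
  sqi (rst D (%x. p x - moll a r T (rst D p) x)) &
  l2n (rst D (%x. p x - moll a r T (rst D p) x)) <= C * T * l2n (rst D (grad p))" using star_estimate[OF D] by blast
 have ps: "sqi (rst D (p n))" for n by (rule sqi_rst[OF C1_cont[OF p] S(2,5)])
 have M0: "M >= 0" using b(1)[of 0] norm_ge_zero order_trans by blast
 obtain s u where s: "strict_mono s" and u: "!!y. (%n. inner (cls (rst D (p (s n)))) y) ---> inner u y"
  using weakly_convergent_subseq[of "%n. cls (rst D (p n))", OF b(1)] by blast
 have conv: "convergent (%n. cls (rst D (moll a r T (rst D (p (s n))))))" and
  convs: "sqi (rst D (moll a r T (rst D (p (s n)))))" if T: "0 < T" "T <= 1" for T n
 proof -
  have d: "T * r ~= 0" using T S(3) by simp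
  define k where "k x = (%y. kern (T * r) ((1 - T) *R x + T *R a - y))" for x
  have kc: "C1c UNIV (k x)" for x unfolding k_def by (rule kern_reflected_C1c[OF d]) simp
  have ks: "sqi (k x)" for x by (rule C1c_sqi(1)[OF kc])
  have eq: "moll a r T (rst D (p n)) x = inner (cls (rst D (p n))) (cls (k x))" for n x
   unfolding inner_cls[OF ps ks] mollify_eq_convol[OF d] convol_def by (simp add: k_def mult_ac)
  have nk: "l2n (k x) = l2n (k 0)" for x
  proof -
   have e: "k x y = k 0 (y - (1 - T) *R x)" for y by (simp add: k_def algebra_simps)
   have "(l2n (k x))^2 = (\<integral>y. (norm (k 0 (y + - ((1 - T) *R x))))^2)" unfolding norm_cls[OF ks] by (simp add: e)
   also have "... = (l2n (k 0))^2" unfolding norm_cls[OF ks] by (rule integral_shift)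
   finally show ?thesis by simp
  qed
  have bound: "\<bar>moll a r T (rst D (p n)) x\<bar> <= M * l2n (k 0)" for n x
  proof -
   have "\<bar>inner (cls (rst D (p n))) (cls (k x))\<bar> <= l2n (rst D (p n)) * l2n (k x)" by (rule Cauchy_Schwarz_ineq2)
   also have "... <= M * l2n (k x)" by (rule mult_right_mono[OF b(1) norm_ge_zero])
   finally show ?thesis unfolding eq nk[of x] .
  qed
  have [measurable]: "D : sets borel" "!!n. p n : BM" using S(5) p by (auto intro: C1_bm)
  define L where "L x = lim (%n. moll a r T (rst D (p (s n))) x)" for x
  have lim: "(%n. moll a r T (rst D (p (s n))) x) ---> L x" for x
  proof -
   have "convergent (%n. moll a r T (rst D (p (s n))) x)" unfolding eq using u by (rule convergentI)
   then show ?thesis unfolding L_def convergent_LIMSEQ_iff .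
  qed
  have [measurable]: "L : BM" unfolding L_def by measurable
  have dom: "sqi (%x. (M * l2n (k 0)) *R (indicator D x :: real))" by (intro sqi_scaleR sqi_indicator_set S)
  note dc = l2_dominated_convergence[OF _ _ dom, of "%n. rst D (moll a r T (rst D (p (s n))))" "rst D L"]
  have "(%n. cls (rst D (moll a r T (rst D (p (s n)))))) ---> cls (rst D L)"
   and "sqi (rst D (moll a r T (rst D (p (s n)))))"
  proof -
   have 1: "(%x. indicator D x *R moll a r T (rst D (p (s n))) x) : BM" for n by measurable
   have 2: "(%x. indicator D x *R L x) : BM" by measurable
   have 3: "AE x. (%n. indicator D x *R moll a r T (rst D (p (s n))) x) ---> indicator D x *R L x" by (intro AE_I2 tendsto_scaleR tendsto_const lim)
   have 4: "AE x. norm (indicator D x *R moll a r T (rst D (p (s n))) x)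
     <= norm ((M * l2n (k 0)) *R (indicator D x :: real))" for n using order_trans[OF bound abs_ge_self] by (intro AE_I2) (simp add: indicator_def)
   show "(%n. cls (rst D (moll a r T (rst D (p (s n)))))) ---> cls (rst D L)" by (rule dc(3)[OF 1 2 3 4])
   show "sqi (rst D (moll a r T (rst D (p (s n)))))" by (rule dc(2)[OF 1 2 3 4])
  qed
  then show "convergent (%n. cls (rst D (moll a r T (rst D (p (s n))))))"
   "sqi (rst D (moll a r T (rst D (p (s n)))))" by (auto intro: convergentI)
 qed
 have "Cauchy (%n. cls (rst D (p (s n))))"
 proof (rule metric_CauchyI)
  fix e :: real assume e: "e > 0"
  define T where "T = min 1 (e / (4 * C * (M + 1)))"
  have T: "0 < T" "T <= 1" using e C M0 by (auto simp: T_def)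
  have "C * T * M <= C * (e / (4 * C * (M + 1))) * M" using C M0 by (intro mult_right_mono mult_left_mono) (auto simp: T_def)
  also have "... = e / 4 * (M / (M + 1))" using C by simp
  also have "... <= e / 4 * 1" using e M0 by (intro mult_left_mono) auto
  finally have CT: "C * T * M <= e / 4" by simp
  define q where "q n = cls (rst D (moll a r T (rst D (p (s n)))))" for n
  have pq: "norm (cls (rst D (p (s n))) - q n) <= e / 4" for n
  proof -
   have "cls (rst D (p (s n))) - q n = cls (rst D (%x. p (s n) x - moll a r T (rst D (p (s n))) x))"
    unfolding q_def cls_diff[OF ps convs[OF T]] by (simp add: right_diff_distrib)
   then have "norm (cls (rst D (p (s n))) - q n) <= C * T * l2n (rst D (grad (p (s n))))" using est[OF p T] by simp
   also have "... <= C * T * M" using C T b(2) by (intro mult_left_mono) auto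
   finally show ?thesis using CT by simp
  qed
  have "Cauchy q" using conv[OF T] unfolding q_def by (rule convergent_Cauchy)
  then obtain N where N: "!!m n. m >= N ==> n >= N ==> norm (q m - q n) < e / 4" using e unfolding Cauchy_iff by (meson divide_pos_pos zero_less_numeral)
  show "EX N. ALL m>=N. ALL n>=N. dist (cls (rst D (p (s m)))) (cls (rst D (p (s n)))) < e"
  proof (intro exI[of _ N] allI impI)
   fix m n assume mn: "m >= N" "n >= N"
   have "norm (cls (rst D (p (s m))) - cls (rst D (p (s n)))) <= norm (cls (rst D (p (s m))) - q m) + norm (q m - q n) + norm (q n - cls (rst D (p (s n))))"
    using norm_triangle_ineq[of "cls (rst D (p (s m))) - q m" "q m - cls (rst D (p (s n)))"]
     norm_triangle_ineq[of "q m - q n" "q n - cls (rst D (p (s n)))"] by simp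
   also have "... < e" using pq[of m] pq[of n] N[OF mn] e by (simp add: norm_minus_commute)
   finally show "dist (cls (rst D (p (s m)))) (cls (rst D (p (s n)))) < e" by (simp add: dist_norm)
  qed
 qed
 then have "convergent (%n. cls (rst D (p (s n))))" by (rule l2_Cauchy_convergent)
 with s show ?thesis by blast
qed

lemma rellich_ball:
 fixes p :: "nat => real^3 => real"
 assumes R: "R > 0" and p: "!!n. C1c (ball 0 R) (p n)" and b: "!!n. l2n (grad (p n)) <= M"
 shows "EX s. strict_mono s & convergent (%n. cls (p (s n)))"
proof -
 let ?D = "ball (0::real^3) (4 * R)"
 obtain C where C: "C > 0" "!!\<phi>. C1c (ball 0 R) \<phi> ==> l2n \<phi> <= C * l2n (grad \<phi>)" using poincare_ball[OF R] by blast
 have r: "rst ?D (p n) = p n" "rst ?D (grad (p n)) = grad (p n)" for n using C1c_ball_supp[OF p[of n]] R by (intro rst_id; force)+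
 have 1: "l2n (p n) <= max M (C * M)" for n using order_trans[OF C(2)[OF p[of n]] mult_left_mono[OF b[of n], of C]] C(1) by (simp add: le_max_iff_disj)
 have 2: "l2n (grad (p n)) <= max M (C * M)" for n using b[of n] by (simp add: le_max_iff_disj)
 show ?thesis using star_rellich[OF ball_star_ball[OF R] C1c_C1[OF p], where M = "max M (C * M)", unfolded r, OF 1 2] .
qed

section \<open>Sobolev inequalities with a weight and on level sets\<close>

lemma nn_integral_powr_01:
 assumes "s > -1" shows "(\<integral>\<^sup>+t. ind 1 t * en (t powr s)) = en (1 / (s + 1))"
proof -
 have "((%t. t powr s) has_integral (1 / (s + 1))) {0..1}" using has_integral_powr_from_0[OF assms, of 1] by simp
 from nn_integral_has_integral_lebesgue[OF _ this]
 have "(\<integral>\<^sup>+x. en (indicat_real {0..1} x * x powr s)) = en (1 / (s + 1))" by simp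
 moreover have "(\<integral>\<^sup>+t. ind 1 t * en (t powr s)) = (\<integral>\<^sup>+x. en (indicat_real {0..1} x * x powr s))"
  by (intro nn_integral_cong) (auto simp: indicator_def)
 ultimately show ?thesis by simp
qed

text \<open>A pointwise stand-in for Hoelder's inequality: integrating it and then choosing
  \<open>l\<close> gives the Hoelder exponents.\<close>

lemma square_le_powr_split:
 fixes s l q :: real
 assumes "s >= 0" "l > 0" "q > 2"
 shows "s\<^sup>2 <= l\<^sup>2 + l powr (2 - q) * s powr q"
proof (cases "s <= l")
 case True
 then have "s\<^sup>2 <= l\<^sup>2" using assms by (intro power_mono) auto
 moreover have "0 <= l powr (2 - q) * s powr q" by simp
 ultimately show ?thesis by linarith
next
 case False
 then have "s > 0" using assms by simp
 then have "s\<^sup>2 = s powr (2 - q) * s powr q" by (simp add: powr_add[symmetric])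
 also have "... <= l powr (2 - q) * s powr q" using False assms by (intro mult_right_mono powr_mono2') auto
 finally show ?thesis by (simp add: add_increasing)
qed

text \<open>The adjoint of averaging after a dilation is averaging after the inverse dilation. It
  moves the average from the gradient to the weight.\<close>

lemma av_dual:
 assumes [measurable]: "m : BM" "G : BM" and t: "t < 1"
 shows "(\<integral>\<^sup>+x. m x * av (1 - t) a d G x)
  = en (1 / \<bar>1 - t\<bar>^3) * (\<integral>\<^sup>+y. G y * av (1 / (1 - t)) (- (1 / (1 - t)) *R a) (- (1 / (1 - t)) * d) m y)"
proof -
 define c where "c = 1 - t"
 have c: "c ~= 0" using t by (simp add: c_def)
 have "(\<integral>\<^sup>+x. m x * av c a d G x) = (\<integral>\<^sup>+x. \<integral>\<^sup>+z. m x * (en (bump z) * G (c *R x + a + d *R z)))"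
  unfolding av_def by (intro nn_integral_cong nn_integral_cmult[symmetric]) measurable
 also have "... = (\<integral>\<^sup>+z. \<integral>\<^sup>+x. m x * (en (bump z) * G (c *R x + a + d *R z)))" by (rule lborel_pair.Fubini') measurable
 also have "... = (\<integral>\<^sup>+z. en (1 / \<bar>c\<bar>^3) * (\<integral>\<^sup>+y. m ((1 / c) *R y + (- (1 / c)) *R a + (- (1 / c) * d) *R z) * (en (bump z) * G y)))"
 proof (rule nn_integral_cong)
  fix z
  define F where "F y = m ((1 / c) *R y + (- (1 / c)) *R a + (- (1 / c) * d) *R z) * (en (bump z) * G y)" for y
  have Fm: "F : BM" unfolding F_def by measurable
  have "m x * (en (bump z) * G (c *R x + a + d *R z)) = F ((a + d *R z) + c *R x)" for x using c by (simp add: F_def algebra_simps)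
  then show "(\<integral>\<^sup>+x. m x * (en (bump z) * G (c *R x + a + d *R z))) = en (1 / \<bar>c\<bar>^3) * (\<integral>\<^sup>+y. F y)"
   by (simp only: nn_integral_affine[OF Fm c])
 qed
 also have "... = en (1 / \<bar>c\<bar>^3) * (\<integral>\<^sup>+z. (\<integral>\<^sup>+y. m ((1 / c) *R y + (- (1 / c)) *R a + (- (1 / c) * d) *R z) * (en (bump z) * G y)))"
  by (rule nn_integral_cmult) measurable
 also have "(\<integral>\<^sup>+z. (\<integral>\<^sup>+y. m ((1 / c) *R y + (- (1 / c)) *R a + (- (1 / c) * d) *R z) * (en (bump z) * G y)))
  = (\<integral>\<^sup>+y. (\<integral>\<^sup>+z. m ((1 / c) *R y + (- (1 / c)) *R a + (- (1 / c) * d) *R z) * (en (bump z) * G y)))"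
  by (rule lborel_pair.Fubini') measurable
 also have "... = (\<integral>\<^sup>+y. G y * av (1 / c) (- (1 / c) *R a) (- (1 / c) * d) m y)"
  unfolding av_def by (intro nn_integral_cong) (subst nn_integral_cmult[symmetric], measurable, simp add: mult_ac)
 finally show ?thesis by (simp add: c_def)
qed

lemma sobolev_pointwise:
 assumes R: "R > 0" and v: "C1c (ball 0 R) v"
 shows "x : ball 0 (4 * R) ==> en \<bar>v x\<bar> <= en (8 * R) * (\<integral>\<^sup>+t. ind 1 t * av (1 - t) (t *R axis 1 (3 * R)) (t * (R / 2)) (%y. en (norm (grad v y))) x)"
proof -
 let ?D = "ball (0::real^3) (4 * R)"
 note S = star_ballD[OF ball_star_ball[OF R]]
 assume x: "x : ?D"
 have d: "norm (b - x) <= 8 * R" if "x : ?D" "b : cball (axis 1 (3 * R)) (R / 2)" for x b using S(4) that norm_triangle_ineq4[of b x] by force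
 have r: "rst ?D v = v" "rst ?D (grad v) = grad v" using C1c_ball_supp[OF v] R by (intro rst_id; force)+
 have r': "indicator ?D y *R grad v y = grad v y" for y using fun_cong[OF r(2)] .
 from star_key[OF ball_star_ball[OF R] C1c_C1[OF v] d zero_less_one order_refl x, unfolded r r']
  mollify_0_outside[of R v, OF C1c_ball_supp(1)[OF v] R]
 show ?thesis by simp
qed

text \<open>This makes the product of E0 with an H^1_0 function an L2 field. The condition q > 3
  enters as k = 3 / q < 1: means of f^2 over balls of radius t r grow at most like t^(-2k), and
  Cauchy-Schwarz with weights t^(-k/2) and t^(k/2) leaves the integrable power t^(-k).\<close>

lemma sobolev_weighted:
 assumes R: "R > 0" and q: "q > 3" and f: "sqi (f :: real^3 => real)" and fq: "(\<integral>\<^sup>+x. en (\<bar>f x\<bar> powr q)) < \<infinity>"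
 shows "EX C>0. ALL v. C1c (ball 0 R) v --> sqi (%x. v x *R f x) & l2n (%x. v x *R f x) <= C * l2n (grad v)"
proof -
 have [measurable]: "f : BM" using f by (rule sqi_bm)
 obtain Q where Q: "(\<integral>\<^sup>+x. en (\<bar>f x\<bar> powr q)) = en Q" "Q >= 0" using fq by (cases "\<integral>\<^sup>+x. en (\<bar>f x\<bar> powr q)") auto
 obtain B where B: "B > 0" "!!x. bump x <= B" using bump_bounded by blast
 define r where "r = R / 2"
 have r: "r > 0" using R by (simp add: r_def)
 define a :: "real^3" where "a = axis 1 (3 * R)"
 define k where "k = 3 / q"
 have k: "0 < k" "k < 1" using q by (auto simp: k_def)
 define m where "m x = en ((f x)^2)" for x
 have [measurable]: "m : BM" unfolding m_def by measurable
 have mint: "(\<integral>\<^sup>+x. m x) = en ((l2n f)^2)" using nn_norm_cls[OF f] by (simp add: m_def)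
 define K1 where "K1 = 1 + B * Q / r^3"
 define K2 where "K2 = B / r^3 * (l2n f)^2"
 define K where "K = 8 * (K1 + K2)"
 have K12: "K1 >= 1" "K2 >= 0" using B Q r by (auto simp: K1_def K2_def)
 have avm: "av l a' d m y <= en (t powr (- 2 * k) * K1)" if t: "0 < t" and d: "\<bar>d\<bar> >= t * r" for l a' d y t
 proof -
  \<comment> \<open>The threshold that balances the two terms of
    \<open>square_le_powr_split\<close>: since k q = 3, both become multiples of t^(-2k).\<close>
  define lam where "lam = t powr (- k)"
  have lam: "lam > 0" using t by (simp add: lam_def)
  have tr: "t * r > 0" using t r by simp
  have "av l a' d m y <= av l a' d (%y. en (lam\<^sup>2) + en (lam powr (2 - q)) * en (\<bar>f y\<bar> powr q)) y" unfolding av_def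
  proof (intro nn_integral_mono mult_left_mono)
   fix z
   let ?u = "l *R y + a' + d *R z"
   have "(f ?u)^2 <= lam\<^sup>2 + lam powr (2 - q) * \<bar>f ?u\<bar> powr q" using square_le_powr_split[of "\<bar>f ?u\<bar>" lam q] lam q by simp
   then show "m ?u <= en (lam\<^sup>2) + en (lam powr (2 - q)) * en (\<bar>f ?u\<bar> powr q)"
    by (simp add: m_def ennreal_plus[symmetric] ennreal_mult[symmetric] del: ennreal_plus)
  qed simp
  also have "... = en (lam\<^sup>2) + en (lam powr (2 - q)) * av l a' d (%y. en (\<bar>f y\<bar> powr q)) y"
  proof -
   have "av l a' d (%y. en (lam\<^sup>2) + en (lam powr (2 - q)) * en (\<bar>f y\<bar> powr q)) y
    = (\<integral>\<^sup>+z. en (lam\<^sup>2) * en (bump z) + en (lam powr (2 - q)) * (en (bump z) * en (\<bar>f (l *R y + a' + d *R z)\<bar> powr q)))"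
    unfolding av_def by (simp add: distrib_left mult_ac)
   also have "... = (\<integral>\<^sup>+z. en (lam\<^sup>2) * en (bump z)) + (\<integral>\<^sup>+z. en (lam powr (2 - q)) * (en (bump z) * en (\<bar>f (l *R y + a' + d *R z)\<bar> powr q)))"
    by (rule nn_integral_add) measurable
   also have "... = en (lam\<^sup>2) + en (lam powr (2 - q)) * av l a' d (%y. en (\<bar>f y\<bar> powr q)) y" by (simp add: nn_integral_cmult nn_integral_bump av_def)
   finally show ?thesis .
  qed
  also have "... <= en (lam\<^sup>2) + en (lam powr (2 - q)) * (en (B / \<bar>d\<bar>^3) * en Q)"
   using av_le[of "%y. en (\<bar>f y\<bar> powr q)" d B] B(2) d tr Q(1) by (intro add_left_mono mult_left_mono) auto
  also have "... = en (lam\<^sup>2 + lam powr (2 - q) * (B / \<bar>d\<bar>^3 * Q))"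
  proof -
   have "en (lam powr (2 - q)) * (en (B / \<bar>d\<bar>^3) * en Q) = en (lam powr (2 - q) * (B / \<bar>d\<bar>^3 * Q))"
    using B(1) Q(2) by (subst ennreal_mult[symmetric]; (subst ennreal_mult[symmetric])?; simp)
   then show ?thesis using B(1) Q(2) by (simp only:) (simp add: ennreal_plus)
  qed
  also have "... <= en (t powr (- 2 * k) * K1)"
  proof (rule ennreal_leI)
   have "B / \<bar>d\<bar>^3 * Q <= B / (t * r)^3 * Q" using B Q tr d by (intro mult_right_mono divide_left_mono power_mono) auto
   then have "lam\<^sup>2 + lam powr (2 - q) * (B / \<bar>d\<bar>^3 * Q) <= lam\<^sup>2 + lam powr (2 - q) * (B / (t * r)^3 * Q)"
    by (intro add_left_mono mult_left_mono) auto
   also have "... = t powr (- 2 * k) * K1"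
   proof -
   have l2: "lam\<^sup>2 = t powr (- 2 * k)" by (simp add: lam_def power2_eq_square powr_add[symmetric])
   have "lam powr (2 - q) * (B / (t * r)^3 * Q) = (lam powr (2 - q) * t powr (-3)) * (B * Q / r^3)"
    using t r by (simp add: power_mult_distrib powr_minus powr_numeral field_simps)
   also have "lam powr (2 - q) * t powr (-3) = t powr (- 2 * k)"
   proof -
    have "- k * (2 - q) + (-3) = - 2 * k" using q by (simp add: k_def field_simps)
    then show ?thesis by (simp add: lam_def powr_powr powr_add[symmetric])
   qed
   finally show ?thesis unfolding l2 by (simp add: K1_def distrib_left)
   qed
   finally show "lam\<^sup>2 + lam powr (2 - q) * (B / \<bar>d\<bar>^3 * Q) <= t powr (- 2 * k) * K1" .
  qed
  finally show ?thesis .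
 qed
 \<comment> \<open>For small t the average is shifted to the weight by \<open>av_dual\<close> and
   bounded by \<open>avm\<close>; for t above 1/2 the kernel is bounded outright.\<close>
 have main: "(\<integral>\<^sup>+x. m x * avt a r t G x) <= en (K * t powr (- 2 * k)) * (\<integral>\<^sup>+y. G y)"
  if [measurable]: "G : BM" and t: "0 < t" "t <= 1" for G t
 proof (cases "t <= 1/2")
  case True
  have "(\<integral>\<^sup>+x. m x * avt a r t G x)
   = en (1 / \<bar>1 - t\<bar>^3) * (\<integral>\<^sup>+y. G y * av (1 / (1 - t)) (- (1 / (1 - t)) *R (t *R a)) (- (1 / (1 - t)) * (t * r)) m y)"
   by (rule av_dual) (use True in auto)
  also have "... <= en 8 * (\<integral>\<^sup>+y. G y * en (t powr (- 2 * k) * K1))"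
  proof (intro mult_mono nn_integral_mono mult_left_mono avm t ennreal_leI)
   have "1 / \<bar>1 - t\<bar>^3 <= 1 / (1/2)^3" using True by (intro divide_left_mono power_mono mult_pos_pos) auto
   then show "1 / \<bar>1 - t\<bar>^3 <= 8" by (simp add: power3_eq_cube)
   have "1 / (1 - t) >= 1" using True t by simp
   then have "1 / (1 - t) * (t * r) >= 1 * (t * r)" using t r by (intro mult_right_mono) auto
   moreover have "\<bar>- (1 / (1 - t)) * (t * r)\<bar> = 1 / (1 - t) * (t * r)" using True t r by (simp add: abs_mult)
   ultimately show "t * r <= \<bar>- (1 / (1 - t)) * (t * r)\<bar>" by simp
  qed auto
  also have "... = en (8 * (t powr (- 2 * k) * K1)) * (\<integral>\<^sup>+y. G y)" using K12 by (subst nn_integral_multc) (simp_all add: ennreal_mult mult_ac)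
  also have "... <= en (K * t powr (- 2 * k)) * (\<integral>\<^sup>+y. G y)" using K12 by (intro mult_right_mono ennreal_leI) (auto simp: K_def algebra_simps)
  finally show ?thesis .
 next
  case False
  have tr: "t * r ~= 0" using t r by simp
  have "(\<integral>\<^sup>+x. m x * avt a r t G x) <= (\<integral>\<^sup>+x. m x * (en (B / \<bar>t * r\<bar>^3) * (\<integral>\<^sup>+y. G y)))"
   by (intro nn_integral_mono mult_left_mono av_le tr B(2)) auto
  also have "... = en ((l2n f)^2) * (en (B / \<bar>t * r\<bar>^3) * (\<integral>\<^sup>+y. G y))" by (subst nn_integral_multc) (simp_all add: mint)
  also have "... = en ((l2n f)^2 * (B / \<bar>t * r\<bar>^3)) * (\<integral>\<^sup>+y. G y)" using B(1) by (subst ennreal_mult) (simp_all add: mult.assoc)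
  also have "... <= en (K * t powr (- 2 * k)) * (\<integral>\<^sup>+y. G y)"
  proof (intro mult_right_mono ennreal_leI)
   have "(1/2 * r)^3 <= \<bar>t * r\<bar>^3" using False r by (intro power_mono) auto
   then have "(l2n f)^2 * (B / \<bar>t * r\<bar>^3) <= (l2n f)^2 * (B / (1/2 * r)^3)" using B(1) r t by (intro mult_left_mono divide_left_mono) auto
   also have "... = 8 * K2" by (simp add: K2_def power_mult_distrib power3_eq_cube)
   also have "... <= K" using K12 by (simp add: K_def)
   also have "... <= K * t powr (- 2 * k)"
   proof -
    have "1 powr (- 2 * k) <= t powr (- 2 * k)" using t k by (intro powr_mono2') auto
    moreover have "K >= 0" using K12 by (simp add: K_def)
    ultimately show ?thesis using mult_left_mono[of 1 "t powr (- 2 * k)" K] by simp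
   qed
   finally show "(l2n f)^2 * (B / \<bar>t * r\<bar>^3) <= K * t powr (- 2 * k)" .
  qed simp
  finally show ?thesis .
 qed
 define I where "I = 1 / (1 - k)"
 have I: "I > 0" using k by (simp add: I_def)
 have Iint: "(\<integral>\<^sup>+t. ind 1 t * en (t powr (- k))) = en I" using nn_integral_powr_01[of "- k"] k by (simp add: I_def)
 define C where "C = 8 * R * I * sqrt K"
 have K0: "K > 0" using K12 by (simp add: K_def)
 show ?thesis
 proof (intro exI[of _ C] conjI allI impI)
  show "C > 0" using R I K0 by (simp add: C_def)
  fix v assume v: "C1c (ball 0 R) v"
  have [measurable]: "v : BM" "grad v : BM" using C1c_C1[OF v] by (auto intro: C1_bm C1_grad_bm)
  define g where "g y = en (norm (grad v y))" for y
  have [measurable]: "g : BM" unfolding g_def by measurable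
  define h where "h t x = avt a r t (%y. (g y)^2) x" for t x
  let ?u = "%t x. ind 1 t * en (t powr (k / 2)) * avt a r t g x" and ?q = "%t x. ind 1 t * en (t powr k) * (m x * h t x)" and ?w = "%t x. ind 1 t * en (t powr k) * h t x" and ?v = "%t. ind 1 t * en (t powr (- k / 2))" and ?n = "en ((l2n (grad v))^2)" and ?A = "%t x. avt a r t g x"
  have hm[measurable]: "(%(t, x). h t x) : borel_measurable (borel \<Otimes>\<^sub>M borel)" unfolding h_def by measurable
  have [measurable]: "(%t. ?A t x) : BM" for x unfolding av_def by measurable
  have pt: "en ((norm (v x *R f x))^2) <= en ((8 * R)^2 * I) * (\<integral>\<^sup>+t. ?q t x)" for x
  proof (cases "x : ball 0 (4 * R)")
   case True
   have sp: "ind 1 t * ?A t x <=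
    (?v t) * (?u t x)" if "t ~= 0" for t
   proof (cases "t : {0..1}")
    case True
    have "en (t powr (- k / 2)) * en (t powr (k / 2)) = 1" using True that by (simp add: ennreal_mult[symmetric] powr_add[symmetric])
    then show ?thesis using True by (simp add: mult.assoc[symmetric])
   qed simp
   have "(\<integral>\<^sup>+t. ind 1 t * ?A t x)
    <= (\<integral>\<^sup>+t. (?v t) * (?u t x))"
    by (intro nn_integral_mono_AE eventually_mono[OF AE_lborel_singleton[of 0]]) (use sp in blast)
   then have "(\<integral>\<^sup>+t. ind 1 t * ?A t x)^2
    <= (\<integral>\<^sup>+t. (?v t) * (?u t x))^2" by (intro power_mono) auto
   also have "... <= (\<integral>\<^sup>+t. (?v t)^2) * (\<integral>\<^sup>+t. (?u t x)^2)"
    by (rule Cauchy_Schwarz_nn_integral) measurable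
   also have "(\<integral>\<^sup>+t. (?v t)^2) = en I" unfolding Iint[symmetric]
    by (intro nn_integral_cong) (auto simp: indicator_def ennreal_power power2_eq_square powr_add[symmetric] ennreal_mult[symmetric])
   also have "en I * (\<integral>\<^sup>+t. (?u t x)^2)
    <= en I * (\<integral>\<^sup>+t. ?w t x)"
   proof (intro mult_left_mono nn_integral_mono)
    fix t :: real
    have "(en (t powr (k / 2)))^2 = en (t powr k)" by (simp add: power2_eq_square powr_add[symmetric] ennreal_mult[symmetric])
    then show "(?u t x)^2 <= ?w t x"
     unfolding h_def by (auto simp: indicator_def power_mult_distrib intro!: mult_left_mono av_square)
   qed simp
   finally have cs: "(\<integral>\<^sup>+t. ind 1 t * ?A t x)^2
    <= en I * (\<integral>\<^sup>+t. ?w t x)" .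
   have "en ((norm (v x *R f x))^2) = m x * (en \<bar>v x\<bar>)^2" by (simp add: m_def ennreal_power ennreal_mult[symmetric] power_mult_distrib mult.commute)
   also have "... <= m x * (en (8 * R) * (\<integral>\<^sup>+t. ind 1 t * ?A t x))^2"
    unfolding g_def a_def r_def by (intro mult_left_mono power_mono sobolev_pointwise[OF R v True]) auto
   also have "... <= m x * ((en (8 * R))^2 * (en I * (\<integral>\<^sup>+t. ?w t x)))"
    unfolding power_mult_distrib by (intro mult_left_mono cs) auto
   also have "... = en ((8 * R)^2 * I) * (m x * (\<integral>\<^sup>+t. ?w t x))"
    using R I by (simp add: ennreal_mult ennreal_power[symmetric] mult_ac)
   also have "m x * (\<integral>\<^sup>+t. ?w t x) = (\<integral>\<^sup>+t. ?q t x)"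
    by (subst nn_integral_cmult[symmetric]) (auto simp: mult_ac)
   finally show ?thesis .
  next
   case False
   then have "v x = 0" using C1c_ball_supp(1)[OF v] R by auto
   then show ?thesis by simp
  qed
  have gs: "sqi (grad v)" by (rule C1c_sqi(2)[OF v])
  have "(\<integral>\<^sup>+x. en ((norm (v x *R f x))^2))
   <= (\<integral>\<^sup>+x. en ((8 * R)^2 * I) * (\<integral>\<^sup>+t. ?q t x))" by (intro nn_integral_mono pt)
  also have "... = en ((8 * R)^2 * I) * (\<integral>\<^sup>+x. (\<integral>\<^sup>+t. ?q t x))" by (rule nn_integral_cmult) measurable
  also have "... <= en ((8 * R)^2 * I) * (en (K * I) * ?n)"
  proof (rule mult_left_mono)
   have "(\<integral>\<^sup>+x. (\<integral>\<^sup>+t. ?q t x))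
    = (\<integral>\<^sup>+t. (\<integral>\<^sup>+x. ?q t x))" by (rule lborel_pair.Fubini'[symmetric]) measurable
   also have "... <= (\<integral>\<^sup>+t. en K * (ind 1 t * en (t powr (- k))) * ?n)"
   proof (intro nn_integral_mono_AE eventually_mono[OF AE_lborel_singleton[of 0]])
    fix t :: real assume t0: "t ~= 0"
    have gn: "(\<integral>\<^sup>+y. (g y)^2) = ?n" unfolding g_def nn_norm_cls[OF gs, symmetric] by (simp add: ennreal_power)
    show "(\<integral>\<^sup>+x. ?q t x)
     <= en K * (ind 1 t * en (t powr (- k))) * ?n"
    proof (cases "t : {0..1}")
     case True
     have "(\<integral>\<^sup>+x. ?q t x) = en (t powr k) * (\<integral>\<^sup>+x. m x * h t x)"
      using True by (subst nn_integral_cmult[symmetric]) auto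
     also have "... <= en (t powr k) * (en (K * t powr (- 2 * k)) * ?n)"
      using main[of "%y. (g y)^2" t] True t0 unfolding h_def gn by (intro mult_left_mono) auto
     also have "... = en (K * (t powr k * t powr (- 2 * k))) * ?n" using K0 by (simp add: ennreal_mult mult_ac)
     also have "t powr k * t powr (- 2 * k) = t powr (- k)" by (simp add: powr_add[symmetric])
     finally show ?thesis using True K0 by (simp add: ennreal_mult)
    qed simp
   qed
   also have "... = en K * en I * ?n" by (simp add: nn_integral_multc nn_integral_cmult Iint)
   finally show "(\<integral>\<^sup>+x. (\<integral>\<^sup>+t. ?q t x))
    <= en (K * I) * ?n" using K0 I by (simp add: ennreal_mult)
  qed simp
  also have "... = en ((C * l2n (grad v))^2)" using R I K0 by (simp add: ennreal_mult[symmetric] C_def power_mult_distrib mult_ac power2_eq_square[of I])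
  finally have fin: "(\<integral>\<^sup>+x. en ((norm (v x *R f x))^2)) <= en ((C * l2n (grad v))^2)" .
  have nn: "0 <= C * l2n (grad v)" using \<open>C > 0\<close> by simp
  show "sqi (%x. v x *R f x)" "l2n (%x. v x *R f x) <= C * l2n (grad v)" by (rule norm_cls_le[OF _ fin nn]; measurable)+
 qed
qed

text \<open>The embedding of W^{1,1} into L^{3/2} would give the exponent 1/3. Any smaller \<theta>
  follows by interpolating geometrically between the bounds \<open>C1\<close> and \<open>w\<close>,
  the latter of order t^(-3) times the measure of \<open>A\<close>, because t^(-3\<theta>) is then
  integrable at 0. Stampacchia's iteration only needs some \<theta> above 1 / q.\<close>

lemma sobolev_level:
 assumes R: "R > 0" and th: "0 < \<theta>" "\<theta> < 1/3"
 shows "EX C>0. ALL v A. C1c (ball 0 R) v --> A : sets borel --> A <= ball 0 R -->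
  (\<integral>\<^sup>+x. indicator A x * en \<bar>v x\<bar>) <= en (C * measure lborel A powr \<theta>) * (\<integral>\<^sup>+x. en (norm (grad v x)))"
proof -
 let ?D = "ball (0::real^3) (4 * R)"
 define a :: "real^3" where "a = axis 1 (3 * R)"
 define r where "r = R / 2"
 have r: "r > 0" using R by (simp add: r_def)
 obtain B where B: "B > 0" "!!x. bump x <= B" using bump_bounded by blast
 obtain C1 where C1: "C1 > 0" "!!g t. g : BM ==> t : {0..1} ==>
  (\<integral>\<^sup>+x. indicator ?D x * avt a r t g x) <= en C1 * (\<integral>\<^sup>+x. g x)"
  using star_av_bound[OF ball_star_ball[OF R]] unfolding a_def r_def by blast
 define I where "I = 1 / (- 3 * \<theta> + 1)"
 have I: "I > 0" using th by (simp add: I_def)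
 define E where "E = C1 powr (1 - \<theta>) * (B / r^3) powr \<theta>"
 have E: "E > 0" using C1 B r by (simp add: E_def)
 define C where "C = 8 * R * (E * I)"
 show ?thesis
 proof (intro exI[of _ C] conjI allI impI)
  show "C > 0" using R E I by (simp add: C_def)
  fix v A assume v: "C1c (ball 0 R) v" and A[measurable]: "A : sets borel" and AR: "A <= ball (0::real^3) R"
  define \<alpha> where "\<alpha> = measure lborel A"
  have AD: "A <= ?D" using AR R by (auto intro: less_le_trans)
  have "emeasure lborel A < \<infinity>" using bounded_subset[OF bounded_ball AR] by (rule emeasure_bounded_finite)
  then have \<alpha>: "emeasure lborel A = en \<alpha>" "\<alpha> >= 0" by (auto simp: \<alpha>_def emeasure_eq_ennreal_measure)
  have [measurable]: "v : BM" "grad v : BM" using C1c_C1[OF v] by (auto intro: C1_bm C1_grad_bm)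
  define g where "g y = en (norm (grad v y))" for y
  have [measurable]: "g : BM" unfolding g_def by measurable
  define \<gamma> where "\<gamma> = (\<integral>\<^sup>+x. g x)"
  define h where "h t x = avt a r t g x" for t x
  have [measurable]: "(%(t, x). h t x) : borel_measurable (borel \<Otimes>\<^sub>M borel)" unfolding h_def by measurable
  have [measurable]: "(%t. h t x) : BM" for x unfolding h_def av_def by measurable
  have key: "(\<integral>\<^sup>+x. indicator A x * h t x) <= en (E * \<alpha> powr \<theta>) * en (t powr (- 3 * \<theta>)) * \<gamma>"
   if t: "0 < t" "t <= 1" for t
  proof -
   have tr: "t * r ~= 0" using t r by simp
   define w where "w = \<alpha> * (B / (t * r)^3)"
   have w0: "w >= 0" using \<alpha> B t r by (simp add: w_def)
   have "(\<integral>\<^sup>+x. indicator A x * h t x) <= (\<integral>\<^sup>+x. indicator ?D x * h t x)"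
    using AD by (intro nn_integral_mono mult_right_mono) (auto simp: indicator_def)
   also have "... <= en C1 * \<gamma>" unfolding h_def \<gamma>_def using C1(2)[of g t] t by simp
   finally have 1: "(\<integral>\<^sup>+x. indicator A x * h t x) <= en C1 * \<gamma>" .
   have "(\<integral>\<^sup>+x. indicator A x * h t x) <= (\<integral>\<^sup>+x. indicator A x * (en (B / \<bar>t * r\<bar>^3) * \<gamma>))"
    unfolding h_def \<gamma>_def by (intro nn_integral_mono mult_left_mono av_le tr B(2)) auto
   also have "... = en \<alpha> * (en (B / \<bar>t * r\<bar>^3) * \<gamma>)" by (subst nn_integral_multc) (simp_all add: \<alpha>)
   also have "... = en w * \<gamma>" unfolding w_def using \<alpha>(2) B(1) t r by (subst ennreal_mult) (simp_all add: mult.assoc)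
   finally have 2: "(\<integral>\<^sup>+x. indicator A x * h t x) <= en w * \<gamma>" .
   have m: "min C1 w <= C1 powr (1 - \<theta>) * w powr \<theta>"
   proof (cases "w <= C1")
    case True
    have "w = w powr (1 - \<theta>) * w powr \<theta>" using w0 by (simp add: powr_add[symmetric])
    also have "... <= C1 powr (1 - \<theta>) * w powr \<theta>" using True w0 th by (intro mult_right_mono powr_mono2) auto
    finally show ?thesis by simp
   next
    case False
    have "C1 = C1 powr (1 - \<theta>) * C1 powr \<theta>" using C1(1) by (simp add: powr_add[symmetric])
    also have "... <= C1 powr (1 - \<theta>) * w powr \<theta>" using False C1(1) th by (intro mult_left_mono powr_mono2) auto
    finally show ?thesis by simp
   qed
   have "w = \<alpha> * ((B / r^3) * t powr (-3))" using t r by (simp add: w_def power_mult_distrib powr_minus powr_numeral field_simps)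
   then have "w powr \<theta> = \<alpha> powr \<theta> * ((B / r^3) powr \<theta> * t powr (- 3 * \<theta>))"
    using \<alpha>(2) B(1) r t by (simp only: powr_mult powr_powr)
   then have "C1 powr (1 - \<theta>) * w powr \<theta> = E * \<alpha> powr \<theta> * t powr (- 3 * \<theta>)" by (simp add: E_def mult_ac)
   with m have m': "min C1 w <= E * \<alpha> powr \<theta> * t powr (- 3 * \<theta>)" by simp
   have "(\<integral>\<^sup>+x. indicator A x * h t x) <= en (min C1 w) * \<gamma>" using 1 2 by (simp add: min_def)
   also have "... <= en (E * \<alpha> powr \<theta> * t powr (- 3 * \<theta>)) * \<gamma>" by (intro mult_right_mono ennreal_leI m') simp
   also have "... = en (E * \<alpha> powr \<theta>) * en (t powr (- 3 * \<theta>)) * \<gamma>" using E by (simp add: ennreal_mult)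
   finally show ?thesis .
  qed
  have "(\<integral>\<^sup>+x. indicator A x * en \<bar>v x\<bar>) <= (\<integral>\<^sup>+x. en (8 * R) * (\<integral>\<^sup>+t. ind 1 t * (indicator A x * h t x)))"
  proof (rule nn_integral_mono)
   fix x
   show "indicator A x * en \<bar>v x\<bar> <= en (8 * R) * (\<integral>\<^sup>+t. ind 1 t * (indicator A x * h t x))"
    using sobolev_pointwise[OF R v, of x] AD unfolding h_def g_def a_def r_def by (cases "x : A") auto
  qed
  also have "... = en (8 * R) * (\<integral>\<^sup>+x. (\<integral>\<^sup>+t. ind 1 t * (indicator A x * h t x)))" by (rule nn_integral_cmult) measurable
  also have "(\<integral>\<^sup>+x. (\<integral>\<^sup>+t. ind 1 t * (indicator A x * h t x)))
   = (\<integral>\<^sup>+t. (\<integral>\<^sup>+x. ind 1 t * (indicator A x * h t x)))" by (rule lborel_pair.Fubini'[symmetric]) measurable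
  also have "en (8 * R) * ... <= en (8 * R) * (\<integral>\<^sup>+t. en (E * \<alpha> powr \<theta>) * (ind 1 t * en (t powr (- 3 * \<theta>))) * \<gamma>)"
  proof (rule mult_left_mono, intro nn_integral_mono_AE eventually_mono[OF AE_lborel_singleton[of 0]])
   fix t :: real assume "t ~= 0"
   then show "(\<integral>\<^sup>+x. ind 1 t * (indicator A x * h t x)) <= en (E * \<alpha> powr \<theta>) * (ind 1 t * en (t powr (- 3 * \<theta>))) * \<gamma>"
    using key[of t] by (cases "t : {0..1}") auto
  qed simp
  also have "(\<integral>\<^sup>+t. en (E * \<alpha> powr \<theta>) * (ind 1 t * en (t powr (- 3 * \<theta>))) * \<gamma>) = en (E * \<alpha> powr \<theta>) * en I * \<gamma>"
   using nn_integral_powr_01[of "- 3 * \<theta>"] th by (simp add: nn_integral_multc nn_integral_cmult I_def)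
  also have "en (8 * R) * (en (E * \<alpha> powr \<theta>) * en I * \<gamma>) = en (C * \<alpha> powr \<theta>) * \<gamma>"
  proof -
   have "C * \<alpha> powr \<theta> = 8 * R * (E * \<alpha> powr \<theta> * I)" by (simp add: C_def)
   then have "en (C * \<alpha> powr \<theta>) = en (8 * R) * (en (E * \<alpha> powr \<theta>) * en I)" using R E I by (simp only:) (simp add: ennreal_mult)
   then show ?thesis by (simp add: mult.assoc)
  qed
  finally show "(\<integral>\<^sup>+x. indicator A x * en \<bar>v x\<bar>) <= en (C * measure lborel A powr \<theta>) * (\<integral>\<^sup>+x. en (norm (grad v x)))"
   by (simp add: \<gamma>_def \<alpha>_def g_def)
 qed
qed

section \<open>The Poincare lemma and its homotopy operator\<close>

definition C1v :: "(real^3 => real^3) => bool" where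
 "C1v w <-> (ALL i. C1 (%x. w x $ i))"

lemma C1v_continuous: "C1v w ==> continuous_on S w"
proof -
 assume "C1v w"
 then have "continuous_on S (%x. \<chi> i. w x $ i)" unfolding C1v_def by (intro continuous_on_vec_lambda C1_cont) simp
 then show ?thesis by simp
qed

lemma C1v_has_derivative:
 assumes "C1v w" shows "(w has_derivative (%h. \<chi> i. grad (%x. w x $ i) x \<bullet> h)) (at x)"
proof -
 have "ALL b:Basis. ((%x. w x \<bullet> b) has_derivative (%h. (\<chi> i. grad (%x. w x $ i) x \<bullet> h) \<bullet> b)) (at x within UNIV)"
 proof
  fix b :: "real^3" assume "b : Basis"
  then obtain i where b: "b = axis i 1" by (auto simp: Basis_vec_def)
  show "((%x. w x \<bullet> b) has_derivative (%h. (\<chi> i. grad (%x. w x $ i) x \<bullet> h) \<bullet> b)) (at x within UNIV)"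
   unfolding b inner_axis using C1_derivative[of "%x. w x $ i" x] assms by (simp add: C1v_def)
 qed
 then show ?thesis by (subst has_derivative_componentwise_within)
qed

lemma curl_nth:
 "curl w x $ 1 = pd 2 (%y. w y $ 3) x - pd 3 (%y. w y $ 2) x"
 "curl w x $ 2 = pd 3 (%y. w y $ 1) x - pd 1 (%y. w y $ 3) x"
 "curl w x $ 3 = pd 1 (%y. w y $ 2) x - pd 2 (%y. w y $ 1) x" by (simp_all add: curl_def vector_3)

lemma C1v_continuous_curl: assumes "C1v w" shows "continuous_on S (curl w)"
proof -
 have p: "continuous_on S (pd i (%y. w y $ j))" for i j using assms C1_cont_pd by (simp add: C1v_def)
 have "continuous_on S (%x. curl w x $ i)" for i using exhaust_3[of i] by (auto simp: curl_nth intro!: continuous_on_diff p)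
 then have "continuous_on S (%x. \<chi> i. curl w x $ i)" by (intro continuous_on_vec_lambda)
 then show ?thesis by simp
qed

lemma curl_cross_nth:
 "cross3 (curl w z) y $ i = (\<Sum>j\<in>UNIV. (pd j (%x. w x $ i) z - pd i (%x. w x $ j) z) * y $ j)"
 using exhaust_3[of i] by (auto simp: cross3_simps sum_3 curl_nth algebra_simps)

text \<open>The classical homotopy operator from 2-forms to 1-forms with base point
  \<open>a\<close>, written for vector fields.\<close>

definition homotopy :: "real^3 => (real^3 => real^3) => real^3 => real^3" where
 "homotopy a c x = integral {0..1} (%t. t *R cross3 (c (a + t *R (x - a))) (x - a))"

lemma continuous_on_cross3[continuous_intros]:
 fixes f g :: "'a::t2_space => real^3"
 assumes "continuous_on S f" "continuous_on S g" shows "continuous_on S (%x. cross3 (f x) (g x))" by (rule continuous_on_cross[OF assms])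

text \<open>The potential at x is the line integral of \<open>w\<close> along the segment from
  \<open>a\<close> to x. The curl term is kept as a defect because the fields of
  \<open>curl_local_compactness\<close> have small curls that need not vanish.\<close>

lemma poincare_lemma:
 assumes w: "C1v w"
 shows "EX p. C1 p & (ALL x. grad p x = w x - homotopy a (curl w) x)"
proof -
 have wc: "C1 (%x. w x $ i)" for i using w by (simp add: C1v_def)
 have wcont: "continuous_on S w" for S by (rule C1v_continuous[OF w])
 define y where "y x t = a + t *R (x - a)" for x :: "real^3" and t :: real
 define f where "f x t = w (y x t) \<bullet> (x - a)" for x t
 define G where "G x t = w (y x t) + t *R (\<Sum>j\<in>UNIV. (x - a) $ j *R grad (%x. w x $ j) (y x t))" for x t
 define p where "p x = integral (cbox 0 1) (f x)" for x
 have yc: "continuous_on UNIV (%q. y (fst q) (snd q))" unfolding y_def by (intro continuous_intros)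
 have Gc: "continuous_on UNIV (%q. G (fst q) (snd q))" unfolding G_def
  by (intro continuous_intros continuous_on_compose2[OF wcont[of UNIV] yc] continuous_on_compose2[OF C1_cont_grad[OF wc, of UNIV] yc]) auto
 have Gc1: "continuous_on S (G x)" for x S using continuous_on_compose2[OF Gc, of S "%t. (x, t)"] by (simp add: continuous_on_Pair)
 have "f x integrable_on cbox 0 1" for x
 proof (rule integrable_continuous)
  have "continuous_on (cbox 0 1) (%t. y x t)" unfolding y_def by (intro continuous_intros)
  then show "continuous_on (cbox 0 1) (f x)" unfolding f_def by (intro continuous_intros continuous_on_compose2[OF wcont[of UNIV]]) auto
 qed
 moreover have "((%x. f x t) has_derivative blinfun_apply (blinfun_inner_right (G x t))) (at x within UNIV)" for x t
 proof -
  have c: "((%x. w (y x t) $ i * (x - a) $ i) has_derivative (%h. w (y x t) $ i * h $ i + (grad (%x. w x $ i) (y x t) \<bullet> (t *R h)) * (x - a) $ i)) (at x)" for i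
  proof (rule has_derivative_mult)
   show "((%x. w (y x t) $ i) has_derivative (%h. grad (%x. w x $ i) (y x t) \<bullet> (t *R h))) (at x)"
    by (rule has_derivative_compose[OF _ C1_derivative[OF wc[of i]], of "%x. y x t"])
     (auto simp: y_def intro!: derivative_eq_intros)
   show "((%x. (x - a) $ i) has_derivative (%h. h $ i)) (at x)"
    by (rule has_derivative_eq_rhs[OF bounded_linear.has_derivative[OF bounded_linear_vec_nth]]) (auto intro!: derivative_eq_intros)
  qed
  have "((%x. \<Sum>i\<in>UNIV. w (y x t) $ i * (x - a) $ i) has_derivative (%h. \<Sum>i\<in>UNIV. w (y x t) $ i * h $ i + (grad (%x. w x $ i) (y x t) \<bullet> (t *R h)) * (x - a) $ i)) (at x)"
   by (intro has_derivative_sum c)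
  moreover have "(%h. \<Sum>i\<in>UNIV. w (y x t) $ i * h $ i + (grad (%x. w x $ i) (y x t) \<bullet> (t *R h)) * (x - a) $ i) = blinfun_apply (blinfun_inner_right (G x t))"
   by (auto simp: G_def inner_add_left inner_sum_left sum.distrib inner_vec_def[of "w _"] sum_distrib_left mult_ac intro!: sum.cong)
  moreover have "(%x. \<Sum>i\<in>UNIV. w (y x t) $ i * (x - a) $ i) = (%x. f x t)" by (simp add: f_def inner_vec_def)
  ultimately show ?thesis by simp
 qed
 moreover have "continuous_on (UNIV \<times> cbox 0 1) (%(x, t). blinfun_inner_right (G x t))"
 proof -
  have "continuous_on UNIV (%q. blinfun_inner_right (G (fst q) (snd q)))" by (rule bounded_linear.continuous_on[OF bounded_linear_blinfun_inner_right Gc])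
  then show ?thesis by (auto simp: split_beta intro: continuous_on_subset)
 qed
 ultimately have lr: "(p has_derivative integral (cbox 0 1) (%t. blinfun_inner_right (G x t))) (at x within UNIV)" for x unfolding p_def by (intro leibniz_rule) auto
 have "integral (cbox 0 1) (%t. blinfun_inner_right (G x t)) = blinfun_inner_right (integral (cbox 0 1) (G x))" for x
  using integral_linear[OF integrable_continuous[OF Gc1[of "cbox 0 1" x]] bounded_linear_blinfun_inner_right] by (simp add: o_def)
 then have pd: "(p has_derivative (%h. integral (cbox 0 1) (G x) \<bullet> h)) (at x)" for x using lr[of x] by simp
 have "continuous_on UNIV (%x. integral (cbox 0 1) (G x))"
 proof (rule integral_continuous_on_param)
  show "continuous_on (UNIV \<times> cbox 0 1) (%(x, t). G x t)" using Gc by (auto simp: split_beta intro: continuous_on_subset)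
 qed
 from C1I[OF pd this] have p: "C1 p" "grad p = (%x. integral (cbox 0 1) (G x))" by auto
 have "integral (cbox 0 1) (G x) = w x - homotopy a (curl w) x" for x
 proof -
  \<comment> \<open>\<open>F\<close> is the derivative of \<open>t *R w (y x t)\<close>, which
    integrates to \<open>w x\<close>; \<open>K\<close> is the antisymmetric part of the Jacobian of
    \<open>w\<close>, that is the integrand of the homotopy operator.\<close>
  define F where "F t = w (y x t) + t *R (\<chi> i. grad (%x. w x $ i) (y x t) \<bullet> (x - a))" for t
  define K where "K t = t *R cross3 (curl w (y x t)) (x - a)" for t
  have yc1: "continuous_on S (y x)" for S unfolding y_def by (intro continuous_intros)
  have Kc: "continuous_on (cbox 0 1) K" unfolding K_def by (intro continuous_intros continuous_on_compose2[OF C1v_continuous_curl[OF w, of UNIV] yc1]) auto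
  have e: "G x t = F t - K t" for t
  proof (rule vec_eq_iff[THEN iffD2], rule allI)
   fix i
   show "G x t $ i = (F t - K t) $ i" by (simp add: G_def F_def K_def curl_cross_nth inner_vec_def sum_subtractf left_diff_distrib right_diff_distrib mult.commute)
  qed
  have "(F has_integral (1 *R w (y x 1) - 0 *R w (y x 0))) {0..1}"
  proof (rule fundamental_theorem_of_calculus)
   fix t :: real
   have "((%t. w (y x t)) has_derivative (%s. \<chi> i. grad (%x. w x $ i) (y x t) \<bullet> (s *R (x - a)))) (at t within {0..1})"
    by (rule has_derivative_compose[OF _ C1v_has_derivative[OF w], of "y x"])
     (auto simp: y_def[abs_def] intro!: derivative_eq_intros)
   moreover have "(%s. \<chi> i. grad (%x. w x $ i) (y x t) \<bullet> (s *R (x - a))) = (%s. s *R (\<chi> i. grad (%x. w x $ i) (y x t) \<bullet> (x - a)))"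
    by (simp add: vec_eq_iff fun_eq_iff)
   ultimately have "((%t. w (y x t)) has_vector_derivative (\<chi> i. grad (%x. w x $ i) (y x t) \<bullet> (x - a))) (at t within {0..1})"
    unfolding has_vector_derivative_def by simp
   from has_vector_derivative_scaleR[OF DERIV_ident this]
   show "((%t. t *R w (y x t)) has_vector_derivative F t) (at t within {0..1})" by (simp add: F_def add.commute)
  qed simp
  then have Fi: "integral {0..1} F = w x" "F integrable_on {0..1}" by (auto simp: y_def integral_unique)
  have "integral {0..1} (G x) = integral {0..1} F - integral {0..1} K"
   unfolding e[abs_def] using Kc by (intro Henstock_Kurzweil_Integration.integral_diff Fi(2) integrable_continuous_real) simp
  then show ?thesis unfolding Fi(1) by (simp add: K_def[abs_def] homotopy_def y_def)
 qed
 with p show ?thesis by (intro exI[of _ p]) simp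
qed

lemma norm_cross_le: "norm (cross3 x y) <= norm x * norm y"
proof (rule power2_le_imp_le)
 show "(norm (cross3 x y))^2 <= (norm x * norm y)^2" using norm_cross_dot[of x y] zero_le_power2[of "x \<bullet> y"] by linarith
qed simp

text \<open>Undoing the dilation by t costs t^(-3) in the squared norm. Writing t as t^(-1/4)
  t^(5/4) in Cauchy-Schwarz leaves the power 5/2 - 3, so that both t-integrals are the integral of
  t^(-1/2), which is 2; hence the constant 2 d.\<close>

lemma homotopy_bound:
 assumes D: "star_ball D a r"
 shows "EX C>0. ALL c. continuous_on UNIV c --> continuous_on UNIV (homotopy a c) &
  l2n (rst D (homotopy a c)) <= C * l2n (rst D c)"
proof -
 note S = star_ballD[OF D]
 obtain M where M: "M > 0" "!!x. x : D ==> norm x <= M" using S(2) by (metis bounded_pos)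
 have aD: "a : D" using S(3,4) by auto
 define d where "d = 2 * M"
 have d: "norm (x - a) <= d" if "x : D" for x using M(2)[OF that] M(2)[OF aD] norm_triangle_ineq4[of x a] by (simp add: d_def)
 have d0: "d > 0" using M by (simp add: d_def)
 show ?thesis
 proof (intro exI[of _ "2 * d"] conjI allI impI)
  fix c :: "real^3 => real^3" assume c: "continuous_on UNIV c"
  have Fc: "continuous_on UNIV (%q. snd q *R cross3 (c (a + snd q *R (fst q - a))) (fst q - a))" by (intro continuous_intros continuous_on_compose2[OF c]) auto
  show Hc: "continuous_on UNIV (homotopy a c)" unfolding homotopy_def box_real(2)[symmetric]
  proof (rule integral_continuous_on_param)
   show "continuous_on (UNIV \<times> cbox 0 1) (%(x, t). t *R cross3 (c (a + t *R (x - a))) (x - a))" using Fc by (auto simp: split_beta intro: continuous_on_subset)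
  qed
  have [measurable]: "c : BM" "D : sets borel" "homotopy a c : BM" using c Hc S(5) by (auto intro: bm_cont)
  have cs: "sqi (rst D c)" by (rule sqi_rst[OF c S(2,5)])
  define g where "g y = en (norm (rst D c y))" for y
  let ?k = "%t x. ind 1 t * en (t powr (5/4)) * (en d * g (a + t *R (x - a)))" and ?h = "%t x. ind 1 t * en (t powr (5/2)) * (g (a + t *R (x - a)))^2" and ?n = "en ((l2n (rst D c))^2)"
  have [measurable]: "g : BM" unfolding g_def by measurable
  have pt: "en ((norm (rst D (homotopy a c) x))^2) <= en (2 * d\<^sup>2) * (\<integral>\<^sup>+t. ?h t x)" for x
  proof (cases "x : D")
   case True
   define F where "F t = t *R cross3 (c (a + t *R (x - a))) (x - a)" for t
   have Fcont: "continuous_on {0..1} F" unfolding F_def by (intro continuous_intros continuous_on_compose2[OF c]) auto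
   have si: "set_integrable lborel {0..1} F" by (rule borel_integrable_atLeastAtMost'[OF Fcont])
   have "homotopy a c x = (LINT t:{0..1}|lborel. F t)" using set_borel_integral_eq_integral(2)[OF si] unfolding homotopy_def F_def[symmetric] by simp
   then have "en (norm (homotopy a c x)) <= (\<integral>\<^sup>+t. en (norm (ind 1 t *R F t)))"
    using integral_norm_bound_ennreal[OF si[unfolded set_integrable_def]] by (simp add: set_lebesgue_integral_def)
   also have "... <= (\<integral>\<^sup>+t. (ind 1 t * en (t powr (- 1/4))) * (?k t x))"
   proof (intro nn_integral_mono_AE eventually_mono[OF AE_lborel_singleton[of 0]])
    fix t :: real assume t0: "t ~= 0"
    show "en (norm (ind 1 t *R F t)) <= (ind 1 t * en (t powr (- 1/4))) * (?k t x)"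
    proof (cases "t : {0..1}")
     case t: True
     have "a + t *R (x - a) = (1 - (1 - t)) *R x + (1 - t) *R a" by (simp add: algebra_simps)
     then have inD: "a + t *R (x - a) : D" using S(7)[OF True, of a "1 - t"] S(3) t by simp
     have "norm (F t) <= t * (norm (c (a + t *R (x - a))) * norm (x - a))"
      unfolding F_def using t mult_left_mono[OF norm_cross_le[of "c (a + t *R (x - a))" "x - a"], of t] by simp
     also have "... <= t * (d * norm (c (a + t *R (x - a))))"
      using t mult_right_mono[OF d[OF True] norm_ge_zero[of "c (a + t *R (x - a))"]] by (intro mult_left_mono) (simp_all add: mult.commute)
     also have "... = t powr (- 1/4) * (t powr (5/4) * (d * norm (c (a + t *R (x - a)))))" using t t0 by (simp add: powr_add[symmetric] mult.assoc[symmetric])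
     finally show ?thesis using t inD d0 by (simp add: g_def ennreal_mult[symmetric])
    qed simp
   qed
   finally have 1: "en (norm (homotopy a c x)) <= (\<integral>\<^sup>+t. (ind 1 t * en (t powr (- 1/4))) * (?k t x))" .
   have "en ((norm (rst D (homotopy a c) x))^2) = (en (norm (homotopy a c x)))^2" using True by (simp add: ennreal_power)
   also have "... <= (\<integral>\<^sup>+t. (ind 1 t * en (t powr (- 1/4))) * (?k t x))^2"
    by (intro power_mono 1) simp
   also have "... <= (\<integral>\<^sup>+t. (ind 1 t * en (t powr (- 1/4)))^2) * (\<integral>\<^sup>+t. (?k t x)^2)"
    by (rule Cauchy_Schwarz_nn_integral) measurable
   also have "(\<integral>\<^sup>+t. (ind 1 t * en (t powr (- 1/4)))^2) = (\<integral>\<^sup>+t. ind 1 t * en (t powr (-1/2)))"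
    by (intro nn_integral_cong) (auto simp: indicator_def ennreal_power power2_eq_square powr_add[symmetric] ennreal_mult[symmetric])
   also have "... = en 2" using nn_integral_powr_01[of "-1/2"] by simp
   also have "(\<integral>\<^sup>+t. (?k t x)^2)
    = (\<integral>\<^sup>+t. en (d\<^sup>2) * (?h t x))"
   proof (rule nn_integral_cong)
    fix t :: real
    have "(en (t powr (5/4)))^2 = en (t powr (5/2))" by (simp add: power2_eq_square powr_add[symmetric] ennreal_mult[symmetric])
    then show "(?k t x)^2 = en (d\<^sup>2) * (?h t x)"
     using d0 by (auto simp: indicator_def power_mult_distrib ennreal_power mult_ac)
   qed
   also have "... = en (d\<^sup>2) * (\<integral>\<^sup>+t. ?h t x)" by (rule nn_integral_cmult) measurable
   finally show ?thesis using d0 by (simp add: ennreal_mult mult.assoc)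
  qed simp
  have "(\<integral>\<^sup>+x. en ((norm (rst D (homotopy a c) x))^2))
   <= (\<integral>\<^sup>+x. en (2 * d\<^sup>2) * (\<integral>\<^sup>+t. ?h t x))" by (intro nn_integral_mono pt)
  also have "... = en (2 * d\<^sup>2) * (\<integral>\<^sup>+x. (\<integral>\<^sup>+t. ?h t x))"
   by (rule nn_integral_cmult) measurable
  also have "(\<integral>\<^sup>+x. (\<integral>\<^sup>+t. ?h t x))
   = (\<integral>\<^sup>+t. (\<integral>\<^sup>+x. ?h t x))" by (rule lborel_pair.Fubini'[symmetric]) measurable
  also have "... = (\<integral>\<^sup>+t. ind 1 t * en (t powr (-1/2)) * ?n)"
  proof (intro nn_integral_cong_AE eventually_mono[OF AE_lborel_singleton[of 0]])
   fix t :: real assume t0: "t ~= 0"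
   have e: "a + t *R (x - a) = (a - t *R a) + t *R x" for x by (simp add: algebra_simps)
   have gn: "(\<integral>\<^sup>+y. (g y)^2) = ?n" unfolding g_def nn_norm_cls[OF cs, symmetric] by (simp add: ennreal_power)
   show "(\<integral>\<^sup>+x. ?h t x) = ind 1 t * en (t powr (-1/2)) * ?n"
   proof (cases "t : {0..1}")
    case True
    have "(\<integral>\<^sup>+x. ?h t x)
     = en (t powr (5/2)) * (\<integral>\<^sup>+x. (g ((a - t *R a) + t *R x))^2)" using True unfolding e by (subst nn_integral_cmult[symmetric]) auto
    also have "(\<integral>\<^sup>+x. (g ((a - t *R a) + t *R x))^2) = en (1 / \<bar>t\<bar>^3) * ?n"
     using nn_integral_affine[of "%y. (g y)^2" t "a - t *R a"] t0 by (simp add: gn)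
    also have "en (t powr (5/2)) * (en (1 / \<bar>t\<bar>^3) * ?n) = en (t powr (5/2) * (1 / \<bar>t\<bar>^3)) * ?n"
     by (subst ennreal_mult) (simp_all add: mult.assoc)
    also have "t powr (5/2) * (1 / \<bar>t\<bar>^3) = t powr (-1/2)"
    proof -
     have "t powr (5/2) = t powr (-1/2) * t powr 3" by (simp add: powr_add[symmetric])
     moreover have "t powr 3 = \<bar>t\<bar>^3" using True t0 by (simp add: powr_numeral)
     ultimately show ?thesis using t0 by simp
    qed
    finally show ?thesis using True by simp
   qed simp
  qed
  also have "... = en 2 * ?n" using nn_integral_powr_01[of "-1/2"] by (simp add: nn_integral_multc)
  also have "en (2 * d\<^sup>2) * (en 2 * ?n) = en ((2 * d * l2n (rst D c))^2)"
   by (simp only: ennreal_mult[symmetric] zero_le_numeral zero_le_power2 mult_nonneg_nonneg) (simp add: power_mult_distrib)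
  finally have fin: "(\<integral>\<^sup>+x. en ((norm (rst D (homotopy a c) x))^2)) <= en ((2 * d * l2n (rst D c))^2)" .
  show "l2n (rst D (homotopy a c)) <= 2 * d * l2n (rst D c)" by (rule norm_cls_le(2)[OF _ fin]) (use d0 in auto)
 qed (use d0 in simp)
qed

section \<open>The weak curl\<close>

lemma difference_quotient_limit:
 assumes "C1 f" "h ---> 0" "!!n. h n ~= 0"
 shows "(%n. (f (x + h n *R v) - f x) / h n) ---> grad f x \<bullet> v"
proof -
 have "((%t. f (x + t *R v)) has_derivative (%s. grad f (x + 0 *R v) \<bullet> (s *R v))) (at 0)"
  by (rule has_derivative_compose[OF _ C1_derivative[OF assms(1)]]) (auto intro!: derivative_eq_intros)
 then have "((%t. f (x + t *R v)) has_real_derivative grad f x \<bullet> v) (at 0)" by (simp add: has_field_derivative_def mult_commute_abs)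
 then have *: "(%h. (f (x + h *R v) - f x) / h) \<midarrow>0\<rightarrow> grad f x \<bullet> v" by (simp add: DERIV_def)
 have "filterlim h (at 0) sequentially" using assms(2,3) by (auto simp: filterlim_at)
 from filterlim_compose[OF * this] show ?thesis .
qed

lemma difference_quotient_bound:
 assumes "C1 f" "h ~= 0" "!!y. dist y x <= \<bar>h\<bar> * norm v ==> norm (grad f y) <= B"
 shows "\<bar>(f (x + h *R v) - f x) / h\<bar> <= B * norm v"
proof -
 obtain t where t: "t : {0<..<1}" "f (x + h *R v) - f x = grad f (x + t *R (h *R v)) \<bullet> (h *R v)" using C1_mean_value[OF assms(1)] by blast
 have "dist (x + t *R (h *R v)) x <= \<bar>h\<bar> * norm v" using t(1) by (simp add: dist_norm mult.assoc[symmetric] abs_mult mult_right_mono mult_left_le_one_le)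
 from assms(3)[OF this] have B: "norm (grad f (x + t *R (h *R v))) <= B" .
 have "(f (x + h *R v) - f x) / h = grad f (x + t *R (h *R v)) \<bullet> v" using assms(2) t(2) by simp
 also have "\<bar>...\<bar> <= norm (grad f (x + t *R (h *R v))) * norm v" by (rule Cauchy_Schwarz_ineq2)
 also have "... <= B * norm v" by (intro mult_right_mono B) simp
 finally show ?thesis .
qed

text \<open>Symmetry of second derivatives for a function that has only first ones. The derivative
  in direction j is replaced by a forward difference quotient on \<phi>, which a translation turns
  into a backward one on \<open>f\<close>; only direction i is integrated by parts.\<close>

lemma integral_pd_swap:
 assumes f: "C1 f" and \<phi>: "C1c UNIV \<phi>"
 shows "(\<integral>x. pd i f x * pd j \<phi> x) = (\<integral>x. pd j f x * pd i \<phi> x)"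
proof -
 have p: "C1 \<phi>" by (rule C1c_C1[OF \<phi>])
 obtain K where K: "compact K" "!!x. x ~: K ==> \<phi> x = 0" "!!x. x ~: K ==> grad \<phi> x = 0" using \<phi> C1c_obtain by metis
 obtain R where R: "R > 0" "!!x. x : K ==> norm x <= R" by (metis K(1) bounded_pos compact_imp_bounded)
 let ?S = "cball (0::real^3) (R + 1)" and ?S2 = "cball (0::real^3) (R + 2)"
 obtain B where B: "B > 0" "!!x. norm (grad \<phi> x) <= B" using compact_support_bounded[OF C1_cont_grad[OF p] K(1,3)] by blast
 obtain B2 where B2: "!!x. x : ?S2 ==> norm (grad f x) <= B2" using compact_imp_bounded[OF compact_continuous_image[OF C1_cont_grad[OF f] compact_cball[of 0 "R + 2"]]]
  unfolding bounded_iff by blast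
 have pdb: "\<bar>pd i f x\<bar> <= B2" if "x : ?S2" for x i using order_trans[OF component_le_norm_cart[of "grad f x" i] B2[OF that]] by simp
 have pdp: "\<bar>pd i \<phi> x\<bar> <= B" for x i using order_trans[OF component_le_norm_cart[of "grad \<phi> x" i] B(2)[of x]] by simp
 have B20: "B2 >= 0" using order_trans[OF norm_ge_zero B2[of 0]] R by simp
 define e :: "real^3" where "e = axis j 1"
 have ne: "norm e = 1" by (simp add: e_def norm_axis_1)
 define h where "h n = 1 / real (Suc n)" for n
 have h: "h n > 0" "h n <= 1" "h n ~= 0" for n by (auto simp: h_def)
 have h0: "h ---> 0" unfolding h_def by (rule LIMSEQ_Suc[OF lim_1_over_n])
 define q where "q n x = (\<phi> (x + h n *R e) - \<phi> x) / h n" for n x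
 define g where "g n x = (f (x + (- h n) *R e) - f x) / (- h n)" for n x
 have [measurable]: "f : BM" "\<phi> : BM" "!!i. pd i f : BM" "!!i. pd i \<phi> : BM" using f p by (auto intro!: bm_cont C1_cont C1_cont_pd)
 have qz: "q n x = 0" if "x ~: ?S" for n x
 proof -
  have "norm (h n *R e) <= 1" using h[of n] ne by simp
  then have "x ~: K" "x + h n *R e ~: K" using R(2)[of x] R(2)[of "x + h n *R e"] that norm_triangle_ineq4[of "x + h n *R e" "h n *R e"] by auto
  then show ?thesis using K(2) by (simp add: q_def)
 qed
 have phz: "pd i \<phi> x = 0" if "x ~: ?S" for x i
 proof -
  have "x ~: K" using R(2)[of x] that by auto
  then show ?thesis using K(3)[of x] by (simp add: vec_eq_iff)
 qed
 have w: "integrable lborel (%x. C * indicator ?S x)" for C :: real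
  using emeasure_compact_finite[OF compact_cball[of "0::real^3" "R + 1"]] by (intro integrable_mult_right integrable_real_indicator) auto
 have "(%n. \<integral>x. pd i f x * q n x) ---> (\<integral>x. pd i f x * pd j \<phi> x)"
 proof (rule integral_dominated_convergence[OF _ _ w[of "B2 * B"]])
  show "AE x. (%n. pd i f x * q n x) ---> pd i f x * pd j \<phi> x" using difference_quotient_limit[OF p h0 h(3), of _ "axis j 1"] unfolding q_def e_def
   by (intro AE_I2 tendsto_mult tendsto_const) (simp add: inner_axis)
  show "AE x. norm (pd i f x * q n x) <= B2 * B * indicator ?S x" for n
  proof (rule AE_I2)
   fix x :: "real^3"
   show "norm (pd i f x * q n x) <= B2 * B * indicator ?S x"
   proof (cases "x : ?S")
    case True
    have "\<bar>q n x\<bar> <= B * norm e" unfolding q_def by (rule difference_quotient_bound[OF p h(3)]) (rule B(2))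
    then have "\<bar>pd i f x\<bar> * \<bar>q n x\<bar> <= B2 * B" using pdb[of x i] True B20 ne by (intro mult_mono) auto
    then show ?thesis using True by (simp add: abs_mult)
   qed (simp add: qz)
  qed
 qed (simp_all add: q_def)
 moreover have "(%n. \<integral>x. g n x * pd i \<phi> x) ---> (\<integral>x. pd j f x * pd i \<phi> x)"
 proof (rule integral_dominated_convergence[OF _ _ w[of "B2 * B"]])
  have "(%n. g n x) ---> grad f x \<bullet> e" for x unfolding g_def using tendsto_minus[OF h0] h(3) by (intro difference_quotient_limit[OF f]) auto
  then show "AE x. (%n. g n x * pd i \<phi> x) ---> pd j f x * pd i \<phi> x" unfolding e_def by (intro AE_I2 tendsto_mult tendsto_const) (simp add: inner_axis)
  show "AE x. norm (g n x * pd i \<phi> x) <= B2 * B * indicator ?S x" for n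
  proof (rule AE_I2)
   fix x :: "real^3"
   show "norm (g n x * pd i \<phi> x) <= B2 * B * indicator ?S x"
   proof (cases "x : ?S")
    case True
    have "\<bar>g n x\<bar> <= B2 * norm e" unfolding g_def
    proof (rule difference_quotient_bound[OF f])
     fix y assume "dist y x <= \<bar>- h n\<bar> * norm e"
     then have "norm (y - x) <= 1" using h[of n] ne by (simp add: dist_norm)
     then have "y : ?S2" using True norm_triangle_ineq[of "y - x" x] by simp
     then show "norm (grad f y) <= B2" by (rule B2)
    qed (use h in simp)
    then have "\<bar>g n x\<bar> * \<bar>pd i \<phi> x\<bar> <= B2 * B" using pdp[of i x] B20 ne B(1) by (intro mult_mono) auto
    then show ?thesis using True by (simp add: abs_mult)
   qed (simp add: phz)
  qed
 qed (simp_all add: g_def)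
 moreover have "(\<integral>x. pd i f x * q n x) = (\<integral>x. g n x * pd i \<phi> x)" for n
 proof -
  define fs where "fs x = f (1 *R x + (- h n) *R e)" for x
  have fs: "C1 fs" "grad fs = (%x. 1 *R grad f (1 *R x + (- h n) *R e))" unfolding fs_def[abs_def] by (rule C1_affine[OF f])+
  note ibp1 = C1c_integration_by_parts[OF fs(1) \<phi>, of i]
  note ibp2 = C1c_integration_by_parts[OF f \<phi>, of i]
  define F where "F x = pd i f (x + (- h n) *R e) * \<phi> x" for x
  have sh: "(\<integral>x. pd i f x * \<phi> (x + h n *R e)) = (\<integral>x. F x)" using integral_shift[of F "h n *R e"] by (simp add: F_def algebra_simps)
  have Fi: "integrable lborel F" using ibp1(3) unfolding pd_of_grad[OF fs(2)] F_def[abs_def] by (simp add: mult.commute)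
  have shi: "integrable lborel (%x. pd i f x * \<phi> (x + h n *R e))" using integrable_affine_iff[of 1 F "h n *R e"] Fi by (simp add: F_def algebra_simps)
  have i2: "integrable lborel (%x. pd i f x * \<phi> x)" using ibp2(3) by (simp add: mult.commute)
  have "(\<integral>x. pd i f x * q n x) = (\<integral>x. (pd i f x * \<phi> (x + h n *R e) - pd i f x * \<phi> x) / h n)" by (simp add: q_def right_diff_distrib)
  also have "... = ((\<integral>x. F x) - (\<integral>x. pd i f x * \<phi> x)) / h n" using shi i2 by (simp add: sh)
  also have "(\<integral>x. F x) = - (\<integral>x. fs x * pd i \<phi> x)" using ibp1(1) by (simp add: F_def pd_of_grad[OF fs(2)] mult.commute[of "\<phi> _"])
  also have "(\<integral>x. pd i f x * \<phi> x) = - (\<integral>x. f x * pd i \<phi> x)" using ibp2(1) by (simp add: mult.commute)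
  also have "(- (\<integral>x. fs x * pd i \<phi> x) - - (\<integral>x. f x * pd i \<phi> x)) / h n = (\<integral>x. (fs x * pd i \<phi> x - f x * pd i \<phi> x) / (- h n))"
   using ibp1(2) ibp2(2) h(3)[of n] by (simp add: field_simps)
  also have "... = (\<integral>x. g n x * pd i \<phi> x)" by (simp add: g_def fs_def left_diff_distrib)
  finally show ?thesis .
 qed
 ultimately show ?thesis using LIMSEQ_unique by auto
qed

lemma cross_axis_expand:
 "u \<bullet> cross3 g b = b $ 1 * (u $ 2 * g $ 3 - u $ 3 * g $ 2) + b $ 2 * (u $ 3 * g $ 1 - u $ 1 * g $ 3) + b $ 3 * (u $ 1 * g $ 2 - u $ 2 * g $ 1)"
 by (simp add: cross3_simps inner_vec_def sum_3 algebra_simps)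

lemma sqi_cross: assumes "sqi g" shows "sqi (%x. cross3 (g x) b)"
proof (rule sqi_mono[OF _ sqi_scaleR[OF assms, of "norm b"]])
 have [measurable]: "g : BM" using assms by (rule sqi_bm)
 have "continuous_on UNIV (%y. cross3 y b)" by (intro continuous_intros)
 then have "(%y. cross3 y b) : BM" by (rule bm_cont)
 then show "(%x. cross3 (g x) b) : BM" using measurable_compose[of g borel borel "%y. cross3 y b" borel] by measurable
 show "AE x. norm (cross3 (g x) b) <= norm (norm b *R g x)"
 proof (rule AE_I2)
  fix x show "norm (cross3 (g x) b) <= norm (norm b *R g x)" using norm_cross_le[of "g x" b] by (simp add: mult.commute)
 qed
qed

lemma sqi_scale: "sqi (\<phi> :: real^3 => real) ==> sqi (%x. \<phi> x *R (b :: real^3))"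
 by (rule sqi_mono[OF _ sqi_scaleR[of \<phi> "norm b"]]) (auto dest!: sqi_bm simp: abs_mult mult.commute)

abbreviation (input) "gcross \<phi> b == (%x. cross3 (grad \<phi> x) b)"

text \<open>Weakly, the curl of a gradient is zero, tested with \<phi> b whose curl is
  \<open>gcross \<phi> b\<close>. Expanding the triple product leaves exactly the antisymmetric
  pairs of \<open>integral_pd_swap\<close>.\<close>

lemma integral_grad_cross_grad:
 assumes f: "C1 f" and \<phi>: "C1c UNIV \<phi>"
 shows "(\<integral>x. grad f x \<bullet> cross3 (grad \<phi> x) b) = 0"
proof -
 have i: "integrable lborel (%x. pd i f x * pd j \<phi> x)" for i j
 proof -
  obtain K where K: "compact K" "!!x. x ~: K ==> grad \<phi> x = 0" using C1c_obtain[OF \<phi>] by metis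
  show ?thesis by (rule integrable_compact_support[OF _ K(1)])
    (use K(2) C1_cont_pd[OF f] C1_cont_pd[OF C1c_C1[OF \<phi>]] in \<open>auto simp: vec_eq_iff intro!: continuous_on_mult\<close>)
 qed
 show ?thesis unfolding cross_axis_expand using integral_pd_swap[OF f \<phi>] by (simp add: i)
qed

definition L2on :: "(real^3) set => 'b::euclidean_space l2 set" where
 "L2on \<Omega> = {u. AE x. x ~: \<Omega> --> rep u x = 0}"

lemma L2on_cls: "sqi f ==> cls f : L2on \<Omega> <-> (AE x. x ~: \<Omega> --> f x = 0)"
proof -
 assume f: "sqi f"
 from rep_cls[OF f] have "(AE x. x ~: \<Omega> --> rep (cls f) x = 0) <-> (AE x. x ~: \<Omega> --> f x = 0)"
 proof (intro iffI)
  assume "AE x. x ~: \<Omega> --> rep (cls f) x = 0"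
  then show "AE x. x ~: \<Omega> --> f x = 0" using rep_cls[OF f] by eventually_elim simp
 next
  assume "AE x. x ~: \<Omega> --> f x = 0"
  then show "AE x. x ~: \<Omega> --> rep (cls f) x = 0" using rep_cls[OF f] by eventually_elim simp
 qed
 then show ?thesis by (simp add: L2on_def)
qed

text \<open>Exhibits the set as the kernel of a bounded operator, from which closedness and
  linearity are read off.\<close>

lemma L2on_kernel:
 assumes "\<Omega> : sets borel"
 shows "L2on \<Omega> = {u :: 'b::euclidean_space l2. mulop (indicator (- \<Omega>)) u = 0}"
proof -
 have m: "(indicator (- \<Omega>) :: real^3 => real) : BM" "AE x. \<bar>indicator (- \<Omega>) x :: real\<bar> <= 1" using assms by (auto simp: indicator_def)
 have "mulop (indicator (- \<Omega>)) u = 0 <-> (AE x. x ~: \<Omega> --> rep u x = 0)" for u :: "'b l2"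
 proof -
  have "mulop (indicator (- \<Omega>)) u = 0 <-> (AE x. indicator (- \<Omega>) x *R rep u x = 0)"
   unfolding mulop_def zero_l2_def by (rule cls_eq_iff[OF sqi_mulop[OF m] sqi_zero])
  also have "... <-> (AE x. x ~: \<Omega> --> rep u x = 0)" by (rule AE_cong) (auto simp: indicator_def)
  finally show ?thesis .
 qed
 then show ?thesis by (simp add: L2on_def)
qed

lemma L2on_closed:
 assumes "\<Omega> : sets borel"
 shows "closed (L2on \<Omega> :: 'b::euclidean_space l2 set)" "subspace (L2on \<Omega> :: 'b l2 set)"
proof -
 have m: "(indicator (- \<Omega>) :: real^3 => real) : BM" "AE x. \<bar>indicator (- \<Omega>) x :: real\<bar> <= 1" using assms by (auto simp: indicator_def)
 interpret bounded_linear "mulop (indicator (- \<Omega>)) :: 'b l2 => 'b l2" by (rule bounded_linear_mulop(1)[OF m]) simp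
 show "closed (L2on \<Omega> :: 'b l2 set)" unfolding L2on_kernel[OF assms] by (intro closed_Collect_eq continuous_on continuous_on_id continuous_on_const)
 show "subspace (L2on \<Omega> :: 'b l2 set)" unfolding L2on_kernel[OF assms] by (auto simp: subspace_def add scaleR zero)
qed

text \<open>The graph of the weak curl. The curl is an unbounded operator, and a closed subspace of
  a product is the convenient form for limits and projections. Test fields \<phi> b with constant b
  generate all others. The fields are extended by zero but the tests are supported inside \<Omega>,
  so no boundary condition is imposed.\<close>

definition curlrel :: "(real^3) set => ((real^3) l2 \<times> (real^3) l2) set" where
 "curlrel \<Omega> = {(w, c). w : L2on \<Omega> & c : L2on \<Omega> &
  (\<forall>\<phi> b. C1c \<Omega> \<phi> --> inner w (cls (gcross \<phi> b)) = inner c (cls (%x. \<phi> x *R b)))}"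

lemma curlrel_closed:
 assumes "\<Omega> : sets borel" shows "closed (curlrel \<Omega>)" "subspace (curlrel \<Omega>)"
proof -
 have e: "curlrel \<Omega> = (L2on \<Omega> \<times> L2on \<Omega>) \<inter> (\<Inter>\<phi>\<in>{\<phi>. C1c \<Omega> \<phi>}. \<Inter>b. {p. inner (fst p) (cls (gcross \<phi> b)) = inner (snd p) (cls (%x. \<phi> x *R b))})"
  by (auto simp: curlrel_def)
 show "closed (curlrel \<Omega>)" unfolding e by (intro closed_Int closed_Times closed_INT ballI L2on_closed[OF assms] closed_Collect_eq continuous_intros)
 show "subspace (curlrel \<Omega>)" using L2on_closed(2)[OF assms] by (auto simp: subspace_def curlrel_def inner_add_left zero_prod_def)
qed

lemma grad_curlrel:
 assumes \<Omega>: "\<Omega> : sets borel" "bounded \<Omega>" and f: "C1 f"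
 shows "(cls (rst \<Omega> (grad f)), 0) : curlrel \<Omega>"
proof -
 have s: "sqi (rst \<Omega> (grad f))" by (rule sqi_rst[OF C1_cont_grad[OF f] \<Omega>(2,1)])
 have "inner (cls (rst \<Omega> (grad f))) (cls (gcross \<phi> b)) = 0" if \<phi>: "C1c \<Omega> \<phi>" for \<phi> b
 proof -
  obtain K where K: "K <= \<Omega>" "!!x. x ~: K ==> grad \<phi> x = 0" using C1c_obtain[OF \<phi>] by metis
  have "inner (cls (rst \<Omega> (grad f))) (cls (gcross \<phi> b)) = (\<integral>x. rst \<Omega> (grad f) x \<bullet> cross3 (grad \<phi> x) b)"
   by (rule inner_cls[OF s sqi_cross[OF C1c_sqi(2)[OF \<phi>]]])
  also have "... = (\<integral>x. grad f x \<bullet> cross3 (grad \<phi> x) b)"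
  proof (rule lint_cong)
   fix x :: "real^3"
   show "rst \<Omega> (grad f) x \<bullet> cross3 (grad \<phi> x) b = grad f x \<bullet> cross3 (grad \<phi> x) b"
   proof (cases "x : \<Omega>")
    case False
    then have "grad \<phi> x = 0" using K by blast
    then show ?thesis by simp
   qed simp
  qed simp
  also have "... = 0" by (rule integral_grad_cross_grad[OF f C1c_mono[OF \<phi>]]) simp
  finally show ?thesis .
 qed
 moreover have "cls (rst \<Omega> (grad f)) : L2on \<Omega>" unfolding L2on_cls[OF s] by simp
 moreover have "(0 :: (real^3) l2) : L2on \<Omega>" using L2on_closed(2)[OF \<Omega>(1)] subspace_0 by blast
 ultimately show ?thesis by (simp add: curlrel_def)
qed

text \<open>The lower-order term of the product rule, a scalar times a fixed bounded gradient, as an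
  operator on classes, so that L2 limits pass through it.\<close>

definition vmul :: "(real^3 => real^3) => real l2 => (real^3) l2" where
 "vmul G u = cls (%x. rep u x *R G x)"

lemma sqi_vmul:
 assumes "sqi (u :: real^3 => real)" "(G :: real^3 => real^3) : BM" "!!x. norm (G x) <= B"
 shows "sqi (%x. u x *R G x)"
proof (rule sqi_mono[OF _ sqi_scaleR[OF assms(1), of B]])
 show "(%x. u x *R G x) : BM" using sqi_bm[OF assms(1)] assms(2) by measurable
 show "AE x. norm (u x *R G x) <= norm (B *R u x)"
  using mult_left_mono[OF order_trans[OF assms(3) abs_ge_self[of B]], of "\<bar>u _\<bar>"] by (intro AE_I2) (simp add: abs_mult mult.commute)
qed

lemma vmul_cls:
 assumes "sqi u" "G : BM" "!!x. norm (G x) <= B"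
 shows "vmul G (cls u) = cls (%x. u x *R G x)" unfolding vmul_def
proof (rule cls_eqI[OF sqi_vmul[OF sqi_rep assms(2,3)] sqi_vmul[OF assms]])
 show "AE x. rep (cls u) x *R G x = u x *R G x" using rep_cls[OF assms(1)] by eventually_elim simp
qed

lemma bounded_linear_vmul:
 assumes G: "G : BM" "!!x. norm (G x) <= B"
 shows "bounded_linear (vmul G)"
proof (rule bounded_linear_intro[where K = B])
 have rv: "AE x. rep (vmul G u) x = rep u x *R G x" for u unfolding vmul_def by (rule rep_cls[OF sqi_vmul[OF sqi_rep G]])
 show "vmul G (u + v) = vmul G u + vmul G v" for u v
  by (rule l2_eqI) (use rep_add[of u v] rv[of u] rv[of v] rv[of "u + v"] rep_add[of "vmul G u" "vmul G v"] in \<open>eventually_elim, simp add: scaleR_add_left\<close>)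
 show "vmul G (r *R v) = r *R vmul G v" for r v
  by (rule l2_eqI) (use rep_scaleR[of r v] rv[of v] rv[of "r *R v"] rep_scaleR[of r "vmul G v"] in \<open>eventually_elim, simp\<close>)
 show "norm (vmul G u) <= norm u * B" for u
 proof -
  have B0: "B >= 0" using G(2)[of 0] norm_ge_zero order_trans by blast
  have "norm (vmul G u) <= l2n (%x. B *R rep u x)" unfolding vmul_def
  proof (rule norm_cls_mono)
   show "(%x. rep u x *R G x) : BM" using G(1) by simp
   show "sqi (%x. B *R rep u x)" by (intro sqi_scaleR sqi_rep)
   show "AE x. norm (rep u x *R G x) <= norm (B *R rep u x)" using mult_left_mono[OF G(2), of "\<bar>rep u _\<bar>"] B0 by (intro AE_I2) (simp add: abs_mult mult.commute)
  qed
  also have "... = norm (B *R u)" by (simp add: scaleR_l2_def)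
  finally show ?thesis using B0 by (simp add: mult.commute)
 qed
qed

lemma mollify_approx_small:
 assumes w: "sqi (w :: real^3 => real^3)" "sqi (c :: real^3 => real^3)" and r: "r > 0" and e: "e > 0"
 shows "EX t. 0 < t & t <= 1/2 & norm (cls (moll a r t w) - cls w) < e
  & norm (cls (moll a r t c) - cls c) < e"
proof -
 define t where "t n = 1 / (real n + 2 + norm a + r)" for n
 have t: "0 < t n" "t n <= 1/2" "t n * norm a <= 1" "t n * r <= 1" for n using r by (auto simp: t_def field_simps add_nonneg_pos)
 have t0: "t ---> 0"
 proof (rule tendsto_sandwich[OF _ _ tendsto_const lim_1_over_n])
  show "\<forall>\<^sub>F n in sequentially. 0 <= t n" using t(1) less_imp_le by (intro always_eventually) blast
  show "\<forall>\<^sub>F n in sequentially. t n <= 1 / real n"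
  proof (rule eventually_sequentiallyI[of 1])
   fix n :: nat assume "1 <= n"
   moreover have "0 < real n + 2 + norm a + r" using r by (simp add: add_nonneg_pos)
   ultimately show "t n <= 1 / real n" unfolding t_def using r by (intro divide_left_mono mult_pos_pos) auto
  qed
 qed
 have "(%n. cls (mollify (1 - t n) (t n *R a) (t n * r) v)) ---> cls v" if "sqi v" for v :: "real^3 => real^3"
 proof (rule mollify_tendsto[OF that])
  show "(%n. 1 - t n) ---> 1" using tendsto_diff[OF tendsto_const t0, of 1] by simp
  show "(%n. t n *R a) ---> 0" using tendsto_scaleR[OF t0 tendsto_const, of a] by simp
  show "(%n. t n * r) ---> 0" using tendsto_mult[OF t0 tendsto_const, of r] by simp
  show "1/2 <= 1 - t n" for n using t(2)[of n] by simp
  show "norm (t n *R a) <= 1" for n using t(1,3)[of n] by simp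
  show "\<bar>t n * r\<bar> <= 1" for n using t(1,4)[of n] r by simp
  show "t n * r ~= 0" for n using t(1)[of n] r by simp
 qed
 from LIMSEQ_D[OF this[OF w(1)] e] LIMSEQ_D[OF this[OF w(2)] e]
 obtain N1 N2 where "!!n. n >= N1 ==> norm (cls (mollify (1 - t n) (t n *R a) (t n * r) w) - cls w) < e"
  "!!n. n >= N2 ==> norm (cls (mollify (1 - t n) (t n *R a) (t n * r) c) - cls c) < e" by blast
 then show ?thesis using t(1,2) by (intro exI[of _ "t (max N1 N2)"]) auto
qed

lemma curl_mollify:
 assumes wc: "(w, c) : curlrel \<Omega>" and D: "D <= \<Omega>" "D : sets borel" and d: "d ~= 0" and cb: "cball (l *R x + a) \<bar>d\<bar> <= D"
 shows "curl (mollify l a d (rst D (rep w))) x = l *R mollify l a d (rst D (rep c)) x"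
proof -
 define b0 where "b0 = l *R x + a"
 have ws: "sqi (rst D (rep w))" "sqi (rst D (rep c))" by (intro sqi_indicator sqi_rep D)+
 define \<phi> where "\<phi> = (%y. kern d (b0 - y))"
 have \<phi>: "C1c D \<phi>" unfolding \<phi>_def by (rule kern_reflected_C1c[OF d cb[folded b0_def]])
 have \<phi>\<Omega>: "C1c \<Omega> \<phi>" by (rule C1c_mono[OF \<phi> D(1)])
 obtain K where K: "K <= D" "!!y. y ~: K ==> \<phi> y = 0" "!!y. y ~: K ==> grad \<phi> y = 0" using C1c_obtain[OF \<phi>] by metis
 have g: "pd i \<phi> y = - pd i (kern d) (b0 - y)" for i y unfolding \<phi>_def by (simp add: kern_reflected(2)[OF d])
 have gi: "integrable lborel (%y. rst D (rep w) y $ i * pd j \<phi> y)" for i j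
 proof -
  have "sqi (pd j \<phi>)" using sqi_component[OF C1c_sqi(2)[OF \<phi>], of j] by simp
  from sqi_inner[OF sqi_component[OF ws(1), of i] this] show ?thesis by simp
 qed
 have W: "mollify l a d (rst D (rep w)) y $ j = mollify l a d (%y. rst D (rep w) y $ j) y" for y j by (rule mollify_component[OF ws(1) d])
 have pdW: "pd i (%y. mollify l a d (rst D (rep w)) y $ j) x = - l * (\<integral>y. rst D (rep w) y $ j * pd i \<phi> y)" for i j
  unfolding W mollify_C1(2)[OF d sqi_component[OF ws(1)]] by (simp add: convol_def b0_def[symmetric] g mult.commute)
 have eq: "(\<integral>y. rst D (rep w) y \<bullet> cross3 (grad \<phi> y) b) = (\<integral>y. \<phi> y * (rst D (rep c) y \<bullet> b))" for b
 proof -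
  have "(\<integral>y. rst D (rep w) y \<bullet> cross3 (grad \<phi> y) b) = (\<integral>y. rep w y \<bullet> cross3 (grad \<phi> y) b)"
  proof (rule lint_cong)
   fix y :: "real^3"
   show "rst D (rep w) y \<bullet> cross3 (grad \<phi> y) b = rep w y \<bullet> cross3 (grad \<phi> y) b"
   proof (cases "y : D")
    case False
    then have "grad \<phi> y = 0" using K(1,3) by blast
    then show ?thesis by simp
   qed simp
  qed simp
  also have "... = inner w (cls (gcross \<phi> b))" using inner_cls[OF sqi_rep sqi_cross[OF C1c_sqi(2)[OF \<phi>]], of w b] by simp
  also have "... = inner c (cls (%x. \<phi> x *R b))" using wc \<phi>\<Omega> by (auto simp: curlrel_def)
  also have "... = (\<integral>y. rep c y \<bullet> (\<phi> y *R b))" using inner_cls[OF sqi_rep sqi_scale[OF C1c_sqi(1)[OF \<phi>]], of c b] by simp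
  also have "... = (\<integral>y. \<phi> y * (rst D (rep c) y \<bullet> b))"
  proof (rule lint_cong)
   fix y :: "real^3"
   show "rep c y \<bullet> (\<phi> y *R b) = \<phi> y * (rst D (rep c) y \<bullet> b)"
   proof (cases "y : D")
    case False
    then have "\<phi> y = 0" using K(1,2) by blast
    then show ?thesis by simp
   qed simp
  qed simp
  finally show ?thesis .
 qed
 have C: "mollify l a d (rst D (rep c)) x $ i = (\<integral>y. \<phi> y * (rst D (rep c) y \<bullet> axis i 1))" for i unfolding mollify_component[OF ws(2) d]
  by (subst mollify_eq_convol[OF d]) (simp add: convol_def \<phi>_def b0_def inner_axis)
 define I where "I i j = (\<integral>y. rst D (rep w) y $ i * pd j \<phi> y)" for i j
 have E: "b $ 1 * (I 2 3 - I 3 2) + b $ 2 * (I 3 1 - I 1 3) + b $ 3 * (I 1 2 - I 2 1)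
  = (\<integral>y. \<phi> y * (rst D (rep c) y \<bullet> b))" for b unfolding eq[of b, symmetric] cross_axis_expand grad_nth I_def using gi by simp
 have "curl (mollify l a d (rst D (rep w))) x $ i = l * mollify l a d (rst D (rep c)) x $ i" for i unfolding C E[of "axis i 1", symmetric] using exhaust_3[of i]
  by (auto simp: curl_nth pdW[folded I_def] axis_def algebra_simps)
 then show ?thesis by (simp add: vec_eq_iff)
qed

text \<open>At points of \<open>D\<close> the averaging ball of \<open>moll a r t\<close> stays in
  \<open>D\<close>, so cutting the field off at the boundary of \<open>D\<close> beforehand produces
  no surface term.\<close>

lemma curl_mollify_star:
 assumes wc: "(w, c) : curlrel \<Omega>" and D: "star_ball D a r" "D <= \<Omega>" and t: "0 < t" "t <= 1/2" and x: "x : D"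
 shows "curl (moll a r t (rst D (rep w))) x = (1 - t) *R moll a r t (rst D (rep c)) x"
proof (rule curl_mollify[OF wc D(2)])
 note S = star_ballD[OF D(1)]
 show "D : sets borel" by (rule S(5))
 show "t * r ~= 0" using t S(3) by simp
 show "cball ((1 - t) *R x + t *R a) \<bar>t * r\<bar> <= D"
 proof
  fix y assume y: "y : cball ((1 - t) *R x + t *R a) \<bar>t * r\<bar>"
  define z where "z = (1 / (t * r)) *R (y - ((1 - t) *R x + t *R a))"
  have "norm z <= 1" using y t S(3) unfolding z_def by (simp add: dist_norm norm_minus_commute divide_le_eq abs_mult)
  moreover have "y = (1 - t) *R x + t *R a + (t * r) *R z" using t S(3) by (simp add: z_def)
  ultimately show "y : D" using S(8)[OF x, of z t] t by simp
 qed
qed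

text \<open>On the star-shaped piece the mollified field is a gradient plus \<open>H n\<close>, and
  \<open>H n\<close> is controlled by the curl and tends to 0. The potentials are bounded in H^1,
  hence precompact in L2. Multiplying the gradient by \<zeta> gives the gradient of \<zeta>
  \<open>p n\<close>, which is the curl-free \<open>g n\<close>, minus \<open>p n\<close> times the
  gradient of \<zeta>, which converges along the subsequence.\<close>

lemma curl_local_compactness:
 assumes \<Omega>: "open \<Omega>" "bounded \<Omega>" and U: "open U" and D: "star_ball (U \<inter> \<Omega>) a r" and z: "C1c U \<zeta>"
  and wc: "!!n. (w n, c n) : curlrel \<Omega>" and wb: "!!n. norm (w n) <= 1" and c0: "c ---> 0"
 shows "EX s g. strict_mono (s :: nat => nat) & (ALL n. (g n, 0) : curlrel \<Omega>) & convergent (%n. mulop \<zeta> (w (s n)) - g n)"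
proof -
 define D where "D = U \<inter> \<Omega>"
 have D: "star_ball D a r" using assms(4) by (simp add: D_def)
 note S = star_ballD[OF D]
 have Db: "D : sets borel" "bounded D" "D <= \<Omega>" using S by (auto simp: D_def)
 have \<Omega>b: "\<Omega> : sets borel" using \<Omega> by simp
 obtain C1' where C1': "C1' > 0" "!!p T. C1 p ==> 0 < T ==> T <= 1 ==>
  sqi (rst D (%x. p x - moll a r T (rst D p) x)) &
  l2n (rst D (%x. p x - moll a r T (rst D p) x)) <= C1' * T * l2n (rst D (grad p))" using star_estimate[OF D] by blast
 obtain C2 where C2: "C2 > 0" "!!c. continuous_on UNIV c ==> continuous_on UNIV (homotopy a c)"
  "!!c. continuous_on UNIV c ==> l2n (rst D (homotopy a c)) <= C2 * l2n (rst D c)" using homotopy_bound[OF D] by blast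
 obtain M where M: "M > 0" "!!n. norm (c n) <= M" using Bseq_def convergent_imp_Bseq[OF convergentI[OF c0]] by blast
 define wn where "wn n = rst D (rep (w n))" for n
 define cn where "cn n = rst D (rep (c n))" for n
 have sw: "sqi (wn n)" "sqi (cn n)" for n unfolding wn_def cn_def by (intro sqi_indicator sqi_rep Db)+
 have cnle: "l2n (cn n) <= norm (c n)" "l2n (wn n) <= norm (w n)" for n
  using norm_cls_mono[OF sqi_bm[OF sw(2)[of n]] sqi_rep[of "c n"]] norm_cls_mono[OF sqi_bm[OF sw(1)[of n]] sqi_rep[of "w n"]] by (auto simp: cn_def wn_def indicator_def)
 have "ALL n. EX t. 0 < t & t <= 1/2 & norm (cls (moll a r t (wn n)) - cls (wn n)) < 1 / real (Suc n)
  & norm (cls (moll a r t (cn n)) - cls (cn n)) < 1 / real (Suc n)" using mollify_approx_small[OF sw S(3)] by simp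
 then obtain t where t: "!!n. 0 < t n" "!!n. t n <= 1/2"
  and tw: "!!n. norm (cls (mollify (1 - t n) (t n *R a) (t n * r) (wn n)) - cls (wn n)) < 1 / real (Suc n)"
  and tc: "!!n. norm (cls (mollify (1 - t n) (t n *R a) (t n * r) (cn n)) - cls (cn n)) < 1 / real (Suc n)" by metis
 define W where "W n = mollify (1 - t n) (t n *R a) (t n * r) (wn n)" for n
 define Cm where "Cm n = mollify (1 - t n) (t n *R a) (t n * r) (cn n)" for n
 have tr: "t n * r ~= 0" "1 - t n ~= 0" for n using t[of n] S(3) by auto
 have W1: "C1v (W n)" for n unfolding C1v_def W_def using C1_mollify_vec[OF tr(1) sw(1)] by blast
 have Ws: "sqi (W n)" "sqi (Cm n)" for n unfolding W_def Cm_def by (rule mollify_L2(1)[OF _ tr(2)], rule sw)+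
 have curlW: "x : D ==> curl (W n) x = (1 - t n) *R Cm n x" for n x unfolding W_def Cm_def wn_def cn_def by (rule curl_mollify_star[OF wc D Db(3) t(1) t(2)])
 have inv0: "(%n. 1 / real (Suc n)) ---> 0" by (rule LIMSEQ_Suc[OF lim_1_over_n])
 have cv0: "(%n. norm (c n) + 1 / real (Suc n)) ---> 0" using tendsto_add[OF tendsto_norm_zero[OF c0] inv0] by simp
 have curlc: "continuous_on UNIV (curl (W n))" for n by (rule C1v_continuous_curl[OF W1])
 have curlb: "l2n (rst D (curl (W n))) <= norm (c n) + 1 / real (Suc n)" for n
 proof -
  have "l2n (rst D (curl (W n))) <= l2n (Cm n)"
  proof (rule norm_cls_mono[OF sqi_bm[OF sqi_rst[OF curlc Db(2,1)]] Ws(2)])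
   have "norm ((1 - t n) *R Cm n x) <= norm (Cm n x)" for x using t[of n] by (simp add: mult_left_le_one_le)
   then show "AE x. norm (rst D (curl (W n)) x) <= norm (Cm n x)" using curlW by (intro AE_I2) (simp add: indicator_def)
  qed
  also have "... <= l2n (cn n) + norm (cls (Cm n) - cls (cn n))" by (rule norm_triangle_sub)
  also have "... <= norm (c n) + 1 / real (Suc n)" using cnle(1)[of n] tc[of n] by (simp add: Cm_def)
  finally show ?thesis .
 qed
 define H where "H n = homotopy a (curl (W n))" for n
 have Hc: "continuous_on UNIV (H n)" for n unfolding H_def by (rule C2(2)[OF curlc])
 have Hb: "l2n (rst D (H n)) <= C2 * (norm (c n) + 1 / real (Suc n))" for n
  unfolding H_def using C2(1) by (intro order_trans[OF C2(3)[OF curlc]] mult_left_mono curlb) auto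
 have H0: "(%n. cls (rst D (H n))) ---> 0"
 proof (rule tendsto_norm_zero_cancel, rule tendsto_sandwich[OF _ _ tendsto_const])
  show "(%n. C2 * (norm (c n) + 1 / real (Suc n))) ---> 0" using tendsto_mult[OF tendsto_const cv0, of C2] by simp
 qed (use Hb in \<open>auto intro: always_eventually\<close>)
 have "ALL n. EX p. C1 p & (ALL x. grad p x = W n x - H n x)" unfolding H_def using poincare_lemma[OF W1] by blast
 then obtain p0 where p0: "!!n. C1 (p0 n)" "!!n x. grad (p0 n) x = W n x - H n x" by metis
 \<comment> \<open>The mean over the ball around \<open>a\<close> is removed, so that
   \<open>star_estimate\<close> at T = 1 bounds \<open>p n\<close> by its gradient.\<close>
 define p where "p n x = p0 n x + (- mollify 0 a r (rst D (p0 n)) 0)" for n x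
 have mconst: "mollify 0 a r f x = mollify 0 a r f 0" for f :: "real^3 => real" and x by (simp add: mollify_def)
 have p: "C1 (p n)" "grad (p n) = (%x. W n x - H n x)" for n using C1_add[OF p0(1)[of n] C1_const(1)[of "- mollify 0 a r (rst D (p0 n)) 0"]] p0(2)[of n]
  unfolding p_def[abs_def] by (auto simp: C1_const(2))
 have wle: "l2n (W n) <= 2" for n
 proof -
  have "l2n (W n) <= l2n (wn n) + norm (cls (W n) - cls (wn n))" by (rule norm_triangle_sub)
  moreover have "1 / real (Suc n) <= 1" by simp
  ultimately show ?thesis using cnle(2)[of n] wb[of n] tw[of n] unfolding W_def by linarith
 qed
 define M' where "M' = 2 + C2 * (M + 1)"
 have rs: "sqi (rst D (W n))" "sqi (rst D (H n))" for n using sqi_rst[OF C1v_continuous[OF W1] Db(2,1)] sqi_rst[OF Hc Db(2,1)] by auto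
 have rw: "l2n (rst D (f :: real^3 => real^3)) <= l2n f" if "sqi f" for f
  using norm_cls_mono[OF sqi_bm[OF sqi_indicator[OF that Db(1)]] that] by (auto simp: indicator_def)
 have gb: "l2n (rst D (grad (p n))) <= M'" for n
 proof -
  have "cls (rst D (grad (p n))) = cls (rst D (W n)) - cls (rst D (H n))" unfolding cls_diff[OF rs] p(2) by (simp add: scaleR_diff_right)
  then have "l2n (rst D (grad (p n))) <= l2n (rst D (W n)) + l2n (rst D (H n))" by (simp add: norm_triangle_ineq4)
  also have "... <= 2 + C2 * (norm (c n) + 1 / real (Suc n))" using rw[OF Ws(1)[of n]] wle[of n] Hb[of n] by simp
  also have "... <= M'" unfolding M'_def using C2(1) M(2)[of n] by (intro add_left_mono mult_left_mono add_mono) auto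
  finally show ?thesis .
 qed
 have pb: "l2n (rst D (p n)) <= C1' * M'" for n
 proof -
  have "grad (p n) = grad (p0 n)" using p(2)[of n] p0(2)[of n] by auto
  moreover have "rst D (p n) = rst D (%x. p0 n x - moll a r 1 (rst D (p0 n)) x)"
  proof -
   have "moll a r 1 (rst D (p0 n)) x = mollify 0 a r (rst D (p0 n)) 0" for x by (simp add: mollify_def)
   then show ?thesis unfolding p_def by (simp only:) simp
  qed
  ultimately have "l2n (rst D (p n)) <= C1' * l2n (rst D (grad (p n)))" using C1'(2)[OF p0(1)[of n], of 1] by simp
  also have "... <= C1' * M'" using C1'(1) gb[of n] by (intro mult_left_mono) auto
  finally show ?thesis .
 qed
 obtain s where s: "strict_mono s" "convergent (%n. cls (rst D (p (s n))))"
  using star_rellich[OF D p(1), where M = "max (C1' * M') M'"] pb gb by (meson max.cobounded1 max.cobounded2 order_trans)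
 define g where "g n = cls (rst \<Omega> (grad (%x. \<zeta> x * p n x)))" for n
 have z1: "C1 \<zeta>" by (rule C1c_C1[OF z])
 obtain K where K: "compact K" "K <= U" "!!y. y ~: K ==> \<zeta> y = 0" "!!y. y ~: K ==> grad \<zeta> y = 0" using C1c_obtain[OF z] by metis
 obtain B where B: "B > 0" "!!x. \<bar>\<zeta> x\<bar> <= B" using compact_support_bounded[OF C1_cont[OF z1] K(1,3)] by auto
 obtain B' where B': "B' > 0" "!!x. norm (grad \<zeta> x) <= B'" using compact_support_bounded[OF C1_cont_grad[OF z1] K(1,4)] by auto
 have zm: "\<zeta> : BM" "AE x. \<bar>\<zeta> x\<bar> <= B" "grad \<zeta> : BM" using z1 B by (auto intro: C1_bm C1_grad_bm)
 have gk: "(g n, 0) : curlrel \<Omega>" for n unfolding g_def by (rule grad_curlrel[OF \<Omega>b \<Omega>(2) C1_mult(1)[OF z1 p(1)]])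
 have key: "mulop \<zeta> (w n) - g n = mulop \<zeta> (cls (wn n) - cls (rst D (W n))) + mulop \<zeta> (cls (rst D (H n))) - vmul (grad \<zeta>) (cls (rst D (p n)))" for n
 proof -
  have s1: "sqi (rst D (p n))" by (rule sqi_rst[OF C1_cont[OF p(1)] Db(2,1)])
  have s2: "sqi (rst \<Omega> (grad (%x. \<zeta> x * p n x)))" by (rule sqi_rst[OF C1_cont_grad[OF C1_mult(1)[OF z1 p(1)]] \<Omega>(2) \<Omega>b])
  note m = sqi_bdd_mult[OF zm(1,2)]
  have wL: "AE x. x ~: \<Omega> --> rep (w n) x = 0" using wc[of n] by (simp add: curlrel_def L2on_def)
  have "mulop \<zeta> (w n) - g n = cls (%x. \<zeta> x *R rep (w n) x - rst \<Omega> (grad (%x. \<zeta> x * p n x)) x)"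
   unfolding g_def mulop_def by (rule cls_diff[OF m[OF sqi_rep] s2])
  also have "... = cls (%x. (\<zeta> x *R (wn n x - rst D (W n) x) + \<zeta> x *R rst D (H n) x) - rst D (p n) x *R grad \<zeta> x)"
  proof (rule cls_eqI)
   show "sqi (%x. \<zeta> x *R rep (w n) x - rst \<Omega> (grad (%x. \<zeta> x * p n x)) x)" by (intro sqi_diff m sqi_rep s2)
   show "sqi (%x. (\<zeta> x *R (wn n x - rst D (W n) x) + \<zeta> x *R rst D (H n) x) - rst D (p n) x *R grad \<zeta> x)"
    by (intro sqi_diff sqi_add m sqi_vmul[OF s1 zm(3) B'(2)] sw rs)
   show "AE x. \<zeta> x *R rep (w n) x - rst \<Omega> (grad (%x. \<zeta> x * p n x)) x
    = (\<zeta> x *R (wn n x - rst D (W n) x) + \<zeta> x *R rst D (H n) x) - rst D (p n) x *R grad \<zeta> x" using wL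
   proof eventually_elim
    case (elim x)
    have gr: "grad (%x. \<zeta> x * p n x) x = \<zeta> x *R (W n x - H n x) + p n x *R grad \<zeta> x" unfolding C1_mult(2)[OF z1 p(1)] p(2) ..
    show ?case
    proof (cases "x : U")
     case True
     then show ?thesis using elim unfolding gr by (cases "x : \<Omega>") (simp_all add: D_def wn_def algebra_simps)
    next
     case False
     then have "\<zeta> x = 0" "grad \<zeta> x = 0" using K by blast+
     then show ?thesis unfolding gr by simp
    qed
   qed
  qed
  also have "... = (cls (%x. \<zeta> x *R (wn n x - rst D (W n) x)) + cls (%x. \<zeta> x *R rst D (H n) x)) - cls (%x. rst D (p n) x *R grad \<zeta> x)"
   by (subst cls_add; (subst cls_diff)?; intro sqi_diff sqi_add m sqi_vmul[OF s1 zm(3) B'(2)] sw rs refl)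
  also have "cls (%x. \<zeta> x *R (wn n x - rst D (W n) x)) = mulop \<zeta> (cls (wn n) - cls (rst D (W n)))"
   unfolding cls_diff[OF sw(1) rs(1)] by (rule mulop_cls[OF zm(1,2) sqi_diff[OF sw(1) rs(1)], symmetric])
  also have "cls (%x. \<zeta> x *R rst D (H n) x) = mulop \<zeta> (cls (rst D (H n)))" by (rule mulop_cls[OF zm(1,2) rs(2), symmetric])
  also have "cls (%x. rst D (p n) x *R grad \<zeta> x) = vmul (grad \<zeta>) (cls (rst D (p n)))" by (rule vmul_cls[OF s1 zm(3) B'(2), symmetric])
  finally show ?thesis .
 qed
 have wd0: "(%n. cls (wn n) - cls (rst D (W n))) ---> 0"
 proof (rule tendsto_norm_zero_cancel, rule tendsto_sandwich[OF _ _ tendsto_const inv0])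
  have "norm (cls (wn n) - cls (rst D (W n))) <= 1 / real (Suc n)" for n
  proof -
   have "wn n x - rst D (W n) x = rst D (%x. wn n x - W n x) x" for x by (simp add: wn_def indicator_def)
   then have "cls (wn n) - cls (rst D (W n)) = cls (rst D (%x. wn n x - W n x))" unfolding cls_diff[OF sw(1) rs(1)] by simp
   then have "norm (cls (wn n) - cls (rst D (W n))) <= norm (cls (wn n) - cls (W n))" using rw[OF sqi_diff[OF sw(1) Ws(1)]] by (simp add: cls_diff[OF sw(1) Ws(1)])
   then show ?thesis using tw[of n] by (simp add: W_def norm_minus_commute)
  qed
  then show "\<forall>\<^sub>F n in sequentially. norm (cls (wn n) - cls (rst D (W n))) <= 1 / real (Suc n)" by (intro always_eventually) blast
 qed simp
 obtain P where P: "(%n. cls (rst D (p (s n)))) ---> P" using s(2) unfolding convergent_def by blast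
 note bl = bounded_linear_mulop(1)[OF zm(1,2) less_imp_le[OF B(1)]]
 have "(%n. mulop \<zeta> (cls (wn (s n)) - cls (rst D (W (s n)))) + mulop \<zeta> (cls (rst D (H (s n)))) - vmul (grad \<zeta>) (cls (rst D (p (s n)))))
  ---> mulop \<zeta> 0 + mulop \<zeta> 0 - vmul (grad \<zeta>) P"
  by (intro tendsto_diff tendsto_add bounded_linear.tendsto[OF bl] bounded_linear.tendsto[OF bounded_linear_vmul[OF zm(3) B'(2)]] P
    LIMSEQ_subseq_LIMSEQ[OF wd0 s(1), unfolded o_def] LIMSEQ_subseq_LIMSEQ[OF H0 s(1), unfolded o_def])
 then have "convergent (%n. mulop \<zeta> (w (s n)) - g (s n))" unfolding key by (rule convergentI)
 then show ?thesis using s(1) gk by (intro exI[of _ s] exI[of _ "%n. g (s n)"]) blast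
qed

section \<open>Partitions of unity and star-shaped covers of Lipschitz domains\<close>

lemma pos_square_deriv: "((%s. (max 0 s)^2) has_real_derivative 2 * max 0 s) (at s)"
proof -
 consider "s > 0" | "s < 0" | "s = 0" by linarith
 then show ?thesis
 proof cases
  case 1
  have "((%s. s\<^sup>2) has_real_derivative 2 * max 0 s) (at s)" using 1 by (auto intro!: derivative_eq_intros)
  then show ?thesis by (rule has_field_derivative_transform_within_open[of _ _ _ "{0<..}"]) (use 1 in auto)
 next
  case 2
  have "((%s. 0) has_real_derivative 2 * max 0 s) (at s)" using 2 by simp
  then show ?thesis by (rule has_field_derivative_transform_within_open[of _ _ _ "{..<0}"]) (use 2 in auto)
 next
  case 3
  have "(%h. ((max 0 (0 + h))^2 - (max 0 0)^2) / h) \<midarrow>0\<rightarrow> (0::real)"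
  proof (rule tendsto_norm_zero_cancel, rule tendsto_sandwich[OF _ _ tendsto_const])
   show "\<forall>\<^sub>F h::real in at 0. norm (((max 0 (0 + h))^2 - (max 0 0)^2) / h) <= \<bar>h\<bar>"
    by (intro always_eventually allI) (auto simp: max_def power2_eq_square)
   show "((%h::real. \<bar>h\<bar>) \<longlongrightarrow> 0) (at 0)" by (intro tendsto_rabs_zero tendsto_ident_at)
  qed simp
  then show ?thesis using 3 by (simp add: DERIV_def)
 qed
qed

lemma C1_norm_square: "C1 (%y. (y - x) \<bullet> (y - x))"
proof (rule C1I(1)[of _ "%y. 2 *R (y - x)"])
 show "((%y. (y - x) \<bullet> (y - x)) has_derivative (%h. 2 *R (y - x) \<bullet> h)) (at y)" for y by (auto intro!: derivative_eq_intros simp: inner_commute)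
qed (intro continuous_intros)

lemma C1_ball_bump: assumes "r > 0"
 shows "EX b. C1 b & (ALL y. b y >= 0) & (ALL y:ball x r. b y > 0) & (ALL y. y ~: cball x r --> b y = 0)"
proof -
 define b where "b y = (max 0 (r\<^sup>2 + (-1) * ((y - x) \<bullet> (y - x))))^2" for y
 have "C1 b" unfolding b_def[abs_def] by (rule C1_compose(1)[OF C1_add(1)[OF C1_const(1) C1_cmult(1)[OF C1_norm_square]] pos_square_deriv]) (intro continuous_intros)
 moreover have "b y > 0" if "y : ball x r" for y
 proof -
  have "(norm (y - x))^2 < r\<^sup>2" using that assms by (intro power_strict_mono) (auto simp: dist_norm norm_minus_commute)
  then show ?thesis by (simp add: b_def dot_square_norm)
 qed
 moreover have "b y = 0" if "y ~: cball x r" for y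
 proof -
  have "r\<^sup>2 <= (norm (y - x))^2" using that assms by (intro power_mono) (auto simp: dist_norm norm_minus_commute)
  then show ?thesis by (simp add: b_def dot_square_norm)
 qed
 ultimately show ?thesis by (intro exI[of _ b]) (auto simp: b_def)
qed

text \<open>Dividing by the sum of the bumps would leave the class of globally defined functions; the
 quotient \<open>s / (s\<^sup>2 + (max 0 (m - s))\<^sup>2)\<close> is continuously differentiable on the whole line and agrees with \<open>1 / s\<close> for \<open>s >= m\<close>.\<close>

lemma C1_partition_of_unity:
 fixes K :: "(real^3) set"
 assumes K: "compact K" and U: "!!x. x : K ==> open (U x) & x : U x"
 shows "EX F \<zeta>. finite F & F <= K & (ALL x:F. C1c (U x) (\<zeta> x)) & (ALL y:K. (\<Sum>x\<in>F. \<zeta> x y) = (1::real))"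
proof (cases "K = {}")
 case True then show ?thesis by (intro exI[of _ "{}"]) auto
next
 case False
 have "ALL x:K. EX r>0. cball x r <= U x" using U open_contains_cball by meson
 then obtain r where r: "!!x. x : K ==> r x > 0" "!!x. x : K ==> cball x (r x) <= U x" by metis
 have "ALL x:K. EX b. C1 b & (ALL y. b y >= 0) & (ALL y:ball x (r x). b y > 0) & (ALL y. y ~: cball x (r x) --> b y = 0)" using C1_ball_bump r(1) by blast
 then obtain b where b: "!!x. x : K ==> C1 (b x)" "!!x y. x : K ==> b x y >= 0"
  "!!x y. x : K ==> y : ball x (r x) ==> b x y > 0" "!!x y. x : K ==> y ~: cball x (r x) ==> b x y = 0" by metis
 have "K <= (\<Union>x\<in>K. ball x (r x))" using r(1) by force
 then obtain F where F: "F <= K" "finite F" "K <= (\<Union>x\<in>F. ball x (r x))" using compactE_image[OF K, of K "%x. ball x (r x)"] by (metis open_ball)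
 define B where "B y = (\<Sum>x\<in>F. b x y)" for y
 have BC: "C1 B" unfolding B_def[abs_def] by (rule C1_sum(1)) (use b(1) F(1) in blast)
 have Bpos: "B y > 0" if "y : K" for y
 proof -
  obtain x where x: "x : F" "y : ball x (r x)" using subsetD[OF F(3) \<open>y : K\<close>] by blast
  show ?thesis unfolding B_def using x F(1,2) b(2,3) by (intro sum_pos2[of F x]) (auto dest: subsetD)
 qed
 obtain y0 where y0: "y0 : K" "!!y. y : K ==> B y0 <= B y" using continuous_attains_inf[OF K False C1_cont[OF BC]] by blast
 define m where "m = B y0"
 have m: "m > 0" using Bpos y0 by (simp add: m_def)
 define D where "D s = s\<^sup>2 + (max 0 (m - s))^2" for s
 define D' where "D' s = 2 * s - 2 * max 0 (m - s)" for s
 have D0: "D s > 0" for s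
 proof (cases "s = 0")
  case True then show ?thesis using m by (simp add: D_def)
 next
  case False then show ?thesis unfolding D_def by (intro add_pos_nonneg) auto
 qed
 have Dd: "(D has_real_derivative D' s) (at s)" for s unfolding D_def[abs_def] D'_def by (rule derivative_eq_intros DERIV_chain2[OF pos_square_deriv] refl | simp)+
 define k where "k s = s / D s" for s
 define k' where "k' s = (D s - s * D' s) / (D s * D s)" for s
 have kd: "(k has_real_derivative k' s) (at s)" for s unfolding k_def[abs_def] k'_def using D0[of s] by (auto intro!: derivative_eq_intros Dd simp: mult.commute)
 have kc: "continuous_on UNIV k'"
 proof -
  have "continuous_on UNIV D" "continuous_on UNIV D'" unfolding D_def[abs_def] D'_def[abs_def] by (intro continuous_intros)+
  moreover have "D s * D s ~= 0" for s using D0[of s] by simp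
  ultimately show ?thesis unfolding k'_def[abs_def] by (intro continuous_intros) auto
 qed
 define \<zeta> where "\<zeta> x y = k (B y) * b x y" for x y
 have "C1c (U x) (\<zeta> x)" if "x : F" for x
 proof (rule C1cI[where K = "cball x (r x)"])
  have xK: "x : K" using that F by blast
  show "C1 (\<zeta> x)" unfolding \<zeta>_def[abs_def] by (rule C1_mult(1)[OF C1_compose(1)[OF BC kd kc] b(1)[OF xK]])
  show "cball x (r x) <= U x" by (rule r(2)[OF xK])
  show "\<zeta> x y = 0" if "y ~: cball x (r x)" for y using b(4)[OF xK that] by (simp add: \<zeta>_def)
 qed simp
 moreover have "(\<Sum>x\<in>F. \<zeta> x y) = 1" if "y : K" for y
 proof -
  have "D (B y) = (B y)^2" using y0(2)[OF that] by (simp add: D_def m_def)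
  then have "k (B y) * B y = 1" using Bpos[OF that] by (simp add: k_def power2_eq_square)
  then show ?thesis by (simp only: \<zeta>_def sum_distrib_left[symmetric] B_def)
 qed
 ultimately show ?thesis using F by blast
qed

text \<open>Near a boundary point the domain lies below a Lipschitz graph. On segments from a point
  near the graph to a ball placed deep below it, the height falls by at least 4 P t while the graph
  moves by at most 2 P t, so the segment stays below the graph.\<close>

lemma lipschitz_domain_star_cover:
 assumes \<Omega>: "lipschitz_domain \<Omega>" and x: "p : closure \<Omega>"
 shows "EX U a r. open U & p : U & star_ball (U \<inter> \<Omega>) a r"
proof (cases "p : \<Omega>")
 case True
 have "open \<Omega>" using \<Omega> by (simp add: lipschitz_domain_def)
 then obtain e where e: "e > 0" "ball p e <= \<Omega>" using True open_contains_ball by blast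
 have "star_ball (ball p e) p (e / 2)" unfolding star_ball_def
 proof (intro conjI ballI)
  fix x b and t :: real assume "x : ball p e" "b : cball p (e / 2)" "t : {0..1}"
  then show "(1 - t) *R x + t *R b : ball p e" using convexD_alt[OF convex_ball, of x p e b t] e(1) by (auto simp: field_simps)
 qed (use e(1) in auto)
 moreover have "ball p e \<inter> \<Omega> = ball p e" using e(2) by blast
 ultimately show ?thesis using e(1) by (intro exI[of _ "ball p e"] exI[of _ p] exI[of _ "e / 2"]) simp
next
 case False
 have o: "open \<Omega>" "bounded \<Omega>" using \<Omega> by (auto simp: lipschitz_domain_def)
 have "p : frontier \<Omega>" using x False o(1) by (simp add: frontier_def interior_open)
 then obtain Q :: "real^3 => real^3" and r h L :: real and g :: "real \<times> real => real" where
  Q: "orthogonal_transformation Q" and r: "r > 0" and h: "h > 0" and L: "L-lipschitz_on UNIV g" and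
  loc: "!!x. let y = Q (x - p) in (norm (y $ 1, y $ 2) < r & \<bar>y $ 3\<bar> < h) --> (x : \<Omega> <-> y $ 3 < g (y $ 1, y $ 2))"
  using \<Omega> unfolding lipschitz_domain_def by blast
 have loc': "x : \<Omega> <-> Q (x - p) $ 3 < g (Q (x - p) $ 1, Q (x - p) $ 2)"
  if "norm (Q (x - p) $ 1, Q (x - p) $ 2) < r" "\<bar>Q (x - p) $ 3\<bar> < h" for x using loc[of x] that by (simp add: Let_def)
 have lin: "linear Q" and iso: "!!v. norm (Q v) = norm v" using Q by (auto simp: orthogonal_transformation)
 have L0: "L >= 0" using L by (rule lipschitz_on_nonneg)
 have gL: "\<bar>g u - g v\<bar> <= L * norm (u - v)" for u v using lipschitz_onD[OF L, of u v] by (simp add: dist_norm)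
 have pair: "norm (y $ 1, y $ 2) <= norm y" "\<bar>y $ 3\<bar> <= norm y" for y :: "real^3"
 proof -
  have "(norm (y $ 1, y $ 2))^2 <= (norm y)^2" unfolding norm_Pair power2_norm_eq_inner[of y] by (simp add: inner_vec_def sum_3 power2_eq_square)
  then show "norm (y $ 1, y $ 2) <= norm y" by (rule power2_le_imp_le) simp
  show "\<bar>y $ 3\<bar> <= norm y" using component_le_norm_cart[of y 3] by simp
 qed
 \<comment> \<open>The graph passes through \<open>p\<close>: a positive value would put
   \<open>p\<close> into \<Omega>, a negative one would keep it away from the closure.\<close>
 have g0: "g (0, 0) = 0"
 proof -
  have "\<not> 0 < g (0, 0)" using loc'[of p] False r h by (simp add: linear_0[OF lin])
  moreover have "\<not> g (0, 0) < 0"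
  proof
   assume neg: "g (0, 0) < 0"
   define e where "e = min (min r h) (- g (0, 0) / (L + 2))"
   have e: "e > 0" using r h neg L0 by (simp add: e_def divide_neg_pos)
   obtain z where z: "z : \<Omega>" "dist z p < e" using x e closure_approachable by blast
   define y where "y = Q (z - p)"
   have ny: "norm y < e" using z(2) by (simp add: y_def iso dist_norm)
   have "norm (y $ 1, y $ 2) < e" "\<bar>y $ 3\<bar> < e" using pair[of y] ny by auto
   then have "y $ 3 < g (y $ 1, y $ 2)" using loc'[of z] z(1) by (simp add: y_def e_def)
   moreover have "g (y $ 1, y $ 2) <= g (0, 0) + L * e"
    using gL[of "(y $ 1, y $ 2)" "(0, 0)"] mult_left_mono[OF less_imp_le[OF \<open>norm (y $ 1, y $ 2) < e\<close>] L0] by simp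
   ultimately have "- e < g (0, 0) + L * e" using \<open>\<bar>y $ 3\<bar> < e\<close> by linarith
   moreover have "(L + 2) * e <= - g (0, 0)"
   proof -
    have "e <= - g (0, 0) / (L + 2)" by (simp add: e_def)
    then show ?thesis using L0 by (simp add: field_simps)
   qed
   ultimately show False using e by (simp add: algebra_simps)
  qed
  ultimately show ?thesis by simp
 qed
 \<comment> \<open>P = \<Lambda> \<rho> bounds the graph over the disc of radius \<rho>, and it is
   at least \<rho> because \<Lambda> is at least 1. The cylinder has half-height 8 P, which fits
   into h; the centre at depth 6 P leaves room for the ball of radius \<rho> / 2 between the heights
   -8 P and -5 P.\<close>
 define \<Lambda> where "\<Lambda> = L + 1"
 have \<Lambda>: "\<Lambda> >= 1" "L <= \<Lambda>" using L0 by (auto simp: \<Lambda>_def)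
 define \<rho> where "\<rho> = min r (h / (8 * \<Lambda>))"
 have \<rho>: "\<rho> > 0" "\<rho> <= r" "8 * \<Lambda> * \<rho> <= h"
 proof -
  show "\<rho> > 0" "\<rho> <= r" using r h \<Lambda> by (auto simp: \<rho>_def)
  have "\<rho> <= h / (8 * \<Lambda>)" by (simp add: \<rho>_def)
  then show "8 * \<Lambda> * \<rho> <= h" using \<Lambda> by (simp add: field_simps)
 qed
 define P where "P = \<Lambda> * \<rho>"
 have P: "P >= \<rho>" "L * \<rho> <= P" using \<Lambda> \<rho>(1) by (auto simp: P_def)
 have PL: "2 * L * \<rho> <= 2 * P" using P(2) by simp
 define V where "V y <-> norm (y $ 1, y $ 2) < \<rho> & \<bar>y $ 3\<bar> < 8 * P" for y :: "real^3"
 define U where "U = {x. V (Q (x - p))}"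
 have Qc: "continuous_on UNIV (%x. Q (x - p))"
  by (rule continuous_on_compose2[OF linear_continuous_on[of Q UNIV] continuous_on_diff[OF continuous_on_id continuous_on_const]])
   (use lin in \<open>auto simp: linear_conv_bounded_linear\<close>)
 have Uo: "open U"
 proof -
  have "continuous_on UNIV (%x. norm (Q (x - p) $ 1, Q (x - p) $ 2))" "continuous_on UNIV (%x. \<bar>Q (x - p) $ 3\<bar>)"
   using continuous_on_norm[OF continuous_on_Pair[OF continuous_on_component[OF Qc] continuous_on_component[OF Qc]]]
    continuous_on_rabs[OF continuous_on_component[OF Qc]] by blast+
  then show ?thesis unfolding U_def V_def by (intro open_Collect_conj open_Collect_less continuous_on_const)
 qed
 have D: "x : U \<inter> \<Omega> <-> V (Q (x - p)) & Q (x - p) $ 3 < g (Q (x - p) $ 1, Q (x - p) $ 2)" for x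
  using loc'[of x] \<rho> by (auto simp: U_def V_def P_def mult.assoc)
 obtain Qi where Qi: "!!v. Q (Qi v) = v" using orthogonal_transformation_surj[OF Q] by (metis surj_def)
 define ya :: "real^3" where "ya = axis 3 (- 6 * P)"
 have ya: "ya $ 1 = 0" "ya $ 2 = 0" "ya $ 3 = - 6 * P" by (simp_all add: ya_def axis_def)
 define a where "a = p + Qi ya"
 have Qa: "Q (b - p) = ya + Q (b - a)" for b
 proof -
  have "b - p = Qi ya + (b - a)" by (simp add: a_def)
  then show ?thesis by (simp only: linear_add[OF lin] Qi)
 qed
 have star: "(1 - t) *R x + t *R b : U \<inter> \<Omega>" if x: "x : U \<inter> \<Omega>" and b: "b : cball a (\<rho> / 2)" and t: "t : {0..1}" for x b t
 proof -
  define y where "y = Q (x - p)"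
  define \<beta> where "\<beta> = Q (b - p)"
  define z where "z = Q ((1 - t) *R x + t *R b - p)"
  have zz: "z = (1 - t) *R y + t *R \<beta>"
  proof -
   have "(1 - t) *R x + t *R b - p = (1 - t) *R (x - p) + t *R (b - p)" by (simp add: algebra_simps)
   then show ?thesis by (simp add: z_def y_def \<beta>_def linear_add[OF lin] linear_scale[OF lin])
  qed
  have y: "norm (y $ 1, y $ 2) < \<rho>" "\<bar>y $ 3\<bar> < 8 * P" "y $ 3 < g (y $ 1, y $ 2)" using x D by (auto simp: y_def V_def)
  have "norm (\<beta> - ya) <= \<rho> / 2" using b Qa[of b] iso by (simp add: \<beta>_def dist_norm norm_minus_commute)
  then have \<beta>: "norm (\<beta> $ 1, \<beta> $ 2) <= \<rho> / 2" "\<bar>\<beta> $ 3 + 6 * P\<bar> <= \<rho> / 2" using pair[of "\<beta> - ya"] ya by auto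
  have \<beta>3: "\<bar>\<beta> $ 3\<bar> < 8 * P" "\<beta> $ 3 <= - 5 * P" using \<beta>(2) P(1) \<rho>(1) by linarith+
  have zp: "(z $ 1, z $ 2) = (1 - t) *R (y $ 1, y $ 2) + t *R (\<beta> $ 1, \<beta> $ 2)" by (simp add: zz)
  have zn: "norm (z $ 1, z $ 2) < \<rho>"
  proof -
   have "(1 - t) *R (y $ 1, y $ 2) + t *R (\<beta> $ 1, \<beta> $ 2) : ball 0 \<rho>" using y(1) \<beta>(1) \<rho>(1) t by (intro convexD_alt[OF convex_ball]) auto
   then show ?thesis unfolding zp by simp
  qed
  have z3: "z $ 3 = (1 - t) * y $ 3 + t * \<beta> $ 3" by (simp add: zz)
  have zn3: "\<bar>z $ 3\<bar> < 8 * P"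
  proof -
   have "(1 - t) *R (y $ 3) + t *R (\<beta> $ 3) : ball 0 (8 * P)" using y(2) \<beta>3(1) t by (intro convexD_alt[OF convex_ball]) auto
   then show ?thesis unfolding z3 by simp
  qed
  \<comment> \<open>Below height -P no point can reach the graph. Otherwise the starting point is at
    height at least -P too, since the end point lies below -P, and the comparison of slopes
    applies.\<close>
  have "z $ 3 < g (z $ 1, z $ 2)"
  proof (cases "z $ 3 < - P")
   case True
   have "L * norm (z $ 1, z $ 2) <= L * \<rho>" using zn L0 by (intro mult_left_mono) auto
   then have "- P <= g (z $ 1, z $ 2)" using gL[of "(z $ 1, z $ 2)" "(0, 0)"] g0 P(2) by (simp add: abs_le_iff)
   then show ?thesis using True by simp
  next
   case F: False
   have "y $ 3 >= - P"
   proof (rule ccontr)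
    assume "\<not> ?thesis"
    then have "y $ 3 < - P" by simp
    moreover have "\<beta> $ 3 < - P" using \<beta>3(2) P(1) \<rho>(1) by linarith
    ultimately have "(1 - t) *R (y $ 3) + t *R (\<beta> $ 3) : {..< - P}" using t by (intro convexD_alt[OF convex_real_interval(4)]) auto
    then show False using F z3 by simp
   qed
   then have y3: "y $ 3 - \<beta> $ 3 >= 4 * P" using \<beta>3(2) by simp
   have "(z $ 1, z $ 2) - (y $ 1, y $ 2) = t *R ((\<beta> $ 1, \<beta> $ 2) - (y $ 1, y $ 2))" unfolding zp by (simp add: algebra_simps)
   then have "norm ((z $ 1, z $ 2) - (y $ 1, y $ 2)) = t * norm ((\<beta> $ 1, \<beta> $ 2) - (y $ 1, y $ 2))"
    using t norm_scaleR[of t "(\<beta> $ 1, \<beta> $ 2) - (y $ 1, y $ 2)"] by (simp only: abs_of_nonneg atLeastAtMost_iff)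
   also have "... <= t * (2 * \<rho>)"
    using norm_triangle_ineq4[of "(\<beta> $ 1, \<beta> $ 2)" "(y $ 1, y $ 2)"] y(1) \<beta>(1) \<rho>(1) t by (intro mult_left_mono) auto
   finally have "L * norm ((z $ 1, z $ 2) - (y $ 1, y $ 2)) <= L * (t * (2 * \<rho>))" using L0 by (rule mult_left_mono)
   also have "... = t * (2 * L * \<rho>)" by simp
   also have "... <= t * (2 * P)" using PL t by (intro mult_left_mono) auto
   finally have "g (z $ 1, z $ 2) >= g (y $ 1, y $ 2) - t * (2 * P)" using gL[of "(z $ 1, z $ 2)" "(y $ 1, y $ 2)"] by linarith
   moreover have "z $ 3 = y $ 3 - t * (y $ 3 - \<beta> $ 3)" using z3 by (simp add: algebra_simps)
   moreover have "t * (2 * P) <= t * (y $ 3 - \<beta> $ 3)" using y3 t P \<rho>(1) by (intro mult_left_mono) auto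
   ultimately show ?thesis using y(3) by linarith
  qed
  then show ?thesis unfolding D z_def[symmetric] V_def using zn zn3 by simp
 qed
 have "V ya" "ya $ 3 < g (ya $ 1, ya $ 2)" using P \<rho>(1) by (auto simp: V_def ya g0)
 then have "a : U \<inter> \<Omega>" unfolding D Qa[of a] by (simp add: linear_0[OF lin])
 then have "star_ball (U \<inter> \<Omega>) a (\<rho> / 2)" unfolding star_ball_def using star Uo o \<rho>(1) by (auto intro: bounded_subset)
 moreover have "p : U" using P \<rho>(1) by (simp add: U_def V_def linear_0[OF lin])
 ultimately show ?thesis using Uo by blast
qed

lemma lipschitz_domainD: "lipschitz_domain \<Omega> ==> open \<Omega> & bounded \<Omega> & \<Omega> : sets borel" by (auto simp: lipschitz_domain_def)

lemma lipschitz_domain_partition: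
 fixes \<Omega> :: "(real^3) set"
 assumes \<Omega>: "lipschitz_domain \<Omega>"
 obtains F :: "(real^3) set" and U a r \<zeta> where "finite F" "!!x. x : F ==> open (U x)"
  "!!x. x : F ==> star_ball (U x \<inter> \<Omega>) (a x) (r x)" "!!x. x : F ==> C1c (U x) (\<zeta> x)"
  "!!y. y : \<Omega> ==> (\<Sum>x\<in>F. \<zeta> x y) = (1::real)"
proof -
 have "ALL p:closure \<Omega>. EX U a r. open U & p : U & star_ball (U \<inter> \<Omega>) a r" using lipschitz_domain_star_cover[OF \<Omega>] by blast
 then obtain U a r where U: "!!p. p : closure \<Omega> ==> open (U p) & p : U p" "!!p. p : closure \<Omega> ==> star_ball (U p \<inter> \<Omega>) (a p) (r p)" by metis
 have "compact (closure \<Omega>)" using lipschitz_domainD[OF \<Omega>] by (simp add: compact_closure)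
 from C1_partition_of_unity[OF this U(1)] obtain F \<zeta> where "finite F" "F <= closure \<Omega>" "ALL x:F. C1c (U x) (\<zeta> x)" "ALL y:closure \<Omega>. (\<Sum>x\<in>F. \<zeta> x y) = (1::real)"
  by auto
 then show ?thesis using U closure_subset[of \<Omega>] by (intro that[of F U a r \<zeta>]) auto
qed

lemma C1c_bounded: assumes "C1c U \<zeta>" shows "EX B>=0. ALL x. \<bar>\<zeta> x\<bar> <= B"
proof -
 obtain K where K: "compact K" "!!x. x ~: K ==> \<zeta> x = 0" using C1c_obtain[OF assms] by metis
 from compact_imp_bounded[OF compact_continuous_image[OF C1_cont[OF C1c_C1[OF assms]] K(1)]]
 obtain B where "!!x. x : K ==> \<bar>\<zeta> x\<bar> <= B" by (auto simp: bounded_iff)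
 then show ?thesis using K(2) by (intro exI[of _ "max B 0"]) (metis abs_zero max.coboundedI1 max.cobounded2)
qed

lemma mulop_C1c_cls: "C1c U \<zeta> ==> sqi f ==> mulop \<zeta> (cls f) = cls (%x. \<zeta> x *R f x)"
 using C1c_bounded[of U \<zeta>] C1_bm[OF C1c_C1[of U \<zeta>]] by (auto intro!: mulop_cls)

lemma sqi_mulop_C1c: "C1c U \<zeta> ==> sqi f ==> sqi (%x. \<zeta> x *R f x)"
 using C1c_bounded[of U \<zeta>] C1_bm[OF C1c_C1[of U \<zeta>]] by (auto intro!: sqi_bdd_mult)

lemma partition_mulop:
 assumes F: "finite F" "!!x. x : F ==> C1c (U x) (\<zeta> x)" "!!y. y : \<Omega> ==> (\<Sum>x\<in>F. \<zeta> x y) = 1" and w: "w : L2on \<Omega>"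
 shows "(\<Sum>x\<in>F. mulop (\<zeta> x) w) = (w :: 'b::euclidean_space l2)"
proof -
 have "(\<Sum>x\<in>F. mulop (\<zeta> x) w) = (\<Sum>x\<in>F. cls (%y. \<zeta> x y *R rep w y))" using mulop_C1c_cls[OF F(2) sqi_rep, of _ w] by (intro sum.cong) auto
 also have "... = cls (%y. \<Sum>x\<in>F. \<zeta> x y *R rep w y)" by (rule cls_sum) (rule sqi_mulop_C1c[OF F(2) sqi_rep])
 also have "... = cls (rep w)"
 proof (rule cls_eqI)
  show "sqi (%y. \<Sum>x\<in>F. \<zeta> x y *R rep w y)" by (rule sqi_sum) (rule sqi_mulop_C1c[OF F(2) sqi_rep])
  from w show "AE y. (\<Sum>x\<in>F. \<zeta> x y *R rep w y) = rep w y" unfolding L2on_def mem_Collect_eq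
  proof eventually_elim
   case (elim y) then show ?case using F(3)[of y] by (cases "y : \<Omega>") (simp_all flip: scaleR_left.sum)
  qed
 qed simp
 finally show ?thesis by simp
qed

section \<open>The weak curl has closed range\<close>

lemma curl_compactness:
 assumes \<Omega>: "lipschitz_domain \<Omega>"
  and wc: "!!n. (w n, c n) : curlrel \<Omega>" and wb: "!!n. norm (w n) <= 1" and c0: "c ---> 0"
 shows "EX s g. strict_mono (s :: nat => nat) & (ALL n. (g n, 0) : curlrel \<Omega>) & convergent (%n. w (s n) - g n)"
proof (rule lipschitz_domain_partition[OF \<Omega>])
 note o = lipschitz_domainD[OF \<Omega>]
 note sub = curlrel_closed(2)[of \<Omega>]
 fix F :: "(real^3) set" and U a r \<zeta> assume F: "finite F" "!!x. x : F ==> open (U x)" "!!x. x : F ==> star_ball (U x \<inter> \<Omega>) (a x) (r x)"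
  "!!x. x : F ==> C1c (U x) (\<zeta> x)" "!!y. y : \<Omega> ==> (\<Sum>x\<in>F. \<zeta> x y) = 1"

 have "A <= F ==> EX s g. strict_mono (s :: nat => nat) & (ALL n. (g n, 0) : curlrel \<Omega>) & convergent (%n. (\<Sum>x\<in>A. mulop (\<zeta> x) (w (s n))) - g n)"
  if "finite A" for A using that
 proof induction
  case empty
  show ?case using subspace_0[OF sub] o by (intro exI[of _ "%n. n"] exI[of _ "%n. 0"]) (auto simp: strict_mono_def convergent_const zero_prod_def)
 next
  case (insert x A)
  then obtain s g where s: "strict_mono s" "!!n. (g n, 0) : curlrel \<Omega>" "convergent (%n. (\<Sum>x\<in>A. mulop (\<zeta> x) (w (s n))) - g n)" by auto
  have xF: "x : F" using insert by blast
  have "EX s' g'. strict_mono (s' :: nat => nat) & (ALL n. (g' n, 0) : curlrel \<Omega>) & convergent (%n. mulop (\<zeta> x) ((%n. w (s n)) (s' n)) - g' n)"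
  proof (rule curl_local_compactness[where c = "%n. c (s n)", OF _ _ F(2,3,4)[OF xF]])
   show "(%n. c (s n)) ---> 0" using LIMSEQ_subseq_LIMSEQ[OF c0 s(1)] by (simp add: o_def)
  qed (use o wc wb in auto)
  then obtain s' g' where s': "strict_mono s'" "!!n. (g' n, 0) : curlrel \<Omega>" "convergent (%n. mulop (\<zeta> x) (w (s (s' n))) - g' n)" by auto
  have "convergent (%n. (\<Sum>x\<in>A. mulop (\<zeta> x) (w (s (s' n)))) - g (s' n))" using convergent_subseq_convergent[OF s(3) s'(1)] by (simp add: o_def)
  from convergent_add[OF s'(3) this] have "convergent (%n. (\<Sum>x\<in>insert x A. mulop (\<zeta> x) (w (s (s' n)))) - (g' n + g (s' n)))"
   using insert(1,2) by (simp add: algebra_simps)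
  moreover have "(g' n + g (s' n), 0) : curlrel \<Omega>" for n using subspace_add[OF sub s'(2) s(2), of n "s' n"] o by simp
  moreover have "strict_mono (%n. s (s' n))" using strict_mono_compose[OF s(1) s'(1)] .
  ultimately show ?case by (intro exI[of _ "%n. s (s' n)"] exI[of _ "%n. g' n + g (s' n)"]) auto
 qed
 moreover have "w n : L2on \<Omega>" for n using wc by (auto simp: curlrel_def)
 then have "(\<Sum>x\<in>F. mulop (\<zeta> x) (w n)) = w n" for n using partition_mulop[OF F(1,4,5)] by blast
 ultimately show ?thesis using F(1) by fastforce
qed

text \<open>By contradiction, with unit fields orthogonal to the curl-free ones whose curls tend to
  0. \<open>curl_compactness\<close> yields convergence only after subtracting curl-free fields, but
  by Pythagoras the subtraction cannot decrease distances, so the fields themselves are Cauchy.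
  Their limit is curl-free and orthogonal to itself, yet of norm 1.\<close>

lemma curl_estimate:
 assumes \<Omega>: "lipschitz_domain \<Omega>"
 shows "EX C>0. ALL w c. (w, c) : curlrel \<Omega> --> (ALL g. (g, 0) : curlrel \<Omega> --> inner w g = 0) --> norm w <= C * norm c"
proof (rule ccontr)
 assume n: "\<not> ?thesis"
 have cr: "closed (curlrel \<Omega>)" "subspace (curlrel \<Omega>)" using curlrel_closed[of \<Omega>] lipschitz_domainD[OF \<Omega>] by auto
 have "ALL n::nat. EX w c. (w, c) : curlrel \<Omega> & (ALL g. (g, 0) : curlrel \<Omega> --> inner w g = 0) & norm w > (real n + 1) * norm c"
  using n by (metis add_nonneg_pos linorder_not_le of_nat_0_le_iff zero_less_one)
 then obtain w c where w: "!!n. (w n, c n) : curlrel \<Omega>" "!!n g. (g, 0) : curlrel \<Omega> ==> inner (w n) g = 0"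
  "!!n::nat. norm (w n) > (real n + 1) * norm (c n)" by metis
 have pos: "norm (w n) > 0" for n using w(3)[of n] by (smt (verit) mult_nonneg_nonneg norm_ge_zero of_nat_0_le_iff)
 define v where "v n = (1 / norm (w n)) *R w n" for n
 define d where "d n = (1 / norm (w n)) *R c n" for n
 have v: "(v n, d n) : curlrel \<Omega>" "norm (v n) = 1" for n using subspace_scale[OF cr(2) w(1), of "1 / norm (w n)" n] pos[of n] by (simp_all add: v_def d_def)
 have vg: "inner (v n) g = 0" if "(g, 0) : curlrel \<Omega>" for n g using w(2)[OF that] by (simp add: v_def)
 have "d ---> 0"
 proof (rule tendsto_norm_zero_cancel, rule tendsto_sandwich[OF _ _ tendsto_const LIMSEQ_inverse_real_of_nat])
  have "norm (d n) <= inverse (real (Suc n))" for n using w(3)[of n] pos[of n] by (simp add: d_def field_simps)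
  then show "\<forall>\<^sub>F n in sequentially. norm (d n) <= inverse (real (Suc n))" by simp
 qed simp
 from curl_compactness[OF \<Omega> v(1) eq_refl[OF v(2)] this]
 obtain s g where s: "strict_mono (s :: nat => nat)" "!!n. (g n, 0) : curlrel \<Omega>" "convergent (%n. v (s n) - g n)" by auto
 have cmp: "norm (v (s m) - v (s n)) <= norm ((v (s m) - g m) - (v (s n) - g n))" for m n
 proof -
  have g: "(g m - g n, 0) : curlrel \<Omega>" using subspace_diff[OF cr(2) s(2) s(2), of m n] by simp
  have "orthogonal (v (s m) - v (s n)) (- (g m - g n))" unfolding orthogonal_def using vg[OF g] by (simp add: inner_diff_left inner_diff_right)
  from norm_add_Pythagorean[OF this]
  have "(norm (v (s m) - v (s n)))^2 <= (norm ((v (s m) - v (s n)) + - (g m - g n)))^2" by simp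
  then have "norm (v (s m) - v (s n)) <= norm ((v (s m) - v (s n)) + - (g m - g n))" by (rule power2_le_imp_le) simp
  then show ?thesis by (simp add: algebra_simps)
 qed
 have "Cauchy (%n. v (s n))"
 proof (rule metric_CauchyI)
  fix e :: real assume "0 < e"
  from metric_CauchyD[OF convergent_Cauchy[OF s(3)] this]
  obtain M where "ALL m>=M. ALL n>=M. dist (v (s m) - g m) (v (s n) - g n) < e" by blast
  then show "EX M. ALL m>=M. ALL n>=M. dist (v (s m)) (v (s n)) < e" using cmp unfolding dist_norm by (meson le_less_trans)
 qed
 then obtain W where W: "(%n. v (s n)) ---> W" by (auto simp: Cauchy_convergent_iff convergent_def)
 have "(%n. d (s n)) ---> 0" using LIMSEQ_subseq_LIMSEQ[OF \<open>d ---> 0\<close> s(1)] by (simp add: o_def)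
 from closed_sequentially[OF cr(1) _ tendsto_Pair[OF W this]] v(1) have W0: "(W, 0) : curlrel \<Omega>" by blast
 have "(%n. inner (v (s n)) W) ---> inner W W" by (intro tendsto_intros W)
 then have "inner W W = 0" using vg[OF W0] LIMSEQ_unique[OF _ tendsto_const] by fastforce
 moreover have "norm W = 1" using tendsto_norm[OF W] v(2) LIMSEQ_unique[OF _ tendsto_const] by fastforce
 ultimately show False by simp
qed

text \<open>Preimages are made orthogonal to the curl-free fields; there
  \<open>curl_estimate\<close> turns convergence of the curls into a Cauchy property of the
  preimages, and the graph is closed.\<close>

lemma curl_range_closed:
 assumes \<Omega>: "lipschitz_domain \<Omega>"
 shows "closed (snd ` curlrel \<Omega>)" "subspace (snd ` curlrel \<Omega>)"
proof -
 have cr: "closed (curlrel \<Omega>)" "subspace (curlrel \<Omega>)" using curlrel_closed[of \<Omega>] lipschitz_domainD[OF \<Omega>] by auto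
 show "subspace (snd ` curlrel \<Omega>)" by (rule linear_subspace_image[OF linear_snd cr(2)])
 define Z where "Z = {g. (g, 0) : curlrel \<Omega>}"
 have Z: "closed Z" "subspace Z"
 proof -
  have "closed ((%g. (g, 0)) -` curlrel \<Omega>)" by (rule closed_vimage[OF cr(1)]) (intro continuous_intros)
  then show "closed Z" by (simp add: Z_def vimage_def)
  have "linear (%g :: (real^3) l2. (g, 0 :: (real^3) l2))" by (intro bounded_linear.linear bounded_linear_Pair bounded_linear_ident bounded_linear_zero)
  from linear_subspace_vimage[OF this cr(2)] show "subspace Z" by (simp add: Z_def vimage_def)
 qed
 obtain C where C: "C > 0" "!!w c. (w, c) : curlrel \<Omega> ==> (!!g. g : Z ==> inner w g = 0) ==> norm w <= C * norm c"
  using curl_estimate[OF \<Omega>] unfolding Z_def by blast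
 show "closed (snd ` curlrel \<Omega>)" unfolding closed_sequential_limits
 proof (intro allI impI, elim conjE)
  fix c l assume c: "ALL n. c n : snd ` curlrel \<Omega>" and l: "c ---> l"
  have "EX w. (w, c n) : curlrel \<Omega> & (ALL g:Z. inner w g = 0)" for n
  proof -
   obtain w where w: "(w, c n) : curlrel \<Omega>" using c by force
   obtain p where p: "p : Z" "ALL y:Z. inner (w - p) y = 0" using hilbert_projection[OF Z] by blast
   have "(w - p, c n - 0) : curlrel \<Omega>" using subspace_diff[OF cr(2) w, of "(p, 0)"] p(1) by (simp add: Z_def)
   then show ?thesis using p(2) by auto
  qed
  then obtain w where w: "!!n. (w n, c n) : curlrel \<Omega>" "!!n g. g : Z ==> inner (w n) g = 0" by metis
  have le: "norm (w m - w n) <= C * norm (c m - c n)" for m n using subspace_diff[OF cr(2) w(1) w(1), of m n] w(2) by (intro C(2)) (auto simp: inner_diff_left)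
  have "Cauchy w"
  proof (rule metric_CauchyI)
   fix e :: real assume e: "0 < e"
   from metric_CauchyD[OF LIMSEQ_imp_Cauchy[OF l], of "e / C"] C(1) e
   obtain M where M: "!!m n. m >= M ==> n >= M ==> norm (c m - c n) < e / C" by (auto simp: dist_norm)
   have "norm (w m - w n) < e" if "m >= M" "n >= M" for m n using le[of m n] M[OF that] C(1) by (simp add: field_simps)
   then show "EX M. ALL m>=M. ALL n>=M. dist (w m) (w n) < e" by (auto simp: dist_norm)
  qed
  then obtain W where "w ---> W" by (auto simp: Cauchy_convergent_iff convergent_def)
  from closed_sequentially[OF cr(1) _ tendsto_Pair[OF this l]] w(1) show "l : snd ` curlrel \<Omega>" by force
 qed
qed

text \<open>The admissible corrections of the electric field: for a field E in
  \<open>L2on \<Omega>\<close>, having the same inner products with all curls as E0 means that E -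
  E0 belongs to this space.\<close>

definition curlperp :: "(real^3) set => (real^3) l2 set" where
 "curlperp \<Omega> = {e : L2on \<Omega>. ALL w c. (w, c) : curlrel \<Omega> --> inner e c = 0}"

lemma curlperp_closed:
 assumes "\<Omega> : sets borel" shows "closed (curlperp \<Omega>)" "subspace (curlperp \<Omega>)"
proof -
 have e: "curlperp \<Omega> = L2on \<Omega> \<inter> {e. ALL w c. (w, c) : curlrel \<Omega> --> inner e c = 0}" by (auto simp: curlperp_def)
 show "closed (curlperp \<Omega>)" unfolding e
  by (intro closed_Int L2on_closed(1)[OF assms] closed_Collect_all closed_Collect_imp open_Collect_const closed_Collect_eq continuous_intros)
 show "subspace (curlperp \<Omega>)" using L2on_closed(2)[OF assms, where 'b = "real^3"] by (auto simp: subspace_def curlperp_def inner_add_left)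
qed

text \<open>Closedness of the range is used here: the difference between \<open>C\<close> and its
  projection onto the curls lies in \<open>curlperp\<close>, hence is orthogonal to itself.\<close>

lemma curlperp_perp:
 assumes \<Omega>: "lipschitz_domain \<Omega>" and C: "C : L2on \<Omega>" "!!e. e : curlperp \<Omega> ==> inner C e = 0"
 shows "EX w. (w, C) : curlrel \<Omega>"
proof -
 note o = lipschitz_domainD[OF \<Omega>]
 obtain p where p: "p : snd ` curlrel \<Omega>" "ALL y:snd ` curlrel \<Omega>. inner (C - p) y = 0" using hilbert_projection[OF curl_range_closed[OF \<Omega>]] by blast
 have "p : L2on \<Omega>" using p(1) by (auto simp: curlrel_def)
 then have "C - p : L2on \<Omega>" using subspace_diff[OF L2on_closed(2)] C(1) o by blast
 then have "C - p : curlperp \<Omega>" using p(2) by (force simp: curlperp_def)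
 then have "inner C (C - p) = 0" by (rule C(2))
 moreover have "inner (C - p) p = 0" using p by blast
 ultimately have "inner (C - p) (C - p) = 0" by (simp add: inner_diff_left inner_diff_right inner_commute)
 then show ?thesis using p(1) by force
qed

section \<open>Potentials and the complement of the curls\<close>

text \<open>Pairs of a class and its gradient class. As a closure of compactly supported functions
  it needs neither a trace nor a separate proof of completeness.\<close>

definition h10 :: "(real^3) set => (real l2 \<times> (real^3) l2) set" where
 "h10 \<Omega> = closure {(cls \<phi>, cls (grad \<phi>)) |\<phi>. C1c \<Omega> \<phi>}"

lemma h10_iff: "(v, g) : h10 \<Omega> <-> (\<exists>\<phi>. (ALL n. C1c \<Omega> (\<phi> n)) & (%n. cls (\<phi> n)) ---> v & (%n. cls (grad (\<phi> n))) ---> g)"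
proof
 assume "(v, g) : h10 \<Omega>"
 then obtain x where x: "!!n. x n : {(cls \<phi>, cls (grad \<phi>)) |\<phi>. C1c \<Omega> \<phi>}" "x ---> (v, g)" unfolding h10_def closure_sequential by blast
 from x(1) have "ALL n. \<exists>\<phi>. C1c \<Omega> \<phi> & x n = (cls \<phi>, cls (grad \<phi>))" by blast
 then obtain \<phi> where \<phi>: "!!n. C1c \<Omega> (\<phi> n)" "!!n. x n = (cls (\<phi> n), cls (grad (\<phi> n)))" by metis
 have "x = (%n. (cls (\<phi> n), cls (grad (\<phi> n))))" using \<phi>(2) by blast
 then show "\<exists>\<phi>. (ALL n. C1c \<Omega> (\<phi> n)) & (%n. cls (\<phi> n)) ---> v & (%n. cls (grad (\<phi> n))) ---> g"
  using tendsto_fst[OF x(2)] tendsto_snd[OF x(2)] \<phi>(1) by (intro exI[of _ \<phi>]) simp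
next
 assume "\<exists>\<phi>. (ALL n. C1c \<Omega> (\<phi> n)) & (%n. cls (\<phi> n)) ---> v & (%n. cls (grad (\<phi> n))) ---> g"
 then obtain \<phi> where \<phi>: "!!n. C1c \<Omega> (\<phi> n)" "(%n. cls (\<phi> n)) ---> v" "(%n. cls (grad (\<phi> n))) ---> g" by blast
 show "(v, g) : h10 \<Omega>" unfolding h10_def closure_sequential
  by (intro exI[of _ "%n. (cls (\<phi> n), cls (grad (\<phi> n)))"] conjI allI tendsto_Pair \<phi>(2,3)) (use \<phi>(1) in blast)
qed

lemma C1c_h10: "C1c \<Omega> \<phi> ==> (cls \<phi>, cls (grad \<phi>)) : h10 \<Omega>" unfolding h10_iff by (intro exI[of _ "%n. \<phi>"]) simp

text \<open>Stated for a general additive map because it serves twice, for pairs in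
  \<open>h10\<close> and for triples in \<open>jspace\<close>.\<close>

lemma C1c_closure_subspace:
 fixes L :: "(real^3 => real) => 'a::real_normed_vector"
 assumes add: "!!\<phi> \<psi>. C1c \<Omega> \<phi> ==> C1c \<Omega> \<psi> ==> L (%x. \<phi> x + \<psi> x) = L \<phi> + L \<psi>"
  and scale: "!!\<phi> c. C1c \<Omega> \<phi> ==> L (%x. c * \<phi> x) = c *R L \<phi>"
 shows "subspace (closure (L ` Collect (C1c \<Omega>)))"
proof -
 let ?S = "L ` Collect (C1c \<Omega>)"
 have S: "x + y : ?S" "c *R x : ?S" if "x : ?S" "y : ?S" for x y c using that add[symmetric] scale[symmetric] C1c_add C1c_cmult by (auto intro!: imageI)
 have "0 : ?S" using scale[OF C1c_zero, of 0] C1c_zero by (force intro: image_eqI)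
 then show ?thesis unfolding subspace_def
 proof (intro conjI ballI allI)
  fix x y c assume "x : closure ?S" "y : closure ?S"
  then obtain f g where f: "!!n. f n : ?S" "f ---> x" and g: "!!n. g n : ?S" "g ---> y" unfolding closure_sequential by metis
  show "x + y : closure ?S" unfolding closure_sequential by (intro exI[of _ "%n. f n + g n"] conjI allI S(1) f g tendsto_add)
  show "c *R x : closure ?S" unfolding closure_sequential by (intro exI[of _ "%n. c *R f n"] conjI allI S(2)[OF f(1) f(1)] f(2) tendsto_scaleR tendsto_const)
 qed (use closure_subset[of ?S] in auto)
qed

lemma h10_closed: "closed (h10 \<Omega>)" "subspace (h10 \<Omega>)"
proof -
 show "closed (h10 \<Omega>)" by (simp add: h10_def)
 have e: "h10 \<Omega> = closure ((%\<phi>. (cls \<phi>, cls (grad \<phi>))) ` Collect (C1c \<Omega>))" unfolding h10_def by (rule arg_cong[of _ _ closure]) auto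
 show "subspace (h10 \<Omega>)" unfolding e
 proof (rule C1c_closure_subspace)
  fix \<phi> \<psi> assume \<phi>: "C1c \<Omega> \<phi>" and \<psi>: "C1c \<Omega> \<psi>"
  show "(cls (%x. \<phi> x + \<psi> x), cls (grad (%x. \<phi> x + \<psi> x))) = (cls \<phi>, cls (grad \<phi>)) + (cls \<psi>, cls (grad \<psi>))"
   using C1c_sqi[OF \<phi>] C1c_sqi[OF \<psi>] by (simp add: cls_add C1_add(2)[OF C1c_C1[OF \<phi>] C1c_C1[OF \<psi>]])
  show "(cls (%x. c * \<phi> x), cls (grad (%x. c * \<phi> x))) = c *R (cls \<phi>, cls (grad \<phi>))" for c
   using C1c_sqi[OF \<phi>] by (simp add: cls_scaleR C1_cmult(2)[OF C1c_C1[OF \<phi>]])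
 qed
qed

lemma h10_poincare: "R > 0 ==> EX C>0. ALL v g. (v, g) : h10 (ball 0 R) --> norm v <= C * norm g"
proof -
 assume "R > 0"
 then obtain C where C: "C > 0" "!!\<phi>. C1c (ball 0 R) \<phi> ==> l2n \<phi> <= C * l2n (grad \<phi>)" using poincare_ball by blast
 have "norm v <= C * norm g" if vg: "(v, g) : h10 (ball 0 R)" for v g
 proof -
  obtain \<phi> where \<phi>: "!!n. C1c (ball 0 R) (\<phi> n)" "(%n. cls (\<phi> n)) ---> v" "(%n. cls (grad (\<phi> n))) ---> g" using vg unfolding h10_iff by metis
  show ?thesis by (rule LIMSEQ_le[OF tendsto_norm[OF \<phi>(2)] tendsto_mult[OF tendsto_const tendsto_norm[OF \<phi>(3)]]]) (use C(2)[OF \<phi>(1)] in blast)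
 qed
 then show ?thesis using C(1) by blast
qed

text \<open>Poincare's inequality makes convergence of the gradients alone sufficient.\<close>

lemma h10_complete:
 assumes R: "R > 0" and \<phi>: "!!n. C1c (ball 0 R) (\<phi> n)" and g: "(%n. cls (grad (\<phi> n))) ---> g"
 shows "EX v. (v, g) : h10 (ball 0 R) & (%n. cls (\<phi> n)) ---> v"
proof -
 obtain C where C: "C > 0" "!!v g. (v, g) : h10 (ball 0 R) ==> norm v <= C * norm g" using h10_poincare[OF R] by blast
 have le: "norm (cls (\<phi> m) - cls (\<phi> n)) <= C * norm (cls (grad (\<phi> m)) - cls (grad (\<phi> n)))" for m n
  using subspace_diff[OF h10_closed(2) C1c_h10[OF \<phi>] C1c_h10[OF \<phi>], of m n] by (intro C(2)) simp
 have "Cauchy (%n. cls (\<phi> n))"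
 proof (rule metric_CauchyI)
  fix e :: real assume e: "0 < e"
  from metric_CauchyD[OF LIMSEQ_imp_Cauchy[OF g], of "e / C"] C(1) e
  obtain M where M: "!!m n. m >= M ==> n >= M ==> norm (cls (grad (\<phi> m)) - cls (grad (\<phi> n))) < e / C" by (auto simp: dist_norm)
  have "norm (cls (\<phi> m) - cls (\<phi> n)) < e" if "m >= M" "n >= M" for m n using le[of m n] M[OF that] C(1) by (simp add: field_simps)
  then show "EX M. ALL m>=M. ALL n>=M. dist (cls (\<phi> m)) (cls (\<phi> n)) < e" by (auto simp: dist_norm)
 qed
 then obtain v where v: "(%n. cls (\<phi> n)) ---> v" by (auto simp: Cauchy_convergent_iff convergent_def)
 then have "(v, g) : h10 (ball 0 R)" unfolding h10_iff using \<phi> g by blast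
 then show ?thesis using v by blast
qed

lemma h10_curlrel:
 assumes "(v, g) : h10 \<Omega>" shows "(g, 0) : curlrel UNIV"
proof -
 obtain \<phi> where \<phi>: "!!n. C1c \<Omega> (\<phi> n)" "(%n. cls (grad (\<phi> n))) ---> g" using assms unfolding h10_iff by metis
 have "inner (cls (grad (\<phi> n))) (cls (gcross f b)) = 0" if f: "C1c UNIV f" for n f b
  using inner_cls[OF C1c_sqi(2)[OF \<phi>(1)] sqi_cross[OF C1c_sqi(2)[OF f]], of n b] integral_grad_cross_grad[OF C1c_C1[OF \<phi>(1)] f, of n b] by simp
 then have "(cls (grad (\<phi> n)), 0) : curlrel UNIV" for n by (auto simp: curlrel_def L2on_def)
 then show ?thesis using closed_sequentially[OF curlrel_closed(1) _ tendsto_Pair[OF \<phi>(2) tendsto_const[of 0]], of UNIV] by simp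
qed

lemma mollify_AE_cong:
 assumes "d ~= 0" "f : BM" "g : BM" "AE x. f x = g x"
 shows "mollify l a d f = mollify l a d (g :: real^3 => 'b::euclidean_space)"
proof
 fix x
 have "kern d : BM" using kern_props(2)[OF assms(1)] by (rule C1_bm)
 then show "mollify l a d f x = mollify l a d g x" unfolding mollify_eq_convol[OF assms(1)] convol_def
  using assms(2-4) by (intro integral_cong_AE) (measurable, auto elim: eventually_mono)
qed

lemma cls_rst: "u : L2on \<Omega> ==> \<Omega> : sets borel ==> AE x. rst \<Omega> (rep u) x = rep u x" "u : L2on \<Omega> ==> \<Omega> : sets borel ==> cls (rst \<Omega> (rep u)) = u"
proof -
 assume u: "u : L2on \<Omega>" "\<Omega> : sets borel"
 then show "AE x. rst \<Omega> (rep u) x = rep u x" unfolding L2on_def by (auto simp: indicator_def elim: eventually_mono)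
 then show "cls (rst \<Omega> (rep u)) = u" using cls_eqI[OF sqi_indicator[OF sqi_rep u(2)] sqi_rep] by force
qed

lemma inner_cls_rst:
 assumes "sqi (rst \<Omega> f)" "sqi g" "!!x. x ~: \<Omega> ==> g x = 0"
 shows "inner (cls (rst \<Omega> f)) (cls g) = (\<integral>x. f x \<bullet> g x)"
 unfolding inner_cls[OF assms(1,2)] by (rule lint_cong) (use assms(3) in \<open>auto simp: indicator_def\<close>)

lemma C1_scale_curlrel:
 assumes \<Omega>: "\<Omega> : sets borel" and f: "C1c UNIV f"
 shows "(cls (rst \<Omega> (%x. f x *R b)), cls (rst \<Omega> (gcross f b))) : curlrel \<Omega>"
proof -
 have s: "sqi (rst \<Omega> (%x. f x *R b))" "sqi (rst \<Omega> (gcross f b))" by (intro sqi_indicator \<Omega> sqi_scale sqi_cross C1c_sqi[OF f])+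
 have "inner (cls (rst \<Omega> (%x. f x *R b))) (cls (%x. cross3 (grad \<phi> x) d)) = inner (cls (rst \<Omega> (gcross f b))) (cls (%x. \<phi> x *R d))"
  if \<phi>: "C1c \<Omega> \<phi>" for \<phi> d
 proof -
  have K: "\<phi> x = 0" "grad \<phi> x = 0" if "x ~: \<Omega>" for x using that C1c_obtain[OF \<phi>] by (metis subsetD)+
  define m where "m = cross3 d b"
  note ip = C1c_integration_by_parts[OF C1c_C1[OF f] C1c_mono[OF \<phi> subset_UNIV]]
  have "inner (cls (rst \<Omega> (%x. f x *R b))) (cls (%x. cross3 (grad \<phi> x) d)) = (\<integral>x. (f x *R b) \<bullet> cross3 (grad \<phi> x) d)"
   by (rule inner_cls_rst[OF s(1) sqi_cross[OF C1c_sqi(2)[OF \<phi>]]]) (use K in auto)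
  also have "... = (\<integral>x. m $ 1 * (f x * pd 1 \<phi> x) + m $ 2 * (f x * pd 2 \<phi> x) + m $ 3 * (f x * pd 3 \<phi> x))"
   by (rule arg_cong[of _ _ "integral\<^sup>L lborel"]) (auto simp: m_def cross3_simps)
  also have "... = (\<integral>x. - (m $ 1 * (\<phi> x * pd 1 f x) + m $ 2 * (\<phi> x * pd 2 f x) + m $ 3 * (\<phi> x * pd 3 f x)))" by (simp add: ip)
  also have "... = (\<integral>x. cross3 (grad f x) b \<bullet> (\<phi> x *R d))" by (rule arg_cong[of _ _ "integral\<^sup>L lborel"]) (auto simp: m_def cross3_simps)
  also have "... = inner (cls (rst \<Omega> (gcross f b))) (cls (%x. \<phi> x *R d))"
   by (rule inner_cls_rst[OF s(2) sqi_scale[OF C1c_sqi(1)[OF \<phi>]], symmetric]) (use K in auto)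
  finally show ?thesis .
 qed
 moreover have "cls (rst \<Omega> (%x. f x *R b)) : L2on \<Omega>" "cls (rst \<Omega> (gcross f b)) : L2on \<Omega>" unfolding L2on_cls[OF s(1)] L2on_cls[OF s(2)] by auto
 ultimately show ?thesis unfolding curlrel_def by blast
qed

text \<open>The test fields f b, restricted to \<Omega>, belong to the domain of the weak curl
  without vanishing at the boundary. Orthogonality to their curls says that the zero extension of
  \<open>e\<close> has no surface curl, which is the vanishing tangential trace.\<close>

lemma curlperp_curl_free:
 assumes \<Omega>: "\<Omega> : sets borel" and e: "e : curlperp \<Omega>"
 shows "(e, 0) : curlrel UNIV"
proof -
 have "inner e (cls (gcross \<phi> b)) = 0" if \<phi>: "C1c UNIV \<phi>" for \<phi> b
 proof -
  have s: "sqi (gcross \<phi> b)" by (rule sqi_cross[OF C1c_sqi(2)[OF \<phi>]])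
  have eL: "e : L2on \<Omega>" using e by (simp add: curlperp_def)
  have "inner e (cls (gcross \<phi> b)) = (\<integral>x. rst \<Omega> (rep e) x \<bullet> cross3 (grad \<phi> x) b)"
   using inner_cls[OF sqi_indicator[OF sqi_rep \<Omega>] s, of e] cls_rst(2)[OF eL \<Omega>] by simp
  also have "... = (\<integral>x. rep e x \<bullet> rst \<Omega> (gcross \<phi> b) x)" by simp
  also have "... = inner e (cls (rst \<Omega> (gcross \<phi> b)))" using inner_cls[OF sqi_rep sqi_indicator[OF s \<Omega>], of e] by simp
  also have "... = 0" using e C1_scale_curlrel[OF \<Omega> \<phi>] by (auto simp: curlperp_def)
  finally show ?thesis .
 qed
 then show ?thesis by (auto simp: curlrel_def L2on_def)
qed

lemma curl_mollify_0:
 assumes e: "(e, 0) : curlrel UNIV" and d: "d ~= 0"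
 shows "curl (mollify l a d (rep e)) x = 0"
proof -
 have "mollify l a d (rep (0 :: (real^3) l2)) = mollify l a d (%x. 0)" by (rule mollify_AE_cong[OF d _ _ rep_zero]) auto
 then show ?thesis using curl_mollify[OF e order_refl _ d, of l x a] by (simp add: mollify_def)
qed

text \<open>The mollified field is C1 and curl-free on all of space, so it has a potential. Off the
  ball of radius R + 1 the field is 0 and the complement of that ball is connected, so the potential
  is constant there and is normalized to 0 at \<open>x0\<close>. On cavities enclosed by \<Omega>
  other constants may remain, which is why the conclusion speaks of a ball and not of
  \<Omega>.\<close>

lemma curlperp_potential:
 assumes \<Omega>: "\<Omega> : sets borel" "\<Omega> <= ball 0 R" and R: "R > 0" and e: "e : curlperp \<Omega>"
 shows "\<exists>\<psi>. (\<psi>, e) : h10 (ball 0 (R + 2))"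
proof -
 define d where "d n = 1 / real (Suc n)" for n
 have d: "d n > 0" "d n <= 1" for n by (auto simp: d_def)
 have d0: "d ---> 0" using LIMSEQ_inverse_real_of_nat by (simp add: d_def[abs_def] inverse_eq_divide)
 have eL: "e : L2on \<Omega>" using e by (simp add: curlperp_def)
 define E where "E n = mollify 1 0 (d n) (rep e)" for n
 have E2: "E n = mollify 1 0 (d n) (rst \<Omega> (rep e))" for n
  unfolding E_def by (rule mollify_AE_cong) (use d(1)[of n] \<Omega>(1) cls_rst(1)[OF eL \<Omega>(1)] in \<open>auto elim: eventually_mono\<close>)
 have E0: "E n x = 0" if "norm x > R + 1" for n x
 proof -
  have "bump z *R rst \<Omega> (rep e) (1 *R x + 0 + d n *R z) = 0" for z
  proof (cases "norm z > 1")
   case False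
   have "d n * norm z <= 1 * 1" using d[of n] False by (intro mult_mono) auto
   then have "norm (x + d n *R z) > R" using norm_diff_ineq[of x "d n *R z"] that d(1)[of n] by simp
   then have "x + d n *R z ~: \<Omega>" using \<Omega>(2) by (auto simp: subset_iff)
   then show ?thesis by simp
  qed (simp add: bump(3))
  then show ?thesis unfolding E2 mollify_def by (simp only: integral_zero)
 qed
 have "C1v (E n)" for n unfolding C1v_def E_def using C1_mollify_vec[OF _ sqi_rep] d(1)[of n] by simp
 then have "EX p. C1 p & (ALL x. grad p x = E n x - homotopy 0 (curl (E n)) x)" for n by (rule poincare_lemma)
 moreover have "curl (E n) = (%x. 0)" for n unfolding E_def using curl_mollify_0[OF curlperp_curl_free[OF \<Omega>(1) e]] d(1)[of n] by auto
 ultimately have "EX p. C1 p & grad p = E n" for n by (simp add: homotopy_def fun_eq_iff)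
 then obtain p where p: "!!n. C1 (p n)" "!!n. grad (p n) = E n" by metis
 define x0 :: "real^3" where "x0 = axis 1 (R + 2)"
 have x0: "norm x0 > R + 1" using R by (simp add: x0_def norm_axis_real)
 define \<phi> where "\<phi> n x = p n x + - p n x0" for n x
 have \<phi>1: "C1 (\<phi> n)" "grad (\<phi> n) = E n" for n using C1_add[OF p(1) C1_const(1), of n "- p n x0"] p(2) by (simp_all add: \<phi>_def[abs_def] C1_const(2))
 have "\<phi> n x = 0" if x: "norm x > R + 1" for n x
 proof -
  have con: "connected (- cball (0::real^3) (R + 1))" by (rule connected_complement_bounded_convex) auto
  have "(\<phi> n has_derivative (%h. 0)) (at y)" if "R + 1 < norm y" for y using C1_derivative[OF \<phi>1(1), of n y UNIV] E0[OF that] \<phi>1(2) by simp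
  then have "\<phi> n x = \<phi> n x0" by (intro has_derivative_zero_unique_connected[OF _ con, of "\<phi> n" x x0]) (use x x0 in auto)
  then show ?thesis by (simp add: \<phi>_def)
 qed
 then have \<phi>c: "C1c (ball 0 (R + 2)) (\<phi> n)" for n by (intro C1cI[OF \<phi>1(1), of "cball 0 (R + 1)"]) auto
 have "(%n. cls (E n)) ---> cls (rep e)" unfolding E_def
  by (rule mollify_tendsto[OF sqi_rep tendsto_const tendsto_const d0]) (use d in \<open>auto simp: less_imp_neq[symmetric] abs_of_pos less_imp_le\<close>)
 then have "(%n. cls (grad (\<phi> n))) ---> e" by (simp add: \<phi>1(2))
 then show ?thesis using h10_complete[OF _ \<phi>c] R by fastforce
qed

lemma sqi_cross_bdd:
 assumes w: "sqi w" and g: "g : BM" "!!x. norm (g x) <= B"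
 shows "sqi (%x. cross3 (w x) (g x))"
proof (rule sqi_mono[OF _ sqi_scaleR[OF w, of B]])
 note [measurable] = sqi_bm[OF w] g(1)
 have "(%x. cross3 (w x) (g x)) = (%x. \<chi> i. cross3 (w x) (g x) $ i)" by (simp add: vec_eq_iff fun_eq_iff)
 have "continuous_on UNIV (%p. cross3 (fst p) (snd p :: real^3))" by (intro continuous_intros)
 from measurable_compose[OF _ bm_cont[OF this], of "%x. (w x, g x)" borel]
 show "(%x. cross3 (w x) (g x)) : BM" by (simp add: borel_prod[symmetric])
 have "norm (cross3 (w x) (g x)) <= norm (B *R w x)" for x
  using norm_cross_le[of "w x" "g x"] mult_left_mono[OF order_trans[OF g(2) abs_ge_self], of "norm (w x)" x] by (simp add: mult.commute)
 then show "AE x. norm (cross3 (w x) (g x)) <= norm (B *R w x)" by simp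
qed

lemma C1c_grad_bounded: assumes "C1c U \<zeta>" shows "EX B. ALL x. norm (grad \<zeta> x) <= B"
proof -
 obtain K where K: "compact K" "!!x. x ~: K ==> grad \<zeta> x = 0" using C1c_obtain[OF assms] by metis
 from compact_imp_bounded[OF compact_continuous_image[OF C1_cont_grad[OF C1c_C1[OF assms]] K(1)]]
 obtain B where "!!x. x : K ==> norm (grad \<zeta> x) <= B" by (auto simp: bounded_iff)
 then show ?thesis using K(2) by (intro exI[of _ "max B 0"]) (metis norm_zero max.coboundedI1 max.cobounded2)
qed

lemma sum_cross_axis:
 assumes "C1 \<zeta>" "C1v E"
 shows "(\<Sum>k\<in>UNIV. cross3 (grad (%x. \<zeta> x * E x $ k) x) (axis k 1)) = cross3 (grad \<zeta> x) (E x) + \<zeta> x *R curl E x"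
proof -
 have "grad (%x. \<zeta> x * E x $ k) x = \<zeta> x *R grad (%x. E x $ k) x + E x $ k *R grad \<zeta> x" for k
  using C1_mult(2)[of \<zeta> "%x. E x $ k"] assms by (simp add: C1v_def)
 then show ?thesis by (simp add: sum_3 vec_eq_iff forall_3 cross_components curl_nth axis_def algebra_simps)
qed

text \<open>The dilation \<open>x \<mapsto> (1 + s) x - s a\<close> pulls the support of the mollified field into the part of
 the domain at distance at least \<open>\<rho>\<close> from the complement.\<close>

lemma h10_curlperp_local:
 assumes \<Omega>: "open \<Omega>" "bounded \<Omega>" and e: "e : L2on \<Omega>" "(e, 0) : curlrel UNIV" and wc: "(w, c) : curlrel \<Omega>"
  and U: "open U" and D: "star_ball (U \<inter> \<Omega>) a r" and z: "C1c U \<zeta>"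
 shows "inner c (mulop \<zeta> e) = inner (cls (%x. cross3 (rep w x) (grad \<zeta> x))) e"
proof -
 note S = star_ballD[OF D]
 have \<Omega>b: "\<Omega> : sets borel" using \<Omega> by simp
 obtain K where K: "compact K" "K <= U" "!!x. x ~: K ==> \<zeta> x = 0" using C1c_obtain[OF z] by metis
 obtain B where B: "!!x. norm (grad \<zeta> x) <= B" using C1c_grad_bounded[OF z] by blast
 have zm: "\<zeta> : BM" "grad \<zeta> : BM" using C1_bm C1_grad_bm C1c_C1[OF z] by blast+
 obtain B1 where B1: "B1 >= 0" "!!x. \<bar>\<zeta> x\<bar> <= B1" using C1c_bounded[OF z] by blast
 obtain \<epsilon> where \<epsilon>: "\<epsilon> > 0" "!!x y. x : K ==> dist x y < \<epsilon> ==> y : U"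
 proof -
  obtain e where "e > 0" "(\<Union>x\<in>K. ball x e) <= U" by (rule compact_subset_open_imp_ball_epsilon_subset[OF K(1) U K(2)])
  then show ?thesis by (intro that[of e]) (auto simp: UN_subset_iff subset_iff)
 qed
 obtain M where M: "M > 0" "!!x. x : K ==> norm x <= M" using compact_imp_bounded[OF K(1)] bounded_pos by blast
 \<comment> \<open>\<open>Q\<close> bounds the vector by which the dilation moves a point of
   \<open>K\<close>, before the factor \<open>s n\<close>. Keeping \<open>s n * Q\<close> below
   \<epsilon> ensures that the moved point stays in \<open>U\<close>.\<close>
 define Q where "Q = M + norm a + r + 1"
 have Q: "Q >= 1" using M S(3) by (simp add: Q_def)
 define q where "q = min \<epsilon> 1 / (2 * Q)"
 have q: "q > 0" "q * Q < \<epsilon>" "q * Q <= 1" using \<epsilon>(1) Q by (auto simp: q_def min_def)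
 define s where "s n = q / real (Suc n)" for n
 have s: "s n > 0" "s n <= q" for n using q(1) by (auto simp: s_def divide_le_eq)
 have s0: "s ---> 0" using tendsto_mult[OF tendsto_const LIMSEQ_inverse_real_of_nat, of q] by (simp add: s_def[abs_def] divide_inverse)
 have sQ: "s n * Q < \<epsilon>" "s n * Q <= 1" for n using mult_right_mono[OF s(2)[of n], of Q] Q q by linarith+
 define E where "E n = mollify (1 + s n) (- s n *R a) (- s n * (r / 2)) (rep e)" for n
 have dn: "- s n * (r / 2) ~= 0" for n using s(1)[of n] S(3) by simp
 have E2: "E n = mollify (1 + s n) (- s n *R a) (- s n * (r / 2)) (rst \<Omega> (rep e))" for n
  unfolding E_def by (rule mollify_AE_cong[OF dn]) (use \<Omega>b cls_rst(1)[OF e(1) \<Omega>b] in \<open>auto elim: eventually_mono\<close>)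
 have EC: "C1v (E n)" for n unfolding C1v_def E_def using C1_mollify_vec[OF dn sqi_rep] by blast
 have Ecurl: "curl (E n) x = 0" for n x unfolding E_def by (rule curl_mollify_0[OF e(2) dn])
 have "(%n. cls (E n)) ---> cls (rep e)" unfolding E_def
 proof (rule mollify_tendsto[OF sqi_rep])
  show "(%n. 1 + s n) ---> 1" using tendsto_add[OF tendsto_const s0, of 1] by simp
  show "(%n. - s n *R a) ---> 0" using tendsto_scaleR[OF tendsto_minus[OF s0] tendsto_const, of a] by simp
  show "(%n. - s n * (r / 2)) ---> 0" using tendsto_mult[OF tendsto_minus[OF s0] tendsto_const, of "r / 2"] by simp
  show "1 / 2 <= 1 + s n" for n using s(1)[of n] by simp
  show "norm (- s n *R a) <= 1" for n
  proof -
   have "s n * norm a <= s n * Q" using s(1)[of n] M(1) S(3) by (intro mult_left_mono) (auto simp: Q_def)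
   from order_trans[OF this sQ(2)] show ?thesis using s(1)[of n] by simp
  qed
  show "\<bar>- s n * (r / 2)\<bar> <= 1" for n
  proof -
   have "s n * (r / 2) <= s n * Q" using s(1)[of n] M(1) S(3) by (intro mult_left_mono) (auto simp: Q_def)
   from order_trans[OF this sQ(2)] show ?thesis using s(1)[of n] S(3) by (simp add: abs_mult)
  qed
 qed (rule dn)
 then have Elim: "(%n. cls (E n)) ---> e" by simp
 define \<rho> where "\<rho> n = s n / (1 + s n) * (r / 2)" for n
 have \<rho>: "\<rho> n > 0" for n using s(1)[of n] S(3) by (simp add: \<rho>_def)
 \<comment> \<open>If the average at x is not 0, it meets a point y of the star-shaped piece.
   Inverting the dilation puts x on a segment from y to a point of the ball of radius r / 2 around
   \<open>a\<close>. The other half of the radius r is room to move x: every u within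
   \<open>\<rho> n\<close> lies on a segment from y to a point of \<open>cball a r\<close>, hence in
   \<Omega>.\<close>
 have supp: "ball x (\<rho> n) <= \<Omega>" if x: "x : K" and nz: "E n x ~= 0" for x n
 proof -
  have "EX z. bump z *R rst \<Omega> (rep e) ((1 + s n) *R x + - s n *R a + (- s n * (r / 2)) *R z) ~= 0"
  proof (rule ccontr)
   assume "\<not> ?thesis"
   then have "E n x = 0" unfolding E2 mollify_def by (simp only: not_ex not_not integral_zero)
   then show False using nz by simp
  qed
  then obtain z where z: "bump z ~= 0" and y: "(1 + s n) *R x + - s n *R a + (- s n * (r / 2)) *R z : \<Omega>" by (auto simp: indicator_def split: if_splits)
  have z1: "norm z <= 1" using z bump(3)[of z] by force
  define y where "y = (1 + s n) *R x + - s n *R a + (- s n * (r / 2)) *R z"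
  define t where "t = s n / (1 + s n)"
  have t: "0 < t" "t <= 1" "(1 - t) * (1 + s n) = 1" "(1 - t) * s n = t" using s(1)[of n] by (auto simp: t_def field_simps)
  have "norm (x - y) <= s n * Q"
  proof -
   have "x - y = s n *R (a + (r / 2) *R z - x)" by (simp add: y_def algebra_simps)
   moreover have "norm (a + (r / 2) *R z - x) <= Q"
   proof -
    have "norm ((r / 2) *R z) <= r / 2" using mult_left_mono[OF z1, of "r / 2"] S(3) by simp
    then show ?thesis using norm_triangle_ineq4[of "a + (r / 2) *R z" x] norm_triangle_ineq[of a "(r / 2) *R z"] M(2)[OF x] S(3) unfolding Q_def by linarith
   qed
   ultimately show ?thesis using s(1)[of n] by simp
  qed
  then have "y : U \<inter> \<Omega>" using \<epsilon>(2)[OF x, of y] sQ(1)[of n] y by (simp add: dist_norm y_def)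
  show ?thesis
  proof
   fix u assume u: "u : ball x (\<rho> n)"
   define b where "b = a + (r / 2) *R z + (1 / t) *R (u - x)"
   have "norm ((1 / t) *R (u - x)) <= r / 2"
    using u t(1) S(3) unfolding norm_scaleR by (simp add: \<rho>_def t_def[symmetric] dist_norm norm_minus_commute divide_le_eq mult.commute)
   moreover have "norm ((r / 2) *R z) <= r / 2" using mult_left_mono[OF z1, of "r / 2"] S(3) by simp
   ultimately have "b : cball a r"
   proof -
    have "b - a = (r / 2) *R z + (1 / t) *R (u - x)" by (simp add: b_def)
    then have "dist a b = norm ((r / 2) *R z + (1 / t) *R (u - x))" by (metis dist_norm norm_minus_commute)
    then show ?thesis using norm_triangle_ineq[of "(r / 2) *R z" "(1 / t) *R (u - x)"]
      \<open>norm ((1 / t) *R (u - x)) <= r / 2\<close> \<open>norm ((r / 2) *R z) <= r / 2\<close> unfolding mem_cball by linarith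
   qed
   then have "(1 - t) *R y + t *R b : U \<inter> \<Omega>" using S(7)[OF \<open>y : U \<inter> \<Omega>\<close>] t by auto
   moreover have "(1 - t) *R y + t *R b = u"
   proof -
    have "(1 - t) *R y = ((1 - t) * (1 + s n)) *R x - ((1 - t) * s n) *R a - ((1 - t) * s n) *R ((r / 2) *R z)"
     by (simp add: y_def scaleR_add_right scaleR_diff_right mult.assoc)
    moreover have "t *R b = t *R a + t *R ((r / 2) *R z) + (u - x)" using t(1) by (simp add: b_def scaleR_add_right)
    ultimately show ?thesis unfolding t(3,4) by simp
   qed
   ultimately show "u : \<Omega>" by simp
  qed
 qed
 have ne: "- \<Omega> ~= {}" using \<Omega>(2) by (metis Compl_empty_eq double_complement not_bounded_UNIV)
 have \<phi>: "C1c \<Omega> (%x. \<zeta> x * E n x $ k)" for n k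
 proof (rule C1cI[where K = "K \<inter> {x. \<rho> n <= infdist x (- \<Omega>)}"])
  show "C1 (%x. \<zeta> x * E n x $ k)" using C1_mult(1)[OF C1c_C1[OF z]] EC[of n] by (simp add: C1v_def)
  have "closed {x. \<rho> n <= infdist x (- \<Omega>)}" by (intro closed_Collect_le continuous_intros)
  then show "compact (K \<inter> {x. \<rho> n <= infdist x (- \<Omega>)})" using K(1) by (rule compact_Int_closed[rotated])
  show "K \<inter> {x. \<rho> n <= infdist x (- \<Omega>)} <= \<Omega>"
  proof
   fix x assume "x : K \<inter> {x. \<rho> n <= infdist x (- \<Omega>)}"
   then show "x : \<Omega>" using \<rho>[of n] infdist_zero[of x "- \<Omega>"] by (cases "x : \<Omega>") auto
  qed
  fix x assume x: "x ~: K \<inter> {x. \<rho> n <= infdist x (- \<Omega>)}"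
  show "\<zeta> x * E n x $ k = 0"
  proof (rule ccontr)
   assume "\<not> ?thesis"
   then have "x : K" "E n x ~= 0" using K(3) by auto
   then have "ball x (\<rho> n) <= \<Omega>" by (rule supp)
   then have "\<rho> n <= infdist x (- \<Omega>)" unfolding infdist_notempty[OF ne] by (intro cINF_greatest[OF ne]) (auto simp: subset_iff not_less[symmetric])
   then show False using x \<open>x : K\<close> by blast
  qed
 qed
 have sE: "sqi (E n)" for n unfolding E_def by (rule mollify_L2(1)) (use s(1)[of n] dn in auto)
 have sw: "sqi (%x. cross3 (rep w x) (grad \<zeta> x))" by (rule sqi_cross_bdd[OF sqi_rep zm(2) B])
 \<comment> \<open>Now \<zeta> \<open>E n\<close> is an admissible test field for the pair (w, c).
   As \<open>E n\<close> is curl-free, only the cross product with the gradient of \<zeta>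
   survives.\<close>
 have "inner c (mulop \<zeta> (cls (E n))) = inner (cls (%x. cross3 (rep w x) (grad \<zeta> x))) (cls (E n))" for n
 proof -
  note \<phi>s = C1c_sqi[OF \<phi>, of n]
  have "inner c (mulop \<zeta> (cls (E n))) = inner c (\<Sum>k\<in>UNIV. cls (%x. (\<zeta> x * E n x $ k) *R axis k 1))"
   unfolding cls_sum[OF sqi_scale[OF \<phi>s(1)]] mulop_C1c_cls[OF z sE]
   by (rule arg_cong[of _ _ "%f. inner c (cls f)"]) (simp add: fun_eq_iff vec_eq_iff axis_def if_distrib sum.If_cases cong: if_cong)
  also have "... = inner w (\<Sum>k\<in>UNIV. cls (%x. cross3 (grad (%x. \<zeta> x * E n x $ k) x) (axis k 1)))"
   unfolding inner_sum_right using wc \<phi> by (intro sum.cong) (auto simp: curlrel_def)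
  also have "... = inner w (cls (%x. cross3 (grad \<zeta> x) (E n x)))" unfolding cls_sum[OF sqi_cross[OF \<phi>s(2)]] sum_cross_axis[OF C1c_C1[OF z] EC] Ecurl by simp
  also have "... = (\<integral>x. rep w x \<bullet> cross3 (grad \<zeta> x) (E n x))"
  proof -
   have "(%x. cross3 (grad \<zeta> x) (E n x)) = (%x. (-1) *R cross3 (E n x) (grad \<zeta> x))" by (simp add: fun_eq_iff cross_skew[of "grad \<zeta> _"])
   then have "sqi (%x. cross3 (grad \<zeta> x) (E n x))" using sqi_scaleR[OF sqi_cross_bdd[OF sE zm(2) B], of "-1"] by simp
   then show ?thesis using inner_cls[OF sqi_rep, of _ w] by simp
  qed
  also have "... = inner (cls (%x. cross3 (rep w x) (grad \<zeta> x))) (cls (E n))" unfolding inner_cls[OF sw sE] by (rule lint_cong) (simp_all add: cross3_simps)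
  finally show ?thesis .
 qed
 moreover have "(%n. inner c (mulop \<zeta> (cls (E n)))) ---> inner c (mulop \<zeta> e)"
  using bounded_linear.tendsto[OF bounded_linear_mulop(1)[OF zm(1) _ B1(1)] Elim] B1(2) by (intro tendsto_intros) auto
 moreover have "(%n. inner (cls (%x. cross3 (rep w x) (grad \<zeta> x))) (cls (E n))) ---> inner (cls (%x. cross3 (rep w x) (grad \<zeta> x))) e"
  by (intro tendsto_intros Elim)
 ultimately show ?thesis using LIMSEQ_unique by auto
qed

text \<open>The converse of \<open>curlperp_potential\<close>. The local identities are summed over
  a partition of unity, and the terms with the gradients of the cutoffs cancel because these sum to
  0 on \<Omega>. The Lipschitz property enters through the star-shaped pieces, where a gradient that
  is 0 off \<Omega> can be approximated by fields with compact support in \<Omega>.\<close>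

lemma h10_curlperp:
 assumes \<Omega>: "lipschitz_domain \<Omega>" and e: "(\<psi>, e) : h10 V" "e : L2on \<Omega>"
 shows "e : curlperp \<Omega>"
proof (rule lipschitz_domain_partition[OF \<Omega>])
 note o = lipschitz_domainD[OF \<Omega>]
 fix F :: "(real^3) set" and U a r \<zeta> assume F: "finite F" "!!x. x : F ==> open (U x)" "!!x. x : F ==> star_ball (U x \<inter> \<Omega>) (a x) (r x)"
  "!!x. x : F ==> C1c (U x) (\<zeta> x)" "!!y. y : \<Omega> ==> (\<Sum>x\<in>F. \<zeta> x y) = (1::real)"
 have g0: "(\<Sum>x\<in>F. grad (\<zeta> x) y) = 0" if "y : \<Omega>" for y
 proof -
  have "grad (%y. (\<Sum>x\<in>F. \<zeta> x y) - 1) y = 0" by (rule grad_eq_0_outside[of "- \<Omega>"]) (use o F(5) that in auto)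
  moreover have "grad (%y. (\<Sum>x\<in>F. \<zeta> x y) + - 1) y = (\<Sum>x\<in>F. grad (\<zeta> x) y)"
   using C1_add(2)[OF C1_sum(1) C1_const(1), of F \<zeta> "-1"] C1_sum(2)[of F \<zeta>] C1c_C1[OF F(4)] by (simp add: C1_const)
  ultimately show ?thesis by simp
 qed
 have "inner e c = 0" if wc: "(w, c) : curlrel \<Omega>" for w c
 proof -
  have sw: "sqi (%y. cross3 (rep w y) (grad (\<zeta> x) y))" if x: "x : F" for x
   using C1c_grad_bounded[OF F(4)[OF x]] C1_grad_bm[OF C1c_C1[OF F(4)[OF x]]] sqi_cross_bdd[OF sqi_rep] by blast
  have "inner c e = (\<Sum>x\<in>F. inner c (mulop (\<zeta> x) e))" using partition_mulop[OF F(1,4,5) e(2)] by (simp flip: inner_sum_right)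
  also have "... = (\<Sum>x\<in>F. inner (cls (%y. cross3 (rep w y) (grad (\<zeta> x) y))) e)"
   using h10_curlperp_local[OF _ _ e(2) h10_curlrel[OF e(1)] wc F(2,3,4)] o by (intro sum.cong) auto
  also have "... = inner (cls (%y. \<Sum>x\<in>F. cross3 (rep w y) (grad (\<zeta> x) y))) (cls (rep e))"
   using cls_sum[of F "%x y. cross3 (rep w y) (grad (\<zeta> x) y)"] sw by (simp flip: inner_sum_left)
  also have "... = (\<integral>y. (\<Sum>x\<in>F. cross3 (rep w y) (grad (\<zeta> x) y)) \<bullet> rep e y)" by (rule inner_cls[OF sqi_sum[OF sw] sqi_rep])
  also have "... = 0"
  proof (rule integral_eq_zero_AE)
   have cs: "(\<Sum>x\<in>F. cross3 v (g x)) = cross3 v (\<Sum>x\<in>F. g x)" for v and g :: "real^3 => real^3"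
    by (induction F rule: infinite_finite_induct) (auto simp: cross_add_right)
   from e(2) show "AE y. (\<Sum>x\<in>F. cross3 (rep w y) (grad (\<zeta> x) y)) \<bullet> rep e y = 0" unfolding L2on_def mem_Collect_eq
    by eventually_elim (use g0 in \<open>auto simp: cs\<close>)
  qed
  finally show ?thesis by (simp add: inner_commute)
 qed
 then show ?thesis using e(2) by (auto simp: curlperp_def)
qed

section \<open>Truncation of potentials and level set estimates\<close>

lemma mulop_tendsto_const:
 "s : BM ==> AE x. \<bar>s x\<bar> <= B ==> f ---> u ==> (%n. mulop s (f n)) ---> mulop s (u :: 'b::euclidean_space l2)"
proof -
 assume s: "s : BM" "AE x. \<bar>s x\<bar> <= B" and f: "f ---> u"
 have "AE x. \<bar>s x\<bar> <= max B 0" using s(2) by eventually_elim simp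
 from bounded_linear.tendsto[OF bounded_linear_mulop(1)[OF s(1) this] f] show ?thesis by simp
qed

text \<open>The multipliers converge almost everywhere but not uniformly. The product is split into
  the multiplier applied to \<open>f n - u\<close>, small by uniform boundedness, and to the fixed
  \<open>u\<close>, handled by dominated convergence.\<close>

lemma mulop_tendsto:
 fixes u :: "'b::euclidean_space l2"
 assumes a: "!!n. a n : BM" "a' : BM" "!!n. AE x. \<bar>a n x\<bar> <= B"
  and lim: "AE x. (%n. a n x) ---> a' x" and f: "f ---> u"
 shows "(%n. mulop (a n) (f n)) ---> mulop a' u"
proof -
 have B: "AE x. \<bar>a n x\<bar> <= max B 0" for n by (rule eventually_mono[OF a(3)[of n]]) simp
 note bl = bounded_linear_mulop[OF a(1) B, where 'b = 'b, simplified]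
 have "(%n. cls (%x. a n x *R rep u x)) ---> cls (%x. a' x *R rep u x)"
 proof (rule l2_dominated_convergence(3)[OF _ _ sqi_scaleR[OF sqi_rep, of "max B 0" u]])
  show "(%x. a n x *R rep u x) : BM" "(%x. a' x *R rep u x) : BM" for n using a(1)[of n] a(2) by measurable
  show "AE x. (%n. a n x *R rep u x) ---> a' x *R rep u x" using lim by eventually_elim (intro tendsto_intros)
  show "AE x. norm (a n x *R rep u x) <= norm (max B 0 *R rep u x)" for n using B[of n] by eventually_elim (simp add: mult_right_mono)
 qed
 then have 1: "(%n. mulop (a n) u) ---> mulop a' u" by (simp add: mulop_def)
 have "(%n. mulop (a n) (f n - u)) ---> 0"
 proof (rule tendsto_norm_zero_cancel, rule tendsto_sandwich[OF _ _ tendsto_const])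
  show "(%n. max B 0 * norm (f n - u)) ---> 0" using tendsto_mult[OF tendsto_const tendsto_norm[OF tendsto_diff[OF f tendsto_const[of u]]], of "max B 0"] by simp
 qed (use bl(2) in auto)
 from tendsto_add[OF this 1] show ?thesis using linear_diff[OF bounded_linear.linear[OF bl(1)]] by simp
qed

lemma C1c_compose: assumes "C1c V \<phi>" "!!s. (T has_real_derivative T' s) (at s)" "continuous_on UNIV T'" "T 0 = 0"
 shows "C1c V (%x. T (\<phi> x))"
proof -
 obtain K where "compact K" "K <= V" "!!x. x ~: K ==> \<phi> x = 0" using C1c_obtain[OF assms(1)] by metis
 then show ?thesis using assms(4) by (intro C1cI[OF C1_compose(1)[OF C1c_C1[OF assms(1)] assms(2,3)]]) auto
qed

text \<open>A subsequence is needed because L2 convergence of \<open>\<phi> n\<close> gives almost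
  everywhere convergence of the factors \<open>T' (\<phi> n x)\<close> only along one.\<close>

lemma C1c_compose_tendsto:
 assumes \<phi>: "!!n. C1c V (\<phi> n)" "(%n. cls (\<phi> n)) ---> v" "(%n. cls (grad (\<phi> n))) ---> g"
  and T: "!!s. (T has_real_derivative T' s) (at s)" "continuous_on UNIV T'" "!!s. \<bar>T' s\<bar> <= B"
 shows "EX k. strict_mono k & (AE x. (%n. \<phi> (k n) x) ---> rep v x)
  & (%n. cls (grad (%x. T (\<phi> (k n) x)))) ---> mulop (%x. T' (rep v x)) g"
proof -
 obtain k where k: "strict_mono k" "AE x. (%n. rep (cls (\<phi> (k n))) x) ---> rep v x" using l2_AE_subseq[OF \<phi>(2)] by auto
 have [measurable]: "T' : BM" using T(2) by (rule bm_cont)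
 note [measurable] = C1_bm[OF C1c_C1[OF \<phi>(1)]]
 have "AE x. ALL n. rep (cls (\<phi> (k n))) x = \<phi> (k n) x" unfolding AE_all_countable using rep_cls[OF C1c_sqi(1)[OF \<phi>(1)]] by blast
 with k(2) have a: "AE x. (%n. \<phi> (k n) x) ---> rep v x" by eventually_elim simp
 have "cls (grad (%x. T (\<phi> n x))) = mulop (%x. T' (\<phi> n x)) (cls (grad (\<phi> n)))" for n
  using mulop_cls[of "%x. T' (\<phi> n x)" B "grad (\<phi> n)"] C1_compose(2)[OF C1c_C1[OF \<phi>(1)] T(1,2)] T(3) C1c_sqi(2)[OF \<phi>(1)] by simp
 moreover have "(%n. mulop (%x. T' (\<phi> (k n) x)) (cls (grad (\<phi> (k n))))) ---> mulop (%x. T' (rep v x)) g"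
 proof (rule mulop_tendsto[where B = B])
  from a show "AE x. (%n. T' (\<phi> (k n) x)) ---> T' (rep v x)" by eventually_elim (use T(2) in \<open>auto intro!: continuous_on_tendsto_compose[of UNIV T']\<close>)
  show "(%n. cls (grad (\<phi> (k n)))) ---> g" using LIMSEQ_subseq_LIMSEQ[OF \<phi>(3) k(1)] by (simp add: o_def)
 qed (use T(3) in simp_all)
 ultimately show ?thesis using a k(1) by auto
qed

lemma h10_chain:
 assumes v: "(v, g) : h10 V" and T: "!!s. (T has_real_derivative T' s) (at s)" "continuous_on UNIV T'" "T 0 = 0" "!!s. \<bar>T' s\<bar> <= B"
 shows "(cls (%x. T (rep v x)), mulop (%x. T' (rep v x)) g) : h10 V" "sqi (%x. T (rep v x))"
proof -
 obtain \<phi> where \<phi>: "!!n. C1c V (\<phi> n)" "(%n. cls (\<phi> n)) ---> v" "(%n. cls (grad (\<phi> n))) ---> g" using v unfolding h10_iff by metis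
 obtain k where k: "strict_mono k" "(%n. cls (grad (%x. T (\<phi> (k n) x)))) ---> mulop (%x. T' (rep v x)) g" using C1c_compose_tendsto[OF \<phi> T(1,2,4)] by blast
 have Tc: "continuous_on UNIV T" using T(1) by (meson DERIV_isCont continuous_at_imp_continuous_on)
 have Tm: "T : BM" using Tc by (rule bm_cont)
 note [measurable] = Tm C1_bm[OF C1c_C1[OF \<phi>(1)]]
 have Tl: "\<bar>T s - T t\<bar> <= B * \<bar>s - t\<bar>" for s t
  using field_differentiable_bound[of UNIV T T' B s t] T(1,4) by (auto simp: has_field_derivative_at_within)
 have sT: "sqi (%x. T (u x))" if "sqi u" for u
  using Tl[of _ 0] T(3) sqi_bm[OF that] Tm by (intro sqi_mono[OF _ sqi_scaleR[OF that, of B]]) (auto simp: abs_mult intro!: order_trans[OF _ mult_right_mono[OF abs_ge_self]])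
 show "sqi (%x. T (rep v x))" by (rule sT) simp
 have "(%n. cls (%x. T (\<phi> (k n) x))) ---> cls (%x. T (rep v x))"
 proof (rule LIM_zero_cancel, rule tendsto_norm_zero_cancel, rule tendsto_sandwich[OF _ _ tendsto_const])
  have "norm (cls (%x. T (\<phi> (k n) x)) - cls (%x. T (rep v x))) <= norm (B *R (cls (\<phi> (k n)) - cls (rep v)))" for n
   unfolding cls_diff[OF sT[OF C1c_sqi(1)[OF \<phi>(1)]] sT[OF sqi_rep]] cls_diff[OF C1c_sqi(1)[OF \<phi>(1)] sqi_rep] cls_scaleR[OF sqi_diff[OF C1c_sqi(1)[OF \<phi>(1)] sqi_rep]]
   using Tl by (intro norm_cls_mono sqi_diff sT C1c_sqi(1)[OF \<phi>(1)] sqi_scaleR sqi_rep AE_I2) (measurable, auto simp: abs_mult intro!: order_trans[OF Tl mult_right_mono[OF abs_ge_self]])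
  then show "\<forall>\<^sub>F n in sequentially. norm (cls (%x. T (\<phi> (k n) x)) - cls (%x. T (rep v x))) <= \<bar>B\<bar> * norm (cls (\<phi> (k n)) - v)" by simp
  show "(%n. \<bar>B\<bar> * norm (cls (\<phi> (k n)) - v)) ---> 0"
   using tendsto_mult[OF tendsto_const tendsto_norm[OF tendsto_diff[OF LIMSEQ_subseq_LIMSEQ[OF \<phi>(2) k(1)] tendsto_const[of v]]], of "\<bar>B\<bar>"] by (simp add: o_def)
 qed simp
 then show "(cls (%x. T (rep v x)), mulop (%x. T' (rep v x)) g) : h10 V"
  unfolding h10_iff using C1c_compose[OF \<phi>(1) T(1,2,3)] k(2) by (intro exI[of _ "%n x. T (\<phi> (k n) x)"]) simp
qed

lemma h10_mult:
 assumes v: "(v, g) : h10 V" and f: "C1c W f"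
 shows "(mulop f v, mulop f g + vmul (grad f) v) : h10 V"
proof -
 obtain \<phi> where \<phi>: "!!n. C1c V (\<phi> n)" "(%n. cls (\<phi> n)) ---> v" "(%n. cls (grad (\<phi> n))) ---> g" using v unfolding h10_iff by metis
 obtain B where B: "!!x. norm (grad f x) <= B" using C1c_grad_bounded[OF f] by blast
 obtain B1 where B1: "!!x. \<bar>f x\<bar> <= B1" using C1c_bounded[OF f] by blast
 note m = C1_bm[OF C1c_C1[OF f]] C1_grad_bm[OF C1c_C1[OF f]]
 have eq: "mulop f (cls (\<phi> n)) = cls (%x. f x * \<phi> n x)"
  "mulop f (cls (grad (\<phi> n))) + vmul (grad f) (cls (\<phi> n)) = cls (grad (%x. f x * \<phi> n x))" for n
  using mulop_C1c_cls[OF f C1c_sqi(1)[OF \<phi>(1)], of n] mulop_C1c_cls[OF f C1c_sqi(2)[OF \<phi>(1)], of n]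
   vmul_cls[OF C1c_sqi(1)[OF \<phi>(1)] m(2) B, of n] C1_mult(2)[OF C1c_C1[OF f] C1c_C1[OF \<phi>(1)], of n]
   cls_add[OF sqi_mulop_C1c[OF f C1c_sqi(2)[OF \<phi>(1)]] sqi_vmul[OF C1c_sqi(1)[OF \<phi>(1)] m(2) B], of n n] by simp_all
 show ?thesis unfolding h10_iff
 proof (intro exI[of _ "%n x. f x * \<phi> n x"] conjI allI)
  show "C1c V (%x. f x * \<phi> n x)" for n by (rule C1c_mult[OF C1c_C1[OF f] \<phi>(1)])
  show "(%n. cls (%x. f x * \<phi> n x)) ---> mulop f v" unfolding eq(1)[symmetric] using m(1) B1 \<phi>(2) by (intro mulop_tendsto_const) auto
  show "(%n. cls (grad (%x. f x * \<phi> n x))) ---> mulop f g + vmul (grad f) v" unfolding eq(2)[symmetric]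
   using m(1) B1 \<phi>(3) by (intro tendsto_add mulop_tendsto_const bounded_linear.tendsto[OF bounded_linear_vmul[OF m(2) B] \<phi>(2)]) auto
 qed
qed

text \<open>With the modulus as a class, integrals of it over level sets are inner products with
  indicators and hence continuous in L2.\<close>

definition absl :: "'b::euclidean_space l2 => real l2" where "absl u = cls (%x. norm (rep u x))"

lemma sqi_norm: "sqi f ==> sqi (%x. norm (f x))" by (auto simp: sqi_def)

lemma absl_cls: "sqi f ==> absl (cls f) = cls (%x. norm (f x))"
 unfolding absl_def by (rule cls_eqI[OF sqi_norm sqi_norm]) (use rep_cls[of f] in \<open>auto elim: eventually_mono\<close>)

lemma absl_tendsto: assumes "f ---> u" shows "(%n. absl (f n)) ---> absl u"
proof (rule LIM_zero_cancel, rule tendsto_norm_zero_cancel, rule tendsto_sandwich[OF _ _ tendsto_const])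
 have "norm (absl (f n) - absl u) <= norm (cls (rep (f n)) - cls (rep u))" for n
  unfolding absl_def cls_diff[OF sqi_norm[OF sqi_rep] sqi_norm[OF sqi_rep]] cls_diff[OF sqi_rep sqi_rep]
  by (intro norm_cls_mono sqi_diff sqi_norm sqi_rep) (auto intro: norm_triangle_ineq3)
 then show "\<forall>\<^sub>F n in sequentially. norm (absl (f n) - absl u) <= norm (f n - u)" by simp
 show "(%n. norm (f n - u)) ---> 0" using assms by (simp add: LIM_zero tendsto_norm_zero)
qed simp

lemma sqi_ind: "A : sets borel ==> A <= ball 0 R ==> sqi (indicator A :: real^3 => real)"
 using emeasure_mono[of A "ball 0 R" lborel] emeasure_bounded_finite[of "ball (0::real^3) R"] by (intro sqi_indicator_set) (auto intro: le_less_trans)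

lemma inner_ind: "A : sets borel ==> A <= ball 0 R ==> sqi f ==> inner (cls (indicator A)) (cls f) = (\<integral>x. indicator A x * f x)"
 using inner_cls[OF sqi_ind, of A R f] by simp

lemma h10_sobolev_level:
 assumes R: "R > 0" and th: "0 < \<theta>" "\<theta> < 1/3"
 shows "EX C>0. ALL v g A. (v, g) : h10 (ball 0 R) --> A : sets borel --> A <= ball 0 R -->
  inner (cls (indicator A)) (absl v) <= C * measure lborel A powr \<theta> * inner (cls (indicator (ball 0 R))) (absl g)"
proof -
 obtain C where C: "C > 0" "ALL v A. C1c (ball 0 R) v --> A : sets borel --> A <= ball 0 R -->
  (\<integral>\<^sup>+x. indicator A x * en \<bar>v x\<bar>) <= en (C * measure lborel A powr \<theta>) * (\<integral>\<^sup>+x. en (norm (grad v x)))"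
  using sobolev_level[OF R th] by blast
 have nn: "(\<integral>\<^sup>+x. indicator A x * en \<bar>f x\<bar>) = en (inner (cls (indicator A)) (cls (%x. \<bar>f x\<bar>)))"
  if "A : sets borel" "A <= ball 0 R" "sqi f" for A and f :: "real^3 => real"
 proof -
  have "integrable lborel (%x. indicator A x * \<bar>f x\<bar>)" using sqi_inner[OF sqi_ind[OF that(1,2)] sqi_norm[OF that(3)]] by simp
  from nn_integral_eq_integral[OF this] show ?thesis using inner_ind[OF that(1,2) sqi_norm[OF that(3)]] by (simp add: ennreal_mult ennreal_indicator)
 qed
 have key: "inner (cls (indicator A)) (absl v) <= C * measure lborel A powr \<theta> * inner (cls (indicator (ball 0 R))) (absl g)"
  if vg: "(v, g) : h10 (ball 0 R)" and A: "A : sets borel" "A <= ball 0 R" for v g A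
 proof -
  obtain \<phi> where \<phi>: "!!n. C1c (ball 0 R) (\<phi> n)" "(%n. cls (\<phi> n)) ---> v" "(%n. cls (grad (\<phi> n))) ---> g" using vg unfolding h10_iff by metis
  have "inner (cls (indicator A)) (absl (cls (\<phi> n))) <= C * measure lborel A powr \<theta> * inner (cls (indicator (ball 0 R))) (absl (cls (grad (\<phi> n))))" for n
  proof -
   note s = C1c_sqi[OF \<phi>(1), of n]
   have "(\<integral>\<^sup>+x. en (norm (grad (\<phi> n) x))) = (\<integral>\<^sup>+x. indicator (ball 0 R) x * en \<bar>norm (grad (\<phi> n) x)\<bar>)"
    using C1c_ball_supp(2)[OF \<phi>(1), of _ n] by (intro nn_integral_cong) (auto simp: indicator_def)
   also have "... = en (inner (cls (indicator (ball 0 R))) (absl (cls (grad (\<phi> n)))))" using nn[OF _ order_refl sqi_norm[OF s(2)]] absl_cls[OF s(2)] by simp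
   finally have *: "(\<integral>\<^sup>+x. en (norm (grad (\<phi> n) x))) = en (inner (cls (indicator (ball 0 R))) (absl (cls (grad (\<phi> n)))))" .
   have p: "inner (cls (indicator B)) (absl (cls f)) >= 0" if "B : sets borel" "B <= ball 0 R" "sqi f" for B and f :: "real^3 => real^3"
    unfolding absl_cls[OF that(3)] inner_ind[OF that(1,2) sqi_norm[OF that(3)]] by (rule integral_nonneg_AE) simp
   have "en (inner (cls (indicator A)) (absl (cls (\<phi> n)))) <= en (C * measure lborel A powr \<theta>) * en (inner (cls (indicator (ball 0 R))) (absl (cls (grad (\<phi> n)))))"
    using C(2)[rule_format, OF \<phi>(1)[of n] A] unfolding * nn[OF A s(1)] by (simp add: absl_cls[OF s(1)])
   then show ?thesis using C(1) p[OF _ order_refl s(2)] by (simp add: ennreal_mult[symmetric])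
  qed
  then show ?thesis
   by (intro LIMSEQ_le[OF tendsto_inner[OF tendsto_const absl_tendsto[OF \<phi>(2)]] tendsto_mult[OF tendsto_const tendsto_inner[OF tendsto_const absl_tendsto[OF \<phi>(3)]]]]) blast
 qed
 then show ?thesis using C(1) by blast
qed

text \<open>Along the levels M (1 - 2^(-n)) the values decay like V c^n with c = 2^(-1/\<beta>): the
  power \<beta> of c^n is 2^(-n), which offsets the shrinking gaps between levels. The argument of
  \<open>f\<close> in the conclusion is the M for which the induction step closes with
  equality.\<close>

lemma stampacchia_iteration:
 fixes f :: "real => real"
 assumes f: "!!k. 0 <= f k" "f 0 <= V" "!!h k. k <= h ==> f h <= f k" and \<beta>: "\<beta> > 0" and D: "D > 0" and V: "V > 0"
  and step: "!!h k. 0 <= k ==> k < h ==> (h - k) * f h <= D * f k powr (1 + \<beta>)"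
 shows "f (2 * 2 powr (1 / \<beta>) * D * V powr \<beta>) = 0"
proof -
 define M where "M = 2 * 2 powr (1 / \<beta>) * D * V powr \<beta>"
 define c where "c = (1/2) powr (1 / \<beta>)"
 have c2: "c = 1 / 2 powr (1 / \<beta>)" by (simp add: c_def powr_divide)
 have "1 < 2 powr (1 / \<beta>)" using \<beta> by (simp add: gr_one_powr)
 then have M: "M > 0" and c: "0 < c" "c < 1" "c powr \<beta> = 1/2" "c * (2 powr (1 / \<beta>)) = 1" using D V \<beta> by (auto simp: M_def c2 powr_powr powr_divide)
 define k where "k n = M * (1 - (1/2)^n)" for n
 have fk: "f (k n) <= V * c ^ n" for n
 proof (induction n)
  case (Suc n)
  have "k (Suc n) - k n = M * (1/2) ^ Suc n" by (simp add: k_def algebra_simps)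
  moreover have "k n >= 0" "k n < k (Suc n)" using M by (simp_all add: k_def power_le_one)
  ultimately have "M * (1/2) ^ Suc n * f (k (Suc n)) <= D * f (k n) powr (1 + \<beta>)" using step by metis
  also have "... <= D * (V * c ^ n) powr (1 + \<beta>)" using Suc f(1) D \<beta> by (intro mult_left_mono powr_mono2) auto
  also have "... = D * V * c ^ n * (V powr \<beta> * (1/2) ^ n)"
  proof -
   have "(c ^ n) powr \<beta> = (1/2) ^ n" using c(1,3) by (metis powr_power powr_realpow mult.commute powr_powr less_le)
   then show ?thesis using V c(1) by (simp add: powr_add powr_mult)
  qed
  also have "... = M * (1/2) ^ Suc n * (V * c ^ Suc n)" using c(4) by (simp add: M_def field_simps)
  finally show ?case using M by simp
 qed (use f(2) in \<open>simp add: k_def\<close>)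
 have "f M <= V * c ^ n" for n using fk[of n] f(3)[of "k n" M] M by (force simp: k_def mult_le_cancel_left1)
 moreover have "(%n. V * c ^ n) ---> 0" using tendsto_mult[OF tendsto_const LIMSEQ_realpow_zero[of c], of V] c by simp
 ultimately have "f M <= 0" by (intro LIMSEQ_le_const) auto
 then show ?thesis using f(1)[of M] by (simp add: M_def)
qed

section \<open>The electric field and the temperature\<close>

lemma inner_mulop:
 assumes "s : BM" "AE x. \<bar>s x\<bar> <= c"
 shows "inner (mulop s u) (v :: 'b::euclidean_space l2) = (\<integral>x. s x * (rep u x \<bullet> rep v x))"
  "integrable lborel (%x. s x * (rep u x \<bullet> rep v x))" "inner (mulop s u) v = inner u (mulop s v)"
proof -
 have s: "sqi (%x. s x *R rep u x)" "sqi (%x. s x *R rep v x)" using sqi_bdd_mult[OF assms sqi_rep] by blast+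
 show 1: "inner (mulop s u) v = (\<integral>x. s x * (rep u x \<bullet> rep v x))" "integrable lborel (%x. s x * (rep u x \<bullet> rep v x))"
  using inner_cls[OF s(1) sqi_rep, of v] sqi_inner[OF s(1) sqi_rep, of v] by (simp_all add: mulop_def)
 show "inner (mulop s u) v = inner u (mulop s v)" unfolding 1 using inner_cls[OF sqi_rep s(2), of u] by (simp add: mulop_def)
qed

text \<open>A C1 substitute for the positive part of s - k: the slope rises linearly from 0 at k to
  1 at h and then stays 1. At h the primitive has reached (h - k) / 2, the origin of a factor 2 in
  the level set estimate.\<close>

lemma truncation_primitive:
 fixes k h :: real assumes "k < h"
 defines "\<tau> \<equiv> %s. ((max 0 (s - k))^2 - (max 0 (s - h))^2) / (2 * (h - k))" and "\<tau>' \<equiv> %s. (max 0 (s - k) - max 0 (s - h)) / (h - k)"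
 shows "(\<tau> has_real_derivative \<tau>' s) (at s)" "continuous_on UNIV \<tau>'" "0 <= \<tau>' s" "\<tau>' s <= 1" "s <= k ==> \<tau>' s = 0" "s <= k ==> \<tau> s = 0" "s >= h ==> \<tau> s >= (h - k) / 2"
proof -
 have a: "((%s. (max 0 (s - c))^2) has_real_derivative 2 * max 0 (s - c)) (at s)" for c
  using DERIV_chain2[OF pos_square_deriv DERIV_diff[OF DERIV_ident DERIV_const], of c s UNIV] by simp
 show "(\<tau> has_real_derivative \<tau>' s) (at s)" unfolding \<tau>_def \<tau>'_def
  using DERIV_cdivide[OF DERIV_diff[OF a[of k] a[of h]], of "2 * (h - k)"] by (simp add: right_diff_distrib[symmetric] del: right_diff_distrib_numeral)
 show "continuous_on UNIV \<tau>'" unfolding \<tau>'_def using assms(1) by (intro continuous_intros) auto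
 show "0 <= \<tau>' s" "\<tau>' s <= 1" "s <= k ==> \<tau>' s = 0" "s <= k ==> \<tau> s = 0" using assms(1) by (auto simp: \<tau>'_def \<tau>_def max_def divide_le_eq)
 assume "s >= h"
 then have "\<tau> s = ((s - k)^2 - (s - h)^2) / (2 * (h - k))" using assms(1) by (simp add: \<tau>_def)
 also have "... = s - (k + h) / 2" using assms(1) by (simp add: field_simps power2_eq_square)
 finally show "\<tau> s >= (h - k) / 2" using \<open>s >= h\<close> by (simp add: field_simps)
qed

text \<open>The data after normalization: E0 stands for a Borel representative that is zero off the
  domain. Potentials live in the ball of radius R + 2 supplied by
  \<open>curlperp_potential\<close>.\<close>

locale joule_problem =
 fixes \<Omega> :: "(real^3) set" and R q \<sigma>1 \<sigma>2 :: real and E0 :: "real^3 => real^3"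
 assumes \<Omega>: "lipschitz_domain \<Omega>" "\<Omega> <= ball 0 R" "R > 0" and \<sigma>: "0 < \<sigma>1" "\<sigma>1 <= \<sigma>2" and q: "q > 3"
  and E0: "sqi E0" "!!x. x ~: \<Omega> ==> E0 x = 0" "(\<integral>\<^sup>+x. en (norm (E0 x) powr q)) < \<infinity>"
begin

abbreviation "\<B> \<equiv> ball (0::real^3) (R + 2)"
abbreviation "\<E> \<equiv> cls E0"

definition adm :: "(real^3 => real) => bool" where
 "adm s <-> s : BM & (ALL x. \<sigma>1 <= s x & s x <= \<sigma>2)"

lemma adm:
 assumes "adm s" shows "s : BM" "AE x. \<bar>s x\<bar> <= \<sigma>2" "bounded_linear (mulop s :: (real^3) l2 => _)"
  "norm (mulop s u) <= \<sigma>2 * norm (u :: (real^3) l2)" "\<sigma>1 * (norm u)^2 <= inner (mulop s u) u"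
proof -
 have b: "\<bar>s x\<bar> <= \<sigma>2" "s x >= \<sigma>1" for x using assms \<sigma> unfolding adm_def by (smt (verit))+
 show s: "s : BM" "AE x. \<bar>s x\<bar> <= \<sigma>2" using assms b by (auto simp: adm_def)
 show "bounded_linear (mulop s :: (real^3) l2 => _)" "norm (mulop s u) <= \<sigma>2 * norm u" using bounded_linear_mulop[OF s] \<sigma> by auto
 have "\<sigma>1 * (l2n (rep u))^2 <= inner (mulop s u) u" unfolding norm_cls[OF sqi_rep] inner_mulop(1)[OF s]
  unfolding integral_mult_right_zero[symmetric] power2_norm_eq_inner
  by (intro integral_mono inner_mulop(2)[OF s] integrable_mult_right inner_rep_integrable mult_right_mono b(2) inner_ge_zero)
 then show "\<sigma>1 * (norm u)^2 <= inner (mulop s u) u" by simp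
qed

definition elec :: "(real^3 => real) => (real^3) l2 => bool" where
 "elec s e <-> e : curlperp \<Omega> & (ALL e':curlperp \<Omega>. inner (mulop s (\<E> + e)) e' = 0)"

lemma \<Omega>_borel: "open \<Omega>" "bounded \<Omega>" "\<Omega> : sets borel" using lipschitz_domainD[OF \<Omega>(1)] by auto

lemma elec_exists: assumes s: "adm s" shows "EX e. elec s e"
 using lax_milgram[OF curlperp_closed[OF \<Omega>_borel(3)] adm(3)[OF s] \<sigma>(1) adm(5)[OF s], of "- mulop s \<E>"]
 by (auto simp: elec_def linear_add[OF bounded_linear.linear[OF adm(3)[OF s]]] add.commute)

lemma elec_bound: assumes s: "adm s" and e: "elec s e" shows "norm e <= \<sigma>2 / \<sigma>1 * norm \<E>"
proof -
 have "inner (mulop s (\<E> + e)) e = 0" using e by (simp add: elec_def)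
 then have "\<sigma>1 * (norm e)^2 <= - inner (mulop s \<E>) e"
  using adm(5)[OF s, of e] by (simp add: linear_add[OF bounded_linear.linear[OF adm(3)[OF s]]] inner_add_left)
 also have "... <= norm (mulop s \<E>) * norm e" using norm_cauchy_schwarz[of "- mulop s \<E>" e] by simp
 also have "... <= \<sigma>2 * norm \<E> * norm e" by (intro mult_right_mono adm(4)[OF s]) simp
 finally show ?thesis using \<sigma>(1) by (cases "norm e = 0") (auto simp: power2_eq_square field_simps intro!: mult_nonneg_nonneg order_trans[OF less_imp_le[OF \<sigma>(1)] \<sigma>(2)])
qed

text \<open>Subtracting the two equations and testing with the difference of the solutions leaves
  the change of coefficient acting on the fixed limit field, so almost everywhere convergence of the
  coefficients suffices.\<close>

lemma elec_tendsto:
 assumes s: "!!n. adm (s n)" "adm s'" "AE x. (%n. s n x) ---> s' x" and e: "!!n. elec (s n) (e n)" "elec s' e'"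
 shows "e ---> e'"
proof (rule LIM_zero_cancel, rule tendsto_norm_zero_cancel, rule tendsto_sandwich[OF _ _ tendsto_const])
 let ?F = "\<E> + e'"
 have "norm (e n - e') <= norm (mulop (s n) ?F - mulop s' ?F) / \<sigma>1" for n
 proof -
  define d where "d = e n - e'"
  have d: "d : curlperp \<Omega>" unfolding d_def using e curlperp_closed(2)[OF \<Omega>_borel(3)] by (intro subspace_diff) (auto simp: elec_def)
  have "mulop (s n) (\<E> + e n) = mulop (s n) d + mulop (s n) ?F"
   unfolding linear_add[OF bounded_linear.linear[OF adm(3)[OF s(1)]], symmetric] by (simp add: d_def add.commute)
  then have "inner (mulop (s n) d) d + inner (mulop (s n) ?F) d = 0" using e(1)[of n] d by (simp add: elec_def flip: inner_add_left)
  moreover have "inner (mulop s' ?F) d = 0" using e(2) d by (simp add: elec_def)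
  ultimately have "\<sigma>1 * (norm d)^2 <= - inner (mulop (s n) ?F - mulop s' ?F) d" using adm(5)[OF s(1), of d n] by (simp add: inner_diff_left)
  also have "... <= norm (mulop (s n) ?F - mulop s' ?F) * norm d" using norm_cauchy_schwarz[of "mulop s' ?F - mulop (s n) ?F" d] by (simp add: norm_minus_commute inner_diff_left)
  finally show ?thesis unfolding d_def[symmetric] using \<sigma>(1) by (cases "norm d = 0") (auto simp: power2_eq_square field_simps)
 qed
 then show "\<forall>\<^sub>F n in sequentially. norm (e n - e') <= norm (mulop (s n) ?F - mulop s' ?F) / \<sigma>1" by simp
 have "(%n. mulop (s n) ?F) ---> mulop s' ?F" by (rule mulop_tendsto[OF adm(1)[OF s(1)] adm(1)[OF s(2)] adm(2)[OF s(1)] s(3) tendsto_const])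
 then show "(%n. norm (mulop (s n) ?F - mulop s' ?F) / \<sigma>1) ---> 0"
  using tendsto_divide[OF tendsto_norm[OF LIM_zero] tendsto_const, of "%n. mulop (s n) ?F" _ sequentially \<sigma>1] \<sigma>(1) by simp
qed simp

text \<open>Hoelder's inequality on \<open>A\<close>, from \<open>square_le_powr_split\<close> with
  threshold a^(-1/q) for a the measure of \<open>A\<close>. Null sets are treated apart since the
  threshold must be positive.\<close>

lemma E0_level:
 "EX Q>0. ALL A. A : sets borel --> A <= \<B> --> l2n (rst A E0) <= Q * measure lborel A powr (1/2 - 1/q)"
proof -
 define Q where "Q = enn2real (\<integral>\<^sup>+x. en (norm (E0 x) powr q))"
 have Q: "(\<integral>\<^sup>+x. en (norm (E0 x) powr q)) = en Q" "Q >= 0" using E0(3) by (auto simp: Q_def)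
 note [measurable] = sqi_bm[OF E0(1)]
 have qi: "integrable lborel (%x. norm (E0 x) powr q)" "(\<integral>x. norm (E0 x) powr q) = Q"
  using Q(1) E0(3) by (auto intro!: integrableI_bounded simp: integral_eq_nn_integral Q_def)
 have "l2n (rst A E0) <= sqrt (1 + Q) * measure lborel A powr (1/2 - 1/q)" if A: "A : sets borel" "A <= \<B>" for A
 proof -
  define a where "a = measure lborel A"
  note [measurable] = A(1)
  have s: "sqi (rst A E0)" by (rule sqi_indicator[OF E0(1) A(1)])
  have fin: "emeasure lborel A < \<infinity>" using emeasure_mono[of A \<B> lborel] emeasure_bounded_finite[of \<B>] A by (auto intro: le_less_trans)
  then have Ai: "integrable lborel (indicator A :: _ => real)" by (intro integrable_real_indicator) (use A in auto)
  have l: "(l2n (rst A E0))^2 <= l\<^sup>2 * a + l powr (2 - q) * Q" if "l > 0" for l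
  proof -
   have "(l2n (rst A E0))^2 <= (\<integral>x. l\<^sup>2 * indicator A x + l powr (2 - q) * norm (E0 x) powr q)" unfolding norm_cls[OF s]
    using square_le_powr_split[OF norm_ge_zero that, of q "E0 _"] q
    by (intro integral_mono sqi_integrable[OF s] Bochner_Integration.integrable_add integrable_mult_right Ai qi(1)) (auto simp: indicator_def)
   also have "... = l\<^sup>2 * a + l powr (2 - q) * Q" using A(1) Ai qi by (subst lint_add) (auto simp: a_def)
   finally show ?thesis .
  qed
  have "(l2n (rst A E0))^2 <= (1 + Q) * a powr (1 - 2/q)"
  proof (cases "a = 0")
   case True
   have "emeasure lborel A = en a" unfolding a_def by (rule emeasure_eq_ennreal_measure) (use fin in auto)
   then have "A : null_sets lborel" using True A(1) by auto
   then have "cls (rst A E0) = 0" unfolding zero_l2_def by (intro cls_eqI s sqi_zero eventually_mono[OF AE_not_in]) auto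
   then show ?thesis using True by simp
  next
   case False
   then have a: "a > 0" by (simp add: a_def order_less_le)
   have "(a powr (- 1/q))^2 * a + (a powr (- 1/q)) powr (2 - q) * Q = (1 + Q) * a powr (1 - 2/q)"
   proof -
    have "(a powr u)^2 * a = a powr (u + u + 1)" for u using a by (simp only: power2_eq_square powr_add powr_one)
    from this[of "- 1/q"] have "(a powr (- 1/q))^2 * a = a powr (- 1/q + - 1/q + 1)" .
    moreover have "(- 1/q) * (2 - q) = 1 - 2/q" "- 1/q + - 1/q + 1 = 1 - 2/q" using q by (auto simp: field_simps)
    ultimately show ?thesis by (simp only: powr_powr) (simp add: algebra_simps)
   qed
   then show ?thesis using l[of "a powr (- 1/q)"] a by simp
  qed
  then have "l2n (rst A E0) <= sqrt ((1 + Q) * a powr (1 - 2/q))" by (rule real_le_rsqrt)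
  also have "... = sqrt (1 + Q) * a powr (1/2 - 1/q)"
  proof -
   have "(1 - 2/q) * (1/2) = 1/2 - 1/q" using q by (simp add: field_simps)
   then show ?thesis unfolding real_sqrt_mult powr_half_sqrt[OF powr_ge_zero, symmetric] powr_powr by (simp only: a_def)
  qed
  finally show ?thesis by (simp add: a_def)
 qed
 then show ?thesis using Q(2) by (intro exI[of _ "sqrt (1 + Q)"]) auto
qed

text \<open>The equation is tested with \<open>mulop t e\<close>. Since t lies between 0 and 1, t^2
  is at most t, so a single factor t in the test still controls the square of the norm; the source
  enters only where t is nonzero.\<close>

lemma elec_energy:
 assumes s: "adm s" and e: "elec s e" and t: "t : BM" "!!x. 0 <= t x & t x <= 1" "mulop t e : curlperp \<Omega>"
  and A: "A : sets borel" "!!x. x : \<Omega> ==> t x ~= 0 ==> x : A"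
 shows "norm (mulop t e) <= \<sigma>2 / \<sigma>1 * l2n (rst A E0)"
proof -
 have tb: "AE x. \<bar>t x\<bar> <= 1" using t(2) by simp
 have st: "sqi (%x. t x *R rep e x)" by (rule sqi_bdd_mult[OF t(1) tb sqi_rep])
 have sA: "sqi (rst A E0)" by (rule sqi_indicator[OF E0(1) A(1)])
 define X where "X = norm (mulop t e)"
 define Y where "Y = l2n (rst A E0)"
 have X2: "X\<^sup>2 = (\<integral>x. (norm (t x *R rep e x))^2)" unfolding X_def mulop_def by (rule norm_cls[OF st])
 have sg: "0 <= s x" "\<sigma>1 <= s x" "s x <= \<sigma>2" for x using s \<sigma> by (auto simp: adm_def intro: order_trans[of 0 \<sigma>1])
 have ss: "sqi (%x. s x *R rep (\<E> + e) x)" using adm(1,2)[OF s] by (intro sqi_bdd_mult[where c = \<sigma>2]) auto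
 have "(\<integral>x. \<sigma>1 * (norm (t x *R rep e x))^2 - \<sigma>2 * (norm (rst A E0 x) * norm (t x *R rep e x))) <= inner (mulop s (\<E> + e)) (mulop t e)"
  unfolding mulop_def inner_cls[OF ss st]
 proof (rule integral_mono_AE)
  show "integrable lborel (%x. \<sigma>1 * (norm (t x *R rep e x))^2 - \<sigma>2 * (norm (rst A E0 x) * norm (t x *R rep e x)))"
   using sqi_inner[OF sqi_norm[OF sA] sqi_norm[OF st]] sqi_integrable[OF st] by (intro Bochner_Integration.integrable_diff integrable_mult_right) auto
  show "AE x. \<sigma>1 * (norm (t x *R rep e x))^2 - \<sigma>2 * (norm (rst A E0 x) * norm (t x *R rep e x)) <= s x *R rep (\<E> + e) x \<bullet> t x *R rep e x"
   using rep_add[of \<E> e] rep_cls[OF E0(1)]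
  proof eventually_elim
   case (elim x)
   have tx: "0 <= t x" "t x <= 1" using t(2) by auto
   have 1: "\<sigma>1 * (norm (t x *R rep e x))^2 <= s x * t x * (norm (rep e x))^2"
   proof -
    have "\<sigma>1 * (t x * t x) <= s x * (t x * 1)" using tx sg \<sigma> by (intro mult_mono) (auto intro: mult_left_le)
    then show ?thesis using mult_right_mono[of "\<sigma>1 * (t x * t x)" "s x * t x" "(norm (rep e x))^2"] by (simp add: power_mult_distrib power2_eq_square[of "t x"] mult.assoc)
   qed
   have 2: "s x * (t x * (E0 x \<bullet> rep e x)) >= - (\<sigma>2 * (norm (rst A E0 x) * norm (t x *R rep e x)))"
   proof (cases "x : \<Omega> & t x ~= 0")
    case True
    have "\<bar>s x * (t x * (E0 x \<bullet> rep e x))\<bar> <= \<sigma>2 * (t x * (norm (E0 x) * norm (rep e x)))"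
     unfolding abs_mult using tx sg \<sigma> by (intro mult_mono Cauchy_Schwarz_ineq2) auto
    then show ?thesis using A(2)[of x] True tx by (simp add: algebra_simps abs_le_iff)
   qed (use E0(2)[of x] sg(1)[of x] \<sigma> in auto)
   show ?case unfolding elim using 1 2 by (simp add: inner_add_left power2_norm_eq_inner algebra_simps)
  qed
 qed (rule sqi_inner[OF ss st])
 moreover have "inner (mulop s (\<E> + e)) (mulop t e) = 0" using e t(3) by (simp add: elec_def)
 moreover have "(\<integral>x. \<sigma>1 * (norm (t x *R rep e x))^2 - \<sigma>2 * (norm (rst A E0 x) * norm (t x *R rep e x)))
   = \<sigma>1 * X\<^sup>2 - \<sigma>2 * (\<integral>x. norm (rst A E0 x) * norm (t x *R rep e x))"
  unfolding X2 using sqi_inner[OF sqi_norm[OF sA] sqi_norm[OF st]] sqi_integrable[OF st] by (subst lint_diff) (auto simp del: norm_scaleR)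
 moreover have "\<sigma>2 * (\<integral>x. norm (rst A E0 x) * norm (t x *R rep e x)) <= \<sigma>2 * (Y * X)"
 proof (rule mult_left_mono)
  have "inner (cls (%x. norm (rst A E0 x))) (cls (%x. norm (t x *R rep e x))) <= l2n (%x. norm (rst A E0 x)) * l2n (%x. norm (t x *R rep e x))"
   by (rule norm_cauchy_schwarz)
  also have "... <= Y * X" unfolding X_def Y_def mulop_def by (intro mult_mono norm_cls_mono sqi_bm[OF sqi_norm] sA st) auto
  finally show "(\<integral>x. norm (rst A E0 x) * norm (t x *R rep e x)) <= Y * X" unfolding inner_cls[OF sqi_norm[OF sA] sqi_norm[OF st]] inner_real_def .
 qed (use \<sigma> in simp)
 ultimately have "\<sigma>1 * X\<^sup>2 <= \<sigma>2 * (Y * X)" by linarith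
 moreover have "X >= 0" "Y >= 0" by (auto simp: X_def Y_def)
 ultimately show ?thesis unfolding X_def[symmetric] Y_def[symmetric] using \<sigma> by (cases "X = 0") (auto simp: power2_eq_square field_simps)
qed

text \<open>Stampacchia's method. The gradient of the truncated potential is 0 off the domain
  because \<open>e\<close> is, so \<open>h10_curlperp\<close> admits it as a test whatever constants
  \<psi> takes there. One \<open>M\<close> serves all admissible \<open>s\<close>, as the bounds for
  the fixed point map require.\<close>

lemma elec_potential_bounded:
 "EX M>=0. ALL s e \<psi>. adm s --> elec s e --> (\<psi>, e) : h10 \<B> --> (AE x. \<bar>rep \<psi> x\<bar> <= M)"
proof -
 \<comment> \<open>The midpoint of 1 / q and 1/3: below 1/3 for \<open>sobolev_level\<close>, and
   above 1 / q so that \<theta> + 1/2 + (1/2 - 1/q) exceeds 1 by \<beta>.\<close>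
 define \<theta> where "\<theta> = (1/q + 1/3) / 2"
 define \<beta> where "\<beta> = \<theta> - 1/q"
 have q3: "1/q < 1/3" "0 < 1/q" using q by (auto simp: field_simps)
 then have th: "0 < \<theta>" "\<theta> < 1/3" "\<beta> > 0" by (auto simp: \<theta>_def \<beta>_def field_simps)
 have R2: "R + 2 > 0" using \<Omega>(3) by simp
 obtain C where C: "C > 0" "ALL v g A. (v, g) : h10 \<B> --> A : sets borel --> A <= \<B> -->
  inner (cls (indicator A)) (absl v) <= C * measure lborel A powr \<theta> * inner (cls (indicator \<B>)) (absl g)" using h10_sobolev_level[OF R2 th(1,2)] by blast
 obtain Q where Q: "Q > 0" "!!A. A : sets borel ==> A <= \<B> ==> l2n (rst A E0) <= Q * measure lborel A powr (1/2 - 1/q)" using E0_level by blast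
 define D where "D = 2 * C * (\<sigma>2 / \<sigma>1 * Q)"
 have D: "D > 0" using C(1) Q(1) \<sigma> by (simp add: D_def)
 define V where "V = measure lborel \<B> + 1"
 have V: "V > 0" by (simp add: V_def add_nonneg_pos)
 define M where "M = 2 * 2 powr (1 / \<beta>) * D * V powr \<beta>"
 have M: "M >= 0" using D by (simp add: M_def)
 have fB: "emeasure lborel \<B> < \<infinity>" by (rule emeasure_bounded_finite) simp
 \<comment> \<open>The sign \<kappa> handles the upper and the lower bound at once, by truncating
   \<psi> or its negative.\<close>
 have one: "AE x. \<kappa> * rep \<psi> x <= M" if s: "adm s" and e: "elec s e" and \<psi>: "(\<psi>, e) : h10 \<B>" and \<kappa>: "\<kappa> = 1 \<or> \<kappa> = -1" for s e \<psi> and \<kappa> :: real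
 proof -
  define A where "A k = {x : \<B>. \<kappa> * rep \<psi> x > k}" for k
  have A: "A k : sets borel" "A k <= \<B>" for k unfolding A_def by (measurable, auto)
  have Af: "emeasure lborel (A k) < \<infinity>" for k using emeasure_mono[OF A(2)[of k], of lborel] fB by (auto intro: le_less_trans)
  have Afm: "A k : fmeasurable lborel" for k using A(1)[of k] Af[of k] by (simp add: fmeasurableI)
  define f where "f k = measure lborel (A k)" for k
  have step: "(h - k) * f h <= D * f k powr (1 + \<beta>)" if "0 <= k" "k < h" for h k
  proof -
   define \<tau> where "\<tau> s = ((max 0 (s - k))^2 - (max 0 (s - h))^2) / (2 * (h - k))" for s
   define \<tau>' where "\<tau>' s = (max 0 (s - k) - max 0 (s - h)) / (h - k)" for s
   note T = truncation_primitive[OF \<open>k < h\<close>, folded \<tau>_def \<tau>'_def]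
   note h = h10_chain[OF \<psi>, of "%s. \<tau> (\<kappa> * s)" "%s. \<kappa> * \<tau>' (\<kappa> * s)" 1]
   have hT: "(cls (%x. \<tau> (\<kappa> * rep \<psi> x)), mulop (%x. \<kappa> * \<tau>' (\<kappa> * rep \<psi> x)) e) : h10 \<B>" "sqi (%x. \<tau> (\<kappa> * rep \<psi> x))"
   proof -
    have a: "((%s. \<tau> (\<kappa> * s)) has_real_derivative \<kappa> * \<tau>' (\<kappa> * s)) (at s)" for s
     using DERIV_chain2[OF T(1) DERIV_cmult_Id, of \<kappa> s UNIV] by (simp add: mult.commute)
    have b: "continuous_on UNIV (%s. \<kappa> * \<tau>' (\<kappa> * s))" by (intro continuous_intros continuous_on_compose2[OF T(2)]) auto
    have c: "\<bar>\<kappa> * \<tau>' (\<kappa> * s)\<bar> <= 1" for s using \<kappa> T(3,4)[of "\<kappa> * s"] by (auto simp: abs_mult)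
    show "(cls (%x. \<tau> (\<kappa> * rep \<psi> x)), mulop (%x. \<kappa> * \<tau>' (\<kappa> * rep \<psi> x)) e) : h10 \<B>" "sqi (%x. \<tau> (\<kappa> * rep \<psi> x))"
     using h[OF a b _ c] T(6)[of 0] \<open>0 <= k\<close> by auto
   qed
   define t where "t x = \<tau>' (\<kappa> * rep \<psi> x)" for x
   have tm: "t : BM" unfolding t_def using bm_cont[OF T(2)] by measurable
   have t01: "0 <= t x & t x <= 1" for x using T(3,4) by (simp add: t_def)
   have st: "sqi (%x. t x *R rep e x)" by (rule sqi_bdd_mult[OF tm _ sqi_rep, of 1]) (use t01 in simp)
   have m\<kappa>: "mulop (%x. \<kappa> * \<tau>' (\<kappa> * rep \<psi> x)) e = \<kappa> *R mulop t e"
    unfolding mulop_def t_def cls_scaleR[OF st[unfolded t_def]] by simp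
   have eL: "e : L2on \<Omega>" using e by (simp add: elec_def curlperp_def)
   have sub: "subspace (curlperp \<Omega>)" by (rule curlperp_closed(2)[OF \<Omega>_borel(3)])
   have "mulop t e : L2on \<Omega>" unfolding mulop_def L2on_cls[OF st] using eL unfolding L2on_def mem_Collect_eq by eventually_elim simp
   then have "\<kappa> *R mulop t e : L2on \<Omega>" by (intro subspace_scale L2on_closed(2) \<Omega>_borel(3))
   from h10_curlperp[OF \<Omega>(1) hT(1)[unfolded m\<kappa>] this] have "\<kappa> *R mulop t e : curlperp \<Omega>" .
   from subspace_scale[OF sub this, of \<kappa>] have tN: "mulop t e : curlperp \<Omega>" using \<kappa> by auto
   have iB: "inner (cls (indicator \<B>)) (cls (%x. norm (t x *R rep e x))) = (\<integral>x. indicator \<B> x * norm (t x *R rep e x))"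
    by (rule inner_ind[OF _ order_refl sqi_norm[OF st]]) simp
   have tA: "x : A k" if "x : \<B>" "t x ~= 0" for x using that T(5)[of "\<kappa> * rep \<psi> x"] by (auto simp: A_def t_def not_less[symmetric])
   have "(h - k) / 2 * f h = (\<integral>x. (h - k) / 2 * indicator (A h) x)" using A(1)[of h] by (simp add: f_def)
   also have "... <= (\<integral>x. indicator (A k) x * norm (\<tau> (\<kappa> * rep \<psi> x)))"
   proof (rule integral_mono)
    show "integrable lborel (%x. (h - k) / 2 * indicator (A h) x)" using Af[of h] A(1)[of h] by auto
    show "integrable lborel (%x. indicator (A k) x * norm (\<tau> (\<kappa> * rep \<psi> x)))" using sqi_inner[OF sqi_ind[OF A] sqi_norm[OF hT(2)], of k] by simp
    show "(h - k) / 2 * indicator (A h) x <= indicator (A k) x * norm (\<tau> (\<kappa> * rep \<psi> x))" for x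
     using T(7)[of "\<kappa> * rep \<psi> x"] \<open>k < h\<close> by (auto simp: A_def indicator_def)
   qed
   also have "... = inner (cls (indicator (A k))) (absl (cls (%x. \<tau> (\<kappa> * rep \<psi> x))))" using inner_ind[OF A sqi_norm[OF hT(2)], of k] absl_cls[OF hT(2)] by simp
   also have "... <= C * f k powr \<theta> * inner (cls (indicator \<B>)) (absl (\<kappa> *R mulop t e))" unfolding f_def using C(2)[rule_format, OF hT(1) A] m\<kappa> by simp
   also have "absl (\<kappa> *R mulop t e) = cls (%x. norm (t x *R rep e x))" unfolding mulop_def cls_scaleR[OF st] absl_cls[OF sqi_scaleR[OF st]] using \<kappa> by auto
   also have "inner (cls (indicator \<B>)) (cls (%x. norm (t x *R rep e x))) = inner (cls (indicator (A k))) (cls (%x. norm (t x *R rep e x)))"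
    unfolding iB inner_ind[OF A sqi_norm[OF st]] by (rule lint_cong) (use tA A(2)[of k] in \<open>auto simp: indicator_def\<close>)
   also have "... <= l2n (indicator (A k) :: _ => real) * l2n (%x. norm (t x *R rep e x))" by (rule norm_cauchy_schwarz)
   also have "... <= f k powr (1/2) * (\<sigma>2 / \<sigma>1 * (Q * f k powr (1/2 - 1/q)))"
   proof (intro mult_mono)
    have "(l2n (indicator (A k) :: _ => real))^2 = f k"
    proof -
     have "(%x. (norm (indicator (A k) x :: real))^2) = indicator (A k)" by (auto simp: indicator_def fun_eq_iff)
     then show ?thesis unfolding norm_cls[OF sqi_ind[OF A]] f_def using A(1)[of k] by simp
    qed
    then show "l2n (indicator (A k) :: _ => real) <= f k powr (1/2)" by (metis norm_ge_zero order_refl powr_half_sqrt real_sqrt_unique measure_nonneg f_def)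
    have "l2n (%x. norm (t x *R rep e x)) <= norm (mulop t e)" unfolding mulop_def by (intro norm_cls_mono sqi_bm[OF sqi_norm] st) auto
    also have "... <= \<sigma>2 / \<sigma>1 * l2n (rst (A k) E0)" using \<Omega>(2) tA by (intro elec_energy[OF s e tm t01 tN A(1)]) force
    also have "... <= \<sigma>2 / \<sigma>1 * (Q * f k powr (1/2 - 1/q))" unfolding f_def using Q(2)[OF A] \<sigma> by (intro mult_left_mono) auto
    finally show "l2n (%x. norm (t x *R rep e x)) <= \<sigma>2 / \<sigma>1 * (Q * f k powr (1/2 - 1/q))" .
   qed (auto simp: f_def)
   finally have "(h - k) / 2 * f h <= C * f k powr \<theta> * (f k powr (1/2) * (\<sigma>2 / \<sigma>1 * (Q * f k powr (1/2 - 1/q))))"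
    using C(1) by (simp add: mult_left_mono)
   moreover have "f k powr (1 + \<beta>) = f k powr \<theta> * (f k powr (1/2) * f k powr (1/2 - 1/q))"
    unfolding powr_add[symmetric] by (simp add: \<beta>_def algebra_simps)
   ultimately show ?thesis by (simp add: D_def algebra_simps)
  qed
  have "f M = 0" unfolding M_def
  proof (rule stampacchia_iteration[OF _ _ _ th(3) D V step])
   show "f 0 <= V" unfolding f_def V_def using measure_mono_fmeasurable[OF A(2)[of 0] _ fmeasurableI[OF _ fB]] A(1)[of 0] by fastforce
   show "f h <= f k" if "k <= h" for h k unfolding f_def using that A(1) by (intro measure_mono_fmeasurable Afm) (auto simp: A_def)
  qed (simp add: f_def)
  then have "A M : null_sets lborel" using Af[of M] A(1)[of M] by (auto simp: f_def measure_def enn2real_eq_0_iff null_sets_def)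
  moreover have "\<psi> : L2on \<B>"
  proof -
   obtain \<phi> where \<phi>: "!!n. C1c \<B> (\<phi> n)" "(%n. cls (\<phi> n)) ---> \<psi>" using \<psi> unfolding h10_iff by metis
   have "cls (\<phi> n) : L2on \<B>" for n unfolding L2on_cls[OF C1c_sqi(1)[OF \<phi>(1)]] using C1c_ball_supp(1)[OF \<phi>(1)] by auto
   then show ?thesis using closed_sequentially[OF L2on_closed(1) _ \<phi>(2)] by simp
  qed
  ultimately have "AE x. x ~: A M" "AE x. x ~: \<B> --> rep \<psi> x = 0" unfolding L2on_def by (auto dest: AE_not_in)
  then show ?thesis by eventually_elim (use M in \<open>auto simp: A_def not_less\<close>)
 qed
 have "AE x. \<bar>rep \<psi> x\<bar> <= M" if "adm s" "elec s e" "(\<psi>, e) : h10 \<B>" for s e \<psi>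
  using one[OF that, of 1] one[OF that, of "-1"] by (auto elim: eventually_elim2 simp: abs_le_iff)
 then show ?thesis using M by blast
qed

end

section \<open>The heat equation and the fixed point\<close>

lemma subseq_tendsto:
 fixes X :: "nat => 'a::metric_space"
 assumes "!!r. strict_mono (r :: nat => nat) ==> EX k. strict_mono (k :: nat => nat) & (%n. X (r (k n))) ---> l"
 shows "X ---> l"
proof (rule ccontr)
 assume "\<not> ?thesis"
 then obtain e where e: "e > 0" "\<exists>\<^sub>\<infinity>n. dist (X n) l >= e" unfolding tendsto_iff frequently_def cofinite_eq_sequentially not_le by blast
 then have inf: "infinite {n. dist (X n) l >= e}" by (simp add: INFM_iff_infinite)
 obtain k where k: "strict_mono k" "(%n. X (enumerate {n. dist (X n) l >= e} (k n))) ---> l" using assms[OF strict_mono_enumerate[OF inf]] by blast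
 from tendstoD[OF k(2) e(1)] obtain n where "dist (X (enumerate {n. dist (X n) l >= e} (k n))) l < e" by (auto dest: eventually_happens)
 moreover have "dist (X (enumerate {n. dist (X n) l >= e} (k n))) l >= e" using enumerate_in_set[OF inf, of "k n"] by simp
 ultimately show False by simp
qed

text \<open>Makes approximating test functions uniformly bounded while leaving both value and
  gradient of a limit bounded by \<open>M\<close> unchanged.\<close>

lemma bounded_truncation:
 fixes M :: real assumes M: "M >= 0"
 shows "\<exists>\<beta> \<beta>'. (ALL s. (\<beta> has_real_derivative \<beta>' s) (at s)) & continuous_on UNIV \<beta>' & \<beta> 0 = 0
  & (ALL s. \<bar>\<beta>' s\<bar> <= 2) & (ALL s. \<bar>\<beta> s\<bar> <= M + 1) & (ALL s. \<bar>s\<bar> <= M --> \<beta> s = s & \<beta>' s = 1)"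
proof -
 have l: "M < M + 1" by simp
 define \<tau> where "\<tau> s = ((max 0 (s - M))^2 - (max 0 (s - (M + 1)))^2) / (2 * (M + 1 - M))" for s
 define \<tau>' where "\<tau>' s = (max 0 (s - M) - max 0 (s - (M + 1))) / (M + 1 - M)" for s
 note T = truncation_primitive[OF l, folded \<tau>_def \<tau>'_def]
 have t: "0 <= s - \<tau> s & s - \<tau> s <= M + 1" if "s >= 0" for s
 proof -
  consider "s <= M" | "M <= s" "s <= M + 1" | "M + 1 <= s" by linarith
  then show ?thesis
  proof cases
   case 2
   have "(s - M)^2 <= (s - M) * 1" "(s - M)^2 >= 0" using 2 unfolding power2_eq_square by (intro mult_left_mono, auto)
   then have "0 <= \<tau> s" "\<tau> s <= (s - M) / 2" using 2 by (simp_all add: \<tau>_def)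
   then show ?thesis using 2 M by simp
  qed (use that M T(6)[of s] in \<open>auto simp: \<tau>_def max_def power2_eq_square field_simps\<close>)
 qed
 define \<beta> where "\<beta> s = s - \<tau> s + \<tau> (- s)" for s
 define \<beta>' where "\<beta>' s = 1 - \<tau>' s + \<tau>' (- s) * - 1" for s
 have "(\<beta> has_real_derivative \<beta>' s) (at s)" for s unfolding \<beta>_def \<beta>'_def
  by (intro DERIV_add DERIV_diff DERIV_ident T(1) DERIV_chain2[OF T(1) DERIV_minus[OF DERIV_ident]])
 moreover have "continuous_on UNIV \<beta>'" unfolding \<beta>'_def by (intro continuous_intros T(2) continuous_on_compose2[OF T(2)]) auto
 moreover have "\<bar>\<beta>' s\<bar> <= 2" for s using T(3,4)[of s] T(3,4)[of "- s"] by (simp add: \<beta>'_def abs_le_iff)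
 moreover have "\<bar>\<beta> s\<bar> <= M + 1" for s using t[of s] t[of "- s"] T(6)[of s] T(6)[of "- s"] M by (cases "s >= 0") (auto simp: \<beta>_def abs_le_iff)
 moreover have "\<beta> s = s & \<beta>' s = 1" if "\<bar>s\<bar> <= M" for s using that T(5,6)[of s] T(5,6)[of "- s"] by (simp add: \<beta>_def \<beta>'_def abs_le_iff)
 ultimately show ?thesis using M by (intro exI[of _ \<beta>] exI[of _ \<beta>']) auto
qed

context joule_problem begin

abbreviation "field s e \<equiv> mulop s (\<E> + e)"

text \<open>The product of \<phi> with E0 is recorded as a coordinate of its own: for a limit of
  test functions, possibly unbounded, \<open>mulop\<close> is not under control, whereas in the
  closed space of triples the product is just a limit, bounded by the gradient through
  \<open>sobolev_weighted\<close>.\<close>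

definition jspace :: "(real l2 \<times> (real^3) l2 \<times> (real^3) l2) set" where
 "jspace = closure ((%\<phi>. (cls \<phi>, cls (grad \<phi>), mulop \<phi> \<E>)) ` Collect (C1c \<Omega>))"

lemma jspace_closed: "closed jspace" "subspace jspace"
proof -
 show "subspace jspace" unfolding jspace_def
 proof (rule C1c_closure_subspace)
  fix \<phi> \<psi> assume \<phi>: "C1c \<Omega> \<phi>" and \<psi>: "C1c \<Omega> \<psi>"
  show "(cls (%x. \<phi> x + \<psi> x), cls (grad (%x. \<phi> x + \<psi> x)), mulop (%x. \<phi> x + \<psi> x) \<E>) = (cls \<phi>, cls (grad \<phi>), mulop \<phi> \<E>) + (cls \<psi>, cls (grad \<psi>), mulop \<psi> \<E>)"
   using C1c_sqi[OF \<phi>] C1c_sqi[OF \<psi>] sqi_mulop_C1c[OF \<phi> E0(1)] sqi_mulop_C1c[OF \<psi> E0(1)]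
   by (simp add: mulop_C1c_cls[OF \<phi> E0(1)] mulop_C1c_cls[OF \<psi> E0(1)] mulop_C1c_cls[OF C1c_add[OF \<phi> \<psi>] E0(1)] cls_add C1_add(2)[OF C1c_C1[OF \<phi>] C1c_C1[OF \<psi>]] scaleR_add_left)
  show "(cls (%x. c * \<phi> x), cls (grad (%x. c * \<phi> x)), mulop (%x. c * \<phi> x) \<E>) = c *R (cls \<phi>, cls (grad \<phi>), mulop \<phi> \<E>)" for c
   using C1c_sqi[OF \<phi>] sqi_mulop_C1c[OF \<phi> E0(1)] by (simp add: mulop_C1c_cls[OF \<phi> E0(1)] mulop_C1c_cls[OF C1c_cmult[OF \<phi>] E0(1)] cls_scaleR C1_cmult(2)[OF C1c_C1[OF \<phi>]])
 qed
qed (simp add: jspace_def)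

lemma C1c_jspace: "C1c \<Omega> \<phi> ==> (cls \<phi>, cls (grad \<phi>), mulop \<phi> \<E>) : jspace" unfolding jspace_def by (rule subsetD[OF closure_subset]) auto

lemma jspace_obtain:
 assumes "(v, g, m) : jspace"
 obtains \<phi> where "!!n. C1c \<Omega> (\<phi> n)" "(%n. cls (\<phi> n)) ---> v" "(%n. cls (grad (\<phi> n))) ---> g" "(%n. mulop (\<phi> n) \<E>) ---> m"
proof -
 obtain x where x: "!!n. x n : (%\<phi>. (cls \<phi>, cls (grad \<phi>), mulop \<phi> \<E>)) ` Collect (C1c \<Omega>)" "x ---> (v, g, m)"
  using assms unfolding jspace_def closure_sequential by blast
 from x(1) have "ALL n. \<exists>\<phi>. C1c \<Omega> \<phi> & x n = (cls \<phi>, cls (grad \<phi>), mulop \<phi> \<E>)" by blast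
 then obtain \<phi> where \<phi>: "!!n. C1c \<Omega> (\<phi> n)" "!!n. x n = (cls (\<phi> n), cls (grad (\<phi> n)), mulop (\<phi> n) \<E>)" by metis
 have "x = (%n. (cls (\<phi> n), cls (grad (\<phi> n)), mulop (\<phi> n) \<E>))" using \<phi>(2) by blast
 then show ?thesis using tendsto_fst[OF x(2)] tendsto_fst[OF tendsto_snd[OF x(2)]] tendsto_snd[OF tendsto_snd[OF x(2)]] \<phi>(1) by (intro that[of \<phi>]) auto
qed

lemma jspace_h10: "(v, g, m) : jspace ==> (v, g) : h10 \<Omega>" by (erule jspace_obtain) (auto simp: h10_iff)

lemma jspace_bound: "EX C>0. ALL v g m. (v, g, m) : jspace --> norm v <= C * norm g & norm m <= C * norm g"
proof -
 obtain C1 where C1: "C1 > 0" "!!\<phi>. C1c (ball 0 R) \<phi> ==> l2n \<phi> <= C1 * l2n (grad \<phi>)" using poincare_ball[OF \<Omega>(3)] by blast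
 have "(\<integral>\<^sup>+x. en (\<bar>norm (E0 x)\<bar> powr q)) < \<infinity>" using E0(3) by simp
 from sobolev_weighted[OF \<Omega>(3) q sqi_norm[OF E0(1)] this] obtain C2 where
  C2: "C2 > 0" "!!\<phi>. C1c (ball 0 R) \<phi> ==> sqi (%x. \<phi> x *R norm (E0 x)) & l2n (%x. \<phi> x *R norm (E0 x)) <= C2 * l2n (grad \<phi>)" by blast
 define C where "C = max C1 C2"
 have b: "l2n \<phi> <= C * l2n (grad \<phi>) & norm (mulop \<phi> \<E>) <= C * l2n (grad \<phi>)" if \<phi>: "C1c \<Omega> \<phi>" for \<phi>
 proof -
  note \<phi>b = C1c_mono[OF \<phi> \<Omega>(2)]
  have "norm (mulop \<phi> \<E>) <= l2n (%x. \<phi> x *R norm (E0 x))" unfolding mulop_C1c_cls[OF \<phi> E0(1)]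
   using C2(2)[OF \<phi>b] by (intro norm_cls_mono sqi_bm[OF sqi_mulop_C1c[OF \<phi> E0(1)]]) auto
  then show ?thesis using C1(2)[OF \<phi>b] C2(2)[OF \<phi>b] mult_right_mono[of C1 C "l2n (grad \<phi>)"] mult_right_mono[of C2 C "l2n (grad \<phi>)"]
   by (auto simp: C_def)
 qed
 have "norm v <= C * norm g & norm m <= C * norm g" if vgm: "(v, g, m) : jspace" for v g m
 proof (rule jspace_obtain[OF vgm])
  fix \<phi> assume \<phi>: "!!n. C1c \<Omega> (\<phi> n)" "(%n. cls (\<phi> n)) ---> v" "(%n. cls (grad (\<phi> n))) ---> g" "(%n. mulop (\<phi> n) \<E>) ---> m"
  note r = tendsto_mult[OF tendsto_const tendsto_norm[OF \<phi>(3)], of C]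
  show ?thesis using LIMSEQ_le[OF tendsto_norm[OF \<phi>(2)] r] LIMSEQ_le[OF tendsto_norm[OF \<phi>(4)] r] b[OF \<phi>(1)] by blast
 qed
 then show ?thesis using C1(1) by (intro exI[of _ C]) (auto simp: C_def)
qed

text \<open>The heat source \<open>s |E|\<^sup>2\<close> is only integrable; for \<open>\<E> + e\<close> with \<open>e\<close> the gradient of \<open>\<psi>\<close> it is the
 functional \<open>\<phi> \<mapsto> \<integral> s E \<bullet> (\<phi> E0 - \<psi> grad \<phi>)\<close>, which is bounded because \<open>\<psi>\<close> is.\<close>

definition joule :: "(real^3) l2 => (real^3 => real) => (real^3) l2 => real l2 => real l2 => (real^3) l2 => (real^3) l2 => bool" where
 "joule G0 s e \<psi> v g m <-> elec s e & (\<psi>, e) : h10 \<B> & (v, g, m) : jspace &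
  (ALL v' g' m'. (v', g', m') : jspace --> inner (g + G0 + mulop (rep \<psi>) (field s e)) g' = inner (field s e) m')"

lemma joule_exists: assumes s: "adm s" shows "EX e \<psi> v g m. joule G0 s e \<psi> v g m"
proof -
 obtain e where e: "elec s e" using elec_exists[OF s] by blast
 obtain \<psi> where \<psi>: "(\<psi>, e) : h10 \<B>" using curlperp_potential[OF \<Omega>_borel(3) \<Omega>(2,3)] e by (auto simp: elec_def)
 obtain C where C: "C > 0" "!!v g m. (v, g, m) : jspace ==> norm v <= C * norm g & norm m <= C * norm g" using jspace_bound by blast
 \<comment> \<open>The form sees gradients only. On \<open>jspace\<close> the other two coordinates
   are bounded by C times the gradient, hence the coercivity constant 1 / (1 + 2 C^2).\<close>
 define A :: "real l2 \<times> (real^3) l2 \<times> (real^3) l2 => real l2 \<times> (real^3) l2 \<times> (real^3) l2" where "A x = (0, fst (snd x), 0)" for x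
 have A: "bounded_linear A" unfolding A_def[abs_def] by (intro bounded_linear_Pair bounded_linear_zero bounded_linear_fst_comp bounded_linear_snd)
 have co: "1 / (1 + 2 * C\<^sup>2) * (norm x)^2 <= inner (A x) x" if "x : jspace" for x
 proof (cases x)
  case (fields v g m)
  have "(norm v)^2 <= (C * norm g)^2" "(norm m)^2 <= (C * norm g)^2" using C(2)[of v g m] that fields by (auto intro!: power_mono)
  then have "(norm x)^2 <= (1 + 2 * C\<^sup>2) * (norm g)^2" unfolding fields by (simp add: norm_Pair power_mult_distrib algebra_simps)
  moreover have "1 + 2 * C\<^sup>2 > 0" by (simp add: add_pos_nonneg)
  ultimately show ?thesis unfolding fields by (simp add: A_def inner_prod_def power2_norm_eq_inner[symmetric] field_simps)
 qed
 have "1 / (1 + 2 * C\<^sup>2) > 0" by (simp add: add_pos_nonneg)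
 from lax_milgram[OF jspace_closed A this co, of "(0, - G0 - mulop (rep \<psi>) (field s e), field s e)"]
 obtain x where x: "x : jspace" "ALL y:jspace. inner (A x - (0, - G0 - mulop (rep \<psi>) (field s e), field s e)) y = 0" by blast
 obtain v g m where xe: "x = (v, g, m)" by (cases x)
 have "inner (g + G0 + mulop (rep \<psi>) (field s e)) g' = inner (field s e) m'" if "(v', g', m') : jspace" for v' g' m'
  using bspec[OF x(2) that] by (simp add: xe A_def inner_prod_def inner_diff_left inner_add_left algebra_simps)
 then show ?thesis unfolding joule_def using e \<psi> x(1) xe by blast
qed

lemma field_bound: "adm s ==> elec s e ==> norm (field s e) <= \<sigma>2 * (norm \<E> + \<sigma>2 / \<sigma>1 * norm \<E>)"
 using adm(4)[of s "\<E> + e"] norm_triangle_ineq[of \<E> e] elec_bound[of s e] \<sigma> by (intro order_trans[OF adm(4)] mult_left_mono) auto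

lemma quadratic_bound: "x\<^sup>2 <= a * x ==> x >= 0 ==> a >= 0 ==> x <= (a :: real)" by (cases "x = 0") (auto simp: power2_eq_square)

text \<open>Testing the equation with its own solution gives a quadratic inequality for the norm of
  \<open>g\<close>. The bound is uniform in \<open>s\<close> because those for \<psi>, for the field
  and for \<open>jspace\<close> are, and compactness of the fixed point map rests on it.\<close>

lemma joule_bound: "EX K. ALL s e \<psi> v g m. adm s --> joule G0 s e \<psi> v g m --> norm g <= K"
proof -
 obtain C where C: "C > 0" "!!v g m. (v, g, m) : jspace ==> norm v <= C * norm g & norm m <= C * norm g" using jspace_bound by blast
 obtain M where M: "M >= 0" "!!s e \<psi>. adm s ==> elec s e ==> (\<psi>, e) : h10 \<B> ==> (AE x. \<bar>rep \<psi> x\<bar> <= M)" using elec_potential_bounded by blast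
 define K0 where "K0 = \<sigma>2 * (norm \<E> + \<sigma>2 / \<sigma>1 * norm \<E>)"
 have "norm g <= norm G0 + M * K0 + C * K0" if s: "adm s" and j: "joule G0 s e \<psi> v g m" for s e \<psi> v g m
 proof (rule quadratic_bound)
  let ?W = "mulop (rep \<psi>) (field s e)"
  have j': "elec s e" "(\<psi>, e) : h10 \<B>" "(v, g, m) : jspace" using j by (auto simp: joule_def)
  have F: "norm (field s e) <= K0" unfolding K0_def by (rule field_bound[OF s j'(1)])
  then have K0: "K0 >= 0" by (rule order_trans[rotated]) simp
  have "norm ?W <= M * norm (field s e)" by (rule bounded_linear_mulop(2)[OF _ M(2)[OF s j'(1,2)] M(1)]) simp
  then have W: "norm ?W <= M * K0" using mult_left_mono[OF F M(1)] by simp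
  have "inner (g + G0 + ?W) g = inner (field s e) m" using j j'(3) unfolding joule_def by blast
  then have "(norm g)^2 = inner (field s e) m - inner G0 g - inner ?W g" by (simp add: inner_add_left power2_norm_eq_inner)
  also have "... <= norm (field s e) * norm m + norm G0 * norm g + norm ?W * norm g"
   using norm_cauchy_schwarz[of "field s e" m] norm_cauchy_schwarz[of "- G0" g] norm_cauchy_schwarz[of "- ?W" g] by simp
  also have "... <= K0 * (C * norm g) + norm G0 * norm g + M * K0 * norm g" using F W C(2)[OF j'(3)] K0 M(1) by (intro add_mono mult_mono) auto
  finally show "(norm g)^2 <= (norm G0 + M * K0 + C * K0) * norm g" by (simp add: algebra_simps)
  show "norm G0 + M * K0 + C * K0 >= 0" using K0 M(1) C(1) by simp
 qed simp
 then show ?thesis by blast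
qed

text \<open>Each solution is replaced by a C1c function within 1 / (n + 1) whose gradient exceeds
  the uniform bound by at most 1, and \<open>rellich_ball\<close> is applied to these.\<close>

lemma joule_compact:
 assumes s: "!!n. adm (s n)" and j: "!!n. joule G0 (s n) (e n) (\<psi> n) (v n) (g n) (m n)"
 shows "EX r l. strict_mono (r :: nat => nat) & (%n. v (r n)) ---> l"
proof -
 obtain K where K: "!!n. norm (g n) <= K" using joule_bound[of G0] s j by meson
 have "\<exists>\<phi>. C1c (ball 0 R) \<phi> & norm (cls \<phi> - v n) < inverse (real (Suc n)) & l2n (grad \<phi>) <= K + 1" for n
 proof -
  have "(v n, g n) : h10 \<Omega>" using j jspace_h10 unfolding joule_def by blast
  then obtain \<phi> where \<phi>: "!!k. C1c \<Omega> (\<phi> k)" "(%k. cls (\<phi> k)) ---> v n" "(%k. cls (grad (\<phi> k))) ---> g n" unfolding h10_iff by metis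
  from LIMSEQ_D[OF \<phi>(2), of "inverse (real (Suc n))"] LIMSEQ_D[OF \<phi>(3), of 1] obtain N1 N2 where
   "!!k. k >= N1 ==> norm (cls (\<phi> k) - v n) < inverse (real (Suc n))" "!!k. k >= N2 ==> norm (cls (grad (\<phi> k)) - g n) < 1" by auto
  then have "norm (cls (\<phi> (max N1 N2)) - v n) < inverse (real (Suc n))" "norm (cls (grad (\<phi> (max N1 N2))) - g n) < 1" by auto
  then show ?thesis using norm_triangle_ineq2[of "cls (grad (\<phi> (max N1 N2)))" "g n"] K[of n] C1c_mono[OF \<phi>(1) \<Omega>(2)]
   by (intro exI[of _ "\<phi> (max N1 N2)"]) auto
 qed
 then obtain \<phi> where \<phi>: "!!n. C1c (ball 0 R) (\<phi> n)" "!!n. norm (cls (\<phi> n) - v n) < inverse (real (Suc n))" "!!n. l2n (grad (\<phi> n)) <= K + 1" by metis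
 from rellich_ball[OF \<Omega>(3), of \<phi>, OF \<phi>(1,3)] obtain r l where r: "strict_mono r" "(%n. cls (\<phi> (r n))) ---> l" by (auto simp: convergent_def)
 have "(%n. cls (\<phi> n) - v n) ---> 0" by (rule tendsto_norm_zero_cancel, rule tendsto_sandwich[OF _ _ tendsto_const LIMSEQ_inverse_real_of_nat])
   (intro always_eventually allI norm_ge_zero less_imp_le \<phi>(2))+
 from tendsto_diff[OF r(2) LIMSEQ_subseq_LIMSEQ[OF this r(1)]] have "(%n. v (r n)) ---> l" by (simp add: o_def)
 then show ?thesis using r(1) by blast
qed

text \<open>Convergence of the potentials in L2 makes the multipliers \<open>rep (\<psi> n)\<close>
  converge almost everywhere only along a subsequence, which therefore appears in the conclusion;
  \<open>subseq_tendsto\<close> will remove it. Applied to constant sequences the lemma also shows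
  that \<open>v\<close> depends on \<open>s\<close> alone.\<close>

lemma joule_tendsto:
 assumes s: "!!n. adm (s n)" "adm s'" "AE x. (%n. s n x) ---> s' x"
  and j: "!!n. joule G0 (s n) (e n) (\<psi> n) (v n) (g n) (m n)" "joule G0 s' e' \<psi>' v' g' m'"
 shows "EX r. strict_mono (r :: nat => nat) & (%n. v (r n)) ---> v'"
proof -
 obtain C where C: "C > 0" "!!v g m. (v, g, m) : jspace ==> norm v <= C * norm g & norm m <= C * norm g" using jspace_bound by blast
 obtain M where M: "M >= 0" "!!s e \<psi>. adm s ==> elec s e ==> (\<psi>, e) : h10 \<B> ==> (AE x. \<bar>rep \<psi> x\<bar> <= M)" using elec_potential_bounded by blast
 have j1: "!!n. elec (s n) (e n)" "!!n. (\<psi> n, e n) : h10 \<B>" "!!n. (v n, g n, m n) : jspace" using j(1) by (auto simp: joule_def)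
 have j2: "elec s' e'" "(\<psi>', e') : h10 \<B>" "(v', g', m') : jspace" using j(2) by (auto simp: joule_def)
 have e: "e ---> e'" by (rule elec_tendsto[OF s j1(1) j2(1)])
 have F: "(%n. field (s n) (e n)) ---> field s' e'" by (rule mulop_tendsto[OF adm(1)[OF s(1)] adm(1)[OF s(2)] adm(2)[OF s(1)] s(3) tendsto_add[OF tendsto_const e]])
 have "\<psi> ---> \<psi>'"
 proof -
  obtain P where P: "!!v g. (v, g) : h10 \<B> ==> norm v <= P * norm g" using h10_poincare[of "R + 2"] \<Omega>(3) by auto
  have "norm (\<psi> n - \<psi>') <= P * norm (e n - e')" for n using subspace_diff[OF h10_closed(2) j1(2) j2(2), of n] by (intro P) simp
  moreover have "(%n. P * norm (e n - e')) ---> 0" using tendsto_mult[OF tendsto_const tendsto_norm[OF LIM_zero[OF e]], of P] by simp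
  ultimately show ?thesis by (rule LIM_zero_cancel[OF Lim_null_comparison[OF always_eventually[OF allI]]])
 qed
 then obtain r where r: "strict_mono r" "AE x. (%n. rep (\<psi> (r n)) x) ---> rep \<psi>' x" using l2_AE_subseq by blast
 have Fr: "(%n. field (s (r n)) (e (r n))) ---> field s' e'" using LIMSEQ_subseq_LIMSEQ[OF F r(1)] by (simp add: o_def)
 define W where "W n = mulop (rep (\<psi> n)) (field (s n) (e n))" for n
 define W' where "W' = mulop (rep \<psi>') (field s' e')"
 have W: "(%n. W (r n)) ---> W'" unfolding W_def W'_def by (rule mulop_tendsto[OF _ _ M(2)[OF s(1) j1(1,2)] r(2) Fr]) simp_all
 have b: "norm (v n - v') <= C * (norm (W n - W') + C * norm (field (s n) (e n) - field s' e'))" for n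
 proof -
  let ?dg = "g n - g'" and ?dm = "m n - m'" and ?F = "field (s n) (e n)" and ?F' = "field s' e'"
  have d: "(v n - v', ?dg, ?dm) : jspace" using subspace_diff[OF jspace_closed(2) j1(3) j2(3), of n] by simp
  have "inner (g n + G0 + W n) ?dg = inner ?F ?dm" "inner (g' + G0 + W') ?dg = inner ?F' ?dm" using j(1)[of n] j(2) d unfolding joule_def W_def W'_def by blast+
  then have "(norm ?dg)^2 = inner (?F - ?F') ?dm - inner (W n - W') ?dg" unfolding power2_norm_eq_inner by (simp add: inner_add_left inner_diff_left)
  also have "... <= norm (?F - ?F') * norm ?dm + norm (W n - W') * norm ?dg"
   using norm_cauchy_schwarz[of "?F - ?F'" ?dm] norm_cauchy_schwarz[of "W' - W n" ?dg] by (simp add: inner_diff_left norm_minus_commute)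
  also have "... <= norm (?F - ?F') * (C * norm ?dg) + norm (W n - W') * norm ?dg" using C(2)[OF d] by (intro add_mono mult_left_mono) auto
  finally have "norm ?dg <= norm (W n - W') + C * norm (?F - ?F')" by (rule_tac quadratic_bound) (use C(1) in \<open>auto simp: algebra_simps\<close>)
  then show ?thesis using C(1) C(2)[OF d] mult_left_mono[of "norm ?dg" _ C] by (meson less_imp_le order_trans)
 qed
 have "(%n. C * (norm (W (r n) - W') + C * norm (field (s (r n)) (e (r n)) - field s' e'))) ---> C * (0 + C * 0)"
  by (intro tendsto_intros tendsto_norm_zero LIM_zero W Fr)
 then have "(%n. C * (norm (W (r n) - W') + C * norm (field (s (r n)) (e (r n)) - field s' e'))) ---> 0" by simp
 from b this have "(%n. v (r n)) ---> v'" by (rule LIM_zero_cancel[OF Lim_null_comparison[OF always_eventually[OF allI]]])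
 then show ?thesis using r(1) by blast
qed

text \<open>Undoes the integration by parts built into \<open>joule\<close>. The gradient of
  \<phi>\<psi> lies in \<open>curlperp\<close>, so the field is orthogonal to it, and the term with
  \<psi> and the gradient of \<phi> turns into \<phi> times field times \<open>e\<close>. A bounded
  \<open>v'\<close> is then reached by truncated test functions, whose uniform bound lets the L1
  source pass to the limit.\<close>

lemma joule_weak:
 assumes s: "adm s" and j: "joule G0 s e \<psi> v g m" and v': "(v', g') : h10 \<Omega>" and M: "AE x. \<bar>rep v' x\<bar> <= M"
 shows "inner (g + G0) g' = inner (field s e) (mulop (rep v') (\<E> + e))"
proof -
 obtain P where P: "P >= 0" "AE x. \<bar>rep \<psi> x\<bar> <= P" using elec_potential_bounded s j unfolding joule_def by meson
 have j1: "elec s e" "(\<psi>, e) : h10 \<B>" using j by (auto simp: joule_def)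
 have test: "inner (g + G0) (cls (grad \<phi>)) = inner (field s e) (mulop \<phi> (\<E> + e))" if \<phi>: "C1c \<Omega> \<phi>" for \<phi>
 proof -
  obtain B where B: "!!x. norm (grad \<phi> x) <= B" using C1c_grad_bounded[OF \<phi>] by blast
  note gm = C1_grad_bm[OF C1c_C1[OF \<phi>]]
  obtain B1 where B1: "B1 >= 0" "!!x. \<bar>\<phi> x\<bar> <= B1" using C1c_bounded[OF \<phi>] by blast
  have z: "\<phi> x = 0" "grad \<phi> x = 0" if "x ~: \<Omega>" for x using that C1c_obtain[OF \<phi>] by (metis subsetD)+
  have "mulop \<phi> e + vmul (grad \<phi>) \<psi> : L2on \<Omega>"
  proof (rule subspace_add[OF L2on_closed(2)[OF \<Omega>_borel(3)]])
   show "mulop \<phi> e : L2on \<Omega>" unfolding mulop_def L2on_cls[OF sqi_mulop_C1c[OF \<phi> sqi_rep]] using z by simp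
   show "vmul (grad \<phi>) \<psi> : L2on \<Omega>" unfolding vmul_def L2on_cls[OF sqi_vmul[OF sqi_rep gm B]] using z by simp
  qed
  from h10_curlperp[OF \<Omega>(1) h10_mult[OF j1(2) \<phi>] this] have "inner (field s e) (mulop \<phi> e + vmul (grad \<phi>) \<psi>) = 0"
   using j1(1) by (simp add: elec_def)
  moreover have "inner (g + G0 + mulop (rep \<psi>) (field s e)) (cls (grad \<phi>)) = inner (field s e) (mulop \<phi> \<E>)"
   using j C1c_jspace[OF \<phi>] unfolding joule_def by blast
  moreover have "inner (mulop (rep \<psi>) (field s e)) (cls (grad \<phi>)) = inner (field s e) (vmul (grad \<phi>) \<psi>)"
   unfolding inner_mulop(3)[OF rep_measurable P(2)] vmul_def mulop_cls[OF rep_measurable P(2) C1c_sqi(2)[OF \<phi>]] ..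
  moreover have "mulop \<phi> (\<E> + e) = mulop \<phi> \<E> + mulop \<phi> e"
   by (rule linear_add[OF bounded_linear.linear[OF bounded_linear_mulop(1)[OF C1_bm[OF C1c_C1[OF \<phi>]] _ B1(1)]]]) (use B1(2) in simp)
  ultimately show ?thesis by (simp add: inner_add_left inner_add_right)
 qed
 obtain \<phi> where \<phi>: "!!n. C1c \<Omega> (\<phi> n)" "(%n. cls (\<phi> n)) ---> v'" "(%n. cls (grad (\<phi> n))) ---> g'" using v' unfolding h10_iff by metis
 have "max M 0 >= 0" by simp
 from bounded_truncation[OF this] obtain \<beta> \<beta>' where \<beta>: "!!s. (\<beta> has_real_derivative \<beta>' s) (at s)" "continuous_on UNIV \<beta>'" "\<beta> 0 = 0"
  "!!s. \<bar>\<beta>' s\<bar> <= 2" "!!s. \<bar>\<beta> s\<bar> <= max M 0 + 1" "!!s. \<bar>s\<bar> <= max M 0 ==> \<beta> s = s & \<beta>' s = 1" by blast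
 obtain k where k: "AE x. (%n. \<phi> (k n) x) ---> rep v' x" "(%n. cls (grad (%x. \<beta> (\<phi> (k n) x)))) ---> mulop (%x. \<beta>' (rep v' x)) g'"
  using C1c_compose_tendsto[OF \<phi> \<beta>(1,2,4)] by blast
 have \<beta>c: "continuous_on UNIV \<beta>" using \<beta>(1) by (meson DERIV_isCont continuous_at_imp_continuous_on)
 note [measurable] = bm_cont[OF \<beta>c] bm_cont[OF \<beta>(2)] C1_bm[OF C1c_C1[OF \<phi>(1)]]
 have "mulop (%x. \<beta>' (rep v' x)) g' = cls (rep g')" unfolding mulop_def
  by (intro cls_eqI sqi_bdd_mult[where c = 2] sqi_rep) (use \<beta>(4,6) M in \<open>auto elim!: eventually_mono\<close>)
 then have g': "(%n. cls (grad (%x. \<beta> (\<phi> (k n) x)))) ---> g'" using k(2) by simp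
 have "(%n. mulop (%x. \<beta> (\<phi> (k n) x)) (\<E> + e)) ---> mulop (rep v') (\<E> + e)"
 proof (rule mulop_tendsto[where B = "max M 0 + 1"])
  from k(1) M show "AE x. (%n. \<beta> (\<phi> (k n) x)) ---> rep v' x"
  proof eventually_elim
   case (elim x)
   have "\<beta> (rep v' x) = rep v' x" using \<beta>(6) elim(2) by simp
   then show ?case using continuous_on_tendsto_compose[OF \<beta>c elim(1)] by simp
  qed
 qed (use \<beta>(5) in simp_all)
 from tendsto_inner[OF tendsto_const this, of "field s e"]
 have "(%n. inner (g + G0) (cls (grad (%x. \<beta> (\<phi> (k n) x))))) ---> inner (field s e) (mulop (rep v') (\<E> + e))"
  unfolding test[OF C1c_compose[OF \<phi>(1) \<beta>(1,2,3)]] .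
 then show ?thesis using tendsto_inner[OF tendsto_const g', of "g + G0"] by (rule LIMSEQ_unique[rotated])
qed

text \<open>Schauder's theorem for the map that sends u to \<open>U0\<close> plus the solution with
  coefficient \<sigma>(u), on all of L2. Solutions are selected arbitrarily; the selection is
  continuous because \<open>v\<close> is determined by the coefficient.\<close>

lemma joule_coupled:
 assumes \<sigma>c: "continuous_on UNIV \<sigma>" and \<sigma>b: "!!t. \<sigma>1 <= \<sigma> t & \<sigma> t <= \<sigma>2"
 shows "EX e \<psi> v g m. joule G0 (%x. \<sigma> (rep (U0 + v) x)) e \<psi> v g m"
proof -
 have ad: "adm (%x. \<sigma> (rep u x))" for u using \<sigma>b measurable_compose[OF rep_measurable bm_cont[OF \<sigma>c], of u] by (simp add: adm_def)
 have "ALL u. EX v e \<psi> g m. joule G0 (%x. \<sigma> (rep u x)) e \<psi> v g m" using joule_exists[OF ad] by blast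
 then obtain V e \<psi> g m where j: "!!u. joule G0 (%x. \<sigma> (rep u x)) (e u) (\<psi> u) (V u) (g u) (m u)" by metis
 have "EX u. U0 + V u = u"
 proof (rule schauder_fixpoint)
  show "continuous_on UNIV (%u. U0 + V u)"
  proof (intro continuous_on_add continuous_on_const, unfold continuous_on_sequentially, intro allI ballI impI, elim conjE)
   fix X and u :: "real l2" assume X: "X ---> u"
   show "(V \<circ> X) ---> V u"
   proof (rule subseq_tendsto)
    fix r :: "nat => nat" assume r: "strict_mono r"
    obtain k where k: "strict_mono k" "AE x. (%n. rep (X (r (k n))) x) ---> rep u x" using l2_AE_subseq[OF LIMSEQ_subseq_LIMSEQ[OF X r]] by auto
    from k(2) have "AE x. (%n. \<sigma> (rep (X (r (k n))) x)) ---> \<sigma> (rep u x)" by eventually_elim (use continuous_on_tendsto_compose[OF \<sigma>c] in auto)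
    from joule_tendsto[OF ad ad this j j] obtain l where "strict_mono l" "(%n. V (X (r (k (l n))))) ---> V u" by blast
    then show "EX k. strict_mono k & (%n. (V \<circ> X) (r (k n))) ---> V u" using strict_mono_compose[OF k(1)] by (intro exI[of _ "%n. k (l n)"]) simp
   qed
  qed
  fix x :: "nat => real l2"
  obtain r l where "strict_mono (r :: nat => nat)" "(%n. V (x (r n))) ---> l" using joule_compact[OF ad j, of x] by blast
  then show "EX r l. strict_mono r & (%n. U0 + V (x (r n))) ---> l" using tendsto_add[OF tendsto_const] by blast
 qed
 then obtain u where "U0 + V u = u" by blast
 then show ?thesis using j[of u] by metis
qed

end

section \<open>Weak solutions in terms of Lebesgue integrals\<close>

lemma completion_measurable_AE:
 assumes "f : borel_measurable M" "AE x in M. g x = f x"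
 shows "g : borel_measurable (completion M)"
proof (rule measurableI)
 fix A :: "'b set" assume A: "A : sets borel"
 show "g -` A \<inter> space (completion M) : sets (completion M)"
 proof (rule completion.in_sets_AE)
  show "AE x in completion M. x : f -` A \<inter> space M <-> x : g -` A \<inter> space (completion M)" unfolding AE_completion_iff using assms(2) by eventually_elim auto
  show "f -` A \<inter> space M : sets (completion M)" using measurable_sets[OF assms(1) A] by auto
 qed auto
qed simp

text \<open>The definitions of the problem use set integrals over the Lebesgue completion, the
  Hilbert space uses Borel functions on \<open>lborel\<close>. An almost everywhere equal Borel zero
  extension transfers integrals, measurability and integrability at once.\<close>

lemma set_lint_AE:
 fixes f' :: "real^3 => 'b::euclidean_space"
 assumes "f' : BM" "AE x. indicator \<Omega> x *R f x = f' x"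
 shows "set_lebesgue_integral lebesgue \<Omega> f = integral\<^sup>L lborel f'" "set_borel_measurable lebesgue \<Omega> f"
  "set_integrable lebesgue \<Omega> f <-> integrable lborel f'"
proof -
 have m: "(%x. indicator \<Omega> x *R f x) : borel_measurable lebesgue" "f' : borel_measurable lebesgue"
  using completion_measurable_AE[OF _ assms(2)] assms(1) by (auto intro: measurable_completion)
 then show "set_borel_measurable lebesgue \<Omega> f" by (simp add: set_borel_measurable_def)
 have ae: "AE x in lebesgue. indicator \<Omega> x *R f x = f' x" using assms(2) by (rule AE_completion)
 show "set_lebesgue_integral lebesgue \<Omega> f = integral\<^sup>L lborel f'" unfolding set_lebesgue_integral_def
  using integral_cong_AE[OF m ae] integral_completion[of f' lborel] assms(1) by simp
 show "set_integrable lebesgue \<Omega> f <-> integrable lborel f'" unfolding set_integrable_def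
  using integrable_cong_AE[OF m ae] integrable_completion[of f' lborel] assms(1) by simp
qed

lemma borel_representative:
 fixes f :: "real^3 => 'b::euclidean_space"
 assumes f: "set_borel_measurable lebesgue \<Omega> f" and \<Omega>: "\<Omega> : sets borel"
 shows "EX f':BM. (ALL x. x ~: \<Omega> --> f' x = 0) & (AE x. indicator \<Omega> x *R f x = f' x)"
proof -
 have "EX g':borel_measurable lborel. (AE x. (indicator \<Omega> x *R f x) \<bullet> b = (g' x :: real))" for b
  by (rule completion_ex_borel_measurable_real[OF borel_measurable_inner[OF f[unfolded set_borel_measurable_def] borel_measurable_const]])
 then have "ALL b. EX g'. g' : borel_measurable lborel & (AE x. (indicator \<Omega> x *R f x) \<bullet> b = (g' x :: real))" by blast
 from choice[OF this] obtain g where g: "!!b. g b : BM" "!!b. AE x. (indicator \<Omega> x *R f x) \<bullet> b = g b x" by auto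
 define f' where "f' x = indicator \<Omega> x *R (\<Sum>b\<in>Basis. g b x *R b)" for x
 have "AE x. ALL b:Basis. (indicator \<Omega> x *R f x) \<bullet> b = g b x" by (rule eventually_ball_finite[OF finite_Basis]) (use g(2) in blast)
 then have "AE x. indicator \<Omega> x *R f x = f' x"
 proof eventually_elim
  case (elim x)
  have "(\<Sum>b\<in>Basis. g b x *R b) = (\<Sum>b\<in>Basis. ((indicator \<Omega> x *R f x) \<bullet> b) *R b)" using elim by (intro sum.cong) auto
  then show ?case by (simp only: euclidean_representation f'_def) (simp add: indicator_def)
 qed
 moreover have "f' : BM" unfolding f'_def using g(1) \<Omega> by measurable
 ultimately show ?thesis by (intro bexI[of _ f']) (auto simp: f'_def)
qed

text \<open>The dictionary between the functions of the problem, arbitrary off \<Omega>, and classes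
  of zero extensions.\<close>

definition repr :: "(real^3) set => (real^3 => 'b::euclidean_space) => 'b l2 => bool" where
 "repr \<Omega> f u <-> u : L2on \<Omega> & (AE x. x : \<Omega> --> f x = rep u x)"

lemma repr_AE: "repr \<Omega> f u ==> AE x. indicator \<Omega> x *R f x = rep u x" unfolding repr_def L2on_def by (auto simp: indicator_def elim: eventually_elim2)

lemma repr_rep: "u : L2on \<Omega> ==> repr \<Omega> (rep u) u" by (simp add: repr_def)

lemma repr_C1c: assumes "C1c \<Omega> \<phi>" shows "repr \<Omega> \<phi> (cls \<phi>)" "repr \<Omega> (grad \<phi>) (cls (grad \<phi>))"
proof -
 have z: "\<phi> x = 0" "grad \<phi> x = 0" if "x ~: \<Omega>" for x using that C1c_obtain[OF assms] by (metis subsetD)+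
 show "repr \<Omega> \<phi> (cls \<phi>)" "repr \<Omega> (grad \<phi>) (cls (grad \<phi>))" using z rep_cls[OF C1c_sqi(1)[OF assms]] rep_cls[OF C1c_sqi(2)[OF assms]]
  by (auto simp: repr_def L2on_cls C1c_sqi[OF assms] elim: eventually_mono)
qed

lemma repr_cls: assumes "sqi f" "!!x. x ~: \<Omega> ==> f x = 0" shows "repr \<Omega> f (cls f)"
 using assms rep_cls[OF assms(1)] by (auto simp: repr_def L2on_cls elim: eventually_mono)

lemma L2_repr:
 fixes f :: "real^3 => 'b::euclidean_space"
 assumes \<Omega>: "\<Omega> : sets borel" shows "L2 \<Omega> f <-> (EX u. repr \<Omega> f u)"
proof
 assume f: "L2 \<Omega> f"
 then obtain f' where f': "f' : BM" "!!x. x ~: \<Omega> ==> f' x = 0" "AE x. indicator \<Omega> x *R f x = f' x"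
  using borel_representative[OF _ \<Omega>, of f] unfolding L2_def by blast
 have "AE x. indicator \<Omega> x *R (norm (f x))^2 = (norm (f' x))^2" using f'(3) by eventually_elim (auto simp: indicator_def f'(2))
 with f f'(1) have "sqi f'" unfolding L2_def sqi_def using set_lint_AE(3)[of "%x. (norm (f' x))^2"] by auto
 moreover have "AE x. x : \<Omega> --> f x = rep (cls f') x" using f'(3) rep_cls[OF \<open>sqi f'\<close>] by eventually_elim auto
 ultimately show "EX u. repr \<Omega> f u" using f'(2) by (intro exI[of _ "cls f'"]) (simp add: repr_def L2on_cls)
next
 assume "EX u. repr \<Omega> f u"
 then obtain u where u: "AE x. indicator \<Omega> x *R f x = rep u x" using repr_AE by blast
 then have "AE x. indicator \<Omega> x *R (norm (f x))^2 = (norm (rep u x))^2" by eventually_elim (auto simp: indicator_def split: if_splits)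
 from set_lint_AE(3)[OF _ this] set_lint_AE(2)[OF _ u] show "L2 \<Omega> f" unfolding L2_def using sqi_integrable[OF sqi_rep] by simp
qed

lemma set_integral_inner:
 assumes "repr \<Omega> f u" "repr \<Omega> g v"
 shows "(LINT x:\<Omega>|lebesgue. f x \<bullet> g x) = inner u v"
proof -
 have "AE x. indicator \<Omega> x *R (f x \<bullet> g x) = rep u x \<bullet> rep v x"
  using repr_AE[OF assms(1)] repr_AE[OF assms(2)] by eventually_elim (auto simp: indicator_def split: if_splits)
 from set_lint_AE(1)[OF _ this] show ?thesis using inner_cls[OF sqi_rep sqi_rep, of u v] by simp
qed

lemma repr_linear:
 assumes \<Omega>: "\<Omega> : sets borel" and f: "repr \<Omega> f u" "repr \<Omega> g v"
 shows "repr \<Omega> (%x. f x + g x) (u + v)" "repr \<Omega> (%x. f x - g x) (u - v)"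
proof -
 have L: "u + v : L2on \<Omega>" "u - v : L2on \<Omega>" using f subspace_add[OF L2on_closed(2)[OF \<Omega>]] subspace_diff[OF L2on_closed(2)[OF \<Omega>]]
  by (auto simp: repr_def)
 have a: "AE x. x : \<Omega> --> f x = rep u x" "AE x. x : \<Omega> --> g x = rep v x" using f by (auto simp: repr_def)
 show "repr \<Omega> (%x. f x + g x) (u + v)" unfolding repr_def using L a rep_add[of u v] by (auto elim: eventually_elim2[OF eventually_conj])
 show "repr \<Omega> (%x. f x - g x) (u - v)" unfolding repr_def using L a rep_diff[of u v] by (auto elim: eventually_elim2[OF eventually_conj])
qed

lemma repr_unique: "repr \<Omega> f u ==> repr \<Omega> f v ==> u = v"
 using repr_AE[of \<Omega> f u] repr_AE[of \<Omega> f v] by (intro l2_eqI) (auto elim: eventually_elim2)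

lemma inner_eq_limit: assumes "!!n. inner a (X n) = inner b (Y n)" "X ---> x" "Y ---> y" shows "inner a x = inner b y"
 using tendsto_inner[OF tendsto_const[of a] assms(2)] tendsto_inner[OF tendsto_const[of b] assms(3)] unfolding assms(1) by (rule LIMSEQ_unique)

lemma wgrad_rep:
 "wgrad \<Omega> (rep u) (rep g) <-> (\<forall>\<phi> i. C1c \<Omega> \<phi> --> inner u (cls (pd i \<phi>)) = - inner g (cls (%x. \<phi> x *R axis i 1)))"
proof -
 have "inner u (cls (pd i \<phi>)) = (\<integral>x. rep u x * pd i \<phi> x)" "inner g (cls (%x. \<phi> x *R axis i 1)) = (\<integral>x. rep g x $ i * \<phi> x)" if \<phi>: "C1c \<Omega> \<phi>" for \<phi> i
  using inner_cls[OF sqi_rep, of "pd i \<phi>" u] sqi_component[OF C1c_sqi(2)[OF \<phi>], of i] inner_cls[OF sqi_rep sqi_scale[OF C1c_sqi(1)[OF \<phi>]], of g "axis i 1"]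
  by (simp_all add: inner_axis mult.commute)
 then show ?thesis by (simp add: wgrad_def)
qed

text \<open>Both integrals are written as inner products with \<open>cls \<phi>\<close> and
  \<open>cls (grad \<phi>)\<close>; in this form \<open>test_fun_dense\<close> extends the identity
  from smooth to C1 test functions.\<close>

lemma weak_grad_iff:
 assumes \<Omega>: "open \<Omega>" and u: "repr \<Omega> u U" "repr \<Omega> G g"
 shows "weak_grad \<Omega> u G <-> wgrad \<Omega> (rep U) (rep g)"
proof -
 have l: "(LINT x:\<Omega>|lebesgue. u x * pd i \<phi> x) = inner U (cls (pd i \<phi>))" "(LINT x:\<Omega>|lebesgue. G x $ i * \<phi> x) = inner g (cls (%x. \<phi> x *R axis i 1))"
  if \<phi>: "C1c \<Omega> \<phi>" for \<phi> i
 proof -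
  have z: "\<phi> x = 0" "grad \<phi> x = 0" if "x ~: \<Omega>" for x using that C1c_obtain[OF \<phi>] by (metis subsetD)+
  have "repr \<Omega> (pd i \<phi>) (cls (pd i \<phi>))" "repr \<Omega> (%x. \<phi> x *R axis i 1) (cls (%x. \<phi> x *R (axis i 1 :: real^3)))"
  proof -
   have "pd i \<phi> x = 0" if "x ~: \<Omega>" for x using z(2)[OF that] grad_nth[of \<phi> x i] by simp
   then show "repr \<Omega> (pd i \<phi>) (cls (pd i \<phi>))" using sqi_component[OF C1c_sqi(2)[OF \<phi>], of i] by (intro repr_cls) simp_all
   show "repr \<Omega> (%x. \<phi> x *R axis i 1) (cls (%x. \<phi> x *R (axis i 1 :: real^3)))"
    by (rule repr_cls[OF sqi_scale[OF C1c_sqi(1)[OF \<phi>]]]) (simp add: z(1))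
  qed
  from set_integral_inner[OF u(1) this(1)] set_integral_inner[OF u(2) this(2)]
  show "(LINT x:\<Omega>|lebesgue. u x * pd i \<phi> x) = inner U (cls (pd i \<phi>))" "(LINT x:\<Omega>|lebesgue. G x $ i * \<phi> x) = inner g (cls (%x. \<phi> x *R axis i 1))"
   by (simp_all add: inner_axis mult.commute)
 qed
 have eq: "inner U (cls (pd i \<phi>)) = inner (cls (%x. rep U x *R axis i 1)) (cls (grad \<phi>))"
  "inner g (cls (%x. \<phi> x *R axis i 1)) = inner (cls (%x. rep g x $ i)) (cls \<phi>)" if \<phi>: "C1c \<Omega> \<phi>" for \<phi> i
  using inner_cls[OF sqi_rep, of "pd i \<phi>" U] sqi_component[OF C1c_sqi(2)[OF \<phi>], of i] inner_cls[OF sqi_rep sqi_scale[OF C1c_sqi(1)[OF \<phi>]], of g "axis i 1"]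
   inner_cls[OF sqi_scale[OF sqi_rep] C1c_sqi(2)[OF \<phi>], of U "axis i 1"] inner_cls[OF sqi_component[OF sqi_rep] C1c_sqi(1)[OF \<phi>], of g i]
  by (simp_all add: inner_axis inner_axis' mult.commute)
 show ?thesis unfolding wgrad_rep
 proof (intro iffI allI impI)
  fix \<phi> i assume w: "weak_grad \<Omega> u G" and \<phi>: "C1c \<Omega> \<phi>"
  obtain \<phi>s where s: "!!n. test_fun \<Omega> (\<phi>s n)" "(%n. cls (\<phi>s n)) ---> cls \<phi>" "(%n. cls (grad (\<phi>s n))) ---> cls (grad \<phi>)"
   using test_fun_dense[OF \<phi> \<Omega>] by metis
  have "inner (cls (%x. rep U x *R axis i 1)) (cls (grad (\<phi>s n))) = inner (- cls (%x. rep g x $ i)) (cls (\<phi>s n))" for n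
   using w s(1)[of n] l[OF test_fun_obtain[OF s(1)[of n]], of i] eq[OF test_fun_obtain[OF s(1)[of n]], of i] by (simp add: weak_grad_def)
  from inner_eq_limit[OF this s(3,2)] show "inner U (cls (pd i \<phi>)) = - inner g (cls (%x. \<phi> x *R axis i 1))" unfolding eq[OF \<phi>] by simp
 next
  assume "\<forall>\<phi> i. C1c \<Omega> \<phi> --> inner U (cls (pd i \<phi>)) = - inner g (cls (%x. \<phi> x *R axis i 1))"
  then show "weak_grad \<Omega> u G" unfolding weak_grad_def using l test_fun_obtain by simp
 qed
qed

lemma vtest_fun_scale: assumes "test_fun \<Omega> \<phi>" shows "vtest_fun \<Omega> (%x. \<phi> x *R b)"
proof -
 have "test_fun \<Omega> (%x. c * \<phi> x)" for c
 proof (rule test_funI[of _ "closure {x. \<phi> x ~= 0}"])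
  show "smooth (%x. c * \<phi> x)"
  proof (rule smoothI[of _ "{%x. c * f x |f. smooth f}"])
   fix g assume "g : {%x. c * f x |f. smooth f}"
   then obtain f where f: "g = (%x. c * f x)" "smooth f" by blast
   show "g differentiable at x" for x using C1_differentiable[OF C1_cmult(1)[OF smooth_C1(1)[OF f(2)]]] by (simp add: f(1))
   show "pd i g : {%x. c * f x |f. smooth f}" for i
    using pd_of_grad[OF C1_cmult(2)[OF smooth_C1(1)[OF f(2)], of c], of i] smooth_C1(2)[OF f(2), of i] by (auto simp: f(1))
  qed (use assms in \<open>auto simp: test_fun_def\<close>)
 qed (use assms closure_subset[of "{x. \<phi> x ~= 0}"] in \<open>auto simp: test_fun_def\<close>)
 from this[of "b $ _"] show ?thesis by (simp add: vtest_fun_def mult.commute[of "b $ _"])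
qed

text \<open>In one direction a smooth scalar times a constant vector is an admissible vector test
  and density does the rest; in the other a vector test is the sum of its components times axis
  vectors, and the curl splits accordingly.\<close>

lemma weak_curl_iff:
 assumes \<Omega>: "open \<Omega>" and w: "repr \<Omega> H w" "repr \<Omega> C c"
 shows "weak_curl \<Omega> H C <-> (w, c) : curlrel \<Omega>"
proof
 assume wc: "weak_curl \<Omega> H C"
 have "inner w (cls (gcross \<phi> b)) = inner c (cls (%x. \<phi> x *R b))" if \<phi>: "C1c \<Omega> \<phi>" for \<phi> b
 proof -
  have sb: "sqi (%x. cross3 b (rep w x))" "sqi (%x. rep c x \<bullet> b)"
   using sqi_cross[OF sqi_rep, of w "- b"] cross_skew[of b] sqi_inner sqi_mono[OF _ sqi_scaleR[OF sqi_rep], of "%x. rep c x \<bullet> b" "norm b" c] Cauchy_Schwarz_ineq2[of "rep c _" b]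
   by (auto simp: mult.commute)
  have eq: "inner w (cls (gcross f b)) = inner (cls (%x. cross3 b (rep w x))) (cls (grad f))"
   "inner c (cls (%x. f x *R b)) = inner (cls (%x. rep c x \<bullet> b)) (cls f)" if f: "C1c \<Omega> f" for f
  proof -
   have "rep w x \<bullet> cross3 (grad f x) b = cross3 b (rep w x) \<bullet> grad f x" for x by (simp add: cross3_simps)
   then show "inner w (cls (gcross f b)) = inner (cls (%x. cross3 b (rep w x))) (cls (grad f))"
    "inner c (cls (%x. f x *R b)) = inner (cls (%x. rep c x \<bullet> b)) (cls f)"
    using inner_cls[OF sqi_rep sqi_cross[OF C1c_sqi(2)[OF f]], of w b] inner_cls[OF sb(1) C1c_sqi(2)[OF f]]
     inner_cls[OF sqi_rep sqi_scale[OF C1c_sqi(1)[OF f]], of c b] inner_cls[OF sb(2) C1c_sqi(1)[OF f]] by (simp_all add: mult.commute)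
  qed
  obtain \<phi>s where s: "!!n. test_fun \<Omega> (\<phi>s n)" "(%n. cls (\<phi>s n)) ---> cls \<phi>" "(%n. cls (grad (\<phi>s n))) ---> cls (grad \<phi>)"
   using test_fun_dense[OF \<phi> \<Omega>] by metis
  have "inner (cls (%x. cross3 b (rep w x))) (cls (grad (\<phi>s n))) = inner (cls (%x. rep c x \<bullet> b)) (cls (\<phi>s n))" for n
  proof -
   note t = test_fun_obtain[OF s(1)[of n]]
   have z: "\<phi>s n x = 0" "grad (\<phi>s n) x = 0" if "x ~: \<Omega>" for x using that C1c_obtain[OF t] by (metis subsetD)+
   have "curl (%x. \<phi>s n x *R b) x = cross3 (grad (\<phi>s n) x) b" for x
    using fun_cong[OF C1_cmult(2)[OF C1c_C1[OF t]], of _ x] pd_of_grad[OF C1_cmult(2)[OF C1c_C1[OF t]]]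
    by (simp add: vec_eq_iff forall_3 curl_nth cross_components mult.commute[of "\<phi>s n _"])
   then have "(LINT x:\<Omega>|lebesgue. H x \<bullet> cross3 (grad (\<phi>s n) x) b) = (LINT x:\<Omega>|lebesgue. C x \<bullet> (\<phi>s n x *R b))"
    using wc[unfolded weak_curl_def, rule_format, OF vtest_fun_scale[OF s(1)[of n], of b]] by (simp only:)
   then show ?thesis unfolding eq[OF t, symmetric]
    using set_integral_inner[OF w(1) repr_cls[OF sqi_cross[OF C1c_sqi(2)[OF t]]], of b] set_integral_inner[OF w(2) repr_cls[OF sqi_scale[OF C1c_sqi(1)[OF t]]], of b] z by simp
  qed
  from inner_eq_limit[OF this s(3,2)] show ?thesis unfolding eq[OF \<phi>] .
 qed
 then show "(w, c) : curlrel \<Omega>" using w by (auto simp: curlrel_def repr_def)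
next
 assume wc: "(w, c) : curlrel \<Omega>"
 show "weak_curl \<Omega> H C" unfolding weak_curl_def
 proof (intro allI impI)
  fix f assume "vtest_fun \<Omega> f"
  then have f: "C1c \<Omega> (%x. f x $ k)" for k using test_fun_obtain by (auto simp: vtest_fun_def)
  note s = C1c_sqi[OF f]
  have z: "f x $ k = 0" "grad (%x. f x $ k) x = 0" if "x ~: \<Omega>" for x k using that C1c_obtain[OF f[of k]] by (metis subsetD)+
  have "C1v f" using C1c_C1[OF f] by (simp add: C1v_def)
  then have cu: "curl f = (%x. \<Sum>k\<in>UNIV. cross3 (grad (%x. f x $ k) x) (axis k 1))" using sum_cross_axis[OF C1_const(1)[of 1]] by (simp add: C1_const fun_eq_iff)
  have ff: "(\<Sum>k\<in>UNIV. f x $ k *R axis k 1) = f x" for x by (simp add: vec_eq_iff axis_def if_distrib sum.If_cases cong: if_cong)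
  have sf: "sqi (%x. \<Sum>k\<in>UNIV. f x $ k *R (axis k 1 :: real^3))" "sqi (%x. \<Sum>k\<in>UNIV. cross3 (grad (%x. f x $ k) x) (axis k 1))"
   by (intro sqi_sum sqi_scale sqi_cross s)+
  have "(LINT x:\<Omega>|lebesgue. H x \<bullet> curl f x) = inner w (\<Sum>k\<in>UNIV. cls (%x. cross3 (grad (%x. f x $ k) x) (axis k 1)))"
   unfolding cls_sum[OF sqi_cross[OF s(2)]] cu by (rule set_integral_inner[OF w(1) repr_cls[OF sf(2)]]) (simp add: z)
  also have "... = inner c (\<Sum>k\<in>UNIV. cls (%x. f x $ k *R axis k 1))" unfolding inner_sum_right using wc f by (intro sum.cong) (auto simp: curlrel_def)
  also have "... = (LINT x:\<Omega>|lebesgue. C x \<bullet> (\<Sum>k\<in>UNIV. f x $ k *R axis k 1))" unfolding cls_sum[OF sqi_scale[OF s(1)]]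
   by (rule set_integral_inner[OF w(2) repr_cls[OF sf(1)], symmetric]) (simp add: z)
  finally show "(LINT x:\<Omega>|lebesgue. H x \<bullet> curl f x) = (LINT x:\<Omega>|lebesgue. C x \<bullet> f x)" by (simp only: ff)
 qed
qed

lemma h10_wgrad: assumes "(v, g) : h10 \<Omega>" shows "wgrad W (rep v) (rep g)" unfolding wgrad_rep
proof (intro allI impI)
 fix \<phi> i assume \<phi>: "C1c W \<phi>"
 obtain f where f: "!!n. C1c \<Omega> (f n)" "(%n. cls (f n)) ---> v" "(%n. cls (grad (f n))) ---> g" using assms unfolding h10_iff by metis
 have "inner (cls (pd i \<phi>)) (cls (f n)) = inner (- cls (%x. \<phi> x *R axis i 1)) (cls (grad (f n)))" for n
  using C1_wgrad[OF C1c_C1[OF f(1)], of W n] \<phi> inner_cls[OF C1c_sqi(1)[OF f(1)], of "pd i \<phi>" n] sqi_component[OF C1c_sqi(2)[OF \<phi>], of i]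
   inner_cls[OF C1c_sqi(2)[OF f(1)] sqi_scale[OF C1c_sqi(1)[OF \<phi>]], of n "axis i 1"] by (simp add: wgrad_def inner_axis inner_axis' mult.commute inner_commute)
 from inner_eq_limit[OF this f(2,3)] show "inner v (cls (pd i \<phi>)) = - inner g (cls (%x. \<phi> x *R axis i 1))" by (simp add: inner_commute)
qed

text \<open>A weak gradient on \<Omega> can be mollified only away from the boundary. That is
  enough, since the identity between the mollified gradient and the gradient of the mollified
  function is needed only on the support of \<open>grad \<phi>\<close>.\<close>

lemma wgrad_curl_free:
 assumes G: "wgrad \<Omega> (rep \<psi>) (rep G)" and \<Omega>: "open \<Omega>" and \<phi>: "C1c \<Omega> \<phi>"
 shows "inner G (cls (gcross \<phi> b)) = 0"
proof -
 obtain K where K: "compact K" "K <= \<Omega>" "!!x. x ~: K ==> grad \<phi> x = 0" using C1c_obtain[OF \<phi>] by metis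
 obtain \<epsilon> where \<epsilon>: "\<epsilon> > 0" "(\<Union>x\<in>K. ball x \<epsilon>) <= \<Omega>" by (rule compact_subset_open_imp_ball_epsilon_subset[OF K(1) \<Omega> K(2)])
 define d where "d n = min (\<epsilon> / 2) 1 * inverse (real (Suc n))" for n
 have d: "d n > 0" "d n <= min (\<epsilon> / 2) 1" for n unfolding d_def using \<epsilon>(1) mult_left_mono[of "inverse (real (Suc n))" 1 "min (\<epsilon> / 2) 1"] by (auto simp: inverse_le_1_iff)
 have d0: "d ---> 0" using tendsto_mult[OF tendsto_const LIMSEQ_inverse_real_of_nat, of "min (\<epsilon> / 2) 1"] by (simp add: d_def[abs_def])
 have dn: "d n ~= 0" for n using d(1)[of n] by simp
 note sc = sqi_cross[OF C1c_sqi(2)[OF \<phi>], of b]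
 have "inner (cls (mollify 1 0 (d n) (rep G))) (cls (gcross \<phi> b)) = 0" for n
 proof -
  have "inner (cls (mollify 1 0 (d n) (rep G))) (cls (gcross \<phi> b)) = (\<integral>x. grad (mollify 1 0 (d n) (rep \<psi>)) x \<bullet> cross3 (grad \<phi> x) b)"
   unfolding inner_cls[OF mollify_L2(1)[OF sqi_rep one_neq_zero] sc]
  proof (rule lint_cong)
   fix x show "mollify 1 0 (d n) (rep G) x \<bullet> cross3 (grad \<phi> x) b = grad (mollify 1 0 (d n) (rep \<psi>)) x \<bullet> cross3 (grad \<phi> x) b"
   proof (cases "x : K")
    case True
    have "cball x \<bar>d n\<bar> <= ball x \<epsilon>" using d[of n] \<epsilon>(1) by auto
    then have "cball (1 *R x + 0) \<bar>d n\<bar> <= \<Omega>" using \<epsilon>(2) True by auto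
    from mollify_grad_weak[OF dn sqi_rep sqi_rep G this] show ?thesis by simp
   qed (simp add: K(3))
  qed simp
  also have "... = 0" by (rule integral_grad_cross_grad[OF mollify_C1(1)[OF dn sqi_rep] C1c_mono[OF \<phi> subset_UNIV]])
  finally show ?thesis .
 qed
 moreover have "(%n. cls (mollify 1 0 (d n) (rep G))) ---> cls (rep G)"
  by (rule mollify_tendsto[OF sqi_rep tendsto_const tendsto_const d0 _ _ _ dn]) (use d in \<open>auto simp: abs_of_pos\<close>)
 from tendsto_inner[OF this tendsto_const[of "cls (gcross \<phi> b)"]] calculation
 show ?thesis by (simp add: LIMSEQ_const_iff)
qed

text \<open>A Helmholtz projection. \<open>S\<close> consists of the fields orthogonal to all weak
  gradients, that is divergence free with zero normal trace. The curls
  \<open>gcross \<phi> b\<close> of test fields lie in \<open>S\<close>, so replacing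
  \<open>w\<close> by its projection onto \<open>S\<close> does not change the weak curl.\<close>

lemma curl_gauge:
 assumes \<Omega>: "open \<Omega>" and w: "(w, c) : curlrel \<Omega>"
 shows "EX h. (h, c) : curlrel \<Omega> & (\<forall>\<psi>. ALL G:L2on \<Omega>. wgrad \<Omega> (rep \<psi>) (rep G) --> inner h G = 0)"
proof -
 have \<Omega>b: "\<Omega> : sets borel" using \<Omega> by simp
 define S where "S = {z : L2on \<Omega>. \<forall>\<psi>. ALL G:L2on \<Omega>. wgrad \<Omega> (rep \<psi>) (rep G) --> inner z G = 0}"
 have e: "S = L2on \<Omega> \<inter> {z. \<forall>\<psi> G. G : L2on \<Omega> & wgrad \<Omega> (rep \<psi>) (rep G) --> inner z G = 0}" by (auto simp: S_def)
 have "closed S" unfolding e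
  by (intro closed_Int L2on_closed(1)[OF \<Omega>b] closed_Collect_all closed_Collect_imp open_Collect_const closed_Collect_eq continuous_intros)
 moreover have "subspace S" using L2on_closed(2)[OF \<Omega>b, where 'b = "real^3"] by (auto simp: subspace_def S_def inner_add_left)
 ultimately obtain h where h: "h : S" "ALL y:S. inner (w - h) y = 0" using hilbert_projection by blast
 have wh: "w : L2on \<Omega>" "h : L2on \<Omega>" "c : L2on \<Omega>" using w h(1) by (auto simp: curlrel_def S_def)
 have "inner h (cls (gcross \<phi> b)) = inner w (cls (gcross \<phi> b))" if \<phi>: "C1c \<Omega> \<phi>" for \<phi> b
 proof -
  have "grad \<phi> x = 0" if "x ~: \<Omega>" for x using that C1c_obtain[OF \<phi>] by (metis subsetD)
  then have "cls (gcross \<phi> b) : S" using wgrad_curl_free[OF _ \<Omega> \<phi>] by (auto simp: S_def L2on_cls[OF sqi_cross[OF C1c_sqi(2)[OF \<phi>]]] inner_commute)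
  then show ?thesis using h(2) by (simp add: inner_diff_left)
 qed
 then have "(h, c) : curlrel \<Omega>" using w wh by (auto simp: curlrel_def)
 then show ?thesis using h(1) by (auto simp: S_def)
qed

lemma h10_L2on: assumes "(v, g) : h10 \<Omega>" "\<Omega> : sets borel" shows "v : L2on \<Omega>" "g : L2on \<Omega>"
proof -
 obtain \<phi> where \<phi>: "!!n. C1c \<Omega> (\<phi> n)" "(%n. cls (\<phi> n)) ---> v" "(%n. cls (grad (\<phi> n))) ---> g" using assms(1) unfolding h10_iff by metis
 show "v : L2on \<Omega>" "g : L2on \<Omega>" using repr_C1c[OF \<phi>(1)] closed_sequentially[OF L2on_closed(1)[OF assms(2)] _ \<phi>(2)]
   closed_sequentially[OF L2on_closed(1)[OF assms(2)] _ \<phi>(3)] by (auto simp: repr_def)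
qed

lemma H1_distance:
 assumes \<Omega>: "\<Omega> : sets borel" and f: "repr \<Omega> f v" "repr \<Omega> G g" and \<phi>: "C1c \<Omega> \<phi>"
 shows "(LINT x:\<Omega>|lebesgue. (\<phi> x - f x)^2 + (norm (grad \<phi> x - G x))^2) = (norm (cls \<phi> - v))^2 + (norm (cls (grad \<phi>) - g))^2"
proof -
 note d1 = repr_AE[OF repr_linear(2)[OF \<Omega> repr_C1c(1)[OF \<phi>] f(1)]]
 note d2 = repr_AE[OF repr_linear(2)[OF \<Omega> repr_C1c(2)[OF \<phi>] f(2)]]
 have "AE x. indicator \<Omega> x *R ((\<phi> x - f x)^2 + (norm (grad \<phi> x - G x))^2) = (norm (rep (cls \<phi> - v) x))^2 + (norm (rep (cls (grad \<phi>) - g) x))^2"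
  using d1 d2 by eventually_elim (auto simp: indicator_def split: if_splits)
 from set_lint_AE(1)[OF _ this] show ?thesis
  using norm_cls[OF sqi_rep, of "cls \<phi> - v"] norm_cls[OF sqi_rep, of "cls (grad \<phi>) - g"] sqi_integrable[OF sqi_rep, of "cls \<phi> - v"] sqi_integrable[OF sqi_rep, of "cls (grad \<phi>) - g"] by simp
qed

lemma H10_iff:
 assumes \<Omega>: "open \<Omega>" and f: "repr \<Omega> f v"
 shows "H10 \<Omega> f <-> (EX g. (v, g) : h10 \<Omega>)"
proof
 have \<Omega>b: "\<Omega> : sets borel" using \<Omega> by simp
 assume "H10 \<Omega> f"
 then obtain G \<phi> where G: "L2 \<Omega> G" and \<phi>: "!!n. test_fun \<Omega> (\<phi> n)" "(%n. LINT x:\<Omega>|lebesgue. (\<phi> n x - f x)^2 + (norm (grad (\<phi> n) x - G x))^2) ---> 0"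
  unfolding H10_def by blast
 obtain g where g: "repr \<Omega> G g" using G L2_repr[OF \<Omega>b] by blast
 have l: "(%n. (norm (cls (\<phi> n) - v))^2 + (norm (cls (grad (\<phi> n)) - g))^2) ---> 0" using \<phi>(2) unfolding H1_distance[OF \<Omega>b f g test_fun_obtain[OF \<phi>(1)]] .
 have z: "X ---> x" if "!!n. (norm (X n - x))^2 <= (norm (cls (\<phi> n) - v))^2 + (norm (cls (grad (\<phi> n)) - g))^2" for X and x :: "'c::real_normed_vector"
 proof -
  have "(%n. (norm (X n - x))^2) ---> 0" by (rule Lim_null_comparison[OF always_eventually l]) (use that in simp)
  then have "(%n. norm (X n - x)) ---> 0" using tendsto_real_sqrt[of "%n. (norm (X n - x))^2" 0] by simp
  then show ?thesis by (rule LIM_zero_cancel[OF tendsto_norm_zero_cancel])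
 qed
 have "(%n. cls (\<phi> n)) ---> v" "(%n. cls (grad (\<phi> n))) ---> g" by (rule z, simp)+
 then show "EX g. (v, g) : h10 \<Omega>" unfolding h10_iff using test_fun_obtain[OF \<phi>(1)] by blast
next
 have \<Omega>b: "\<Omega> : sets borel" using \<Omega> by simp
 assume "EX g. (v, g) : h10 \<Omega>"
 then obtain g where vg: "(v, g) : h10 \<Omega>" by blast
 have g: "repr \<Omega> (rep g) g" by (rule repr_rep[OF h10_L2on(2)[OF vg \<Omega>b]])
 obtain \<phi> where \<phi>: "!!n. C1c \<Omega> (\<phi> n)" "(%n. cls (\<phi> n)) ---> v" "(%n. cls (grad (\<phi> n))) ---> g" using vg unfolding h10_iff by metis
 have "\<exists>\<psi>. test_fun \<Omega> \<psi> & norm (cls \<psi> - cls (\<phi> n)) <= inverse (real (Suc n)) & norm (cls (grad \<psi>) - cls (grad (\<phi> n))) <= inverse (real (Suc n))" for n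
 proof -
  obtain s where s: "!!k. test_fun \<Omega> (s k)" "(%k. cls (s k)) ---> cls (\<phi> n)" "(%k. cls (grad (s k))) ---> cls (grad (\<phi> n))"
   using test_fun_dense[OF \<phi>(1) \<Omega>] by metis
  have p: "inverse (real (Suc n)) > 0" by simp
  have "\<forall>\<^sub>F k in sequentially. norm (cls (s k) - cls (\<phi> n)) <= inverse (real (Suc n)) & norm (cls (grad (s k)) - cls (grad (\<phi> n))) <= inverse (real (Suc n))"
   using tendstoD[OF s(2) p] tendstoD[OF s(3) p] by eventually_elim (simp add: dist_norm less_imp_le)
  then show ?thesis using s(1) by (auto simp: eventually_sequentially)
 qed
 then obtain \<psi> where \<psi>: "!!n. test_fun \<Omega> (\<psi> n)" "!!n. norm (cls (\<psi> n) - cls (\<phi> n)) <= inverse (real (Suc n))"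
  "!!n. norm (cls (grad (\<psi> n)) - cls (grad (\<phi> n))) <= inverse (real (Suc n))" by metis
 note n0 = Lim_null_comparison[OF always_eventually[OF allI] LIMSEQ_inverse_real_of_nat]
 have "(%n. cls (\<psi> n)) ---> v" "(%n. cls (grad (\<psi> n))) ---> g"
  using tendsto_add[OF n0[OF \<psi>(2)] \<phi>(2)] tendsto_add[OF n0[OF \<psi>(3)] \<phi>(3)] by simp_all
 from tendsto_add[OF tendsto_power[OF tendsto_norm[OF LIM_zero[OF this(1)]], of 2] tendsto_power[OF tendsto_norm[OF LIM_zero[OF this(2)]], of 2]]
 have "(%n. LINT x:\<Omega>|lebesgue. (\<psi> n x - f x)^2 + (norm (grad (\<psi> n) x - rep g x))^2) ---> 0"
  unfolding H1_distance[OF \<Omega>b f g test_fun_obtain[OF \<psi>(1)]] by simp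
 moreover have "L2 \<Omega> f" "L2 \<Omega> (rep g)" using f g L2_repr[OF \<Omega>b, of f] L2_repr[OF \<Omega>b, of "rep g"] by blast+
 ultimately show "H10 \<Omega> f" unfolding H10_def using weak_grad_iff[OF \<Omega> f g] h10_wgrad[OF vg, of \<Omega>] \<psi>(1)
  by (intro conjI exI[of _ "rep g"] exI[of _ \<psi>] allI) auto
qed

theorem theorem3p3:
  fixes \<Omega> :: "(real^3) set" and \<sigma> :: "real \<Rightarrow> real" and \<sigma>1 \<sigma>2 q :: real
    and u0 :: "real^3 \<Rightarrow> real" and E0 :: "real^3 \<Rightarrow> real^3"
  assumes "lipschitz_domain \<Omega>"
    and "continuous_on UNIV \<sigma>"
    and "0 < \<sigma>1" and "\<sigma>1 \<le> \<sigma>2"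
    and "\<forall>s. \<sigma>1 \<le> \<sigma> s \<and> \<sigma> s \<le> \<sigma>2"
    and "H1 \<Omega> u0"
    and "q > 3" and "Lp \<Omega> q E0"
    and "weak_curl \<Omega> E0 (\<lambda>x. 0)"
  shows "\<exists>u H. weak_solution \<Omega> \<sigma> u0 E0 u H"
proof -
 have \<Omega>: "open \<Omega>" "bounded \<Omega>" "\<Omega> : sets borel" using lipschitz_domainD[OF assms(1)] by auto
 note sub = L2on_closed(2)[OF \<Omega>(3)]
 obtain R where R: "R > 0" "\<Omega> <= ball 0 R" using bounded_subset_ballD[OF \<Omega>(2), of 0] by blast
 obtain e0 where e0: "e0 : BM" "!!x. x ~: \<Omega> ==> e0 x = 0" "AE x. indicator \<Omega> x *R E0 x = e0 x"
  using borel_representative[OF _ \<Omega>(3), of E0] assms(8) unfolding Lp_def by blast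
 have "AE x. indicator \<Omega> x *R (norm (E0 x) powr q) = norm (e0 x) powr q" using e0(3) by eventually_elim (auto simp: indicator_def e0(2))
 then have eq: "integrable lborel (%x. norm (e0 x) powr q)"
  using assms(8) e0(1) set_lint_AE(3)[of "%x. norm (e0 x) powr q" \<Omega> "%x. norm (E0 x) powr q"] by (simp add: Lp_def)
 \<comment> \<open>On a bounded domain L^q with q > 2 embeds into L2, by
   \<open>square_le_powr_split\<close> with threshold 1.\<close>
 have es: "sqi e0"
 proof (rule sqi_bound[OF e0(1)])
  have "emeasure lborel \<Omega> < \<infinity>" by (rule emeasure_bounded_finite[OF \<Omega>(2)])
  then show "integrable lborel (%x. indicator \<Omega> x + norm (e0 x) powr q)" using \<Omega>(3) eq by (intro Bochner_Integration.integrable_add integrable_real_indicator) auto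
  have "(norm (e0 x))^2 <= indicator \<Omega> x + norm (e0 x) powr q" for x
   using square_le_powr_split[OF norm_ge_zero zero_less_one, of q "e0 x"] e0(2)[of x] assms(7) by (cases "x : \<Omega>") auto
  then show "AE x. (norm (e0 x))^2 <= indicator \<Omega> x + norm (e0 x) powr q" by simp
 qed
 interpret J: joule_problem \<Omega> R q \<sigma>1 \<sigma>2 e0 using assms R es e0(2) eq by unfold_locales (auto simp: integrable_iff_bounded)
 have E0: "repr \<Omega> E0 (cls e0)" using e0(3) rep_cls[OF es] e0(2) unfolding repr_def L2on_cls[OF es] by (auto elim: eventually_elim2 simp: indicator_def)
 obtain U0 G0 g0 where U0: "repr \<Omega> u0 U0" "repr \<Omega> G0 g0" "wgrad \<Omega> (rep U0) (rep g0)"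
  using assms(6) weak_grad_iff[OF \<Omega>(1)] unfolding H1_def L2_repr[OF \<Omega>(3)] by metis
 obtain e \<psi> v g m where j: "J.joule g0 (%x. \<sigma> (rep (U0 + v) x)) e \<psi> v g m" using J.joule_coupled[OF assms(2)] assms(5) by meson
 define u where "u = rep (U0 + v)"
 define s where "s x = \<sigma> (u x)" for x
 \<comment> \<open>F is \<sigma>(u) E, the prospective curl of H.\<close>
 define F where "F = J.field s e"
 have sm: "s : BM" unfolding s_def[abs_def] u_def using measurable_compose[OF rep_measurable bm_cont[OF assms(2)], of "U0 + v"] by simp
 have s: "J.adm s" using sm assms(5) by (simp add: J.adm_def s_def)
 have s0: "s x ~= 0" for x using assms(3,5) by (metis not_less order_refl s_def)
 have js: "J.joule g0 s e \<psi> v g m" using j by (simp add: s_def[abs_def] u_def)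
 have vg: "(v, g) : h10 \<Omega>" and el: "J.elec s e" using js J.jspace_h10 by (auto simp: J.joule_def)
 have eL: "e : L2on \<Omega>" "e : curlperp \<Omega>" using el by (auto simp: J.elec_def curlperp_def)
 have EL: "cls e0 + e : L2on \<Omega>" using E0 eL by (intro subspace_add[OF sub]) (auto simp: repr_def)
 have Fr: "AE x. rep F x = s x *R rep (cls e0 + e) x" unfolding F_def by (rule rep_mulop[OF J.adm(1,2)[OF s]])
 have "AE x. x ~: \<Omega> --> rep F x = 0" using Fr EL unfolding L2on_def mem_Collect_eq by eventually_elim simp
 then have FL: "F : L2on \<Omega>" by (simp add: L2on_def)
 obtain w where "(w, F) : curlrel \<Omega>" using curlperp_perp[OF assms(1) FL] el unfolding F_def J.elec_def by blast
 from curl_gauge[OF \<Omega>(1) this] obtain h where h: "(h, F) : curlrel \<Omega>"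
  "!!\<psi> G. G : L2on \<Omega> ==> wgrad \<Omega> (rep \<psi>) (rep G) ==> inner h G = 0" by blast
 have hL: "h : L2on \<Omega>" using h(1) by (simp add: curlrel_def)
 have UL: "U0 + v : L2on \<Omega>" "g + g0 : L2on \<Omega>" using U0 h10_L2on[OF vg \<Omega>(3)] by (auto intro!: subspace_add[OF sub] simp: repr_def)
 note r = repr_rep[OF UL(1), folded u_def] repr_rep[OF UL(2)] repr_rep[OF FL] repr_rep[OF hL]
 have wgU: "weak_grad \<Omega> u (rep (g + g0))" unfolding weak_grad_iff[OF \<Omega>(1) r(1,2)]
  using h10_wgrad[OF vg, of \<Omega>] U0(3) unfolding wgrad_rep by (simp add: inner_add_left)
 have wcH: "weak_curl \<Omega> (rep h) (rep F)" unfolding weak_curl_iff[OF \<Omega>(1) r(4,3)] by (rule h(1))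
 have "repr \<Omega> (%x. u x - u0 x) v" using repr_linear(2)[OF \<Omega>(3) r(1) U0(1)] by simp
 then have H10u: "H10 \<Omega> (%x. u x - u0 x)" using H10_iff[OF \<Omega>(1)] vg by blast
 have div: "H0div0 \<Omega> (rep h)" unfolding H0div0_def
 proof (intro conjI allI impI; (elim conjE)?)
  fix \<phi> G assume a: "L2 \<Omega> \<phi>" "L2 \<Omega> G" "weak_grad \<Omega> \<phi> G"
  then obtain p G' where p: "repr \<Omega> \<phi> p" "repr \<Omega> G G'" using L2_repr[OF \<Omega>(3), of \<phi>] L2_repr[OF \<Omega>(3), of G] by blast
  show "(LINT x:\<Omega>|lebesgue. rep h x \<bullet> G x) = 0" unfolding set_integral_inner[OF r(4) p(2)]
   using h(2) p(2) a(3) weak_grad_iff[OF \<Omega>(1) p] by (auto simp: repr_def)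
 qed (use r(4) L2_repr[OF \<Omega>(3)] in blast)
 have eq1: "(LINT x:\<Omega>|lebesgue. rep (g + g0) x \<bullet> Gv x) = (LINT x:\<Omega>|lebesgue. inverse (\<sigma> (u x)) * (norm (rep F x))^2 * v' x)"
  if a: "H10 \<Omega> v'" "Linf \<Omega> v'" "L2 \<Omega> Gv" "weak_grad \<Omega> v' Gv" for v' Gv
 proof -
  obtain V gv where V: "repr \<Omega> v' V" "repr \<Omega> Gv gv" using a(1,3) L2_repr[OF \<Omega>(3), of v'] L2_repr[OF \<Omega>(3), of Gv] unfolding H10_def by blast
  \<comment> \<open>Membership in H^1_0 supplies some gradient of v', the assumptions supply
    \<open>Gv\<close>; by uniqueness of weak gradients they have the same class, as shown in the
    next lines.\<close>
  obtain g' where g': "(V, g') : h10 \<Omega>" using H10_iff[OF \<Omega>(1) V(1)] a(1) by blast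
  have "AE x. x : \<Omega> --> rep g' x = rep gv x"
   by (rule wgrad_unique[OF \<Omega>(1) sqi_rep sqi_rep h10_wgrad[OF g']]) (use a(4) weak_grad_iff[OF \<Omega>(1) V] in blast)
  then have "repr \<Omega> (rep gv) g'" using h10_L2on(2)[OF g' \<Omega>(3)] by (auto simp: repr_def elim: eventually_mono)
  moreover have "repr \<Omega> (rep gv) gv" using V(2) by (intro repr_rep) (simp add: repr_def)
  ultimately have gg: "g' = gv" by (rule repr_unique)
  obtain M where M: "AE x in lebesgue. x : \<Omega> --> \<bar>v' x\<bar> <= M" using a(2) by (auto simp: Linf_def)
  have VM: "AE x. \<bar>rep V x\<bar> <= max M 0" using M[unfolded AE_completion_iff] repr_AE[OF V(1)]
  proof eventually_elim
   case (elim x)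
   then show ?case unfolding elim(2)[symmetric] by (cases "x : \<Omega>") auto
  qed
  have "inner (g + g0) gv = inner F (mulop (rep V) (cls e0 + e))" using J.joule_weak[OF s js g' VM] by (simp add: gg F_def)
  also have "... = (\<integral>x. rep F x \<bullet> rep (mulop (rep V) (cls e0 + e)) x)" using inner_cls[OF sqi_rep sqi_rep, of F] by simp
  also have "... = (LINT x:\<Omega>|lebesgue. inverse (\<sigma> (u x)) * (norm (rep F x))^2 * v' x)"
  proof (rule set_lint_AE(1)[symmetric])
   show "AE x. indicator \<Omega> x *R (inverse (\<sigma> (u x)) * (norm (rep F x))^2 * v' x) = rep F x \<bullet> rep (mulop (rep V) (cls e0 + e)) x"
    using Fr rep_mulop[OF rep_measurable VM, of "cls e0 + e"] repr_AE[OF V(1)]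
   proof eventually_elim
    case (elim x)
    have "indicator \<Omega> x *R (inverse (\<sigma> (u x)) * (norm (rep F x))^2 * v' x) = inverse (s x) * (norm (rep F x))^2 * rep V x"
     using elim(3) by (simp add: s_def)
    also have "... = rep F x \<bullet> (rep V x *R rep (cls e0 + e) x)" unfolding elim(1) using s0[of x] by (simp add: power2_norm_eq_inner power2_eq_square[of "s x"] field_simps)
    finally show ?case by (simp only: elim(2))
   qed
  qed simp
  finally show ?thesis by (simp add: set_integral_inner[OF r(2) V(2)])
 qed
 \<comment> \<open>Dividing F by \<sigma>(u) returns the field E0 + e, and e is orthogonal to every
   weak curl.\<close>
 have eq2: "(LINT x:\<Omega>|lebesgue. inverse (\<sigma> (u x)) * (rep F x \<bullet> Cw x)) = (LINT x:\<Omega>|lebesgue. E0 x \<bullet> Cw x)"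
  if a: "H0div0 \<Omega> w" "L2 \<Omega> Cw" "weak_curl \<Omega> w Cw" for w Cw
 proof -
  obtain W c where W: "repr \<Omega> w W" "repr \<Omega> Cw c" using a(1,2) L2_repr[OF \<Omega>(3)] unfolding H0div0_def by blast
  then have "inner e c = 0" using a(3) weak_curl_iff[OF \<Omega>(1)] eL(2) by (auto simp: curlperp_def)
  have "(LINT x:\<Omega>|lebesgue. inverse (\<sigma> (u x)) * (rep F x \<bullet> Cw x)) = (\<integral>x. rep (cls e0 + e) x \<bullet> rep c x)"
  proof (rule set_lint_AE(1))
   show "AE x. indicator \<Omega> x *R (inverse (\<sigma> (u x)) * (rep F x \<bullet> Cw x)) = rep (cls e0 + e) x \<bullet> rep c x" using Fr repr_AE[OF W(2)]
   proof eventually_elim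
    case (elim x)
    then show ?case using s0[of x] unfolding elim(2)[symmetric] elim(1) by (simp add: s_def)
   qed
  qed simp
  also have "... = inner (cls e0 + e) c" using inner_cls[OF sqi_rep sqi_rep, of "cls e0 + e" c] by simp
  finally show ?thesis using \<open>inner e c = 0\<close> by (simp add: set_integral_inner[OF E0 W(2)] inner_add_left)
 qed
 have L2s: "L2 \<Omega> u" "L2 \<Omega> (rep (g + g0))" "L2 \<Omega> (rep F)" "L2 \<Omega> (rep h)"
  using r L2_repr[OF \<Omega>(3), of u] L2_repr[OF \<Omega>(3), of "rep _"] by blast+
 then have "H1 \<Omega> u" "Hcurl \<Omega> (rep h)" using wgU wcH unfolding H1_def Hcurl_def by blast+
 then have "weak_solution \<Omega> \<sigma> u0 E0 u (rep h)" unfolding weak_solution_def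
  using L2s wgU wcH H10u div eq1 eq2 by (intro conjI exI[of _ "rep (g + g0)"] exI[of _ "rep F"] allI impI; (elim conjE)?) blast+
 then show ?thesis by blast
qed

end
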